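(* Let $\Lambda$ be a real $q$-constrained Willmore surface and suppose $p(\lambda)$ is a $q$-conserved quantity of $\Lambda$. Let $\alpha,L^\alpha$ be (real) Bäcklund transformation parameters to $\Lambda$ corresponding to the multiplier $q$, with associated map $r^*$. If $p(\alpha)\perp L^\alpha$, then $$p^*(\lambda):=r^*(1)^{-1}\,r^*(\lambda)\,p(\lambda)$$ is a $q^*$-conserved quantity of the Bäcklund transform $\Lambda^*$ of $\Lambda$ of parameters $\alpha,L^\alpha$, provided that $\Lambda^*$ immerses.
   Context: $n\ge 3$; $\mathbb{R}^{n+1,1}$ has metric $(\,,\,)$ of signature $(n+1,1)$, extended complex bilinearly to $\mathbb{C}^{n+2}$; $\mathcal{L}$ is the set of non-zero null vectors of $\mathbb{R}^{n+1,1}$; $M$ is an oriented surface; $\underline{\mathbb{C}}^{n+2}=M\times\mathbb{C}^{n+2}$ with trivial flat connection $d$. The theory is local: restriction to a suitable non-empty open subset of $M$ is always understood. $\wedge^{2}\mathbb{C}^{n+2}\cong o(\mathbb{C}^{n+2})$ by $(v_1\wedge v_2)(w)=(w,v_1)v_2-(w,v_2)v_1$; $[\mu\wedge\eta](X,Y)=[\mu_X,\eta_Y]-[\mu_Y,\eta_X]$ for Lie-algebra-valued $1$-forms; $d^\nabla$ is the exterior derivative on endomorphism-valued forms. Surfaces. A real surface is a null line subbundle $\Lambda\subset M\times\mathbb{R}^{n+1,1}$ defining an immersion $M\to\mathbb{P}(\mathcal{L})\cong S^n$ (standing assumption: not contained in any proper subsphere of $S^n$). $M$ carries the conformal structure of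 the metrics $g_\sigma(X,Y)=(d_X\sigma,d_Y\sigma)$, $\sigma\in\Gamma(\Lambda)$ never-zero; $(1,0)$/$(0,1)$-parts and $*$ (with $*\omega=-\omega\circ J$) refer to it. For $z$ a holomorphic chart, $\Lambda^{1,0}=\langle\sigma,\sigma_z\rangle$, $\Lambda^{0,1}=\langle\sigma,\sigma_{\bar z}\rangle$, $\Lambda^{(1)}=\Lambda^{1,0}+\Lambda^{0,1}$, and the (complexified) central sphere congruence is $S=\langle\sigma,\sigma_z,\sigma_{\bar z},\sigma_{z\bar z}\rangle$. $\mathcal{D}:=\pi_S\circ d\circ\pi_S+\pi_{S^\perp}\circ d\circ\pi_{S^\perp}$, $\mathcal{N}:=d-\mathcal{D}$. For a real $q\in\Omega^1(\Lambda\wedge\Lambda^{(1)})$, $\Lambda$ is $q$-constrained Willmore ($q$ is a multiplier) if $d^{\mathcal{D}}q=0$ and $d^{\mathcal{D}}*\mathcal{N}=2[q\wedge*\mathcal{N}]$. Set $d^{\lambda,q}_S:=\mathcal{D}+\lambda^{-1}\mathcal{N}^{1,0}+\lambda\mathcal{N}^{0,1}+(\lambda^{-2}-1)q^{1,0}+(\lambda^2-1)q^{0,1}$. A $q$-conserved quantity of a $q$-constrained Willmore surface $\Lambda$ is a Laurent polynomial $p(\lambda)=\lambda^{-1}v+v_0+\lambda\overline v$ with $v_0\in\Gamma(S)$ real, $v\in\Gamma(S^\perp)$ (complexified), $p(1)\ne0$, and $d^{\lambda,q}_Sp(\lambda)=0$ for all $\lambda\in\mathbb{C}\backslash\{0\}$.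 Bäcklund transformation. Let $\rho=\pi_S-\pi_{S^\perp}$. For $a\in\mathbb{C}\backslash\{-1,0,1\}$ and a null line subbundle $L\subset\underline{\mathbb{C}}^{n+2}$ with $\rho L\cap L^\perp=\{0\}$, let $\pi_L,\pi_{\rho L},\pi_\perp$ be the projections for $\underline{\mathbb{C}}^{n+2}=L\oplus\rho L\oplus(L\oplus\rho L)^\perp$ and $$p_{a,L}(\lambda)=\tfrac{a-\lambda}{a+\lambda}\pi_L+\pi_\perp+\tfrac{a+\lambda}{a-\lambda}\pi_{\rho L},\qquad q_{a,L}(\lambda)=\tfrac{\lambda-a}{\lambda+a}\pi_L+\pi_\perp+\tfrac{\lambda+a}{\lambda-a}\pi_{\rho L},$$ extended by $p_{a,L}(\infty)=-\pi_L+\pi_\perp-\pi_{\rho L}$, $q_{a,L}(\infty)=I$. Real Bäcklund transformation parameters to $\Lambda$ (for the multiplier $q$) are $\alpha\in\mathbb{C}\backslash(S^1\cup\{0\})$ and a $d^{\alpha,q}_S$-parallel null line subbundle $L^\alpha$ with, locally, $\rho L^\alpha\cap(L^\alpha)^\perp=\{0\}$ and $\rho\tilde L^\alpha\cap(\tilde L^\alpha)^\perp=\{0\}$, where $\tilde L^\alpha:=q_{\overline\alpha^{-1},\overline{L^\alpha}}(\alpha)L^\alpha$. Set $r^*:=p_{\alpha,\tilde L^\alpha}\,q_{\overline\alpha^{-1},\overline{L^\alpha}}$ and $$(\Lambda^* )^{1,0}:=r^*(1)^{-1}r^*(\infty)\Lambda^{1,0},\quad(\Lambda^* )^{0,1}:=r^*(1)^{-1}r^*(0)\Lambda^{0,1},\quad\Lambda^*:=(\Lambda^*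 )^{1,0}\cap(\Lambda^* )^{0,1},$$ $$q^*:=\mathrm{Ad}_{r^*(1)^{-1}}\big(\mathrm{Ad}_{r^*(0)}q^{1,0}+\mathrm{Ad}_{r^*(\infty)}q^{0,1}\big).$$ $\Lambda^*$ is the Bäcklund transform; it immerses if this real line bundle defines an immersion of $M$ into $\mathbb{P}(\mathcal{L})$, in which case it is a real $q^*$-constrained Willmore surface. *)

theory Defs
  imports "HOL-Analysis.Analysis"
begin

section \<open>The space \<open>\<complex>\<^sup>n\<^sup>+\<^sup>2\<close> with the complexified Lorentz form\<close>

text \<open>
  With \<open>n = CARD('n)\<close>, the index type \<open>'n option option\<close> has \<open>n + 2\<close> elements; \<open>None\<close> is the
  time-like direction. The space \<open>\<real>\<^sup>n\<^sup>+\<^sup>1\<^sup>,\<^sup>1\<close> is the set of vectors fixed by complex conjugation.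
  Complex subspaces are formed with \<open>vec.span\<close>, the span over \<open>\<complex>\<close>.
\<close>

type_synonym 'n cvec = "complex ^ ('n option option)"

definition form :: "'n::finite cvec \<Rightarrow> 'n cvec \<Rightarrow> complex" where
  "form v w = (\<Sum>i\<in>UNIV. v $ Some i * w $ Some i) - v $ None * w $ None"

definition vconj :: "'n::finite cvec \<Rightarrow> 'n cvec" where
  "vconj v = (\<chi> i. cnj (v $ i))"

definition real_vecs :: "'n::finite cvec set" where
  "real_vecs = {v. vconj v = v}"

definition perp :: "'n::finite cvec set \<Rightarrow> 'n cvec set" where
  "perp A = {v. \<forall>w\<in>A. form v w = 0}"

definition proj_along :: "'n::finite cvec set \<Rightarrow> 'n cvec set \<Rightarrow> 'n cvec \<Rightarrow> 'n cvec" where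
  \<comment> \<open>projection onto \<open>A\<close> for a direct sum decomposition \<open>A \<oplus> B\<close>\<close>
  "proj_along A B v = (THE a. a \<in> A \<and> v - a \<in> B)"

definition wedge :: "'n::finite cvec \<Rightarrow> 'n cvec \<Rightarrow> 'n cvec \<Rightarrow> 'n cvec" where
  "wedge v1 v2 w = form w v1 *s v2 - form w v2 *s v1"

definition wedge_space :: "'n::finite cvec set \<Rightarrow> 'n cvec set \<Rightarrow> ('n cvec \<Rightarrow> 'n cvec) set" where
  "wedge_space A B =
     {(\<lambda>w. \<Sum>i<k. wedge (a i) (b i) w) | (k::nat) a b. \<forall>i<k. a i \<in> A \<and> b i \<in> B}"

definition Ad :: "('n::finite cvec \<Rightarrow> 'n cvec) \<Rightarrow> ('n cvec \<Rightarrow> 'n cvec) \<Rightarrow> 'n cvec \<Rightarrow> 'n cvec" where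
  "Ad A B = A \<circ> B \<circ> inv A"


section \<open>Calculus on open subsets of the plane\<close>

text \<open>
  The surface is (the image in \<open>\<complex>\<close> under a holomorphic chart of) a non-empty open set \<open>U\<close>.
  Real tangent vectors are complex numbers, \<open>J\<close> is multiplication by \<open>\<i>\<close>. Sections are functions
  of the point; \<open>1\<close>-forms take a point and a tangent vector.
\<close>

type_synonym 'n sect = "complex \<Rightarrow> 'n cvec"
type_synonym 'n subbundle = "complex \<Rightarrow> 'n cvec set"
type_synonym 'n endo_form = "complex \<Rightarrow> complex \<Rightarrow> 'n cvec \<Rightarrow> 'n cvec"

definition dd :: "'n::finite sect \<Rightarrow> complex \<Rightarrow> complex \<Rightarrow> 'n cvec" where
  "dd f x X = frechet_derivative f (at x) X"

primrec iter_dd :: "complex list \<Rightarrow> 'n::finite sect \<Rightarrow> 'n sect" where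
  "iter_dd [] f = f"
| "iter_dd (X # Xs) f = (\<lambda>x. dd (iter_dd Xs f) x X)"

definition smooth_on :: "complex set \<Rightarrow> 'n::finite sect \<Rightarrow> bool" where
  \<comment> \<open>\<open>C\<^sup>\<infinity>\<close>, for open \<open>U\<close>: all iterated directional derivatives exist and are differentiable\<close>
  "smooth_on U f \<longleftrightarrow> (\<forall>Xs. \<forall>x\<in>U. iter_dd Xs f differentiable (at x))"

definition dz :: "'n::finite sect \<Rightarrow> 'n sect" where
  "dz f x = (1/2) *s (dd f x 1 - \<i> *s dd f x \<i>)"

definition dzbar :: "'n::finite sect \<Rightarrow> 'n sect" where
  "dzbar f x = (1/2) *s (dd f x 1 + \<i> *s dd f x \<i>)"

definition star_form :: "'n::finite endo_form \<Rightarrow> 'n endo_form" where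
  "star_form \<omega> x X v = - \<omega> x (\<i> * X) v"

definition part10 :: "'n::finite endo_form \<Rightarrow> 'n endo_form" where
  "part10 \<omega> x X v = (1/2) *s (\<omega> x X v - \<i> *s \<omega> x (\<i> * X) v)"

definition part01 :: "'n::finite endo_form \<Rightarrow> 'n endo_form" where
  "part01 \<omega> x X v = (1/2) *s (\<omega> x X v + \<i> *s \<omega> x (\<i> * X) v)"

definition bracket_wedge ::
  "'n::finite endo_form \<Rightarrow> 'n endo_form \<Rightarrow> complex \<Rightarrow> complex \<Rightarrow> complex \<Rightarrow> 'n cvec \<Rightarrow> 'n cvec" where
  "bracket_wedge \<mu> \<eta> x X Y v =
     (\<mu> x X (\<eta> x Y v) - \<eta> x Y (\<mu> x X v)) - (\<mu> x Y (\<eta> x X v) - \<eta> x X (\<mu> x Y v))"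

definition local_section :: "'n::finite subbundle \<Rightarrow> complex \<Rightarrow> complex set \<Rightarrow> 'n sect \<Rightarrow> bool" where
  \<comment> \<open>never-zero smooth sections near \<open>x\<close>\<close>
  "local_section B x V \<sigma> \<longleftrightarrow>
     open V \<and> x \<in> V \<and> smooth_on V \<sigma> \<and> (\<forall>y\<in>V. \<sigma> y \<in> B y \<and> \<sigma> y \<noteq> 0)"

definition null_line_bundle :: "complex set \<Rightarrow> 'n::finite subbundle \<Rightarrow> bool" where
  "null_line_bundle U L \<longleftrightarrow>
     (\<forall>x\<in>U. \<exists>V \<sigma>. V \<subseteq> U \<and> local_section L x V \<sigma> \<and>
        (\<forall>y\<in>V. L y = vec.span {\<sigma> y} \<and> form (\<sigma> y) (\<sigma> y) = 0))"


section \<open>Surfaces in the conformal \<open>n\<close>-sphere\<close>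

text \<open>
  A real line bundle is represented by its complexification, a complex line bundle locally spanned
  by real sections.
\<close>

definition immerses :: "complex set \<Rightarrow> 'n::finite subbundle \<Rightarrow> bool" where
  \<comment> \<open>the differential of \<open>x \<mapsto> [\<sigma> x]\<close> in the projective space is \<open>d\<sigma>\<close> modulo \<open>\<sigma>\<close>\<close>
  "immerses U \<Lambda> \<longleftrightarrow>
     (\<forall>x\<in>U. \<exists>V \<sigma>. V \<subseteq> U \<and> local_section \<Lambda> x V \<sigma> \<and>
        (\<forall>y\<in>V. \<Lambda> y = vec.span {\<sigma> y} \<and> \<sigma> y \<in> real_vecs \<and> form (\<sigma> y) (\<sigma> y) = 0 \<and>
           (\<forall>X. X \<noteq> 0 \<longrightarrow> dd \<sigma> y X \<notin> vec.span {\<sigma> y})))"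

definition conformal_coordinate :: "complex set \<Rightarrow> 'n::finite subbundle \<Rightarrow> bool" where
  \<comment> \<open>the metrics \<open>g\<^sub>\<sigma>\<close> are conformal to \<open>\<bar>dz\<bar>\<^sup>2\<close>, i.e. the coordinate of \<open>U\<close> is holomorphic\<close>
  "conformal_coordinate U \<Lambda> \<longleftrightarrow>
     (\<forall>x\<in>U. \<forall>V \<sigma>. local_section \<Lambda> x V \<sigma> \<and> (\<forall>y\<in>V. \<sigma> y \<in> real_vecs) \<longrightarrow>
        (\<exists>c>0. \<forall>X Y. form (dd \<sigma> x X) (dd \<sigma> x Y) = complex_of_real (c * (X \<bullet> Y))))"

definition real_surface :: "complex set \<Rightarrow> 'n::finite subbundle \<Rightarrow> bool" where
  "real_surface U \<Lambda> \<longleftrightarrow> immerses U \<Lambda> \<and> conformal_coordinate U \<Lambda>"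

definition in_proper_subsphere :: "complex set \<Rightarrow> 'n::finite subbundle \<Rightarrow> bool" where
  \<comment> \<open>proper subspheres are the projectivised light cones of proper Lorentzian subspaces of \<open>\<real>\<^sup>n\<^sup>+\<^sup>1\<^sup>,\<^sup>1\<close>\<close>
  "in_proper_subsphere U \<Lambda> \<longleftrightarrow>
     (\<exists>W. subspace W \<and> W \<subset> real_vecs \<and> (\<exists>w\<in>W. Re (form w w) < 0) \<and>
        (\<forall>x\<in>U. \<Lambda> x \<inter> real_vecs \<subseteq> W))"

text \<open>
  The following spans do not depend on the choice of the never-zero section \<open>\<sigma>\<close>, so spanning over
  all choices gives, e.g., \<open>\<langle>\<sigma>, \<sigma>\<^sub>z\<rangle>\<close> for any one of them.
\<close>

definition Lam10 :: "'n::finite subbundle \<Rightarrow> 'n subbundle" where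
  "Lam10 \<Lambda> x = vec.span (\<Union>{{\<sigma> x, dz \<sigma> x} | \<sigma> V. local_section \<Lambda> x V \<sigma>})"

definition Lam01 :: "'n::finite subbundle \<Rightarrow> 'n subbundle" where
  "Lam01 \<Lambda> x = vec.span (\<Union>{{\<sigma> x, dzbar \<sigma> x} | \<sigma> V. local_section \<Lambda> x V \<sigma>})"

definition Lam1 :: "'n::finite subbundle \<Rightarrow> 'n subbundle" where
  "Lam1 \<Lambda> x = vec.span (Lam10 \<Lambda> x \<union> Lam01 \<Lambda> x)"

definition csc :: "'n::finite subbundle \<Rightarrow> 'n subbundle" where
  \<comment> \<open>the complexified central sphere congruence\<close>
  "csc \<Lambda> x = vec.span
     (\<Union>{{\<sigma> x, dz \<sigma> x, dzbar \<sigma> x, dz (dzbar \<sigma>) x} | \<sigma> V. local_section \<Lambda> x V \<sigma>})"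

definition proj_S :: "'n::finite cvec set \<Rightarrow> 'n cvec \<Rightarrow> 'n cvec" where
  "proj_S S = proj_along S (perp S)"

definition proj_Sperp :: "'n::finite cvec set \<Rightarrow> 'n cvec \<Rightarrow> 'n cvec" where
  "proj_Sperp S = proj_along (perp S) S"

definition refl_S :: "'n::finite cvec set \<Rightarrow> 'n cvec \<Rightarrow> 'n cvec" where
  "refl_S S v = proj_S S v - proj_Sperp S v"

definition Dconn :: "'n::finite subbundle \<Rightarrow> 'n sect \<Rightarrow> complex \<Rightarrow> complex \<Rightarrow> 'n cvec" where
  "Dconn \<Lambda> f x X =
     proj_S (csc \<Lambda> x) (dd (\<lambda>y. proj_S (csc \<Lambda> y) (f y)) x X) +
     proj_Sperp (csc \<Lambda> x) (dd (\<lambda>y. proj_Sperp (csc \<Lambda> y) (f y)) x X)"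

definition Nform :: "'n::finite subbundle \<Rightarrow> 'n endo_form" where
  \<comment> \<open>\<open>d - \<D>\<close> is tensorial: its value on a vector \<open>v\<close> is computed on the constant section \<open>v\<close>\<close>
  "Nform \<Lambda> x X v = dd (\<lambda>_. v) x X - Dconn \<Lambda> (\<lambda>_. v) x X"

definition D_End :: "'n::finite subbundle \<Rightarrow> (complex \<Rightarrow> 'n cvec \<Rightarrow> 'n cvec) \<Rightarrow> 'n endo_form" where
  "D_End \<Lambda> A x X v = Dconn \<Lambda> (\<lambda>y. A y v) x X - A x (Dconn \<Lambda> (\<lambda>_. v) x X)"

definition extD ::
  "'n::finite subbundle \<Rightarrow> 'n endo_form \<Rightarrow> complex \<Rightarrow> complex \<Rightarrow> complex \<Rightarrow> 'n cvec \<Rightarrow> 'n cvec" where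
  \<comment> \<open>the exterior derivative evaluated on constant, hence commuting, vector fields \<open>X\<close>, \<open>Y\<close>\<close>
  "extD \<Lambda> \<omega> x X Y v = D_End \<Lambda> (\<lambda>y. \<omega> y Y) x X v - D_End \<Lambda> (\<lambda>y. \<omega> y X) x Y v"

definition real_wedge_form :: "complex set \<Rightarrow> 'n::finite subbundle \<Rightarrow> 'n endo_form \<Rightarrow> bool" where
  "real_wedge_form U \<Lambda> q \<longleftrightarrow>
     (\<forall>X v. smooth_on U (\<lambda>x. q x X v)) \<and>
     (\<forall>x\<in>U. (\<forall>v. linear (\<lambda>X. q x X v)) \<and>
        (\<forall>X. q x X \<in> wedge_space (\<Lambda> x) (Lam1 \<Lambda> x)) \<and>
        (\<forall>X v. q x X (vconj v) = vconj (q x X v)))"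

definition constrained_willmore :: "complex set \<Rightarrow> 'n::finite subbundle \<Rightarrow> 'n endo_form \<Rightarrow> bool" where
  "constrained_willmore U \<Lambda> q \<longleftrightarrow>
     real_surface U \<Lambda> \<and> real_wedge_form U \<Lambda> q \<and>
     (\<forall>x\<in>U. \<forall>X Y v. extD \<Lambda> q x X Y v = 0) \<and>
     (\<forall>x\<in>U. \<forall>X Y v.
        extD \<Lambda> (star_form (Nform \<Lambda>)) x X Y v = 2 *s bracket_wedge q (star_form (Nform \<Lambda>)) x X Y v)"

definition conn ::
  "'n::finite subbundle \<Rightarrow> 'n endo_form \<Rightarrow> complex \<Rightarrow> 'n sect \<Rightarrow> complex \<Rightarrow> complex \<Rightarrow> 'n cvec" where
  \<comment> \<open>\<open>d\<^sub>S\<close> with spectral parameter \<open>l\<close> and multiplier \<open>q\<close>\<close>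
  "conn \<Lambda> q l f x X =
     Dconn \<Lambda> f x X + inverse l *s part10 (Nform \<Lambda>) x X (f x) + l *s part01 (Nform \<Lambda>) x X (f x) +
     (inverse (l^2) - 1) *s part10 q x X (f x) + (l^2 - 1) *s part01 q x X (f x)"

definition conserved_quantity ::
  "complex set \<Rightarrow> 'n::finite subbundle \<Rightarrow> 'n endo_form \<Rightarrow> (complex \<Rightarrow> 'n sect) \<Rightarrow> bool" where
  "conserved_quantity U \<Lambda> q p \<longleftrightarrow>
     constrained_willmore U \<Lambda> q \<and>
     (\<exists>v v0. smooth_on U v \<and> smooth_on U v0 \<and>
        (\<forall>x\<in>U. v0 x \<in> csc \<Lambda> x \<and> v0 x \<in> real_vecs \<and> v x \<in> perp (csc \<Lambda> x)) \<and>
        (\<forall>l. l \<noteq> 0 \<longrightarrow> (\<forall>x\<in>U. p l x = inverse l *s v x + v0 x + l *s vconj (v x)))) \<and>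
     (\<forall>x\<in>U. p 1 x \<noteq> 0) \<and>
     (\<forall>l. l \<noteq> 0 \<longrightarrow> (\<forall>x\<in>U. \<forall>X. conn \<Lambda> q l (p l) x X = 0))"


section \<open>Baecklund transformation\<close>

text \<open>The fibrewise maps \<open>p\<^sub>a\<^sub>,\<^sub>L\<close> and \<open>q\<^sub>a\<^sub>,\<^sub>L\<close>; here \<open>S\<close> and \<open>L\<close> are the fibres at one point.\<close>

definition proj_L :: "'n::finite cvec set \<Rightarrow> 'n cvec set \<Rightarrow> 'n cvec \<Rightarrow> 'n cvec" where
  "proj_L S L = proj_along L
     (vec.span (refl_S S ` L \<union> perp (vec.span (L \<union> refl_S S ` L))))"

definition proj_rhoL :: "'n::finite cvec set \<Rightarrow> 'n cvec set \<Rightarrow> 'n cvec \<Rightarrow> 'n cvec" where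
  "proj_rhoL S L = proj_along (refl_S S ` L)
     (vec.span (L \<union> perp (vec.span (L \<union> refl_S S ` L))))"

definition proj_perp :: "'n::finite cvec set \<Rightarrow> 'n cvec set \<Rightarrow> 'n cvec \<Rightarrow> 'n cvec" where
  "proj_perp S L = proj_along (perp (vec.span (L \<union> refl_S S ` L))) (vec.span (L \<union> refl_S S ` L))"

definition p_map ::
  "'n::finite cvec set \<Rightarrow> complex \<Rightarrow> 'n cvec set \<Rightarrow> complex \<Rightarrow> 'n cvec \<Rightarrow> 'n cvec" where
  "p_map S a L l v =
     ((a - l) / (a + l)) *s proj_L S L v + proj_perp S L v + ((a + l) / (a - l)) *s proj_rhoL S L v"

definition q_map ::
  "'n::finite cvec set \<Rightarrow> complex \<Rightarrow> 'n cvec set \<Rightarrow> complex \<Rightarrow> 'n cvec \<Rightarrow> 'n cvec" where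
  "q_map S a L l v =
     ((l - a) / (l + a)) *s proj_L S L v + proj_perp S L v + ((l + a) / (l - a)) *s proj_rhoL S L v"

definition p_map_inf :: "'n::finite cvec set \<Rightarrow> 'n cvec set \<Rightarrow> 'n cvec \<Rightarrow> 'n cvec" where
  "p_map_inf S L v = - proj_L S L v + proj_perp S L v - proj_rhoL S L v"

definition q_map_inf :: "'n::finite cvec set \<Rightarrow> 'n cvec set \<Rightarrow> 'n cvec \<Rightarrow> 'n cvec" where
  "q_map_inf S L v = v"

definition L_tilde :: "'n::finite subbundle \<Rightarrow> complex \<Rightarrow> 'n subbundle \<Rightarrow> 'n subbundle" where
  "L_tilde \<Lambda> \<alpha> L x = q_map (csc \<Lambda> x) (inverse (cnj \<alpha>)) (vconj ` L x) \<alpha> ` L x"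

definition parallel_bundle ::
  "complex set \<Rightarrow> 'n::finite subbundle \<Rightarrow> 'n endo_form \<Rightarrow> complex \<Rightarrow> 'n subbundle \<Rightarrow> bool" where
  "parallel_bundle U \<Lambda> q \<alpha> L \<longleftrightarrow>
     (\<forall>x\<in>U. \<forall>V s. local_section L x V s \<longrightarrow> (\<forall>X. conn \<Lambda> q \<alpha> s x X \<in> L x))"

definition backlund_parameters ::
  "complex set \<Rightarrow> 'n::finite subbundle \<Rightarrow> 'n endo_form \<Rightarrow> complex \<Rightarrow> 'n subbundle \<Rightarrow> bool" where
  "backlund_parameters U \<Lambda> q \<alpha> L \<longleftrightarrow>
     \<alpha> \<noteq> 0 \<and> norm \<alpha> \<noteq> 1 \<and> null_line_bundle U L \<and> parallel_bundle U \<Lambda> q \<alpha> L \<and>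
     (\<forall>x\<in>U. refl_S (csc \<Lambda> x) ` L x \<inter> perp (L x) = {0} \<and>
        refl_S (csc \<Lambda> x) ` L_tilde \<Lambda> \<alpha> L x \<inter> perp (L_tilde \<Lambda> \<alpha> L x) = {0})"

definition rstar ::
  "'n::finite subbundle \<Rightarrow> complex \<Rightarrow> 'n subbundle \<Rightarrow> complex \<Rightarrow> complex \<Rightarrow> 'n cvec \<Rightarrow> 'n cvec" where
  "rstar \<Lambda> \<alpha> L l x =
     p_map (csc \<Lambda> x) \<alpha> (L_tilde \<Lambda> \<alpha> L x) l \<circ>
     q_map (csc \<Lambda> x) (inverse (cnj \<alpha>)) (vconj ` L x) l"

definition rstar_inf ::
  "'n::finite subbundle \<Rightarrow> complex \<Rightarrow> 'n subbundle \<Rightarrow> complex \<Rightarrow> 'n cvec \<Rightarrow> 'n cvec" where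
  "rstar_inf \<Lambda> \<alpha> L x =
     p_map_inf (csc \<Lambda> x) (L_tilde \<Lambda> \<alpha> L x) \<circ> q_map_inf (csc \<Lambda> x) (vconj ` L x)"

definition backlund_10 :: "'n::finite subbundle \<Rightarrow> complex \<Rightarrow> 'n subbundle \<Rightarrow> 'n subbundle" where
  "backlund_10 \<Lambda> \<alpha> L x = (inv (rstar \<Lambda> \<alpha> L 1 x) \<circ> rstar_inf \<Lambda> \<alpha> L x) ` Lam10 \<Lambda> x"

definition backlund_01 :: "'n::finite subbundle \<Rightarrow> complex \<Rightarrow> 'n subbundle \<Rightarrow> 'n subbundle" where
  "backlund_01 \<Lambda> \<alpha> L x = (inv (rstar \<Lambda> \<alpha> L 1 x) \<circ> rstar \<Lambda> \<alpha> L 0 x) ` Lam01 \<Lambda> x"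

definition backlund_transform :: "'n::finite subbundle \<Rightarrow> complex \<Rightarrow> 'n subbundle \<Rightarrow> 'n subbundle" where
  "backlund_transform \<Lambda> \<alpha> L x = backlund_10 \<Lambda> \<alpha> L x \<inter> backlund_01 \<Lambda> \<alpha> L x"

definition backlund_multiplier ::
  "'n::finite subbundle \<Rightarrow> 'n endo_form \<Rightarrow> complex \<Rightarrow> 'n subbundle \<Rightarrow> 'n endo_form" where
  "backlund_multiplier \<Lambda> q \<alpha> L x X =
     Ad (inv (rstar \<Lambda> \<alpha> L 1 x))
       (\<lambda>v. Ad (rstar \<Lambda> \<alpha> L 0 x) (part10 q x X) v + Ad (rstar_inf \<Lambda> \<alpha> L x) (part01 q x X) v)"

definition conserved_transform ::
  "'n::finite subbundle \<Rightarrow> complex \<Rightarrow> 'n subbundle \<Rightarrow> (complex \<Rightarrow> 'n sect) \<Rightarrow> complex \<Rightarrow> 'n sect" where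
  \<comment> \<open>rational in \<open>l\<close>; at the poles \<open>\<plusminus>\<alpha>\<close>, \<open>\<plusminus>1 / cnj \<alpha>\<close> of \<open>rstar\<close> its value (division by zero) is meaningless\<close>
  "conserved_transform \<Lambda> \<alpha> L p l x = inv (rstar \<Lambda> \<alpha> L 1 x) (rstar \<Lambda> \<alpha> L l x (p l x))"

end

theory Submission
  imports Defs
begin

text \<open>
  The \<open>(1,0)\<close>- and \<open>(0,1)\<close>-parts of the pencil \<open>d\<^sup>\<lambda>\<^sup>,\<^sup>q\<close> are polynomials of degree two in \<open>1/\<lambda>\<close> and in \<open>\<lambda>\<close>.
  Gauging by \<open>p\<^sub>a\<^sub>,\<^sub>L\<close> with a null line \<open>L\<close> parallel at \<open>\<lambda> = a\<close> preserves this shape, since parallelism cancels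
  the pole at \<open>a\<close> and the reflection \<open>\<rho>\<close> the one at \<open>-a\<close>. Two such steps followed by the constant gauge
  \<open>r\<^sup>*(1)\<^sup>-\<^sup>1\<close> give a flat pencil with reflection \<open>r\<^sup>*(1)\<^sup>-\<^sup>1 \<rho> r\<^sup>*(1)\<close>. This reflection fixes every section \<open>\<sigma>\<close> of
  \<open>\<Lambda>\<^sup>*\<close> together with \<open>\<sigma>\<^sub>z\<close>, its conjugate and the mixed second derivative, so by dimension it is the
  reflection in the central sphere congruence of \<open>\<Lambda>\<^sup>*\<close>. Hence the pencil is that of \<open>\<Lambda>\<^sup>*\<close> and \<open>q\<^sup>*\<close>, and comparing
  coefficients in its flatness for generic \<open>\<lambda>\<close> gives the constrained Willmore equations.

  Reality of \<open>r\<^sup>*(1)\<^sup>-\<^sup>1 r\<^sup>*(\<lambda>)\<close> is Bianchi permutability of the dressings by \<open>L\<close> and its conjugate; it holds because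
  both orders have the same logarithmic derivative in \<open>\<lambda>\<close>. Finally \<open>p(\<alpha>) \<bottom> L\<close> and the symmetries of \<open>p\<close> make
  \<open>r\<^sup>*(1)\<^sup>-\<^sup>1 r\<^sup>* p\<close> pole-free away from \<open>0\<close> and \<open>\<infinity>\<close>, hence a Laurent polynomial of the required kind; it is
  parallel for generic \<open>\<lambda>\<close> and so, by continuity, for all \<open>\<lambda> \<noteq> 0\<close>.
\<close>

section \<open>Complex normed spaces and matrix algebras\<close>

text \<open>The conclusion asks for more than parallelism: \<open>conserved_quantity\<close>
  contains \<open>constrained_willmore\<close>, while the transform is only assumed to immerse. Its
  conformality, its sphere congruence, the shape and reality of its multiplier and its two structure
  equations must therefore all be read off the dressed pencil. The (1,0)- and (0,1)-parts are one
  kind of object, read in the parameter \<lambda> or in 1/\<lambda>. Inverting \<lambda> and a turns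
  (a - \<lambda>)/(a + \<lambda>) into its negative; this is the source of the signs
  \<open>eps\<close> and \<open>s\<close>, and the sign is absorbed by the value of the gauge at
  infinity. Two dressings are needed because a single one puts poles at \<alpha> and -\<alpha> only,
  a set not invariant under \<lambda> -> 1/cnj \<lambda>. The conjugate line is parallel at 1/cnj
  \<alpha> and is used first; it moves \<open>L\<close> to \<open>L_tilde\<close>, which is the line
  of the second step. At the four poles the formula for the transformed quantity has values coming
  from division by zero. The conserved quantity is the Laurent polynomial that agrees with it
  everywhere else.\<close>

class cvs = real_normed_vector +
  fixes scC :: "complex \<Rightarrow> 'a \<Rightarrow> 'a"  (infixr "*\<^sub>C" 75)
  assumes scC_add_right: "a *\<^sub>C (x + y) = a *\<^sub>C x + a *\<^sub>C y"
    and scC_add_left: "(a + b) *\<^sub>C x = a *\<^sub>C x + b *\<^sub>C x"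
    and scC_scC: "a *\<^sub>C (b *\<^sub>C x) = (a * b) *\<^sub>C x"
    and scC_of_real: "of_real r *\<^sub>C x = r *\<^sub>R x"
    and norm_scC_le: "norm (a *\<^sub>C x) \<le> norm a * norm x"

lemma scC_one [simp]: "1 *\<^sub>C x = x" for x :: "'a::cvs"
  using scC_of_real[of 1 x] by simp

lemma scC_zero_left [simp]: "0 *\<^sub>C x = 0" for x :: "'a::cvs"
  using scC_of_real[of 0 x] by simp

lemma scC_zero_right [simp]: "a *\<^sub>C 0 = (0 :: 'a::cvs)"
  using scC_add_right[of a 0 "0 :: 'a"] by simp

lemma scC_minus_left [simp]: "(- a) *\<^sub>C x = - (a *\<^sub>C x)" for x :: "'a::cvs"
  using scC_add_left[of a "- a" x] by (simp add: eq_neg_iff_add_eq_0 add.commute)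

lemma scC_minus_right [simp]: "a *\<^sub>C (- x) = - (a *\<^sub>C x)" for x :: "'a::cvs"
  using scC_add_right[of a x "- x"] by (simp add: eq_neg_iff_add_eq_0 add.commute)

lemma scC_diff_right: "a *\<^sub>C (x - y) = a *\<^sub>C x - a *\<^sub>C y" for x :: "'a::cvs"
  using scC_add_right[of a x "- y"] by simp

lemma scC_diff_left: "(a - b) *\<^sub>C x = a *\<^sub>C x - b *\<^sub>C x" for x :: "'a::cvs"
  using scC_add_left[of a "- b" x] by simp

lemma scC_eq_0_iff [simp]: "a *\<^sub>C x = 0 \<longleftrightarrow> a = 0 \<or> x = 0" for x :: "'a::cvs"
proof
  assume *: "a *\<^sub>C x = 0"
  show "a = 0 \<or> x = 0"
  proof (rule disjCI)
    assume "x \<noteq> 0"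
    show "a = 0"
    proof (rule ccontr)
      assume "a \<noteq> 0"
      then have "x = inverse a *\<^sub>C (a *\<^sub>C x)" by (simp add: scC_scC)
      with * \<open>x \<noteq> 0\<close> show False by simp
    qed
  qed
qed auto

lemma scC_double: "2 *\<^sub>C x = x + x" for x :: "'a::cvs"
  using scC_add_left[of 1 1 x] by simp

lemmas scC_simps = scC_add_right scC_add_left scC_diff_right scC_diff_left scC_scC

instantiation complex :: cvs
begin
definition scC_complex :: "complex \<Rightarrow> complex \<Rightarrow> complex" where
  [simp]: "scC_complex a x = a * x"
instance
  by standard (auto simp: algebra_simps norm_mult scaleR_conv_of_real)
end

instantiation vec :: (cvs, finite) cvs
begin
definition scC_vec :: "complex \<Rightarrow> 'a ^ 'b \<Rightarrow> 'a ^ 'b" where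
  "scC_vec a x = (\<chi> i. a *\<^sub>C (x $ i))"
instance
proof
  fix a :: complex and x :: "'a ^ 'b"
  have "norm (a *\<^sub>C x) = L2_set (\<lambda>i. norm (a *\<^sub>C (x $ i))) UNIV"
    by (simp add: norm_vec_def scC_vec_def)
  also have "\<dots> \<le> L2_set (\<lambda>i. norm a * norm (x $ i)) UNIV"
    by (rule L2_set_mono) (auto intro: norm_scC_le)
  also have "\<dots> = norm a * norm x"
    by (simp add: norm_vec_def L2_set_right_distrib)
  finally show "norm (a *\<^sub>C x) \<le> norm a * norm x" .
qed (auto simp: scC_vec_def vec_eq_iff scC_simps scC_of_real)
end

lemma scC_vec_nth [simp]: "(a *\<^sub>C x) $ i = a *\<^sub>C (x $ i)"
  by (simp add: scC_vec_def)

lemma smult_eq_scC: "a *s x = a *\<^sub>C x" for x :: "complex ^ 'm::finite"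
  by (simp add: vec_eq_iff)

text \<open>
  A copy of the square matrices whose multiplication is composition, so that ring simplification
  applies to endomorphisms.
\<close>

typedef 'm cmat = "UNIV :: (complex ^ 'm ^ 'm) set"
  morphisms rep_cmat abs_cmat ..

definition app :: "'m::finite cmat \<Rightarrow> complex ^ 'm \<Rightarrow> complex ^ 'm"  (infixr "\<cdot>" 75) where
  "A \<cdot> v = rep_cmat A *v v"

text \<open>Turns the fibrewise maps of the given definitions, which are plain functions, into ring
  elements. It represents \<open>f\<close> only when \<open>f\<close> is complex linear, as
  \<open>app_of_lin\<close> requires.\<close>

definition of_lin :: "(complex ^ 'm \<Rightarrow> complex ^ 'm) \<Rightarrow> 'm::finite cmat" where
  "of_lin f = abs_cmat (matrix f)"

lemma app_add [simp]: "A \<cdot> (v + w) = A \<cdot> v + A \<cdot> w"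
  by (simp add: app_def matrix_vector_right_distrib)

lemma app_scC [simp]: "A \<cdot> (c *\<^sub>C v) = c *\<^sub>C (A \<cdot> v)"
  unfolding app_def smult_eq_scC[symmetric] by (simp add: vector_scalar_commute)

lemma app_0 [simp]: "A \<cdot> 0 = 0"
  using app_scC[of A 0 0] by simp

lemma app_minus [simp]: "A \<cdot> (- v) = - (A \<cdot> v)"
  using app_scC[of A "-1" v] by simp

lemma app_diff [simp]: "A \<cdot> (v - w) = A \<cdot> v - A \<cdot> w"
  using app_add[of A v "- w"] by simp

lemma app_of_lin:
  assumes "\<And>x y. f (x + y) = f x + f y" and "\<And>c x. f (c *\<^sub>C x) = c *\<^sub>C f x"
  shows "of_lin f \<cdot> v = f v"
proof -
  have "Vector_Spaces.linear (*s) (*s) f"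
    by standard (auto simp: assms smult_eq_scC scC_simps)
  then show ?thesis
    by (simp add: app_def of_lin_def abs_cmat_inverse matrix_works)
qed

lemma cmat_eqI: "A = B" if "\<And>v. A \<cdot> v = B \<cdot> v"
proof -
  have "rep_cmat A = rep_cmat B"
    using that by (simp add: app_def matrix_eq)
  then show ?thesis by (simp add: rep_cmat_inject)
qed

instantiation cmat :: (finite) ring_1
begin
definition "0 = of_lin (\<lambda>_. 0)"
definition "1 = of_lin (\<lambda>v. v)"
definition "A + B = of_lin (\<lambda>v. A \<cdot> v + B \<cdot> v)"
definition "A - B = of_lin (\<lambda>v. A \<cdot> v - B \<cdot> v)"
definition "- A = of_lin (\<lambda>v. - (A \<cdot> v))"
definition "A * B = of_lin (\<lambda>v. A \<cdot> B \<cdot> v)"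

lemma app_ring:
  "(0 :: 'a cmat) \<cdot> v = 0" "(1 :: 'a cmat) \<cdot> v = v"
  "(A + B) \<cdot> v = A \<cdot> v + B \<cdot> v" "(A - B) \<cdot> v = A \<cdot> v - B \<cdot> v"
  "(- A) \<cdot> v = - (A \<cdot> v)" "(A * B) \<cdot> v = A \<cdot> B \<cdot> v"
  for v :: "complex ^ 'a"
  by (simp_all add: zero_cmat_def one_cmat_def plus_cmat_def minus_cmat_def uminus_cmat_def
      times_cmat_def app_of_lin scC_simps)

instance
proof
  show "(0 :: 'a cmat) \<noteq> 1"
  proof
    assume "(0 :: 'a cmat) = 1"
    then have "(0 :: 'a cmat) \<cdot> (\<chi> i. 1) = (1 :: 'a cmat) \<cdot> (\<chi> i. 1)" by simp
    then show False by (simp add: app_ring vec_eq_iff)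
  qed
qed (auto intro!: cmat_eqI simp: app_ring)
end

declare app_ring [simp]

lemma linear_app: "linear (\<lambda>v. A \<cdot> v)"
  by (rule linearI) (simp_all add: scC_of_real[symmetric])

lemma bounded_linear_app: "bounded_linear (\<lambda>v. A \<cdot> v)"
  using linear_app linear_conv_bounded_linear by blast

text \<open>The operator norm makes composition submultiplicative, so the product rule for bounded
  bilinear maps covers matrix-valued functions.\<close>

instantiation cmat :: (finite) cvs
begin
definition scC_cmat :: "complex \<Rightarrow> 'a cmat \<Rightarrow> 'a cmat" where
  "scC_cmat c A = of_lin (\<lambda>v. c *\<^sub>C (A \<cdot> v))"
definition scaleR_cmat :: "real \<Rightarrow> 'a cmat \<Rightarrow> 'a cmat" where
  "scaleR_cmat r A = of_real r *\<^sub>C A"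
definition norm_cmat :: "'a cmat \<Rightarrow> real" where
  "norm_cmat A = onorm (\<lambda>v. A \<cdot> v)"
definition dist_cmat :: "'a cmat \<Rightarrow> 'a cmat \<Rightarrow> real" where
  "dist_cmat A B = norm (A - B)"
definition sgn_cmat :: "'a cmat \<Rightarrow> 'a cmat" where
  "sgn_cmat A = inverse (norm A) *\<^sub>R A"
definition
  "(uniformity :: ('a cmat \<times> 'a cmat) filter) = (INF e\<in>{0<..}. principal {(x, y). dist x y < e})"
definition
  "open (U :: 'a cmat set) \<longleftrightarrow> (\<forall>x\<in>U. eventually (\<lambda>(x', y). x' = x \<longrightarrow> y \<in> U) uniformity)"

lemma app_scC_left: "(c *\<^sub>C A) \<cdot> v = c *\<^sub>C (A \<cdot> v)" for A :: "'a cmat"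
  by (simp add: scC_cmat_def app_of_lin scC_simps mult.commute)

lemma app_scaleR_left: "(r *\<^sub>R A) \<cdot> v = r *\<^sub>R (A \<cdot> v)" for A :: "'a cmat"
  by (simp add: scaleR_cmat_def app_scC_left scC_of_real)

instance
proof
  fix a b :: complex and r s :: real and x y :: "'a cmat"
  show "(norm x = 0) = (x = 0)"
    using onorm_eq_0[OF bounded_linear_app[of x]]
    by (auto simp: norm_cmat_def intro!: cmat_eqI)
  show "norm (x + y) \<le> norm x + norm y"
    using onorm_triangle[OF bounded_linear_app[of x] bounded_linear_app[of y]]
    by (simp add: norm_cmat_def)
  show "norm (r *\<^sub>R x) = \<bar>r\<bar> * norm x"
    using onorm_scaleR[OF bounded_linear_app[of x], of r]
    by (simp add: norm_cmat_def app_scaleR_left)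
  show "norm (a *\<^sub>C x) \<le> norm a * norm x"
    unfolding norm_cmat_def
  proof (rule onorm_le)
    fix v
    have "norm ((a *\<^sub>C x) \<cdot> v) \<le> norm a * norm (x \<cdot> v)"
      by (simp add: app_scC_left norm_scC_le)
    also have "norm (x \<cdot> v) \<le> onorm ((\<cdot>) x) * norm v"
      by (rule onorm[OF bounded_linear_app])
    finally show "norm ((a *\<^sub>C x) \<cdot> v) \<le> norm a * onorm ((\<cdot>) x) * norm v"
      by (simp add: mult.assoc mult_left_mono)
  qed
qed (auto intro!: cmat_eqI simp: app_scC_left app_scaleR_left scC_simps scC_of_real
      dist_cmat_def sgn_cmat_def uniformity_cmat_def open_cmat_def scaleR_add_left scaleR_add_right)
end

declare app_scC_left [simp] app_scaleR_left [simp]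

instance cmat :: (finite) real_normed_algebra
proof
  fix x y :: "'a cmat" and a :: real
  show "a *\<^sub>R x * y = a *\<^sub>R (x * y)" "x * a *\<^sub>R y = a *\<^sub>R (x * y)"
    by (auto intro!: cmat_eqI simp: scC_of_real[symmetric])
  show "norm (x * y) \<le> norm x * norm y"
    using onorm_compose[OF bounded_linear_app[of x] bounded_linear_app[of y]]
    by (simp add: norm_cmat_def o_def)
qed

lemma scC_mult_left [simp]: "(c *\<^sub>C A) * B = c *\<^sub>C (A * B)" for A :: "'m::finite cmat"
  by (rule cmat_eqI) simp

lemma scC_mult_right [simp]: "A * (c *\<^sub>C B) = c *\<^sub>C (A * B)" for A :: "'m::finite cmat"
  by (rule cmat_eqI) simp

lemma norm_app_le: "norm (A \<cdot> v) \<le> norm A * norm v"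
  unfolding norm_cmat_def by (rule onorm[OF bounded_linear_app])

section \<open>Smooth functions on plane open sets\<close>

text \<open>\<open>dd\<close> is typed for vector-valued sections; projections, gauges and scalar
  factors need the same derivative for other values.\<close>

definition dv :: "(complex \<Rightarrow> 'a::real_normed_vector) \<Rightarrow> complex \<Rightarrow> complex \<Rightarrow> 'a" where
  "dv f x X = frechet_derivative f (at x) X"

lemma dd_eq_dv: "dd = dv"
  by (intro ext) (simp add: dd_def dv_def)

text \<open>
  Everything below is written for a direction \<open>d\<close>: \<open>d = -\<i>\<close> is the \<open>\<partial>\<^sub>z\<close>- or \<open>(1,0)\<close>-direction, \<open>d = \<i>\<close> the
  conjugate, \<open>(0,1)\<close>-direction.
\<close>

definition wd :: "complex \<Rightarrow> (complex \<Rightarrow> 'a::cvs) \<Rightarrow> complex \<Rightarrow> 'a" where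
  "wd d f x = (1/2) *\<^sub>C (dv f x 1 + d *\<^sub>C dv f x \<i>)"

lemma dz_eq_wd: "dz = wd (- \<i>)"
  by (intro ext) (simp add: dz_def wd_def dd_eq_dv smult_eq_scC)

lemma dzbar_eq_wd: "dzbar = wd \<i>"
  by (intro ext) (simp add: dzbar_def wd_def dd_eq_dv smult_eq_scC)

lemma has_derivative_dv: "f differentiable (at x) \<Longrightarrow> (f has_derivative dv f x) (at x)"
  using frechet_derivative_works dv_def by (metis (no_types, lifting) ext)

lemma dv_eqI: "(f has_derivative f') (at x) \<Longrightarrow> dv f x X = f' X"
  by (metis dv_def frechet_derivative_at)

lemma dv_linear: "f differentiable (at x) \<Longrightarrow> linear (dv f x)"
  using has_derivative_dv has_derivative_linear by blast

lemma dv_conv: assumes "f differentiable (at x)"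
  shows "dv f x X = Re X *\<^sub>R dv f x 1 + Im X *\<^sub>R dv f x \<i>"
proof -
  have "dv f x X = dv f x (Re X *\<^sub>R 1 + Im X *\<^sub>R \<i>)"
    by (rule arg_cong[where f="dv f x"]) (simp add: complex_eq_iff)
  then show ?thesis
    by (simp only: linear_add[OF dv_linear[OF assms]] linear_scale[OF dv_linear[OF assms]])
qed

text \<open>The decomposition of df into its dz- and dzbar-parts. Statements about real tangent
  vectors reach the two complex directions through it.\<close>

lemma dv_wd: assumes "f differentiable (at x)"
  shows "dv f x X = X *\<^sub>C wd (- \<i>) f x + cnj X *\<^sub>C wd \<i> f x"
proof -
  have X: "X = of_real (Re X) + \<i> * of_real (Im X)" by (simp add: complex_eq_iff)
  have c: "X / 2 + cnj X / 2 = of_real (Re X)" "cnj X * \<i> / 2 - X * \<i> / 2 = of_real (Im X)"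
    by (simp_all add: complex_eq_iff)
  have "X *\<^sub>C wd (- \<i>) f x + cnj X *\<^sub>C wd \<i> f x
      = (X / 2 + cnj X / 2) *\<^sub>C dv f x 1 + (cnj X * \<i> / 2 - X * \<i> / 2) *\<^sub>C dv f x \<i>"
    by (simp add: wd_def scC_simps)
  then show ?thesis
    unfolding c using dv_conv[OF assms, of X] by (simp add: scC_of_real)
qed

lemma has_derivative_transform_open:
  assumes "(f has_derivative f') (at x)" "open U" "x \<in> U" "\<And>y. y \<in> U \<Longrightarrow> f y = g y"
  shows "(g has_derivative f') (at x)"
  using has_derivative_transform_within_open[OF assms(1-3)] assms(4) by blast

lemma differentiable_cong_open:
  assumes "open U" "x \<in> U" "\<And>y. y \<in> U \<Longrightarrow> f y = g y"
  shows "f differentiable (at x) \<longleftrightarrow> g differentiable (at x)"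
  unfolding differentiable_def
  using has_derivative_transform_open[of f _ x U g] has_derivative_transform_open[of g _ x U f] assms
  by metis

text \<open>Both functions have the same set of derivatives at \<open>x\<close>, so the choice
  inside \<open>frechet_derivative\<close> agrees whether or not a derivative exists.\<close>

lemma dv_cong_open:
  assumes "open U" "x \<in> U" "\<And>y. y \<in> U \<Longrightarrow> f y = g y"
  shows "dv f x X = dv g x X"
proof -
  have "(f has_derivative F) (at x) \<longleftrightarrow> (g has_derivative F) (at x)" for F
    using has_derivative_transform_open[of f F x U g] has_derivative_transform_open[of g F x U f] assms
    by metis
  then show ?thesis by (simp add: dv_def frechet_derivative_def)
qed

lemma wd_cong_open:
  assumes "open U" "x \<in> U" "\<And>y. y \<in> U \<Longrightarrow> f y = g y"
  shows "wd d f x = wd d g x"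
  by (simp add: wd_def dv_cong_open[OF assms])

section \<open>Complex bilinear products and the product rule\<close>

definition cbil :: "('a::cvs \<Rightarrow> 'b::cvs \<Rightarrow> 'c::cvs) \<Rightarrow> bool" where
  "cbil B \<longleftrightarrow> bounded_bilinear B \<and> (\<forall>c x y. B (c *\<^sub>C x) y = c *\<^sub>C B x y \<and> B x (c *\<^sub>C y) = c *\<^sub>C B x y)"

lemma cbilI:
  assumes "\<And>x x' y. B (x + x') y = B x y + B x' y" "\<And>x y y'. B x (y + y') = B x y + B x y'"
    and "\<And>c x y. B (c *\<^sub>C x) y = c *\<^sub>C B x y" "\<And>c x y. B x (c *\<^sub>C y) = c *\<^sub>C B x y"
    and "\<And>x y. norm (B x y) \<le> norm x * norm y * K"
  shows "cbil B"
  unfolding cbil_def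
proof (intro conjI allI)
  show "bounded_bilinear B"
    by standard (use assms in \<open>auto simp: scC_of_real[symmetric]\<close>)
qed (use assms in auto)

lemma cbil_mult_complex: "cbil ((*) :: complex \<Rightarrow> complex \<Rightarrow> complex)"
  by (rule cbilI[where K=1]) (auto simp: algebra_simps norm_mult)

lemma cbil_scC: "cbil ((*\<^sub>C) :: complex \<Rightarrow> 'a \<Rightarrow> 'a::cvs)"
proof (rule cbilI[where K=1])
  fix c x :: complex and y :: 'a
  show "x *\<^sub>C c *\<^sub>C y = c *\<^sub>C x *\<^sub>C y" by (simp add: scC_scC mult.commute)
qed (auto simp: scC_simps norm_scC_le)

lemma cbil_mult_cmat: "cbil ((*) :: 'm::finite cmat \<Rightarrow> 'm cmat \<Rightarrow> 'm cmat)"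
  by (rule cbilI[where K=1]) (auto simp: algebra_simps norm_mult_ineq)

lemma cbil_app: "cbil ((\<cdot>) :: 'm::finite cmat \<Rightarrow> _ \<Rightarrow> _)"
  by (rule cbilI[where K=1]) (auto simp: norm_app_le)

lemma has_derivative_cbil:
  assumes "cbil B" "f differentiable (at x)" "g differentiable (at x)"
  shows "((\<lambda>y. B (f y) (g y)) has_derivative (\<lambda>X. B (f x) (dv g x X) + B (dv f x X) (g x))) (at x)"
  by (rule bounded_bilinear.FDERIV) (use assms in \<open>auto simp: cbil_def intro: has_derivative_dv\<close>)

lemma differentiable_cbil:
  fixes f :: "complex \<Rightarrow> 'a::cvs"
  shows "cbil B \<Longrightarrow> f differentiable (at x) \<Longrightarrow> g differentiable (at x) \<Longrightarrow>
    (\<lambda>y. B (f y) (g y)) differentiable (at x)"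
  using has_derivative_cbil[of B f x g] unfolding differentiable_def by metis

lemma dv_cbil:
  "cbil B \<Longrightarrow> f differentiable (at x) \<Longrightarrow> g differentiable (at x) \<Longrightarrow>
    dv (\<lambda>y. B (f y) (g y)) x X = B (dv f x X) (g x) + B (f x) (dv g x X)"
  by (subst dv_eqI[OF has_derivative_cbil]) (simp_all add: add.commute)

lemma cbil_simps:
  assumes "cbil B"
  shows "B (x + x') y = B x y + B x' y" "B x (y + y') = B x y + B x y'"
    "B (c *\<^sub>C x) y = c *\<^sub>C B x y" "B x (c *\<^sub>C y) = c *\<^sub>C B x y"
  using assms by (auto simp: cbil_def bounded_bilinear.add_left bounded_bilinear.add_right)

text \<open>Proved once for an abstract product; scalar multiples, composition, application to a
  vector, the form and rank-one maps are all instances.\<close>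

lemma wd_cbil:
  assumes "cbil B" "f differentiable (at x)" "g differentiable (at x)"
  shows "wd d (\<lambda>y. B (f y) (g y)) x = B (wd d f x) (g x) + B (f x) (wd d g x)"
  by (simp add: wd_def dv_cbil[OF assms] cbil_simps[OF assms(1)] scC_simps)

lemmas wd_mult = wd_cbil[OF cbil_mult_complex] wd_cbil[OF cbil_mult_cmat]
lemmas wd_app = wd_cbil[OF cbil_app]
lemmas wd_scC = wd_cbil[OF cbil_scC]

lemma differentiable_app: "A differentiable (at x) \<Longrightarrow> s differentiable (at x) \<Longrightarrow>
    (\<lambda>y. A y \<cdot> s y) differentiable (at x)" for A :: "complex \<Rightarrow> 'm::finite cmat"
  by (rule differentiable_cbil[OF cbil_app])

lemma dv_const [simp]: "dv (\<lambda>_. c) x X = 0"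
  by (rule dv_eqI) (auto intro: derivative_eq_intros)

lemma wd_const [simp]: "wd d (\<lambda>_. c) x = 0"
  by (simp add: wd_def)

lemma dv_add: "f differentiable (at x) \<Longrightarrow> g differentiable (at x) \<Longrightarrow>
    dv (\<lambda>y. f y + g y) x X = dv f x X + dv g x X"
  by (rule dv_eqI[OF has_derivative_add[OF has_derivative_dv has_derivative_dv]])

lemma dv_diff: "f differentiable (at x) \<Longrightarrow> g differentiable (at x) \<Longrightarrow>
    dv (\<lambda>y. f y - g y) x X = dv f x X - dv g x X"
  by (rule dv_eqI[OF has_derivative_diff[OF has_derivative_dv has_derivative_dv]])

lemma dv_minus: "f differentiable (at x) \<Longrightarrow> dv (\<lambda>y. - f y) x X = - dv f x X"
  by (rule dv_eqI[OF has_derivative_minus[OF has_derivative_dv]])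

lemma wd_add: "f differentiable (at x) \<Longrightarrow> g differentiable (at x) \<Longrightarrow>
    wd d (\<lambda>y. f y + g y) x = wd d f x + wd d g x"
  by (simp add: wd_def dv_add scC_simps)

lemma wd_diff: "f differentiable (at x) \<Longrightarrow> g differentiable (at x) \<Longrightarrow>
    wd d (\<lambda>y. f y - g y) x = wd d f x - wd d g x"
  by (simp add: wd_def dv_diff scC_simps)

lemma wd_minus: "f differentiable (at x) \<Longrightarrow> wd d (\<lambda>y. - f y) x = - wd d f x"
  by (simp add: wd_def dv_minus scC_simps)

lemma differentiable_scC_const: "f differentiable (at x) \<Longrightarrow> (\<lambda>y. c *\<^sub>C f y) differentiable (at x)"
  for f :: "complex \<Rightarrow> 'a::cvs"
  by (rule differentiable_cbil[OF cbil_scC]) auto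

lemma wd_scC_const: "f differentiable (at x) \<Longrightarrow> wd d (\<lambda>y. c *\<^sub>C f y) x = c *\<^sub>C wd d f x"
  by (simp add: wd_scC)

lemma dv_scC_const: "f differentiable (at x) \<Longrightarrow> dv (\<lambda>y. c *\<^sub>C f y) x X = c *\<^sub>C dv f x X"
  by (simp add: dv_cbil[OF cbil_scC])

text \<open>\<open>smooth_on\<close> is typed for sections only; matrix-valued maps need a version for arbitrary values.\<close>

primrec smk :: "nat \<Rightarrow> complex set \<Rightarrow> (complex \<Rightarrow> 'a::real_normed_vector) \<Rightarrow> bool" where
  "smk 0 U f \<longleftrightarrow> (\<forall>x\<in>U. f differentiable (at x))"
| "smk (Suc k) U f \<longleftrightarrow> (\<forall>x\<in>U. f differentiable (at x)) \<and> (\<forall>X. smk k U (\<lambda>x. dv f x X))"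

definition sm :: "complex set \<Rightarrow> (complex \<Rightarrow> 'a::real_normed_vector) \<Rightarrow> bool" where
  "sm U f \<longleftrightarrow> (\<forall>k. smk k U f)"

lemma smk_diff: "smk k U f \<Longrightarrow> x \<in> U \<Longrightarrow> f differentiable (at x)"
  by (cases k) auto

lemma smk_Suc_D: "smk (Suc k) U f \<Longrightarrow> smk k U f"
proof (induction k arbitrary: f)
  case (Suc k)
  then show ?case by (metis smk.simps(2))
qed auto

lemma smk_cong: "open U \<Longrightarrow> (\<And>y. y \<in> U \<Longrightarrow> f y = g y) \<Longrightarrow> smk k U f \<longleftrightarrow> smk k U g"
proof (induction k arbitrary: f g)
  case 0
  then show ?case using differentiable_cong_open[of U _ f g] by auto
next
  case (Suc k)
  have "smk k U (\<lambda>x. dv f x X) \<longleftrightarrow> smk k U (\<lambda>x. dv g x X)" for X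
    by (rule Suc.IH[OF Suc.prems(1)]) (rule dv_cong_open[OF Suc.prems(1) _ Suc.prems(2)])
  then show ?case using Suc.prems differentiable_cong_open[of U _ f g] by auto
qed

lemma smk_add: "open U \<Longrightarrow> smk k U f \<Longrightarrow> smk k U g \<Longrightarrow> smk k U (\<lambda>x. f x + g x)"
proof (induction k arbitrary: f g)
  case (Suc k)
  have "smk k U (\<lambda>x. dv (\<lambda>x. f x + g x) x X)" for X
    by (rule iffD2[OF smk_cong[OF Suc.prems(1), of _ "\<lambda>x. dv f x X + dv g x X"]])
      (use Suc in \<open>auto intro: dv_add\<close>)
  then show ?case using Suc by auto
qed auto

lemma smk_cbil:
  assumes "cbil B"
  shows "open U \<Longrightarrow> smk k U f \<Longrightarrow> smk k U g \<Longrightarrow> smk k U (\<lambda>x. B (f x) (g x))"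
proof (induction k arbitrary: f g)
  case 0
  then show ?case by (auto intro: differentiable_cbil[OF assms])
next
  case (Suc k)
  have "smk k U (\<lambda>x. dv (\<lambda>x. B (f x) (g x)) x X)" for X
  proof (rule iffD2[OF smk_cong[OF Suc.prems(1), of _ "\<lambda>x. B (dv f x X) (g x) + B (f x) (dv g x X)"]])
    show "smk k U (\<lambda>x. B (dv f x X) (g x) + B (f x) (dv g x X))"
      using Suc.prems smk_Suc_D[OF Suc.prems(2)] smk_Suc_D[OF Suc.prems(3)]
      by (intro smk_add Suc.IH) auto
  qed (use Suc.prems in \<open>auto intro!: dv_cbil[OF assms]\<close>)
  then show ?case using Suc.prems by (auto intro: differentiable_cbil[OF assms])
qed

lemma smk_const: "smk k U (\<lambda>x. c)"
  by (induction k arbitrary: c) auto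

lemma sm_const [simp]: "sm U (\<lambda>x. c)"
  by (simp add: sm_def smk_const)

lemma sm_diff_at: "sm U f \<Longrightarrow> x \<in> U \<Longrightarrow> f differentiable (at x)"
  unfolding sm_def using smk_diff by blast

lemma sm_add: "open U \<Longrightarrow> sm U f \<Longrightarrow> sm U g \<Longrightarrow> sm U (\<lambda>x. f x + g x)"
  unfolding sm_def by (simp add: smk_add)

lemma sm_cbil: "cbil B \<Longrightarrow> open U \<Longrightarrow> sm U f \<Longrightarrow> sm U g \<Longrightarrow> sm U (\<lambda>x. B (f x) (g x))"
  unfolding sm_def by (simp add: smk_cbil)

lemma sm_mult_cmat: "open U \<Longrightarrow> sm U f \<Longrightarrow> sm U g \<Longrightarrow> sm U (\<lambda>x. f x * g x)"
  for f :: "complex \<Rightarrow> 'm::finite cmat"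
  by (rule sm_cbil[OF cbil_mult_cmat])

lemma sm_mult_complex: "open U \<Longrightarrow> sm U f \<Longrightarrow> sm U g \<Longrightarrow> sm U (\<lambda>x. f x * g x)"
  for f :: "complex \<Rightarrow> complex"
  by (rule sm_cbil[OF cbil_mult_complex])

lemma sm_app: "open U \<Longrightarrow> sm U f \<Longrightarrow> sm U g \<Longrightarrow> sm U (\<lambda>x. f x \<cdot> g x)"
  by (rule sm_cbil[OF cbil_app])

lemma sm_scC: "open U \<Longrightarrow> sm U f \<Longrightarrow> sm U g \<Longrightarrow> sm U (\<lambda>x. f x *\<^sub>C g x)"
  by (rule sm_cbil[OF cbil_scC])

lemma sm_minus: "open U \<Longrightarrow> sm U f \<Longrightarrow> sm U (\<lambda>x. - f x)" for f :: "complex \<Rightarrow> 'a::cvs"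
  using sm_scC[of U "\<lambda>_. - 1" f] by simp

lemma sm_diff: "open U \<Longrightarrow> sm U f \<Longrightarrow> sm U g \<Longrightarrow> sm U (\<lambda>x. f x - g x)" for f :: "complex \<Rightarrow> 'a::cvs"
  using sm_add[of U f "\<lambda>x. - g x"] sm_minus[of U g] by simp

lemma sm_cong: "open U \<Longrightarrow> (\<And>y. y \<in> U \<Longrightarrow> f y = g y) \<Longrightarrow> sm U f \<longleftrightarrow> sm U g"
  unfolding sm_def by (intro all_cong1 smk_cong)

lemma sm_dv: "sm U f \<Longrightarrow> sm U (\<lambda>x. dv f x X)"
  unfolding sm_def by (metis smk.simps(2))

lemma sm_wd: "open U \<Longrightarrow> sm U f \<Longrightarrow> sm U (wd d f)"
  unfolding wd_def by (intro sm_scC sm_add sm_dv sm_const)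

lemma sm_sum: "open U \<Longrightarrow> (\<And>i. i \<in> I \<Longrightarrow> sm U (f i)) \<Longrightarrow> sm U (\<lambda>x. \<Sum>i\<in>I. f i x)"
  by (induction I rule: infinite_finite_induct) (auto intro: sm_add)

lemma smk_subset: "V \<subseteq> U \<Longrightarrow> smk k U f \<Longrightarrow> smk k V f"
  by (induction k arbitrary: f) auto

lemma sm_subset: "sm U f \<Longrightarrow> V \<subseteq> U \<Longrightarrow> sm V f"
  unfolding sm_def using smk_subset by blast

lemma smk_local: "(\<And>x. x \<in> U \<Longrightarrow> \<exists>V. x \<in> V \<and> smk k V f) \<Longrightarrow> smk k U f"
proof (induction k arbitrary: f)
  case (Suc k)
  have "smk k U (\<lambda>x. dv f x X)" for X
    by (rule Suc.IH) (use Suc.prems in fastforce)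
  then show ?case using Suc.prems by fastforce
qed fastforce

lemma sm_local: "(\<And>x. x \<in> U \<Longrightarrow> \<exists>V. x \<in> V \<and> sm V f) \<Longrightarrow> sm U f"
  unfolding sm_def by (meson smk_local)

lemma smk_inverse: "open U \<Longrightarrow> (\<And>x. x \<in> U \<Longrightarrow> f x \<noteq> 0) \<Longrightarrow> smk k U f \<Longrightarrow> smk k U (\<lambda>x. inverse (f x))"
  for f :: "complex \<Rightarrow> complex"
proof (induction k)
  case 0
  then show ?case by (auto intro: differentiable_inverse)
next
  case (Suc k)
  have 1: "smk k U (\<lambda>x. inverse (f x))" using Suc smk_Suc_D by metis
  have "smk k U (\<lambda>x. dv (\<lambda>x. inverse (f x)) x X)" for X
  proof (rule iffD2[OF smk_cong[OF Suc.prems(1), of _ "\<lambda>x. (- 1) * ((inverse (f x) * dv f x X) * inverse (f x))"]])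
    show "smk k U (\<lambda>x. (- 1) * ((inverse (f x) * dv f x X) * inverse (f x)))"
      using Suc.prems 1 by (intro smk_cbil[OF cbil_mult_complex] smk_const) auto
    fix y assume "y \<in> U"
    then show "dv (\<lambda>x. inverse (f x)) y X = (- 1) * ((inverse (f y) * dv f y X) * inverse (f y))"
      by (intro dv_eqI has_derivative_eq_rhs[OF Deriv.has_derivative_inverse[OF _ has_derivative_dv]])
        (use Suc.prems in \<open>auto simp: fun_eq_iff\<close>)
  qed
  then show ?case using Suc.prems by (auto intro: differentiable_inverse)
qed

lemma sm_inverse: "open U \<Longrightarrow> sm U f \<Longrightarrow> (\<And>x. x \<in> U \<Longrightarrow> f x \<noteq> 0) \<Longrightarrow> sm U (\<lambda>x. inverse (f x))"
  for f :: "complex \<Rightarrow> complex"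
  unfolding sm_def by (simp add: smk_inverse)

lemma smk_linear:
  assumes "bounded_linear h"
  shows "open U \<Longrightarrow> smk k U f \<Longrightarrow> smk k U (\<lambda>x. h (f x))"
proof (induction k arbitrary: f)
  case 0
  then show ?case
    by (auto simp: differentiable_def intro: bounded_linear.has_derivative[OF assms])
next
  case (Suc k)
  have d: "((\<lambda>x. h (f x)) has_derivative (\<lambda>X. h (dv f y X))) (at y)" if "y \<in> U" for y
    using Suc.prems that by (auto intro: bounded_linear.has_derivative[OF assms] has_derivative_dv)
  have "smk k U (\<lambda>x. dv (\<lambda>x. h (f x)) x X)" for X
    by (rule iffD2[OF smk_cong[OF Suc.prems(1) dv_eqI[OF d]]]) (use Suc in auto)
  then show ?case using d by (auto simp: differentiable_def)
qed

lemma sm_linear: "bounded_linear h \<Longrightarrow> open U \<Longrightarrow> sm U f \<Longrightarrow> sm U (\<lambda>x. h (f x))"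
  unfolding sm_def by (simp add: smk_linear)

lemma dv_blinear: assumes "bounded_linear h" "f differentiable (at x)"
  shows "dv (\<lambda>x. h (f x)) x X = h (dv f x X)"
  by (rule dv_eqI[OF bounded_linear.has_derivative[OF assms(1) has_derivative_dv[OF assms(2)]]])

text \<open>\<open>iter_dd\<close> differentiates along the last list entry first, while
  \<open>smk\<close> peels off the first derivative taken; so the list has to be split at its
  end.\<close>

lemma iter_dd_append: "iter_dd (Xs @ [X]) f = iter_dd Xs (\<lambda>x. dv f x X)"
  by (induction Xs) (simp_all add: dd_eq_dv)

lemma smk_iter: "smk k U f \<longleftrightarrow> (\<forall>Xs. length Xs \<le> k \<longrightarrow> (\<forall>x\<in>U. iter_dd Xs f differentiable (at x)))"
proof (induction k arbitrary: f)
  case (Suc k)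
  show ?case
  proof
    assume *: "smk (Suc k) U f"
    show "\<forall>Xs. length Xs \<le> Suc k \<longrightarrow> (\<forall>x\<in>U. iter_dd Xs f differentiable (at x))"
    proof (intro allI impI)
      fix Xs :: "complex list" assume l: "length Xs \<le> Suc k"
      show "\<forall>x\<in>U. iter_dd Xs f differentiable (at x)"
      proof (cases Xs rule: rev_exhaust)
        case Nil
        then show ?thesis using * by simp
      next
        case (snoc Ys X)
        then show ?thesis using * l Suc.IH[of "\<lambda>x. dv f x X"] by (auto simp: iter_dd_append)
      qed
    qed
  next
    assume *: "\<forall>Xs. length Xs \<le> Suc k \<longrightarrow> (\<forall>x\<in>U. iter_dd Xs f differentiable (at x))"
    have "smk k U (\<lambda>x. dv f x X)" for X
      unfolding Suc.IH using * by (metis Suc_le_mono iter_dd_append length_append_singleton)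
    moreover have "\<forall>x\<in>U. f differentiable (at x)" using *[rule_format, of "[]"] by simp
    ultimately show "smk (Suc k) U f" by simp
  qed
qed auto

lemma smooth_on_eq_sm: "smooth_on U f \<longleftrightarrow> sm U f"
  unfolding smooth_on_def sm_def smk_iter by blast

text \<open>The classical route to the symmetry of second derivatives: the second difference over
  the parallelogram with sides tX and tY is symmetric in X and Y and equals t^2 times the mixed
  derivative up to o(t^2).\<close>

lemma second_difference:
  fixes f :: "complex \<Rightarrow> 'a::real_normed_vector"
  assumes "open U" "x \<in> U" "sm U f" "e > 0"
  shows "\<exists>r>0. \<forall>t. 0 < t \<and> t < r \<longrightarrow>
    norm (f (x + t *\<^sub>R X + t *\<^sub>R Y) - f (x + t *\<^sub>R X) - f (x + t *\<^sub>R Y) + f x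
      - (t * t) *\<^sub>R dv (\<lambda>y. dv f y X) x Y) \<le> e * (t * t)"
proof -
  define h where "h = (\<lambda>y. dv f y X)"
  \<comment> \<open>The summand 1 keeps \<open>K\<close> positive even if both directions
    vanish.\<close>
  define K where "K = norm X + norm Y + 1"
  have K: "K > 0" "norm X \<le> K" "norm X + norm Y \<le> K" by (auto simp: K_def intro: add_nonneg_pos)
  have hd: "(h has_derivative dv h x) (at x)"
    unfolding h_def by (intro has_derivative_dv sm_diff_at[OF sm_dv[OF assms(3)] assms(2)])
  \<comment> \<open>Two errors of size \<open>e' * (t * K)\<close> have to add up to
    \<open>e * t\<close>.\<close>
  define e' where "e' = e / (2 * K)"
  have e': "e' > 0" using K assms(4) by (simp add: e'_def)
  obtain d where d: "d > 0" "\<And>y. norm (y - x) < d \<Longrightarrow> norm (h y - h x - dv h x (y - x)) \<le> e' * norm (y - x)"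
    using hd e' unfolding has_derivative_at_alt by metis
  obtain d' where d': "d' > 0" "ball x d' \<subseteq> U"
    using assms(1,2) open_contains_ball by blast
  define r where "r = min d d' / K"
  have r: "r > 0" using d d' K by (simp add: r_def)
  have small: "norm (s *\<^sub>R X + u *\<^sub>R Y) < min d d'" "norm (s *\<^sub>R X + u *\<^sub>R Y) \<le> t * K"
    if "0 \<le> s" "s \<le> t" "0 \<le> u" "u \<le> t" "0 < t" "t < r" for s u t
  proof -
    have "norm (s *\<^sub>R X + u *\<^sub>R Y) \<le> s * norm X + u * norm Y"
      using that norm_triangle_ineq[of "s *\<^sub>R X" "u *\<^sub>R Y"] by simp
    also have "\<dots> \<le> t * norm X + t * norm Y"
      using that by (intro add_mono mult_right_mono) auto
    also have "\<dots> \<le> t * K" using that K(3) by (simp add: distrib_left[symmetric])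
    finally show *: "norm (s *\<^sub>R X + u *\<^sub>R Y) \<le> t * K" .
    have "t * K < r * K" using that K by simp
    also have "r * K = min d d'" using K by (simp add: r_def)
    finally show "norm (s *\<^sub>R X + u *\<^sub>R Y) < min d d'" using * by simp
  qed
  show ?thesis
  proof (intro exI[of _ r] conjI allI impI r)
    fix t :: real assume t: "0 < t \<and> t < r"
    \<comment> \<open>With the increment in \<open>Y\<close> frozen this is a function of one real
      variable. Differentiability of \<open>h\<close> at \<open>x\<close> makes its derivative
      small, and the mean value inequality on \<open>{0..t}\<close> gives the estimate.\<close>
    define g where "g = (\<lambda>s. f (x + s *\<^sub>R X + t *\<^sub>R Y) - f (x + s *\<^sub>R X) - (s * t) *\<^sub>R dv h x Y)"
    have inU: "x + s *\<^sub>R X + u *\<^sub>R Y \<in> U" if "0 \<le> s" "s \<le> t" "0 \<le> u" "u \<le> t" for s u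
    proof -
      have "dist x (x + s *\<^sub>R X + u *\<^sub>R Y) = norm (s *\<^sub>R X + u *\<^sub>R Y)"
        by (subst dist_commute) (simp add: dist_norm add.assoc)
      then show ?thesis using small(1)[OF that] t d'(2) by (auto simp: subset_iff)
    qed
    have fd: "((\<lambda>s. f (x + s *\<^sub>R X + u *\<^sub>R Y)) has_derivative (\<lambda>k. k *\<^sub>R h (x + s *\<^sub>R X + u *\<^sub>R Y))) (at s within {0..t})"
      if "s \<in> {0..t}" "0 \<le> u" "u \<le> t" for s u
    proof -
      let ?p = "x + s *\<^sub>R X + u *\<^sub>R Y"
      have df: "f differentiable (at ?p)" using inU that sm_diff_at[OF assms(3)] by auto
      have "((\<lambda>s. x + s *\<^sub>R X + u *\<^sub>R Y) has_derivative (\<lambda>k. k *\<^sub>R X)) (at s within {0..t})"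
        by (auto intro!: derivative_eq_intros)
      from has_derivative_compose[OF this has_derivative_dv[OF df]]
      show ?thesis by (simp add: h_def linear_scale[OF dv_linear[OF df]])
    qed
    have gd: "(g has_derivative (\<lambda>k. k *\<^sub>R (h (x + s *\<^sub>R X + t *\<^sub>R Y) - h (x + s *\<^sub>R X) - t *\<^sub>R dv h x Y))) (at s within {0..t})"
      if "s \<in> {0..t}" for s
      unfolding g_def
      using fd[OF that, of t] fd[OF that, of 0] t
      by (auto intro!: derivative_eq_intros simp: algebra_simps)
    have bound: "norm (h (x + s *\<^sub>R X + t *\<^sub>R Y) - h (x + s *\<^sub>R X) - t *\<^sub>R dv h x Y) \<le> e * t"
      if "s \<in> {0..t}" for s
    proof -
      have lin: "linear (dv h x)" using hd has_derivative_linear by blast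
      have 1: "norm (h (x + (s *\<^sub>R X + u *\<^sub>R Y)) - h x - dv h x (s *\<^sub>R X + u *\<^sub>R Y)) \<le> e' * (t * K)"
        if "0 \<le> u" "u \<le> t" for u
      proof -
        have "norm (h (x + (s *\<^sub>R X + u *\<^sub>R Y)) - h x - dv h x (s *\<^sub>R X + u *\<^sub>R Y))
            \<le> e' * norm (s *\<^sub>R X + u *\<^sub>R Y)"
          using d(2)[of "x + (s *\<^sub>R X + u *\<^sub>R Y)"] small(1)[of s t u] that \<open>s \<in> {0..t}\<close> t by simp
        also have "\<dots> \<le> e' * (t * K)"
          using small(2)[of s t u] that \<open>s \<in> {0..t}\<close> t e' by (intro mult_left_mono) auto
        finally show ?thesis .
      qed
      have "h (x + s *\<^sub>R X + t *\<^sub>R Y) - h (x + s *\<^sub>R X) - t *\<^sub>R dv h x Y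
          = (h (x + (s *\<^sub>R X + t *\<^sub>R Y)) - h x - dv h x (s *\<^sub>R X + t *\<^sub>R Y))
            - (h (x + (s *\<^sub>R X + 0 *\<^sub>R Y)) - h x - dv h x (s *\<^sub>R X + 0 *\<^sub>R Y))"
        by (simp add: linear_add[OF lin] linear_scale[OF lin] add.assoc)
      also have "norm \<dots> \<le> e' * (t * K) + e' * (t * K)"
        using 1[of t] 1[of 0] t
          norm_triangle_ineq4[of "h (x + (s *\<^sub>R X + t *\<^sub>R Y)) - h x - dv h x (s *\<^sub>R X + t *\<^sub>R Y)"
            "h (x + (s *\<^sub>R X + 0 *\<^sub>R Y)) - h x - dv h x (s *\<^sub>R X + 0 *\<^sub>R Y)"]
        by linarith
      also have "\<dots> = e * t" using K by (simp add: e'_def field_simps)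
      finally show ?thesis .
    qed
    have "norm (g t - g 0) \<le> (e * t) * norm (t - 0)"
    proof (rule differentiable_bound[of "{0..t}" g])
      show "onorm (\<lambda>k. k *\<^sub>R (h (x + s *\<^sub>R X + t *\<^sub>R Y) - h (x + s *\<^sub>R X) - t *\<^sub>R dv h x Y)) \<le> e * t"
        if "s \<in> {0..t}" for s
        using onorm_scaleR_left[OF bounded_linear_ident, of "h (x + s *\<^sub>R X + t *\<^sub>R Y) - h (x + s *\<^sub>R X) - t *\<^sub>R dv h x Y"]
          bound[OF that] by (simp add: onorm_id)
    qed (use gd t in auto)
    moreover have "g t - g 0 = f (x + t *\<^sub>R X + t *\<^sub>R Y) - f (x + t *\<^sub>R X) - f (x + t *\<^sub>R Y) + f x - (t * t) *\<^sub>R dv h x Y"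
      by (simp add: g_def)
    ultimately show "norm (f (x + t *\<^sub>R X + t *\<^sub>R Y) - f (x + t *\<^sub>R X) - f (x + t *\<^sub>R Y) + f x
      - (t * t) *\<^sub>R dv (\<lambda>y. dv f y X) x Y) \<le> e * (t * t)"
      using t by (simp add: h_def mult.assoc)
  qed
qed

lemma dv_commute:
  fixes f :: "complex \<Rightarrow> 'a::real_normed_vector"
  assumes "open U" "x \<in> U" "sm U f"
  shows "dv (\<lambda>y. dv f y X) x Y = dv (\<lambda>y. dv f y Y) x X"
proof (rule ccontr)
  let ?a = "dv (\<lambda>y. dv f y X) x Y" and ?b = "dv (\<lambda>y. dv f y Y) x X"
  assume "?a \<noteq> ?b"
  \<comment> \<open>A quarter of the gap: the two estimates leave room for at most
    \<open>2 * e\<close>, half of it.\<close>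
  define e where "e = norm (?a - ?b) / 4"
  have e: "e > 0" using \<open>?a \<noteq> ?b\<close> by (simp add: e_def)
  obtain r1 where r1: "r1 > 0" "\<And>t. 0 < t \<Longrightarrow> t < r1 \<Longrightarrow>
      norm (f (x + t *\<^sub>R X + t *\<^sub>R Y) - f (x + t *\<^sub>R X) - f (x + t *\<^sub>R Y) + f x - (t * t) *\<^sub>R ?a) \<le> e * (t * t)"
    using second_difference[OF assms e, of X Y] by blast
  obtain r2 where r2: "r2 > 0" "\<And>t. 0 < t \<Longrightarrow> t < r2 \<Longrightarrow>
      norm (f (x + t *\<^sub>R Y + t *\<^sub>R X) - f (x + t *\<^sub>R Y) - f (x + t *\<^sub>R X) + f x - (t * t) *\<^sub>R ?b) \<le> e * (t * t)"
    using second_difference[OF assms e, of Y X] by blast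
  define t where "t = min r1 r2 / 2"
  have t: "0 < t" "t < r1" "t < r2" using r1(1) r2(1) by (auto simp: t_def min_def)
  let ?d = "f (x + t *\<^sub>R X + t *\<^sub>R Y) - f (x + t *\<^sub>R X) - f (x + t *\<^sub>R Y) + f x"
  have sw: "f (x + t *\<^sub>R Y + t *\<^sub>R X) - f (x + t *\<^sub>R Y) - f (x + t *\<^sub>R X) + f x = ?d"
    by (simp add: algebra_simps)
  have "norm ((t * t) *\<^sub>R (?a - ?b)) = norm ((?d - (t * t) *\<^sub>R ?b) - (?d - (t * t) *\<^sub>R ?a))"
    by (simp add: algebra_simps)
  also have "\<dots> \<le> e * (t * t) + e * (t * t)"
    using r1(2)[OF t(1,2)] r2(2)[OF t(1,3)] norm_triangle_ineq4[of "?d - (t * t) *\<^sub>R ?b" "?d - (t * t) *\<^sub>R ?a"]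
    unfolding sw by linarith
  finally have "(t * t) * norm (?a - ?b) \<le> (t * t) * (2 * e)" using t by (simp add: mult.commute)
  then have "norm (?a - ?b) \<le> 2 * e" using t(1) by (simp del: mult_le_cancel_left_pos add: mult_le_cancel_left)
  then show False using e by (simp add: e_def)
qed

lemma wd_commute:
  assumes "open U" "x \<in> U" "sm U f"
  shows "wd d (wd d' f) x = wd d' (wd d f) x"
proof -
  have "(\<lambda>y. dv f y X) differentiable (at x)" for X
    by (rule sm_diff_at[OF sm_dv[OF assms(3)] assms(2)])
  then have 1: "dv (wd d f) x Y = (1/2) *\<^sub>C (dv (\<lambda>y. dv f y 1) x Y + d *\<^sub>C dv (\<lambda>y. dv f y \<i>) x Y)" for d Y
    unfolding wd_def by (simp add: dv_scC_const dv_add differentiable_scC_const)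
  show ?thesis
    by (simp add: wd_def[of _ "wd _ _"] 1 scC_simps dv_commute[OF assms, of 1 \<i>] add_ac mult.commute)
qed

section \<open>The bilinear form, adjoints and conjugation\<close>

definition gsgn :: "'n option option \<Rightarrow> complex" where
  "gsgn i = (if i = None then - 1 else 1)"

lemma gsgn_sq [simp]: "gsgn i * gsgn i = 1"
  by (simp add: gsgn_def)

lemma form_gsgn: "form v w = (\<Sum>i\<in>UNIV. gsgn i * (v $ i * w $ i))"
proof -
  have "(\<Sum>i\<in>UNIV. f i) = f None + (\<Sum>i\<in>UNIV. f (Some i))" for f :: "'a option option \<Rightarrow> complex"
    by (subst UNIV_option_conv) (simp add: sum.reindex)
  then show ?thesis by (simp add: form_def gsgn_def)
qed

lemma form_sym: "form v w = form w v"
  by (simp add: form_gsgn mult.commute)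

lemma form_add_left [simp]: "form (u + v) w = form u w + form v w"
  by (simp add: form_gsgn algebra_simps sum.distrib)

lemma form_add_right [simp]: "form w (u + v) = form w u + form w v"
  by (simp add: form_gsgn algebra_simps sum.distrib)

lemma form_scC_left [simp]: "form (c *\<^sub>C v) w = c * form v w"
  by (simp add: form_gsgn sum_distrib_left mult.left_commute mult.assoc)

lemma form_scC_right [simp]: "form w (c *\<^sub>C v) = c * form w v"
  using form_scC_left[of c v w] by (simp add: form_sym)

lemma form_0 [simp]: "form 0 v = 0" "form v 0 = 0"
  by (simp_all add: form_gsgn)

lemma form_minus [simp]: "form (- v) w = - form v w" "form w (- v) = - form w v"
  by (simp_all add: form_gsgn sum_negf)

lemma form_diff_left [simp]: "form (u - v) w = form u w - form v w"
  by (simp add: diff_conv_add_uminus del: add_uminus_conv_diff)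

lemma form_diff_right [simp]: "form w (u - v) = form w u - form w v"
  by (simp add: diff_conv_add_uminus del: add_uminus_conv_diff)

lemma form_scaleR [simp]: "form (r *\<^sub>R v) w = r *\<^sub>R form v w" "form w (r *\<^sub>R v) = r *\<^sub>R form w v"
  by (simp_all add: scC_of_real[symmetric])

lemma cbilI_euclidean:
  fixes B :: "complex ^ 'm::finite \<Rightarrow> complex ^ 'k::finite \<Rightarrow> 'c::cvs"
  assumes "\<And>x x' y. B (x + x') y = B x y + B x' y" "\<And>x y y'. B x (y + y') = B x y + B x y'"
    and "\<And>c x y. B (c *\<^sub>C x) y = c *\<^sub>C B x y" "\<And>c x y. B x (c *\<^sub>C y) = c *\<^sub>C B x y"
  shows "cbil B"
proof -
  have "bilinear B"
    unfolding bilinear_def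
    by (intro conjI allI linearI) (use assms in \<open>auto simp: scC_of_real[symmetric]\<close>)
  then show ?thesis
    using assms by (simp add: cbil_def bilinear_conv_bounded_bilinear)
qed

lemma cbil_form: "cbil (form :: 'n::finite cvec \<Rightarrow> _)"
  by (rule cbilI_euclidean) auto

lemma form_axis [simp]: "form v (axis i 1) = gsgn i * v $ i"
  by (simp add: form_gsgn axis_def if_distrib cong: if_cong)

lemma form_nondegenerate: "v = 0" if "\<And>w. form v w = 0"
proof -
  have "v $ i = 0" for i
    using that[of "axis i 1"] by (simp add: gsgn_def split: if_splits)
  then show ?thesis by (simp add: vec_eq_iff)
qed

lemma form_eqI: "v = v'" if "\<And>w. form v w = form v' w"
  using form_nondegenerate[of "v - v'"] that by simp

section \<open>Adjoints with respect to the bilinear form\<close>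

type_synonym 'n omat = "'n option option cmat"

text \<open>The transpose for the complex bilinear form, not a Hermitian adjoint:
  \<open>adj G * G = 1\<close> describes the complex orthogonal group and \<open>adj X = - X\<close>
  its Lie algebra. Pairing with the basis vectors, which have length \<open>gsgn i\<close>, recovers
  the coordinates.\<close>

definition adj :: "'n::finite omat \<Rightarrow> 'n omat" where
  "adj A = of_lin (\<lambda>w. \<chi> i. gsgn i * form (A \<cdot> axis i 1) w)"

lemma axis_expand: "v = (\<Sum>i\<in>UNIV. v $ i *\<^sub>C axis i 1)" for v :: "complex ^ 'm::finite"
  by (simp add: vec_eq_iff axis_def if_distrib cong: if_cong)

lemma form_sum_left: "form (sum f I) w = (\<Sum>i\<in>I. form (f i) w)"
  by (induction I rule: infinite_finite_induct) auto

lemma app_sum: "A \<cdot> sum f I = (\<Sum>i\<in>I. A \<cdot> f i)"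
  by (induction I rule: infinite_finite_induct) auto

lemma adj_app: "form (A \<cdot> v) w = form v (adj A \<cdot> w)"
proof -
  have 1: "adj A \<cdot> w = (\<chi> i. gsgn i * form (A \<cdot> axis i 1) w)"
    unfolding adj_def by (rule app_of_lin) (auto simp: vec_eq_iff algebra_simps)
  have "form (A \<cdot> v) w = form (A \<cdot> (\<Sum>i\<in>UNIV. v $ i *\<^sub>C axis i 1)) w"
    using axis_expand by metis
  also have "\<dots> = (\<Sum>i\<in>UNIV. v $ i * form (A \<cdot> axis i 1) w)"
    by (simp add: app_sum form_sum_left)
  also have "\<dots> = (\<Sum>i\<in>UNIV. gsgn i * (v $ i * (gsgn i * form (A \<cdot> axis i 1) w)))"
    by (intro sum.cong refl) (metis gsgn_sq mult.assoc mult.left_commute mult_1)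
  finally show ?thesis by (simp add: form_gsgn[of v] 1)
qed

lemma adj_app': "form w (A \<cdot> v) = form (adj A \<cdot> w) v"
  using adj_app form_sym by metis

lemma adj_eqI: "adj A = B" if "\<And>v w. form (A \<cdot> v) w = form v (B \<cdot> w)"
proof (rule cmat_eqI, rule form_eqI)
  fix v w
  show "form (adj A \<cdot> v) w = form (B \<cdot> v) w"
    using that[of w v] adj_app[of A w v] by (metis form_sym)
qed

lemma adj_simps [simp]:
  "adj (A + B) = adj A + adj B" "adj (A - B) = adj A - adj B" "adj (- A) = - adj A"
  "adj (A * B) = adj B * adj A" "adj (c *\<^sub>C A) = c *\<^sub>C adj A" "adj 1 = 1" "adj 0 = 0"
  by (rule adj_eqI; simp add: adj_app)+

lemma adj_adj [simp]: "adj (adj A) = A"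
  by (rule adj_eqI) (simp add: adj_app')

section \<open>Rank-one maps and bivectors\<close>

definition tens :: "'n::finite cvec \<Rightarrow> 'n cvec \<Rightarrow> 'n omat" where
  "tens u v = of_lin (\<lambda>w. form w v *\<^sub>C u)"

lemma tens_app [simp]: "tens u v \<cdot> w = form w v *\<^sub>C u"
  unfolding tens_def by (rule app_of_lin) (auto simp: scC_simps)

lemma cbil_tens: "cbil (tens :: 'n::finite cvec \<Rightarrow> _)"
  by (rule cbilI_euclidean; rule cmat_eqI; simp add: scC_simps mult.commute)

lemma adj_tens [simp]: "adj (tens u v) = tens v u"
  by (rule adj_eqI) (simp add: form_sym)

lemma tens_simps [simp]:
  "A * tens u v = tens (A \<cdot> u) v" "tens u v * A = tens u (adj A \<cdot> v)"
  "tens (u + u') v = tens u v + tens u' v" "tens u (v + v') = tens u v + tens u v'"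
  "tens (u - u') v = tens u v - tens u' v" "tens u (v - v') = tens u v - tens u v'"
  "tens (c *\<^sub>C u) v = c *\<^sub>C tens u v" "tens u (c *\<^sub>C v) = c *\<^sub>C tens u v"
  "tens 0 v = 0" "tens u 0 = 0" "tens (- u) v = - tens u v" "tens u (- v) = - tens u v"
  by (rule cmat_eqI; simp add: scC_simps adj_app mult.commute)+

definition wdg :: "'n::finite cvec \<Rightarrow> 'n cvec \<Rightarrow> 'n omat" where
  "wdg u v = tens v u - tens u v"

lemma wedge_eq_wdg: "wedge u v = (\<cdot>) (wdg u v)"
  by (intro ext) (simp add: wedge_def wdg_def smult_eq_scC)

section \<open>Complex conjugation of vectors and endomorphisms\<close>

definition mconj :: "'n::finite omat \<Rightarrow> 'n omat" where
  "mconj A = of_lin (\<lambda>v. vconj (A \<cdot> vconj v))"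

lemma vconj_simps [simp]:
  "vconj (u + v) = vconj u + vconj v" "vconj (u - v) = vconj u - vconj v" "vconj (- v) = - vconj v"
  "vconj (c *\<^sub>C v) = cnj c *\<^sub>C vconj v" "vconj (vconj v) = v" "vconj 0 = 0"
  "vconj (r *\<^sub>R v) = r *\<^sub>R vconj v"
  by (simp_all add: vconj_def vec_eq_iff)

lemma form_vconj: "form (vconj v) (vconj w) = cnj (form v w)"
proof -
  have "cnj (gsgn i) = gsgn i" for i :: "'a option option" by (simp add: gsgn_def)
  then show ?thesis by (simp add: form_gsgn vconj_def)
qed

lemma mconj_app: "mconj A \<cdot> v = vconj (A \<cdot> vconj v)"
  unfolding mconj_def by (rule app_of_lin) auto

lemma vconj_app: "vconj (A \<cdot> v) = mconj A \<cdot> vconj v"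
  by (simp add: mconj_app)

lemma mconj_simps [simp]:
  "mconj (A + B) = mconj A + mconj B" "mconj (A - B) = mconj A - mconj B" "mconj (- A) = - mconj A"
  "mconj (A * B) = mconj A * mconj B" "mconj (c *\<^sub>C A) = cnj c *\<^sub>C mconj A" "mconj 1 = 1"
  "mconj 0 = 0" "mconj (mconj A) = A"
  by (rule cmat_eqI; simp add: mconj_app)+

lemma mconj_tens [simp]: "mconj (tens u v) = tens (vconj u) (vconj v)"
  by (rule cmat_eqI) (metis (no_types, lifting) form_vconj mconj_app tens_app vconj_simps(4,5))

lemma form_vconj_left: "form (vconj v) w = cnj (form v (vconj w))"
  using form_vconj[of v "vconj w"] by simp

lemma mconj_adj: "mconj (adj A) = adj (mconj A)"
proof (rule adj_eqI[symmetric])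
  fix v w
  have "form v (mconj (adj A) \<cdot> w) = form (vconj (adj A \<cdot> vconj w)) v"
    by (simp add: mconj_app form_sym)
  also have "\<dots> = form (mconj A \<cdot> v) w"
    by (simp add: mconj_app form_vconj_left adj_app[symmetric] form_sym[of "adj A \<cdot> vconj w"])
  finally show "form (mconj A \<cdot> v) w = form v (mconj (adj A) \<cdot> w)" by simp
qed

section \<open>Matrix entries and bounded maps on matrices\<close>

definition ent :: "'m::finite cmat \<Rightarrow> 'm \<Rightarrow> 'm \<Rightarrow> complex" where
  "ent A i j = (A \<cdot> axis j 1) $ i"

definition unitm :: "'m \<Rightarrow> 'm \<Rightarrow> 'm::finite cmat" where
  "unitm i j = of_lin (\<lambda>v. v $ j *\<^sub>C axis i 1)"

lemma unitm_app: "unitm i j \<cdot> v = v $ j *\<^sub>C axis i 1"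
  unfolding unitm_def by (rule app_of_lin) (auto simp: scC_simps)

lemma app_sum_left: "sum f I \<cdot> v = (\<Sum>i\<in>I. f i \<cdot> v)"
  by (induction I rule: infinite_finite_induct) auto

lemma ent_expand: "A = (\<Sum>i\<in>UNIV. \<Sum>j\<in>UNIV. ent A i j *\<^sub>C unitm i j)"
proof (rule cmat_eqI)
  fix v
  have "(A \<cdot> v) $ k = (\<Sum>j\<in>UNIV. v $ j * (A \<cdot> axis j 1) $ k)" for k
  proof -
    have "(A \<cdot> v) $ k = (A \<cdot> (\<Sum>i\<in>UNIV. v $ i *\<^sub>C axis i 1)) $ k"
      using axis_expand by metis
    then show ?thesis by (simp add: app_sum)
  qed
  moreover have "((\<Sum>i\<in>UNIV. \<Sum>j\<in>UNIV. ent A i j *\<^sub>C unitm i j) \<cdot> v) $ k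
      = (\<Sum>j\<in>UNIV. \<Sum>i\<in>UNIV. if k = i then v $ j * ent A i j else 0)" for k
    by (subst sum.swap) (auto simp: app_sum_left unitm_app axis_def intro!: sum.cong)
  ultimately show "A \<cdot> v = (\<Sum>i\<in>UNIV. \<Sum>j\<in>UNIV. ent A i j *\<^sub>C unitm i j) \<cdot> v"
    by (simp add: vec_eq_iff ent_def)
qed

lemma norm_ent_le: "norm (ent A i j) \<le> norm A"
proof -
  have "norm (ent A i j) \<le> norm (A \<cdot> axis j 1)"
    unfolding ent_def by (rule Finite_Cartesian_Product.norm_nth_le)
  also have "\<dots> \<le> norm A * norm (axis j 1 :: complex ^ 'a)" by (rule norm_app_le)
  also have "norm (axis j 1 :: complex ^ 'a) = 1" by (simp add: norm_axis_1)
  finally show ?thesis by simp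
qed

text \<open>Expansion in the finitely many matrix units bounds any such map. The third assumption is
  weaker than complex linearity, so that the antilinear \<open>mconj\<close> is covered as
  well.\<close>

lemma bounded_linear_cmatI:
  fixes h :: "'m::finite cmat \<Rightarrow> 'a::real_normed_vector"
  assumes "\<And>A B. h (A + B) = h A + h B" "\<And>r A. h (r *\<^sub>R A) = r *\<^sub>R h A"
    and "\<And>c A. norm (h (c *\<^sub>C A)) \<le> norm c * norm (h A)"
  shows "bounded_linear h"
proof (rule bounded_linear_intro[where K="\<Sum>i\<in>UNIV. \<Sum>j\<in>UNIV. norm (h (unitm i j))"])
  fix A
  interpret h: linear h by (rule linearI) (use assms in auto)
  have "h A = h (\<Sum>i\<in>UNIV. \<Sum>j\<in>UNIV. ent A i j *\<^sub>C unitm i j)"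
    using ent_expand by metis
  also have "\<dots> = (\<Sum>i\<in>UNIV. \<Sum>j\<in>UNIV. h (ent A i j *\<^sub>C unitm i j))" by (simp add: h.sum)
  also have "norm \<dots> \<le> (\<Sum>i\<in>UNIV. \<Sum>j\<in>UNIV. norm A * norm (h (unitm i j)))"
    by (intro sum_norm_le order_trans[OF assms(3)] mult_right_mono norm_ent_le) auto
  finally show "norm (h A) \<le> norm A * (\<Sum>i\<in>UNIV. \<Sum>j\<in>UNIV. norm (h (unitm i j)))"
    by (simp add: sum_distrib_left)
qed (use assms in auto)

lemma norm_vconj [simp]: "norm (vconj v) = norm v"
  by (simp add: vconj_def norm_vec_def)

lemma bounded_linear_vconj: "bounded_linear vconj"
  by (rule bounded_linear_intro[where K=1]) auto

lemma bounded_linear_adj: "bounded_linear adj"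
  by (rule bounded_linear_cmatI) (simp_all add: scC_of_real[symmetric] norm_scC_le)

lemma bounded_linear_mconj: "bounded_linear mconj"
proof (rule bounded_linear_cmatI)
  fix c and A :: "'a omat"
  show "norm (mconj (c *\<^sub>C A)) \<le> norm c * norm (mconj A)"
    using norm_scC_le[of "cnj c"] by simp
qed (simp_all add: scC_of_real[symmetric])

lemma wd_adj: "A differentiable (at x) \<Longrightarrow> wd d (\<lambda>y. adj (A y)) x = adj (wd d A x)"
  by (simp add: wd_def dv_blinear[OF bounded_linear_adj])

lemma wd_vconj: "s differentiable (at x) \<Longrightarrow> wd d (\<lambda>y. vconj (s y)) x = vconj (wd (cnj d) s x)"
  by (simp add: wd_def dv_blinear[OF bounded_linear_vconj])

lemma wd_mconj: "A differentiable (at x) \<Longrightarrow> wd d (\<lambda>y. mconj (A y)) x = mconj (wd (cnj d) A x)"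
  by (simp add: wd_def dv_blinear[OF bounded_linear_mconj])

lemma sm_vconj: "open U \<Longrightarrow> sm U s \<Longrightarrow> sm U (\<lambda>y. vconj (s y))"
  by (rule sm_linear[OF bounded_linear_vconj])

lemma sm_adj: "open U \<Longrightarrow> sm U A \<Longrightarrow> sm U (\<lambda>y. adj (A y))"
  by (rule sm_linear[OF bounded_linear_adj])

lemma sm_form: "open U \<Longrightarrow> sm U s \<Longrightarrow> sm U t \<Longrightarrow> sm U (\<lambda>y. form (s y) (t y))"
  by (rule sm_cbil[OF cbil_form])

lemma sm_tens: "open U \<Longrightarrow> sm U s \<Longrightarrow> sm U t \<Longrightarrow> sm U (\<lambda>y. tens (s y) (t y))"
  by (rule sm_cbil[OF cbil_tens])

lemmas wd_form = wd_cbil[OF cbil_form]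

lemma sm_nth: "open U \<Longrightarrow> sm U s \<Longrightarrow> sm U (\<lambda>y. s y $ i)" for s :: "complex \<Rightarrow> complex ^ 'm::finite"
  by (rule sm_linear[OF bounded_linear_vec_nth])

text \<open>The multiplier is smooth only in the sense that its values on fixed vectors are; the
  entries of the matrix are coordinates of such values.\<close>

lemma sm_cmatI:
  assumes "open U" "\<And>v. sm U (\<lambda>x. A x \<cdot> v)"
  shows "sm U A"
proof -
  have "sm U (\<lambda>x. \<Sum>i\<in>UNIV. \<Sum>j\<in>UNIV. ent (A x) i j *\<^sub>C unitm i j)"
    unfolding ent_def using assms by (intro sm_sum sm_scC sm_nth) auto
  then show ?thesis by (simp add: ent_expand[symmetric])
qed

lemma dv_app_const: "A differentiable (at x) \<Longrightarrow> dv (\<lambda>y. A y \<cdot> v) x X = dv A x X \<cdot> v"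
  by (simp add: dv_cbil[OF cbil_app])

section \<open>Gauge transformations with simple poles\<close>

text \<open>
  \<open>E\<close> and \<open>F\<close> are the projections onto a null line \<open>L\<close> and its reflection \<open>\<rho>L\<close>. For \<open>c = (a - \<lambda>) / (a + \<lambda>)\<close>
  the map \<open>Gam E F c\<close> is \<open>p\<^sub>a\<^sub>,\<^sub>L(\<lambda>)\<close>, and \<open>Gam E F (- c)\<close> is \<open>q\<^sub>a\<^sub>,\<^sub>L(\<lambda>)\<close>.
\<close>

definition null_pair :: "'n::finite omat \<Rightarrow> 'n omat \<Rightarrow> 'n omat \<Rightarrow> bool" where
  "null_pair R E F \<longleftrightarrow> E * E = E \<and> F * F = F \<and> E * F = 0 \<and> F * E = 0 \<and> adj E = F \<and> adj F = E \<and>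
     R * E = F * R \<and> R * F = E * R \<and> (\<forall>X. adj X = - X \<longrightarrow> F * X * E = 0 \<and> E * X * F = 0)"

definition Gam :: "'n::finite omat \<Rightarrow> 'n omat \<Rightarrow> complex \<Rightarrow> 'n omat" where
  "Gam E F c = 1 + (c - 1) *\<^sub>C E + (inverse c - 1) *\<^sub>C F"

lemma null_pairD:
  assumes "null_pair R E F"
  shows "E * E = E" "F * F = F" "E * F = 0" "F * E = 0" "adj E = F" "adj F = E"
    "R * E = F * R" "R * F = E * R"
    "\<And>X. adj X = - X \<Longrightarrow> F * X * E = 0" "\<And>X. adj X = - X \<Longrightarrow> E * X * F = 0"
  using assms by (auto simp: null_pair_def)

text \<open>\<open>Gam E F c\<close> acts by c, 1 and 1/c on \<open>L\<close>, on the complement of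
  \<open>L + \<rho>L\<close> and on \<open>\<rho>L\<close>, so it is a homomorphism in c.\<close>

lemma Gam_mult:
  assumes "null_pair R E F" "c \<noteq> 0" "d \<noteq> 0"
  shows "Gam E F c * Gam E F d = Gam E F (c * d)"
proof -
  note [simp] = null_pairD[OF assms(1)]
  have *: "(1 + a *\<^sub>C E + b *\<^sub>C F) * (1 + a' *\<^sub>C E + b' *\<^sub>C F)
      = 1 + (a + a' + a * a') *\<^sub>C E + (b + b' + b * b') *\<^sub>C F" for a b a' b'
    by (simp add: distrib_left distrib_right scC_scC scC_add_left scC_add_right add_ac mult.commute)
  have "(c - 1) + (d - 1) + (c - 1) * (d - 1) = c * d - 1"
    "(inverse c - 1) + (inverse d - 1) + (inverse c - 1) * (inverse d - 1) = inverse (c * d) - 1"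
    by (simp_all add: algebra_simps)
  then show ?thesis unfolding Gam_def * by (simp only:)
qed

lemma Gam_one [simp]: "Gam E F 1 = 1"
  by (simp add: Gam_def)

text \<open>Taking adjoints swaps \<open>E\<close> and \<open>F\<close>, hence inverts c: all these
  gauges are orthogonal.\<close>

lemma Gam_adj: "null_pair R E F \<Longrightarrow> adj (Gam E F c) = Gam E F (inverse c)"
  using null_pairD(5,6)[of R E F] by (simp add: Gam_def algebra_simps)

lemma Gam_refl: "null_pair R E F \<Longrightarrow> R * Gam E F c = Gam E F (inverse c) * R"
  using null_pairD(7,8)[of R E F] by (simp add: Gam_def algebra_simps)

lemma Gam_inverse:
  assumes "null_pair R E F" "c \<noteq> 0"
  shows "Gam E F c * Gam E F (inverse c) = 1" "Gam E F (inverse c) * Gam E F c = 1"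
  using assms by (simp_all add: Gam_mult)

lemma sm_Gam: "open U \<Longrightarrow> sm U E \<Longrightarrow> sm U F \<Longrightarrow> sm U (\<lambda>x. Gam (E x) (F x) c)"
  unfolding Gam_def by (intro sm_add sm_scC sm_const) auto

lemma wd_Gam: "E differentiable (at x) \<Longrightarrow> F differentiable (at x) \<Longrightarrow>
  wd d (\<lambda>y. Gam (E y) (F y) c) x = (c - 1) *\<^sub>C wd d E x + (inverse c - 1) *\<^sub>C wd d F x"
  unfolding Gam_def by (simp add: wd_add wd_scC_const differentiable_scC_const)

lemma null_pairI:
  assumes "form l l = 0" "form l (R \<cdot> l) \<noteq> 0" "R * R = 1" "adj R = R"
    and "E = inverse (form l (R \<cdot> l)) *\<^sub>C tens l (R \<cdot> l)"
    and "F = inverse (form l (R \<cdot> l)) *\<^sub>C tens (R \<cdot> l) l"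
  shows "null_pair R E F"
proof -
  have RR: "R \<cdot> R \<cdot> l = l"
    using assms(3) by (metis app_ring(2,6))
  have 1: "form (R \<cdot> l) (R \<cdot> l) = 0"
    using adj_app[of R l "R \<cdot> l"] assms RR by simp
  \<comment> \<open>A skew map sends a vector into its own orthogonal complement; as
    \<open>E\<close> and \<open>F\<close> have rank one, this kills the blocks between
    \<open>L\<close> and \<open>\<rho>L\<close>.\<close>
  have 2: "form v (X \<cdot> v) = 0" if "adj X = - X" for X and v :: "'a cvec"
    using adj_app[of X v v] that form_sym[of v "X \<cdot> v"] by simp
  have 3: "form (R \<cdot> l) l = form l (R \<cdot> l)" by (rule form_sym)
  note [simp] = assms(1,2,4) RR 1 3
  have "F * X * E = 0 \<and> E * X * F = 0" if "adj X = - X" for X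
    using 2[OF that, of l] 2[OF that, of "R \<cdot> l"] that by (simp add: assms(5,6))
  then show ?thesis
    by (simp add: null_pair_def assms(5,6) scC_scC)
qed

text \<open>Right multiplication by the gauge scales the columns of the blocks by c, 1 and 1/c, and
  (c - 1)/c = -(1/c - 1). This turns the added terms of \<open>Gam_gauge\<close> into
  commutator-like differences.\<close>

lemma Gam_conj_identity:
  assumes "null_pair R E F" "c \<noteq> 0" and e: "e = 1 - E - F"
  shows "((c - 1) *\<^sub>C (E * S * e + e * S * F) + (inverse c - 1) *\<^sub>C (e * T * E + F * T * e)) * Gam E F c
    = (c - 1) *\<^sub>C (E * S * e - e * T * E) + (inverse c - 1) *\<^sub>C (F * T * e - e * S * F)"
proof -
  note n = null_pairD[OF assms(1)]
  have eG: "e * Gam E F c = e" "E * Gam E F c = c *\<^sub>C E" "F * Gam E F c = inverse c *\<^sub>C F"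
    by (simp_all add: e Gam_def algebra_simps n scC_simps)
  have "((c - 1) *\<^sub>C (E * S * e + e * S * F) + (inverse c - 1) *\<^sub>C (e * T * E + F * T * e)) * Gam E F c
    = (c - 1) *\<^sub>C (E * S * e) + ((c - 1) * inverse c) *\<^sub>C (e * S * F)
      + (((inverse c - 1) * c) *\<^sub>C (e * T * E) + (inverse c - 1) *\<^sub>C (F * T * e))"
    by (simp add: distrib_right mult.assoc eG scC_add_right scC_scC)
  moreover have "(c - 1) * inverse c = - (inverse c - 1)" "(inverse c - 1) * c = - (c - 1)"
    using assms(2) by (simp_all add: field_simps)
  ultimately show ?thesis by (simp only: scC_minus_left scC_diff_right) (simp add: algebra_simps)
qed

text \<open>
  The gauge transform of \<open>d + C + S\<close> by \<open>Gam c\<close>, where \<open>L\<close> is parallel for \<open>d + C + S\<^sub>1\<close> and \<open>\<rho>L\<close>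
  for \<open>d + C + S\<^sub>2\<close>.
\<close>

lemma Gam_gauge:
  assumes np: "null_pair R E F" and c: "c \<noteq> 0" and e: "e = 1 - E - F"
    and dE: "E' = E * (C + S2) * (1 - E) - (1 - E) * (C + S1) * E"
    and dF: "F' = F * (C + S1) * (1 - F) - (1 - F) * (C + S2) * F"
    and sk: "adj S = - S" "adj S1 = - S1" "adj S2 = - S2" 
  shows "(c - 1) *\<^sub>C E' + (inverse c - 1) *\<^sub>C F'
    + (C + S + (c - 1) *\<^sub>C (E * (S - S2) * e + e * (S - S2) * F)
         + (inverse c - 1) *\<^sub>C (e * (S - S1) * E + F * (S - S1) * e)) * Gam E F c
    = Gam E F c * (C + S)"
proof -
  note n = null_pairD[OF np]
  let ?c = "inverse c"
  have z: "E * T * F = 0" "F * T * E = 0" if "adj T = - T" for T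
    using n(9,10)[OF that] by auto
  \<comment> \<open>Skew maps have no block between \<open>L\<close> and \<open>\<rho>L\<close>, so
    \<open>1 - E\<close> may be replaced by \<open>e\<close> next to \<open>S1\<close> and
    \<open>S2\<close>; for \<open>C\<close> the two terms form a commutator.\<close>
  have E': "E' = E * C - C * E + (E * S2 * e - e * S1 * E)"
    unfolding dE e using z[OF sk(3)] z[OF sk(2)] by (simp add: algebra_simps)
  have F': "F' = F * C - C * F + (F * S1 * e - e * S2 * F)"
    unfolding dF e using z[OF sk(3)] z[OF sk(2)] by (simp add: algebra_simps)
  have EE: "E * S * e - e * S * E = E * S - S * E" "F * S * e - e * S * F = F * S - S * F"
    unfolding e using z[OF sk(1)] by (simp_all add: algebra_simps)
  have k1: "((c - 1) *\<^sub>C (E * S2 * e + e * S2 * F) + (?c - 1) *\<^sub>C (e * S1 * E + F * S1 * e)) * Gam E F c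
     = (c - 1) *\<^sub>C (E * S2 * e - e * S1 * E) + (?c - 1) *\<^sub>C (F * S1 * e - e * S2 * F)"
    by (rule Gam_conj_identity[OF np c e])
  have k2: "((c - 1) *\<^sub>C (E * S * e + e * S * F) + (?c - 1) *\<^sub>C (e * S * E + F * S * e)) * Gam E F c
     = (c - 1) *\<^sub>C (E * S - S * E) + (?c - 1) *\<^sub>C (F * S - S * F)"
    unfolding Gam_conj_identity[OF np c e] EE ..
  have split: "C + S + (c - 1) *\<^sub>C (E * (S - S2) * e + e * (S - S2) * F)
         + (?c - 1) *\<^sub>C (e * (S - S1) * E + F * (S - S1) * e)
     = C + S + ((c - 1) *\<^sub>C (E * S * e + e * S * F) + (?c - 1) *\<^sub>C (e * S * E + F * S * e))
       - ((c - 1) *\<^sub>C (E * S2 * e + e * S2 * F) + (?c - 1) *\<^sub>C (e * S1 * E + F * S1 * e))"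
    by (simp only: right_diff_distrib left_diff_distrib scC_diff_right scC_add_right) (simp add: algebra_simps)
  have G: "Gam E F c * T - T * Gam E F c = (c - 1) *\<^sub>C (E * T - T * E) + (?c - 1) *\<^sub>C (F * T - T * F)" for T
    unfolding Gam_def by (simp add: distrib_left distrib_right scC_diff_right)
  have main: "(c - 1) *\<^sub>C E' + (?c - 1) *\<^sub>C F' = (Gam E F c * C - C * Gam E F c)
      + ((c - 1) *\<^sub>C (E * S2 * e - e * S1 * E) + (?c - 1) *\<^sub>C (F * S1 * e - e * S2 * F))"
    unfolding E' F' G by (simp only: scC_add_right) (simp add: add_ac)
  show ?thesis
    unfolding split main left_diff_distrib k1 distrib_right[of _ "_ *\<^sub>C _ + _"]
    unfolding distrib_right[of "C + S"] k2 G[symmetric]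
    by (simp add: algebra_simps)
qed

section \<open>Half pencils of connections\<close>

definition Pl :: "'n::finite omat \<Rightarrow> 'n omat \<Rightarrow> 'n omat \<Rightarrow> complex \<Rightarrow> 'n omat" where
  "Pl A B C l = (inverse l * inverse l) *\<^sub>C A + inverse l *\<^sub>C B + C"

text \<open>
  \<open>d + Pl A B C l\<close> is the \<open>(1,0)\<close>-part (spectral parameter \<open>l = \<lambda>\<close>, direction \<open>\<partial>\<^sub>z\<close>, \<open>d = -\<i>\<close>) or
  the \<open>(0,1)\<close>-part (\<open>l = 1 / \<lambda>\<close>, direction \<open>\<partial>\<close> with respect to \<open>cnj z\<close>, \<open>d = \<i>\<close>) of a pencil of metric
  connections, \<open>R\<close> is the reflection in the bundle \<open>S\<close>, and \<open>W\<close>, \<open>W'\<close> play the roles of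
  \<open>\<Lambda>\<^sup>0\<^sup>,\<^sup>1\<close>, \<open>\<Lambda>\<^sup>1\<^sup>,\<^sup>0\<close> (in the second case in the opposite order).
\<close>

lemma commutator_anti:
  fixes R Z T :: "'a::ring"
  assumes "R * Z = - (Z * R)" "R * T = T * R"
  shows "R * (Z * T - T * Z) = - ((Z * T - T * Z) * R)"
proof -
  have "R * (Z * T) = - (Z * (R * T))" "R * (T * Z) = T * (R * Z)"
    by (metis assms mult.assoc mult_minus_left)+
  then show ?thesis by (simp add: assms right_diff_distrib left_diff_distrib mult.assoc)
qed

lemma commutator_anti2:
  fixes R Z T :: "'a::ring"
  assumes "R * Z = - (Z * R)" "R * T = - (T * R)"
  shows "R * (Z * T - T * Z) = (Z * T - T * Z) * R"
proof -
  have "R * (Z * T) = - (Z * (R * T))" "R * (T * Z) = - (T * (R * Z))"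
    by (metis assms mult.assoc mult_minus_left)+
  then show ?thesis by (simp add: assms right_diff_distrib left_diff_distrib mult.assoc)
qed

locale half =
  fixes d :: complex and U :: "complex set" and R A B C :: "complex \<Rightarrow> 'n::finite omat"
    and W W' :: "complex \<Rightarrow> 'n cvec set"
  assumes openU: "open U"
    and smR: "sm U R" and smA: "sm U A" and smB: "sm U B" and smC: "sm U C"
    and RR: "x \<in> U \<Longrightarrow> R x * R x = 1"
    and adjR: "x \<in> U \<Longrightarrow> adj (R x) = R x"
    and skA: "x \<in> U \<Longrightarrow> adj (A x) = - A x"
    and skB: "x \<in> U \<Longrightarrow> adj (B x) = - B x"
    and skC: "x \<in> U \<Longrightarrow> adj (C x) = - C x"
    and A_R: "x \<in> U \<Longrightarrow> R x * A x = A x * R x"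
    and B_R: "x \<in> U \<Longrightarrow> R x * B x = - (B x * R x)"
    and dR: "x \<in> U \<Longrightarrow> wd d R x = R x * C x - C x * R x"
    and W_R: "x \<in> U \<Longrightarrow> w \<in> W x \<Longrightarrow> R x \<cdot> w = w"
    and A_W: "x \<in> U \<Longrightarrow> w \<in> W x \<Longrightarrow> A x \<cdot> w = 0"
    and B_W: "x \<in> U \<Longrightarrow> w \<in> W x \<Longrightarrow> B x \<cdot> w = 0"
    and A_perp: "x \<in> U \<Longrightarrow> R x \<cdot> v = - v \<Longrightarrow> A x \<cdot> v = 0"
    and stab: "open V \<Longrightarrow> x \<in> V \<Longrightarrow> V \<subseteq> U \<Longrightarrow> s differentiable (at x) \<Longrightarrow> (\<And>y. y \<in> V \<Longrightarrow> s y \<in> W' y)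
      \<Longrightarrow> wd d s x + C x \<cdot> s x \<in> W' x"
begin

lemma diff_at:
  assumes "x \<in> U"
  shows "R differentiable (at x)" "A differentiable (at x)" "B differentiable (at x)" "C differentiable (at x)"
  using assms smR smA smB smC sm_diff_at by blast+

lemma Pl_skew: "x \<in> U \<Longrightarrow> adj (Pl (A x) (B x) (C x) l) = - Pl (A x) (B x) (C x) l"
  by (simp add: Pl_def skA skB skC)

text \<open>\<open>A\<close> is even and \<open>B\<close> odd under the reflection, and
  \<open>R\<close> is parallel for \<open>d + C\<close>; so gauging by \<open>R\<close> replaces
  \<open>l\<close> by \<open>- l\<close>.\<close>

lemma Pl_refl: "x \<in> U \<Longrightarrow> Pl (A x) (B x) (C x) (- l) * R x = R x * Pl (A x) (B x) (C x) l - wd d R x"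
  by (simp add: Pl_def A_R B_R dR distrib_left distrib_right left_diff_distrib right_diff_distrib)

end

text \<open>Constant means independent of the spectral parameter. All coefficients are conjugated,
  and the derivative of the gauge enters only the coefficient of order zero,
  \<open>C\<close>.\<close>

lemma half_const_gauge:
  fixes G R' :: "complex \<Rightarrow> 'n::finite omat"
  assumes "half d U R A B C W W'" and smG: "sm U G"
    and G: "\<And>x. x \<in> U \<Longrightarrow> adj (G x) * G x = 1" "\<And>x. x \<in> U \<Longrightarrow> G x * adj (G x) = 1"
    and R': "\<And>x. x \<in> U \<Longrightarrow> R' x = G x * R x * adj (G x)"
  shows "half d U R' (\<lambda>x. G x * A x * adj (G x)) (\<lambda>x. G x * B x * adj (G x))
    (\<lambda>x. G x * C x * adj (G x) - wd d G x * adj (G x)) (\<lambda>x. (\<cdot>) (G x) ` W x) (\<lambda>x. (\<cdot>) (G x) ` W' x)"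
proof -
  interpret half d U R A B C W W' by fact
  have Gd: "G differentiable (at x)" "(\<lambda>y. adj (G y)) differentiable (at x)" if "x \<in> U" for x
    using smG sm_adj[OF openU smG] sm_diff_at that by blast+
  have GG: "G x * (adj (G x) * T) = T" "adj (G x) * (G x * T) = T" if "x \<in> U" for x T
    using G[OF that] by (simp_all add: mult.assoc[symmetric])
  have Gv: "adj (G x) \<cdot> G x \<cdot> v = v" "G x \<cdot> adj (G x) \<cdot> v = v" if "x \<in> U" for x v
    using G[OF that] by (metis app_ring(2,6))+
  have dG: "adj (wd d G x) = - (adj (G x) * wd d G x * adj (G x))" if x: "x \<in> U" for x
  proof -
    have "wd d (\<lambda>y. adj (G y) * G y) x = wd d (\<lambda>y. 1) x"
      by (rule wd_cong_open[OF openU x]) (use G in auto)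
    then have "adj (wd d G x) * G x + adj (G x) * wd d G x = 0"
      using Gd[OF x] by (simp add: wd_mult wd_adj)
    then have "adj (wd d G x) * G x * adj (G x) + adj (G x) * wd d G x * adj (G x) = 0"
      by (metis distrib_right mult_zero_left)
    then show ?thesis using G[OF x] by (simp add: mult.assoc eq_neg_iff_add_eq_0)
  qed
  have dGR: "wd d R' x = wd d G x * R x * adj (G x) + G x * (R x * C x - C x * R x) * adj (G x)
       + G x * R x * adj (wd d G x)" if x: "x \<in> U" for x
  proof -
    have "wd d R' x = wd d (\<lambda>y. G y * R y * adj (G y)) x"
      by (rule wd_cong_open[OF openU x]) (use R' in auto)
    also have "\<dots> = wd d G x * R x * adj (G x) + G x * wd d R x * adj (G x) + G x * R x * adj (wd d G x)"
      using Gd[OF x] diff_at[OF x]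
      by (simp add: wd_mult wd_adj differentiable_cbil[OF cbil_mult_cmat] distrib_right)
    finally show ?thesis by (simp add: dR[OF x])
  qed
  show ?thesis
  proof
    show "open U" by (rule openU)
    show "sm U R'"
      by (rule iffD2[OF sm_cong[OF openU R']], assumption) (intro sm_mult_cmat sm_adj openU smG smR)
    show "sm U (\<lambda>x. G x * A x * adj (G x))" "sm U (\<lambda>x. G x * B x * adj (G x))"
      "sm U (\<lambda>x. G x * C x * adj (G x) - wd d G x * adj (G x))"
      by (intro sm_mult_cmat sm_diff sm_adj sm_wd openU smG smA smB smC)+
  next
    fix x assume x: "x \<in> U"
    show "R' x * R' x = 1"
      by (simp add: R'[OF x] mult.assoc GG[OF x]) (simp add: mult.assoc[symmetric] RR[OF x] G[OF x])
    show "adj (R' x) = R' x" by (simp add: R'[OF x] adjR[OF x] mult.assoc)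
    show "adj (G x * A x * adj (G x)) = - (G x * A x * adj (G x))"
      "adj (G x * B x * adj (G x)) = - (G x * B x * adj (G x))"
      by (simp_all add: skA[OF x] skB[OF x] mult.assoc)
    show "adj (G x * C x * adj (G x) - wd d G x * adj (G x)) = - (G x * C x * adj (G x) - wd d G x * adj (G x))"
      by (simp add: skC[OF x] mult.assoc dG[OF x] GG[OF x])
    have c: "G x * S * adj (G x) * (G x * T * adj (G x)) = G x * (S * T) * adj (G x)" for S T
      by (simp add: mult.assoc GG[OF x])
    show "R' x * (G x * A x * adj (G x)) = (G x * A x * adj (G x)) * R' x"
      by (simp only: R'[OF x] c A_R[OF x])
    show "R' x * (G x * B x * adj (G x)) = - ((G x * B x * adj (G x)) * R' x)"
      by (simp only: R'[OF x] c B_R[OF x]) simp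
    show "wd d R' x = R' x * (G x * C x * adj (G x) - wd d G x * adj (G x))
        - (G x * C x * adj (G x) - wd d G x * adj (G x)) * R' x"
      unfolding dGR[OF x]
      by (simp add: R'[OF x] dG[OF x] algebra_simps GG[OF x])
    show "R' x \<cdot> w = w" if "w \<in> (\<cdot>) (G x) ` W x" for w
      using that by (auto simp: R'[OF x] Gv[OF x] W_R[OF x])
    show "(G x * A x * adj (G x)) \<cdot> w = 0" if "w \<in> (\<cdot>) (G x) ` W x" for w
      using that by (auto simp: Gv[OF x] A_W[OF x])
    show "(G x * B x * adj (G x)) \<cdot> w = 0" if "w \<in> (\<cdot>) (G x) ` W x" for w
      using that by (auto simp: Gv[OF x] B_W[OF x])
    show "(G x * A x * adj (G x)) \<cdot> v = 0" if "R' x \<cdot> v = - v" for v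
    proof -
      have "adj (G x) \<cdot> R' x \<cdot> v = - (adj (G x) \<cdot> v)" using that by simp
      then have "R x \<cdot> adj (G x) \<cdot> v = - (adj (G x) \<cdot> v)" by (simp add: R'[OF x] Gv[OF x])
      then show ?thesis by (simp add: A_perp[OF x])
    qed
  next
    fix V x and s :: "'n sect"
    assume V: "open V" "x \<in> V" "V \<subseteq> U" and s: "s differentiable (at x)" and sW: "\<And>y. y \<in> V \<Longrightarrow> s y \<in> (\<cdot>) (G y) ` W' y"
    have x: "x \<in> U" using V by auto
    define t where "t = (\<lambda>y. adj (G y) \<cdot> s y)"
    have t: "t differentiable (at x)" unfolding t_def by (rule differentiable_app[OF Gd(2)[OF x] s])
    have "t y \<in> W' y" if "y \<in> V" for y
      using sW[OF that] V(3) that Gv(1)[of y] by (auto simp: t_def)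
    then have tW: "wd d t x + C x \<cdot> t x \<in> W' x" by (rule stab[OF V t])
    have "wd d s x = wd d (\<lambda>y. G y \<cdot> t y) x"
      by (rule wd_cong_open[OF V(1,2)]) (use V(3) Gv(2) in \<open>auto simp: t_def\<close>)
    also have "\<dots> = wd d G x \<cdot> t x + G x \<cdot> wd d t x" by (rule wd_app[OF Gd(1)[OF x] t])
    finally have fin: "wd d s x + (G x * C x * adj (G x) - wd d G x * adj (G x)) \<cdot> s x = G x \<cdot> (wd d t x + C x \<cdot> t x)"
      by (simp add: t_def)
    show "wd d s x + (G x * C x * adj (G x) - wd d G x * adj (G x)) \<cdot> s x \<in> (\<cdot>) (G x) ` W' x"
      unfolding fin by (rule imageI[OF tW])
  qed
qed

text \<open>\<open>par\<close> states that the image of \<open>E\<close> is parallel for the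
  connection at \<open>a\<close>. Phrasing it with the projection makes it independent of a local
  section.\<close>

locale dressing = half +
  fixes E F :: "complex \<Rightarrow> 'n::finite omat" and a :: complex
  assumes smE: "sm U E" and smF: "sm U F"
    and np: "x \<in> U \<Longrightarrow> null_pair (R x) (E x) (F x)"
    and a0: "a \<noteq> 0"
    and par: "x \<in> U \<Longrightarrow> (1 - E x) * (Pl (A x) (B x) (C x) a * E x + wd d E x) = 0"
begin

definition "J x = Gam (E x) (F x) (- 1)"
definition "cm x T = (E x - F x) * T - T * (E x - F x)"
text \<open>Origin of the coefficients: near l = 0 the scalar (a - l)/(a + l) is exp(-2l/a +
  O(l^3)), so the gauge is exp(-(2l/a)(E - F)) up to O(l^3) and its derivative in the point is O(l).
  Conjugating the pencil and collecting the orders -2, -1 and 0 in l gives \<open>A x\<close>,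
  \<open>Bh x\<close> and \<open>Ch x\<close>.\<close>

definition "Bh x = B x - (2 * inverse a) *\<^sub>C cm x (A x)"
definition "Ch x = C x - (2 * inverse a) *\<^sub>C cm x (B x) + (2 * inverse a * inverse a) *\<^sub>C cm x (cm x (A x))"

lemma EF_diff: "x \<in> U \<Longrightarrow> E differentiable (at x)" "x \<in> U \<Longrightarrow> F differentiable (at x)"
  using smE smF sm_diff_at by blast+

lemma wd_F: assumes "x \<in> U" shows "wd d F x = adj (wd d E x)"
proof -
  have "wd d F x = wd d (\<lambda>y. adj (E y)) x"
    by (rule wd_cong_open[OF openU assms]) (simp add: null_pairD(5)[OF np])
  then show ?thesis by (simp add: wd_adj EF_diff[OF assms])
qed

text \<open>The reflection carries the connection at \<open>a\<close> to that at \<open>- a\<close>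
  and \<open>L\<close> to \<open>\<rho>L\<close>, so parallelism is carried along.\<close>

lemma refl_par:
  assumes x: "x \<in> U"
  shows "(1 - F x) * (Pl (A x) (B x) (C x) (- a) * F x + wd d F x) = 0"
proof -
  note n = null_pairD[OF np[OF x]]
  let ?R = "R x" and ?E = "E x" and ?F = "F x" and ?P = "Pl (A x) (B x) (C x)"
  have "wd d (\<lambda>y. R y * E y) x = wd d (\<lambda>y. F y * R y) x"
    by (rule wd_cong_open[OF openU x]) (simp add: null_pairD(7)[OF np])
  then have 1: "wd d R x * ?E + ?R * wd d E x = wd d F x * ?R + ?F * wd d R x"
    using EF_diff[OF x] diff_at[OF x] by (simp add: wd_mult)
  have FF: "(1 - ?F) * (?F * T) = 0" for T
    by (simp add: algebra_simps mult.assoc[symmetric] n)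
  have "(1 - ?F) * (?P (- a) * ?F + wd d F x) * ?R
      = (1 - ?F) * (?P (- a) * ?R * ?E + wd d F x * ?R)"
    using n(7) by (simp add: algebra_simps)
  also have "wd d F x * ?R = wd d R x * ?E + ?R * wd d E x - ?F * wd d R x"
    using 1 by (simp add: algebra_simps)
  also have "?P (- a) * ?R * ?E = ?R * ?P a * ?E - wd d R x * ?E"
    by (simp add: Pl_refl[OF x] left_diff_distrib)
  also have "(1 - ?F) * (?R * ?P a * ?E - wd d R x * ?E + (wd d R x * ?E + ?R * wd d E x - ?F * wd d R x))
     = (1 - ?F) * ?R * (?P a * ?E + wd d E x) - (1 - ?F) * (?F * wd d R x)"
    by (simp add: algebra_simps)
  also have "(1 - ?F) * ?R = ?R * (1 - ?E)" using n(7) by (simp add: algebra_simps)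
  also have "?R * (1 - ?E) * (?P a * ?E + wd d E x) - (1 - ?F) * (?F * wd d R x) = 0"
    unfolding FF mult.assoc par[OF x] by simp
  finally have "(1 - ?F) * (?P (- a) * ?F + wd d F x) * ?R * ?R = 0" by simp
  then show ?thesis by (simp only: mult.assoc RR[OF x] mult_1_right)
qed

text \<open>Parallelism of the image of \<open>E\<close> at \<open>a\<close> gives one off-diagonal
  block of the derivative; the adjoint of \<open>refl_par\<close> controls the kernel and gives the
  other. An idempotent has no further freedom, as differentiating \<open>E * E = E\<close>
  shows.\<close>

lemma wd_E:
  assumes x: "x \<in> U"
  shows "wd d E x = E x * Pl (A x) (B x) (C x) (- a) * (1 - E x) - (1 - E x) * Pl (A x) (B x) (C x) a * E x"
proof -
  note n = null_pairD[OF np[OF x]]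
  let ?E = "E x" and ?F = "F x" and ?P = "Pl (A x) (B x) (C x)" and ?D = "wd d E x"
  have "wd d (\<lambda>y. E y * E y) x = wd d E x"
    by (rule wd_cong_open[OF openU x]) (simp add: null_pairD(1)[OF np])
  then have 5: "?D = ?D * ?E + ?E * ?D"
    using EF_diff[OF x] by (simp add: wd_mult)
  have 1: "?E * ?D = ?D + (1 - ?E) * ?P a * ?E"
    using par[OF x] by (simp add: algebra_simps)
  have "adj ((1 - ?F) * (?P (- a) * ?F + wd d F x)) = 0"
    using refl_par[OF x] by simp
  then have "(- (?E * ?P (- a)) + ?D) * (1 - ?E) = 0"
    by (simp add: n wd_F[OF x] Pl_skew[OF x])
  then have 4: "?D * ?E = ?D - ?E * ?P (- a) * (1 - ?E)"
    by (simp add: algebra_simps)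
  have "?D = ?D - ?E * ?P (- a) * (1 - ?E) + (?D + (1 - ?E) * ?P a * ?E)"
    using 5 unfolding 1 4 .
  then show ?thesis by (simp add: algebra_simps)
qed

lemma wd_F':
  assumes x: "x \<in> U"
  shows "wd d F x = F x * Pl (A x) (B x) (C x) a * (1 - F x) - (1 - F x) * Pl (A x) (B x) (C x) (- a) * F x"
  unfolding wd_F[OF x] wd_E[OF x]
  by (simp add: null_pairD[OF np[OF x]] Pl_skew[OF x] mult.assoc)

text \<open>The eigenvalues 1, 0, -1 of \<open>E - F\<close> grade the endomorphisms. A skew map has
  no component of weight 2 or -2, so \<open>cm\<close> acts on it as plus or minus the identity on
  two pairs of blocks and as 0 elsewhere.\<close>

lemma cm_blocks:
  assumes x: "x \<in> U" and T: "adj T = - T" and e: "e = 1 - E x - F x"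
  shows "cm x T = (E x * T * e + e * T * F x) - (e * T * E x + F x * T * e)"
    and "cm x (cm x T) = (E x * T * e + e * T * F x) + (e * T * E x + F x * T * e)"
proof -
  note n = null_pairD[OF np[OF x]]
  have z: "E x * (T * F x) = 0" "F x * (T * E x) = 0"
    using n(9,10)[OF T] by (simp_all add: mult.assoc)
  have EE: "E x * (E x * S) = E x * S" "F x * (F x * S) = F x * S" "E x * (F x * S) = 0" "F x * (E x * S) = 0" for S
    by (simp_all add: mult.assoc[symmetric] n)
  show "cm x T = (E x * T * e + e * T * F x) - (e * T * E x + F x * T * e)"
    by (simp add: cm_def e algebra_simps z)
  show "cm x (cm x T) = (E x * T * e + e * T * F x) + (e * T * E x + F x * T * e)"
    by (simp add: cm_def e algebra_simps z n EE)
qed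

lemma cm_skew: "x \<in> U \<Longrightarrow> adj T = - T \<Longrightarrow> adj (cm x T) = - cm x T"
  by (simp add: cm_def null_pairD[OF np] algebra_simps)

text \<open>\<open>p\<close> and \<open>r\<close> stand for the inverse square and the inverse of
  the spectral parameter. Keeping them apart from \<open>c\<close> allows \<open>p = 0\<close>,
  \<open>r = 0\<close>, \<open>c = - 1\<close>, which is the parameter at infinity.\<close>

lemma gauge_general:
  assumes x: "x \<in> U" and c: "c \<noteq> 0" and S: "S = p *\<^sub>C A x + r *\<^sub>C B x" and e: "e = 1 - E x - F x"
    and i: "i = inverse a"
  shows "wd d (\<lambda>y. Gam (E y) (F y) c) x
      + (C x + S + ((c - 1) * (p - i * i)) *\<^sub>C (E x * A x * e + e * A x * F x) + ((c - 1) * (r + i)) *\<^sub>C (E x * B x * e + e * B x * F x)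
         + ((inverse c - 1) * (p - i * i)) *\<^sub>C (e * A x * E x + F x * A x * e) + ((inverse c - 1) * (r - i)) *\<^sub>C (e * B x * E x + F x * B x * e))
        * Gam (E x) (F x) c
    = Gam (E x) (F x) c * (C x + S)"
proof -
  define S1 where "S1 = (i * i) *\<^sub>C A x + i *\<^sub>C B x"
  define S2 where "S2 = (i * i) *\<^sub>C A x - i *\<^sub>C B x"
  have P: "Pl (A x) (B x) (C x) a = C x + S1" "Pl (A x) (B x) (C x) (- a) = C x + S2"
    by (simp_all add: Pl_def S1_def S2_def i add_ac)
  have sk: "adj S = - S" "adj S1 = - S1" "adj S2 = - S2"
    by (simp_all add: S S1_def S2_def skA[OF x] skB[OF x])
  have d1: "S - S2 = (p - i * i) *\<^sub>C A x + (r + i) *\<^sub>C B x"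
    by (simp add: S S2_def scC_add_left scC_diff_left)
  have d2: "S - S1 = (p - i * i) *\<^sub>C A x + (r - i) *\<^sub>C B x"
    by (simp add: S S1_def scC_add_left scC_diff_left)
  have Y: "(c - 1) *\<^sub>C (E x * (S - S2) * e + e * (S - S2) * F x)
     = ((c - 1) * (p - i * i)) *\<^sub>C (E x * A x * e + e * A x * F x) + ((c - 1) * (r + i)) *\<^sub>C (E x * B x * e + e * B x * F x)"
    unfolding d1 scC_scC[symmetric] by (simp add: distrib_left distrib_right scC_add_right del: scC_scC)
  have X: "(inverse c - 1) *\<^sub>C (e * (S - S1) * E x + F x * (S - S1) * e)
     = ((inverse c - 1) * (p - i * i)) *\<^sub>C (e * A x * E x + F x * A x * e) + ((inverse c - 1) * (r - i)) *\<^sub>C (e * B x * E x + F x * B x * e)"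
    unfolding d2 scC_scC[symmetric] by (simp add: distrib_left distrib_right scC_add_right del: scC_scC)
  show ?thesis
    using Gam_gauge[OF np[OF x] c e wd_E[OF x, unfolded P] wd_F'[OF x, unfolded P] sk]
    unfolding X Y wd_Gam[OF EF_diff[OF x]] by (simp only: add.assoc)
qed

lemma gauge:
  assumes x: "x \<in> U" and l: "l \<noteq> 0" "l \<noteq> a" "l \<noteq> - a" and c: "c = (a - l) / (a + l)"
  shows "wd d (\<lambda>y. Gam (E y) (F y) c) x + Pl (A x) (Bh x) (Ch x) l * Gam (E x) (F x) c
    = Gam (E x) (F x) c * Pl (A x) (B x) (C x) l"
proof -
  define e where "e = 1 - E x - F x"
  define i k where "i = inverse a" and "k = inverse l"
  define YA where "YA = E x * A x * e + e * A x * F x"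
  define YB where "YB = E x * B x * e + e * B x * F x"
  define XA where "XA = e * A x * E x + F x * A x * e"
  define XB where "XB = e * B x * E x + F x * B x * e"
  have al: "a + l \<noteq> 0" "a - l \<noteq> 0" using l by (auto simp: eq_neg_iff_add_eq_0 add.commute)
  have c0: "c \<noteq> 0" using al by (simp add: c)
  \<comment> \<open>The denominators of \<open>c - 1\<close> and \<open>inverse c - 1\<close> cancel
    against \<open>k + i\<close> and \<open>k - i\<close>: this is the absence of poles at
    \<open>- a\<close> and \<open>a\<close>.\<close>
  have s: "(c - 1) * (k * k - i * i) = - (2 * i * (k - i))" "(c - 1) * (k + i) = - (2 * i)"
    "(inverse c - 1) * (k * k - i * i) = 2 * i * (k + i)" "(inverse c - 1) * (k - i) = 2 * i"
    using al l a0 by (simp_all add: c i_def k_def divide_simps) (simp_all add: algebra_simps)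
  have Bh: "Bh x = B x - (2 * i) *\<^sub>C (YA - XA)"
    using cm_blocks(1)[OF x skA[OF x] e_def] by (simp add: Bh_def i_def YA_def XA_def)
  have Ch: "Ch x = C x - (2 * i) *\<^sub>C (YB - XB) + (2 * i * i) *\<^sub>C (YA + XA)"
    using cm_blocks(1)[OF x skB[OF x] e_def] cm_blocks(2)[OF x skA[OF x] e_def]
    by (simp add: Ch_def i_def YA_def XA_def YB_def XB_def)
  have "Pl (A x) (Bh x) (Ch x) l = C x + ((k * k) *\<^sub>C A x + k *\<^sub>C B x) + (- (2 * i * (k - i))) *\<^sub>C YA
      + (- (2 * i)) *\<^sub>C YB + (2 * i * (k + i)) *\<^sub>C XA + (2 * i) *\<^sub>C XB"
    by (simp add: Pl_def Bh Ch k_def[symmetric] scC_simps algebra_simps)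
  moreover have "Pl (A x) (B x) (C x) l = C x + ((k * k) *\<^sub>C A x + k *\<^sub>C B x)"
    by (simp add: Pl_def k_def add_ac)
  ultimately show ?thesis
    using gauge_general[OF x c0 refl e_def i_def, of "k * k" k]
    unfolding s YA_def[symmetric] YB_def[symmetric] XA_def[symmetric] XB_def[symmetric] by simp
qed

lemma gauge_inf:
  assumes x: "x \<in> U"
  shows "wd d J x + Ch x * J x = J x * C x"
proof -
  define e where "e = 1 - E x - F x"
  define i where "i = inverse a"
  define YA where "YA = E x * A x * e + e * A x * F x"
  define YB where "YB = E x * B x * e + e * B x * F x"
  define XA where "XA = e * A x * E x + F x * A x * e"
  define XB where "XB = e * B x * E x + F x * B x * e"
  have Ch: "Ch x = C x - (2 * i) *\<^sub>C (YB - XB) + (2 * i * i) *\<^sub>C (YA + XA)"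
    using cm_blocks(1)[OF x skB[OF x] e_def] cm_blocks(2)[OF x skA[OF x] e_def]
    by (simp add: Ch_def i_def YA_def XA_def YB_def XB_def)
  have "Ch x = C x + (2 * i * i) *\<^sub>C YA + (- (2 * i)) *\<^sub>C YB + (2 * i * i) *\<^sub>C XA + (2 * i) *\<^sub>C XB"
    by (simp add: Ch scC_simps algebra_simps)
  moreover have "J = (\<lambda>y. Gam (E y) (F y) (- 1))" by (simp add: J_def fun_eq_iff)
  ultimately show ?thesis
    using gauge_general[OF x, of "- 1" 0 0 0, OF _ _ e_def i_def]
    unfolding YA_def[symmetric] YB_def[symmetric] XA_def[symmetric] XB_def[symmetric] by (simp add: mult.assoc)
qed

lemma J_props:
  assumes "x \<in> U"
  shows "J x * J x = 1" "adj (J x) = J x" "R x * J x = J x * R x" "J x \<cdot> J x \<cdot> v = v"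
proof -
  have "Gam (E x) (F x) (- 1) * Gam (E x) (F x) (- 1) = 1"
    using Gam_mult[OF np[OF assms], of "- 1" "- 1"] by simp
  then show 1: "J x * J x = 1" by (simp add: J_def)
  then show "J x \<cdot> J x \<cdot> v = v" by (metis app_ring(2,6))
  show "adj (J x) = J x" "R x * J x = J x * R x"
    using Gam_adj[OF np[OF assms], of "- 1"] Gam_refl[OF np[OF assms], of "- 1"] by (simp_all add: J_def)
qed

lemma smJ: "sm U J"
  unfolding J_def[abs_def] by (rule sm_Gam[OF openU smE smF])

text \<open>\<open>W\<close> belongs to the leading coefficients, hence to l = 0, where the gauge is
  the identity. \<open>W'\<close> is stable under \<open>d + C\<close>, the connection at infinity,
  where the gauge is \<open>J\<close>.\<close>

lemma half_step: "half d U R A Bh Ch W (\<lambda>x. (\<cdot>) (J x) ` W' x)"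
proof
  show "open U" "sm U R" "sm U A" by (rule openU smR smA)+
  have cm: "sm U (\<lambda>x. cm x (T x))" if "sm U T" for T
    unfolding cm_def by (intro sm_diff sm_mult_cmat openU smE smF that)
  show "sm U Bh" "sm U Ch"
    unfolding Bh_def Ch_def by (intro sm_add sm_diff sm_scC sm_const cm openU smA smB smC)+
next
  fix x assume x: "x \<in> U"
  show "R x * R x = 1" "adj (R x) = R x" "adj (A x) = - A x" "R x * A x = A x * R x"
    by (rule RR[OF x] adjR[OF x] skA[OF x] A_R[OF x])+
  show "adj (Bh x) = - Bh x" "adj (Ch x) = - Ch x"
    by (simp_all add: Bh_def Ch_def skA[OF x] skB[OF x] skC[OF x] cm_skew[OF x])
  have RZ: "R x * (E x - F x) = - ((E x - F x) * R x)"
    by (simp add: algebra_simps null_pairD(7,8)[OF np[OF x]])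
  have c1: "R x * cm x T = - (cm x T * R x)" if "R x * T = T * R x" for T
    unfolding cm_def by (rule commutator_anti[OF RZ that])
  have c2: "R x * cm x T = cm x T * R x" if "R x * T = - (T * R x)" for T
    unfolding cm_def by (rule commutator_anti2[OF RZ that])
  show "R x * Bh x = - (Bh x * R x)"
    by (simp add: Bh_def right_diff_distrib left_diff_distrib B_R[OF x] c1[OF A_R[OF x]])
  have "R x * (Ch x - C x) = (Ch x - C x) * R x"
    by (simp add: Ch_def distrib_left distrib_right right_diff_distrib left_diff_distrib c2[OF B_R[OF x]] c2[OF c1[OF A_R[OF x]]])
  then show "wd d R x = R x * Ch x - Ch x * R x"
    by (simp add: dR[OF x] algebra_simps)
  show "R x \<cdot> w = w" "A x \<cdot> w = 0" if "w \<in> W x" for w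
    using that by (simp_all add: W_R[OF x] A_W[OF x])
  show "A x \<cdot> v = 0" if "R x \<cdot> v = - v" for v
    using that by (rule A_perp[OF x])
  show "Bh x \<cdot> w = 0" if w: "w \<in> W x" for w
  proof -
    \<comment> \<open>\<open>E - F\<close> is odd under the reflection, so it moves \<open>w\<close>
      from \<open>S\<close> into the complement, on which \<open>A\<close> vanishes.\<close>
    have "R x \<cdot> (E x - F x) \<cdot> w = (R x * (E x - F x)) \<cdot> w" by (simp only: app_ring)
    also have "\<dots> = - ((E x - F x) \<cdot> w)" by (simp only: RZ app_ring W_R[OF x w])
    finally have "A x \<cdot> (E x - F x) \<cdot> w = 0" by (rule A_perp[OF x])
    then show ?thesis by (simp only: Bh_def cm_def app_ring app_scC_left A_W[OF x w] B_W[OF x w]) simp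
  qed
next
  fix V x and s :: "'n sect"
  assume V: "open V" "x \<in> V" "V \<subseteq> U" and s: "s differentiable (at x)" and sW: "\<And>y. y \<in> V \<Longrightarrow> s y \<in> (\<cdot>) (J y) ` W' y"
  have x: "x \<in> U" using V by auto
  have Jd: "J differentiable (at x)" by (rule sm_diff_at[OF smJ x])
  define t where "t = (\<lambda>y. J y \<cdot> s y)"
  have t: "t differentiable (at x)" unfolding t_def by (rule differentiable_app[OF Jd s])
  have "t y \<in> W' y" if "y \<in> V" for y
    using sW[OF that] V(3) that J_props(4)[of y] by (auto simp: t_def)
  then have tW: "wd d t x + C x \<cdot> t x \<in> W' x" by (rule stab[OF V t])
  have st: "s y = J y \<cdot> t y" if "y \<in> V" for y using that V(3) J_props(4)[of y] by (auto simp: t_def)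
  have "wd d s x = wd d (\<lambda>y. J y \<cdot> t y) x"
    by (rule wd_cong_open[OF V(1,2)]) (rule st)
  also have "\<dots> = wd d J x \<cdot> t x + J x \<cdot> wd d t x" by (rule wd_app[OF Jd t])
  finally have "wd d s x + Ch x \<cdot> s x = (wd d J x + Ch x * J x) \<cdot> t x + J x \<cdot> wd d t x"
    using st[OF V(2)] by simp
  also have "\<dots> = J x \<cdot> (wd d t x + C x \<cdot> t x)" unfolding gauge_inf[OF x] by simp
  finally have fin: "wd d s x + Ch x \<cdot> s x = J x \<cdot> (wd d t x + C x \<cdot> t x)" .
  show "wd d s x + Ch x \<cdot> s x \<in> (\<cdot>) (J x) ` W' x" unfolding fin by (rule imageI[OF tW])
qed

end

text \<open>A parallel section \<open>t\<close> of the line gives \<open>par\<close>.\<close>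

lemma parallel_projection:
  assumes "open V" "x \<in> V" and t: "t differentiable (at x)" and E: "E differentiable (at x)"
    and Et: "\<And>y. y \<in> V \<Longrightarrow> E y \<cdot> t y = t y"
    and rk: "\<And>v. \<exists>k. E x \<cdot> v = k *\<^sub>C t x"
    and idem: "\<And>y. y \<in> V \<Longrightarrow> E y * E y = E y"
    and par: "wd d t x + P \<cdot> t x = k *\<^sub>C t x"
  shows "(1 - E x) * (P * E x + wd d E x) = 0"
proof (rule cmat_eqI)
  fix v
  have "wd d (\<lambda>y. E y * E y) x = wd d E x"
    by (rule wd_cong_open[OF assms(1,2)]) (simp add: idem)
  then have 1: "wd d E x = wd d E x * E x + E x * wd d E x"
    using E by (simp add: wd_mult)
  have z: "(1 - E x) * (E x * wd d E x) = 0"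
    using idem[OF assms(2)] by (simp add: left_diff_distrib mult.assoc[symmetric])
  have "(1 - E x) * wd d E x = (1 - E x) * (wd d E x * E x + E x * wd d E x)"
    using 1 by (rule arg_cong)
  also have "\<dots> = (1 - E x) * wd d E x * E x"
    by (simp only: distrib_left z add_0_right mult.assoc)
  finally have 2: "(1 - E x) * wd d E x = (1 - E x) * wd d E x * E x" .
  have "wd d t x = wd d (\<lambda>y. E y \<cdot> t y) x"
    by (rule wd_cong_open[OF assms(1,2)]) (simp add: Et)
  also have "\<dots> = wd d E x \<cdot> t x + E x \<cdot> wd d t x" by (rule wd_app[OF E t])
  finally have 3: "wd d E x \<cdot> t x = (1 - E x) \<cdot> wd d t x" by (simp add: algebra_simps)
  have EE: "(1 - E x) \<cdot> (1 - E x) \<cdot> v = (1 - E x) \<cdot> v" for v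
  proof -
    have "(1 - E x) * (1 - E x) = 1 - E x" using idem[OF assms(2)] by (simp add: algebra_simps)
    then show ?thesis by (metis app_ring(6))
  qed
  have 4: "(1 - E x) \<cdot> (P \<cdot> t x + wd d E x \<cdot> t x) = 0"
  proof -
    have "(1 - E x) \<cdot> (P \<cdot> t x + wd d E x \<cdot> t x) = (1 - E x) \<cdot> (P \<cdot> t x + wd d t x)"
      unfolding 3 app_add EE ..
    also have "P \<cdot> t x + wd d t x = k *\<^sub>C t x" using par by (simp add: add.commute)
    finally show ?thesis using Et[OF assms(2)] by simp
  qed
  obtain c where c: "E x \<cdot> v = c *\<^sub>C t x" using rk by blast
  have "((1 - E x) * (P * E x + wd d E x)) \<cdot> v = (1 - E x) \<cdot> P \<cdot> E x \<cdot> v + ((1 - E x) * wd d E x) \<cdot> v"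
    by (simp only: app_ring app_add)
  also have "((1 - E x) * wd d E x) \<cdot> v = ((1 - E x) * wd d E x * E x) \<cdot> v"
    by (rule arg_cong[OF 2, of "\<lambda>T. T \<cdot> v"])
  also have "(1 - E x) \<cdot> P \<cdot> E x \<cdot> v + ((1 - E x) * wd d E x * E x) \<cdot> v
      = c *\<^sub>C ((1 - E x) \<cdot> (P \<cdot> t x + wd d E x \<cdot> t x))"
    by (simp only: app_ring(6) c app_scC app_add scC_add_right)
  finally show "((1 - E x) * (P * E x + wd d E x)) \<cdot> v = 0 \<cdot> v"
    by (simp only: 4 scC_zero_right app_ring(1))
qed

text \<open>The \<open>F\<close>-part of the gauge has its pole at \<open>a\<close> and the
  \<open>E\<close>-part at \<open>- a\<close>. \<open>Fz\<close> and \<open>Ez\<close> make the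
  corresponding parts of the Laurent polynomial vanish at exactly these values, so zeros cancel
  poles and the degree does not grow.\<close>

lemma Gam_conserved:
  assumes np: "null_pair R E F" and a: "a \<noteq> 0" and l: "l \<noteq> 0" "l \<noteq> a" "l \<noteq> - a"
    and c: "c = (a - l) / (a + l)"
    and Fz: "F \<cdot> (inverse a *\<^sub>C v + v0 + a *\<^sub>C w) = 0"
    and Ez: "E \<cdot> (- (inverse a *\<^sub>C v) + v0 - a *\<^sub>C w) = 0"
  shows "Gam E F c \<cdot> (inverse l *\<^sub>C v + v0 + l *\<^sub>C w)
    = inverse l *\<^sub>C v + (v0 - (2 * inverse a) *\<^sub>C ((E - F) \<cdot> v)) + l *\<^sub>C (Gam E F (- 1) \<cdot> w)"
proof -
  have al: "a + l \<noteq> 0" "a - l \<noteq> 0" using l by (auto simp: eq_neg_iff_add_eq_0 add.commute)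
  have s: "(c - 1) * (inverse l + inverse a) = - (2 * inverse a)" "(c - 1) * (l + a) = - (2 * l)"
    "(inverse c - 1) * (inverse l - inverse a) = 2 * inverse a" "(inverse c - 1) * (l - a) = - (2 * l)"
    using al l a by (simp_all add: c divide_simps) (simp_all add: algebra_simps)
  have F1: "F \<cdot> (inverse l *\<^sub>C v + v0 + l *\<^sub>C w) = (inverse l - inverse a) *\<^sub>C (F \<cdot> v) + (l - a) *\<^sub>C (F \<cdot> w)"
    using Fz by (simp add: scC_diff_left algebra_simps)
  have E1: "E \<cdot> (inverse l *\<^sub>C v + v0 + l *\<^sub>C w) = (inverse l + inverse a) *\<^sub>C (E \<cdot> v) + (l + a) *\<^sub>C (E \<cdot> w)"
    using Ez by (simp add: scC_add_left algebra_simps)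
  have "Gam E F c \<cdot> (inverse l *\<^sub>C v + v0 + l *\<^sub>C w) = inverse l *\<^sub>C v + v0 + l *\<^sub>C w
     + (((c - 1) * (inverse l + inverse a)) *\<^sub>C (E \<cdot> v) + ((c - 1) * (l + a)) *\<^sub>C (E \<cdot> w))
     + (((inverse c - 1) * (inverse l - inverse a)) *\<^sub>C (F \<cdot> v) + ((inverse c - 1) * (l - a)) *\<^sub>C (F \<cdot> w))"
    unfolding Gam_def app_ring app_scC_left E1 F1 by (simp only: scC_add_right scC_scC)
  also have "\<dots> = inverse l *\<^sub>C v + (v0 - (2 * inverse a) *\<^sub>C ((E - F) \<cdot> v)) + l *\<^sub>C (Gam E F (- 1) \<cdot> w)"
    unfolding s by (simp add: Gam_def scC_simps algebra_simps)
  finally show ?thesis .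
qed

section \<open>Dressing by null lines, permutability and reality\<close>

definition Ef :: "'n::finite omat \<Rightarrow> 'n cvec \<Rightarrow> 'n omat" where
  "Ef R l = inverse (form l (R \<cdot> l)) *\<^sub>C tens l (R \<cdot> l)"

definition Ff :: "'n::finite omat \<Rightarrow> 'n cvec \<Rightarrow> 'n omat" where
  "Ff R l = inverse (form l (R \<cdot> l)) *\<^sub>C tens (R \<cdot> l) l"

abbreviation "GL R l c \<equiv> Gam (Ef R l) (Ff R l) c"

abbreviation "ZL R l \<equiv> Ef R l - Ff R l"

lemma null_pair_EfFf:
  "form l l = 0 \<Longrightarrow> form l (R \<cdot> l) \<noteq> 0 \<Longrightarrow> R * R = 1 \<Longrightarrow> adj R = R \<Longrightarrow> null_pair R (Ef R l) (Ff R l)"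
  by (rule null_pairI[of l R]) (auto simp: Ef_def Ff_def)

text \<open>The derivative is taken in the spectral parameter. In the variable log c the gauges form
  a one-parameter group with generator \<open>E - F\<close>, so the logarithmic derivative of the
  scalar appears.\<close>

lemma has_derivative_Gam:
  assumes np: "null_pair R E F" and f: "(f has_field_derivative f') (at x)" and nz: "f x \<noteq> 0"
  shows "((\<lambda>y. Gam E F (f y)) has_derivative (\<lambda>X. (X * (f' / f x)) *\<^sub>C ((E - F) * Gam E F (f x)))) (at x)"
proof -
  note n = null_pairD[OF np]
  have 1: "((\<lambda>y. f y - 1) has_derivative (\<lambda>X. X * f')) (at x)"
    using f by (auto intro!: derivative_eq_intros simp: has_field_derivative_def mult.commute)
  have 2: "((\<lambda>y. inverse (f y) - 1) has_derivative (\<lambda>X. - (X * f' / (f x * f x)))) (at x)"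
    using has_derivative_diff[OF Deriv.has_derivative_inverse[OF nz f[unfolded has_field_derivative_def]] has_derivative_const[of 1]]
    by (rule has_derivative_eq_rhs) (simp add: fun_eq_iff divide_inverse mult_ac)
  have sc: "((\<lambda>y. g y *\<^sub>C T) has_derivative (\<lambda>X. g' X *\<^sub>C T)) (at x)"
    if "(g has_derivative g') (at x)" for g g' and T :: "'a omat"
  proof -
    have "bounded_bilinear ((*\<^sub>C) :: complex \<Rightarrow> 'a omat \<Rightarrow> 'a omat)"
      using cbil_scC unfolding cbil_def by blast
    from bounded_bilinear.FDERIV[OF this that has_derivative_const[of T]]
    show ?thesis by simp
  qed
  have 3: "((\<lambda>y. Gam E F (f y)) has_derivative (\<lambda>X. 0 + (X * f') *\<^sub>C E + (- (X * f' / (f x * f x))) *\<^sub>C F)) (at x)"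
    unfolding Gam_def by (intro has_derivative_add has_derivative_const sc 1 2)
  have "(E - F) * Gam E F (f x) = f x *\<^sub>C E - inverse (f x) *\<^sub>C F"
    by (simp add: Gam_def algebra_simps n scC_simps)
  then have "0 + (X * f') *\<^sub>C E + (- (X * f' / (f x * f x))) *\<^sub>C F
      = (X * (f' / f x)) *\<^sub>C ((E - F) * Gam E F (f x))" for X
    using nz by (simp add: scC_simps divide_inverse mult.assoc)
  then show ?thesis using 3 by simp
qed

section \<open>Logarithmic derivatives in the space of bivectors\<close>

lemma wdg_conj: "A * wdg u v * adj A = wdg (A \<cdot> u) (A \<cdot> v)"
  by (simp add: wdg_def left_diff_distrib right_diff_distrib)

lemma wdg_anti: "wdg v u = - wdg u v"
  by (simp add: wdg_def)

text \<open>The opposite sign of \<open>wdg\<close>, chosen so that \<open>ZL R l\<close> is a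
  positive multiple of \<open>wg l (R \<cdot> l)\<close> in the formal sense of
  \<open>ZL_wg\<close>.\<close>

abbreviation "wg u v \<equiv> wdg v u"

lemma wg_expand: "wg (m + \<alpha> *\<^sub>C l + \<beta> *\<^sub>C l') (m' + \<gamma> *\<^sub>C l + \<delta> *\<^sub>C l') =
   wg m m' - \<gamma> *\<^sub>C wg l m - \<delta> *\<^sub>C wg l' m + \<alpha> *\<^sub>C wg l m' + \<beta> *\<^sub>C wg l' m' + (\<alpha> * \<delta> - \<beta> * \<gamma>) *\<^sub>C wg l l'"
  by (simp add: wdg_def scC_simps algebra_simps)

text \<open>A normal form common to both sides of the permutability identity. The factor
  \<open>s\<close> is moved next to the scalars so that the relations of
  \<open>dressing_scalars\<close> apply as rewrite rules.\<close>

lemma wg_combination: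
  assumes "A \<noteq> 0"
  shows "s *\<^sub>C ((A / D) *\<^sub>C wg (m + (u * (Y / A)) *\<^sub>C l + (u' * (X / A)) *\<^sub>C l') (m' + (w * (X / A)) *\<^sub>C l + (w' * (Y / A)) *\<^sub>C l')
      - inverse B *\<^sub>C wg m m')
    = (s * A / D - s / B) *\<^sub>C wg m m' - (s * w * (X / D)) *\<^sub>C wg l m - (s * w' * (Y / D)) *\<^sub>C wg l' m
      + (s * u * (Y / D)) *\<^sub>C wg l m' + (s * u' * (X / D)) *\<^sub>C wg l' m'
      + ((s * (u * w')) * (Y * Y / (A * D)) - (s * (u' * w)) * (X * X / (A * D))) *\<^sub>C wg l l'"
proof -
  have 1: "s *\<^sub>C ((A / D) *\<^sub>C T - inverse B *\<^sub>C T') = (s * (A / D)) *\<^sub>C T - (s / B) *\<^sub>C T'" for T T' :: "'a omat"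
    by (simp add: scC_diff_right scC_scC divide_inverse)
  have 2: "s * (A / D) * (z * (Z / A)) = s * z * (Z / D)" for z Z
    using assms by simp
  have 3: "s * (A / D) * (u * (Y / A) * (w' * (Y / A)) - u' * (X / A) * (w * (X / A)))
      = (s * (u * w')) * (Y * Y / (A * D)) - (s * (u' * w)) * (X * X / (A * D))"
    using assms by (simp add: right_diff_distrib divide_simps) (simp add: algebra_simps)
  show ?thesis
    unfolding 1 unfolding wg_expand unfolding scC_add_right scC_diff_right scC_scC
    unfolding 2 3 times_divide_eq_right[of s A D, symmetric] unfolding scC_diff_left
    by (simp only: algebra_simps)
qed

lemma ZL_wg: "ZL R l = inverse (form l (R \<cdot> l)) *\<^sub>C wg l (R \<cdot> l)"
  by (simp add: Ef_def Ff_def wdg_def scC_diff_right)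

text \<open>\<open>k\<close> and \<open>s\<close> are the logarithmic derivatives of
  \<open>c\<close> and \<open>t\<close> as functions of the spectral parameter \<open>x\<close>. The
  eight relations match the coefficients of the mixed and pure bivectors.\<close>

lemma dressing_scalars:
  fixes a b x :: complex
  assumes nz: "a \<noteq> 0" "b \<noteq> 0" "a - x \<noteq> 0" "a + x \<noteq> 0" "x - b \<noteq> 0" "x + b \<noteq> 0" "a - b \<noteq> 0" "a + b \<noteq> 0"
    and c: "c = (a - x) / (a + x)" and t: "t = (x - b) / (x + b)" and t0: "t0 = (a - b) / (a + b)"
    and k: "k = - (2 * a) / ((a - x) * (a + x))" and s: "s = 2 * b / ((x - b) * (x + b))"
  shows "s * (inverse (c * t0) - 1) = - k * (inverse (t * t0) - 1)"
    "s * (t0 / c - 1) = k * (t * t0 - 1)"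
    "s * (c * t0 - 1) = k * (t0 / t - 1)"
    "s * (c / t0 - 1) = - k * (t / t0 - 1)"
    "s * ((t0 / c - 1) * (c * t0 - 1)) = - k * (t0 * t0 - 1)"
    "s * ((c / t0 - 1) * (inverse (c * t0) - 1)) = k * (inverse (t0 * t0) - 1)"
    "k * ((t0 / t - 1) * (t * t0 - 1)) = - s * (t0 * t0 - 1)"
    "k * ((t / t0 - 1) * (inverse (t * t0) - 1)) = s * (inverse (t0 * t0) - 1)"
proof -
  have e: "t0 / c - 1 = - (2 * a * (b - x)) / ((a + b) * (a - x))" "c * t0 - 1 = - (2 * a * (b + x)) / ((a + b) * (a + x))"
    "t0 / t - 1 = 2 * b * (a - x) / ((a + b) * (x - b))" "t * t0 - 1 = - (2 * b * (a + x)) / ((a + b) * (x + b))"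
    "c / t0 - 1 = 2 * a * (b - x) / ((a - b) * (a + x))" "inverse (c * t0) - 1 = 2 * a * (b + x) / ((a - b) * (a - x))"
    "t / t0 - 1 = - (2 * b * (a - x)) / ((a - b) * (x + b))" "inverse (t * t0) - 1 = 2 * b * (a + x) / ((a - b) * (x - b))"
    "t0 * t0 - 1 = - (4 * a * b) / ((a + b) * (a + b))" "inverse (t0 * t0) - 1 = 4 * a * b / ((a - b) * (a - b))"
    using nz unfolding c t t0 by (simp_all add: divide_simps) (simp_all add: algebra_simps)
  show "s * (inverse (c * t0) - 1) = - k * (inverse (t * t0) - 1)"
    unfolding e k s using nz by (simp add: divide_simps) (simp add: algebra_simps)?
  show "s * (t0 / c - 1) = k * (t * t0 - 1)"
    unfolding e k s using nz by (simp add: divide_simps) (simp add: algebra_simps)?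
  show "s * (c * t0 - 1) = k * (t0 / t - 1)"
    unfolding e k s using nz by (simp add: divide_simps) (simp add: algebra_simps)?
  show "s * (c / t0 - 1) = - k * (t / t0 - 1)"
    unfolding e k s using nz by (simp add: divide_simps) (simp add: algebra_simps)?
  show "s * ((t0 / c - 1) * (c * t0 - 1)) = - k * (t0 * t0 - 1)"
    unfolding e k s using nz by (simp add: divide_simps) (simp add: algebra_simps)?
  show "s * ((c / t0 - 1) * (inverse (c * t0) - 1)) = k * (inverse (t0 * t0) - 1)"
    unfolding e k s using nz by (simp add: divide_simps) (simp add: algebra_simps)?
  show "k * ((t0 / t - 1) * (t * t0 - 1)) = - s * (t0 * t0 - 1)"
    unfolding e k s using nz by (simp add: divide_simps) (simp add: algebra_simps)?
  show "k * ((t / t0 - 1) * (inverse (t * t0) - 1)) = s * (inverse (t0 * t0) - 1)"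
    unfolding e k s using nz by (simp add: divide_simps) (simp add: algebra_simps)?
qed

text \<open>
  The infinitesimal form of Bianchi permutability: an identity in the span of the six bivectors
  formed from \<open>l\<close>, \<open>\<rho>l\<close>, \<open>m\<close>, \<open>\<rho>m\<close>.
\<close>

lemma log_derivative_identity:
  fixes R :: "'n::finite omat"
  assumes R: "R * R = 1" "adj R = R"
    and l: "form l l = 0" "form l (R \<cdot> l) \<noteq> 0" and m: "form m m = 0" "form m (R \<cdot> m) \<noteq> 0"
    and lt: "l' = GL R m t0 \<cdot> l" "form l' (R \<cdot> l') \<noteq> 0" and mt: "m' = GL R l t0 \<cdot> m"
    and nz: "c \<noteq> 0" "t \<noteq> 0" "t0 \<noteq> 0"
    and sc: "s * (inverse (c * t0) - 1) = - k * (inverse (t * t0) - 1)"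
    "s * (t0 / c - 1) = k * (t * t0 - 1)"
    "s * (c * t0 - 1) = k * (t0 / t - 1)"
    "s * (c / t0 - 1) = - k * (t / t0 - 1)"
    "s * ((t0 / c - 1) * (c * t0 - 1)) = - k * (t0 * t0 - 1)"
    "s * ((c / t0 - 1) * (inverse (c * t0) - 1)) = k * (inverse (t0 * t0) - 1)"
    "k * ((t0 / t - 1) * (t * t0 - 1)) = - s * (t0 * t0 - 1)"
    "k * ((t / t0 - 1) * (inverse (t * t0) - 1)) = s * (inverse (t0 * t0) - 1)"
  shows "s *\<^sub>C (GL R l (inverse c) * ZL R m' * GL R l c - ZL R m) = k *\<^sub>C (GL R m (inverse t) * ZL R l' * GL R m t - ZL R l)"
    and "form m' (R \<cdot> m') \<noteq> 0"
proof -
  define A B X Y where "A = form l (R \<cdot> l)" and "B = form m (R \<cdot> m)"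
    and "X = form l m" and "Y = form l (R \<cdot> m)"
  \<comment> \<open>\<open>D / A\<close> and \<open>D / B\<close> will be the self-pairings of
    \<open>m'\<close> and \<open>l'\<close> with their reflections. As \<open>D\<close> is symmetric
    in the two lines, nondegeneracy of \<open>l'\<close> passes to \<open>m'\<close>.\<close>
  define D where "D = A * B + (t0 * t0 - 1) * (Y * Y) + (inverse (t0 * t0) - 1) * (X * X)"
  have AB: "A \<noteq> 0" "B \<noteq> 0" using l m by (auto simp: A_def B_def)
  have RR: "R \<cdot> R \<cdot> v = v" for v using R(1) by (metis app_ring(2,6))
  have Rf: "form (R \<cdot> v) w = form v (R \<cdot> w)" for v w using adj_app[of R v w] R(2) by simp
  have f: "form m (R \<cdot> l) = Y" "form (R \<cdot> m) l = Y" "form m l = X" "form (R \<cdot> l) m = Y"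
    "form (R \<cdot> m) (R \<cdot> l) = X" "form (R \<cdot> l) (R \<cdot> m) = X"
    by (simp_all add: Rf RR X_def Y_def form_sym[of m l] form_sym[of m "R \<cdot> l"])
  have npl: "null_pair R (Ef R l) (Ff R l)" and npm: "null_pair R (Ef R m) (Ff R m)"
    using null_pair_EfFf R l m by auto
  have Gl: "GL R l u \<cdot> v = v + ((u - 1) * (form v (R \<cdot> l) / A)) *\<^sub>C l + ((inverse u - 1) * (form v l / A)) *\<^sub>C (R \<cdot> l)" for u v
    by (simp add: Gam_def Ef_def Ff_def A_def scC_scC divide_inverse mult_ac)
  have Gm: "GL R m u \<cdot> v = v + ((u - 1) * (form v (R \<cdot> m) / B)) *\<^sub>C m + ((inverse u - 1) * (form v m / B)) *\<^sub>C (R \<cdot> m)" for u v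
    by (simp add: Gam_def Ef_def Ff_def B_def scC_scC divide_inverse mult_ac)
  have Rm': "R \<cdot> m' = GL R l (inverse t0) \<cdot> R \<cdot> m"
    using Gam_refl[OF npl, of t0] unfolding mt by (metis app_ring(6))
  have Rl': "R \<cdot> l' = GL R m (inverse t0) \<cdot> R \<cdot> l"
    using Gam_refl[OF npm, of t0] unfolding lt by (metis app_ring(6))
  have Gadj: "form (GL R l u \<cdot> v) w = form v (GL R l (inverse u) \<cdot> w)"
    "form (GL R m u \<cdot> v) w = form v (GL R m (inverse u) \<cdot> w)" for u v w
    by (simp_all add: adj_app Gam_adj[OF npl] Gam_adj[OF npm])
  have Gmul: "GL R l u \<cdot> GL R l v \<cdot> w = GL R l (u * v) \<cdot> w" "GL R m u \<cdot> GL R m v \<cdot> w = GL R m (u * v) \<cdot> w"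
    if "u \<noteq> 0" "v \<noteq> 0" for u v w
    using Gam_mult[OF npl that] Gam_mult[OF npm that] by (metis app_ring(6))+
  have tt: "inverse t0 * inverse t0 = inverse (t0 * t0)" by simp
  have it: "inverse t0 \<noteq> 0" using nz by simp
  have Bt: "form m' (R \<cdot> m') = D / A"
  proof -
    have "form m' (R \<cdot> m') = form m (GL R l (inverse (t0 * t0)) \<cdot> R \<cdot> m)"
      unfolding Rm' unfolding mt Gadj Gmul[OF it it] tt ..
    also have "\<dots> = B + (inverse (t0 * t0) - 1) * (X / A) * X + (t0 * t0 - 1) * (Y / A) * Y"
      unfolding Gl by (simp only: form_add_right form_scC_right f inverse_inverse_eq B_def)
    also have "\<dots> = D / A" using AB by (simp add: D_def add_divide_distrib add_ac mult_ac)
    finally show ?thesis .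
  qed
  have At: "form l' (R \<cdot> l') = D / B"
  proof -
    have "form l' (R \<cdot> l') = form l (GL R m (inverse (t0 * t0)) \<cdot> R \<cdot> l)"
      unfolding Rl' unfolding lt(1) Gadj Gmul[OF it it] tt ..
    also have "\<dots> = A + (inverse (t0 * t0) - 1) * (X / B) * X + (t0 * t0 - 1) * (Y / B) * Y"
      unfolding Gm by (simp only: form_add_right form_scC_right f inverse_inverse_eq A_def X_def[symmetric] Y_def[symmetric])
    also have "\<dots> = D / B" using AB by (simp add: D_def add_divide_distrib add_ac mult_ac)
    finally show ?thesis .
  qed
  have D0: "D \<noteq> 0" using lt(2) At by auto
  then show "form m' (R \<cdot> m') \<noteq> 0" using Bt AB by simp
  have c1: "GL R l (inverse c) \<cdot> m' = m + ((t0 / c - 1) * (Y / A)) *\<^sub>C l + ((c / t0 - 1) * (X / A)) *\<^sub>C (R \<cdot> l)"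
    unfolding mt using nz by (simp add: Gmul) (simp add: Gl f divide_inverse mult_ac)
  have c2: "GL R l (inverse c) \<cdot> R \<cdot> m' = R \<cdot> m + ((inverse (c * t0) - 1) * (X / A)) *\<^sub>C l + ((c * t0 - 1) * (Y / A)) *\<^sub>C (R \<cdot> l)"
    unfolding Rm' using nz by (simp add: Gmul) (simp add: Gl f divide_inverse mult_ac)
  have c3: "GL R m (inverse t) \<cdot> l' = l + ((t0 / t - 1) * (Y / B)) *\<^sub>C m + ((t / t0 - 1) * (X / B)) *\<^sub>C (R \<cdot> m)"
    unfolding lt(1) using nz by (simp add: Gmul) (simp add: Gm Y_def[symmetric] X_def[symmetric] divide_inverse mult_ac)
  have c4: "GL R m (inverse t) \<cdot> R \<cdot> l' = R \<cdot> l + ((inverse (t * t0) - 1) * (X / B)) *\<^sub>C m + ((t * t0 - 1) * (Y / B)) *\<^sub>C (R \<cdot> m)"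
    unfolding Rl' using nz by (simp add: Gmul) (simp add: Gm f divide_inverse mult_ac)
  have L: "GL R l (inverse c) * ZL R m' * GL R l c = (A / D) *\<^sub>C wg (GL R l (inverse c) \<cdot> m') (GL R l (inverse c) \<cdot> R \<cdot> m')"
    using wdg_conj[of "GL R l (inverse c)" "R \<cdot> m'" m'] Gam_adj[OF npl, of "inverse c"]
    by (simp add: ZL_wg Bt)
  have M: "GL R m (inverse t) * ZL R l' * GL R m t = (B / D) *\<^sub>C wg (GL R m (inverse t) \<cdot> l') (GL R m (inverse t) \<cdot> R \<cdot> l')"
    using wdg_conj[of "GL R m (inverse t)" "R \<cdot> l'" l'] Gam_adj[OF npm, of "inverse t"]
    by (simp add: ZL_wg At)
  let ?u = "t0 / c - 1" and ?ui = "c / t0 - 1" and ?w = "inverse (c * t0) - 1" and ?wi = "c * t0 - 1"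
  let ?v = "t0 / t - 1" and ?vi = "t / t0 - 1" and ?x = "inverse (t * t0) - 1" and ?xi = "t * t0 - 1"
  let ?p = "t0 * t0 - 1" and ?q = "inverse (t0 * t0) - 1"
  have L2: "s *\<^sub>C (GL R l (inverse c) * ZL R m' * GL R l c - ZL R m) = (s * A / D - s / B) *\<^sub>C wg m (R \<cdot> m)
     - (s * ?w * (X / D)) *\<^sub>C wg l m - (s * ?wi * (Y / D)) *\<^sub>C wg (R \<cdot> l) m + (s * ?u * (Y / D)) *\<^sub>C wg l (R \<cdot> m)
     + (s * ?ui * (X / D)) *\<^sub>C wg (R \<cdot> l) (R \<cdot> m) + ((s * (?u * ?wi)) * (Y * Y / (A * D)) - (s * (?ui * ?w)) * (X * X / (A * D))) *\<^sub>C wg l (R \<cdot> l)"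
    unfolding L c1 c2 ZL_wg[of R m] B_def[symmetric] by (rule wg_combination[OF AB(1)])
  have M2: "k *\<^sub>C (GL R m (inverse t) * ZL R l' * GL R m t - ZL R l) = (k * B / D - k / A) *\<^sub>C wg l (R \<cdot> l)
     - (k * ?x * (X / D)) *\<^sub>C wg m l - (k * ?xi * (Y / D)) *\<^sub>C wg (R \<cdot> m) l + (k * ?v * (Y / D)) *\<^sub>C wg m (R \<cdot> l)
     + (k * ?vi * (X / D)) *\<^sub>C wg (R \<cdot> m) (R \<cdot> l) + ((k * (?v * ?xi)) * (Y * Y / (B * D)) - (k * (?vi * ?x)) * (X * X / (B * D))) *\<^sub>C wg m (R \<cdot> m)"
    unfolding M c3 c4 ZL_wg[of R l] A_def[symmetric] by (rule wg_combination[OF AB(2)])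
  \<comment> \<open>The coefficients of the pure bivectors \<open>wg l (R \<cdot> l)\<close> and
    \<open>wg m (R \<cdot> m)\<close> are not matched scalar by scalar; here the value of
    \<open>D\<close> itself is used.\<close>
  have d1: "(- k * ?p) * (Y * Y / (A * D)) - (k * ?q) * (X * X / (A * D)) = k * B / D - k / A"
    using AB D0 by (simp add: divide_simps) (simp add: D_def algebra_simps)
  have d2: "(- s * ?p) * (Y * Y / (B * D)) - (s * ?q) * (X * X / (B * D)) = s * A / D - s / B"
    using AB D0 by (simp add: divide_simps) (simp add: D_def algebra_simps)
  show "s *\<^sub>C (GL R l (inverse c) * ZL R m' * GL R l c - ZL R m) = k *\<^sub>C (GL R m (inverse t) * ZL R l' * GL R m t - ZL R l)"
    unfolding L2 M2 sc d1 d2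
    by (simp add: wdg_anti[of l m] wdg_anti[of l "R \<cdot> m"] wdg_anti[of "R \<cdot> l" m] wdg_anti[of "R \<cdot> l" "R \<cdot> m"])
qed

lemma ZL_Gam_commute:
  "null_pair R E F \<Longrightarrow> (E - F) * Gam E F c = Gam E F c * (E - F)"
  using null_pairD[of R E F] by (simp add: Gam_def algebra_simps)

lemma Gam_app_inverse:
  assumes "null_pair R E F" "c \<noteq> 0"
  shows "Gam E F c \<cdot> Gam E F (inverse c) \<cdot> v = v" "Gam E F (inverse c) \<cdot> Gam E F c \<cdot> v = v"
  using Gam_inverse[OF assms] by (metis app_ring(2,6))+

lemma form_Gam_null: "null_pair R E F \<Longrightarrow> c \<noteq> 0 \<Longrightarrow> form (Gam E F c \<cdot> v) (Gam E F c \<cdot> w) = form v w"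
  by (simp add: adj_app Gam_adj Gam_app_inverse)

text \<open>Bianchi's quadrilateral. \<open>t0\<close> is at once the value of \<open>tc\<close> at
  \<open>a\<close> and of \<open>cc\<close> at \<open>b\<close>, so \<open>l'\<close> is
  \<open>l\<close> dressed by \<open>m\<close>, and \<open>m'\<close> is \<open>m\<close> dressed by
  \<open>l\<close>, each at its own parameter.\<close>

locale two_lines =
  fixes R :: "'n::finite omat" and l m l' m' :: "'n cvec" and a b t0 :: complex
  assumes R: "R * R = 1" "adj R = R"
    and l: "form l l = 0" "form l (R \<cdot> l) \<noteq> 0" and m: "form m m = 0" "form m (R \<cdot> m) \<noteq> 0"
    and l'_def: "l' = GL R m t0 \<cdot> l" and l'_nz: "form l' (R \<cdot> l') \<noteq> 0" and m'_def: "m' = GL R l t0 \<cdot> m"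
    and ab: "a \<noteq> 0" "b \<noteq> 0" "a \<noteq> b" "a \<noteq> - b" and t0_def: "t0 = (a - b) / (a + b)"
begin

definition "cc x = (a - x) / (a + x)"
definition "tc x = (x - b) / (x + b)"
definition "rr x = GL R l' (cc x) * GL R m (tc x)"
definition "ss x = GL R m' (tc x) * GL R l (cc x)"
definition "reg = UNIV - {a, - a, b, - b}"

lemma regD: assumes "x \<in> reg"
  shows "a - x \<noteq> 0" "a + x \<noteq> 0" "x - b \<noteq> 0" "x + b \<noteq> 0" "a - b \<noteq> 0" "a + b \<noteq> 0"
  using assms ab by (auto simp: reg_def eq_neg_iff_add_eq_0 add.commute)

lemma abnz: "a - b \<noteq> 0" "a + b \<noteq> 0" "t0 \<noteq> 0"
  using ab by (auto simp: eq_neg_iff_add_eq_0 t0_def)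

lemma cc_nz: "x \<in> reg \<Longrightarrow> cc x \<noteq> 0" "x \<in> reg \<Longrightarrow> tc x \<noteq> 0"
  using regD[of x] by (simp_all add: cc_def tc_def)

lemma npl: "null_pair R (Ef R l) (Ff R l)" and npm: "null_pair R (Ef R m) (Ff R m)"
  using null_pair_EfFf R l m by auto

lemma npl': "null_pair R (Ef R l') (Ff R l')"
  by (rule null_pair_EfFf) (use R l'_nz abnz l in \<open>auto simp: l'_def form_Gam_null[OF npm]\<close>)

definition "kk x = - (2 * a) / ((a - x) * (a + x))"
definition "sk x = 2 * b / ((x - b) * (x + b))"

lemma log_id:
  assumes x: "x \<in> reg"
  shows "sk x *\<^sub>C (GL R l (inverse (cc x)) * ZL R m' * GL R l (cc x) - ZL R m)
    = kk x *\<^sub>C (GL R m (inverse (tc x)) * ZL R l' * GL R m (tc x) - ZL R l)"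
    and "form m' (R \<cdot> m') \<noteq> 0"
proof -
  note d = regD[OF x]
  note sc = dressing_scalars[OF ab(1,2) d cc_def[of x] tc_def[of x] t0_def kk_def[of x] sk_def[of x]]
  show "sk x *\<^sub>C (GL R l (inverse (cc x)) * ZL R m' * GL R l (cc x) - ZL R m)
    = kk x *\<^sub>C (GL R m (inverse (tc x)) * ZL R l' * GL R m (tc x) - ZL R l)"
    and "form m' (R \<cdot> m') \<noteq> 0"
    using log_derivative_identity[OF R l m l'_def l'_nz m'_def cc_nz(1)[OF x] cc_nz(2)[OF x] abnz(3) sc]
    by auto
qed

lemma m'_nz: "form m' (R \<cdot> m') \<noteq> 0"
proof -
  \<comment> \<open>The claim does not involve the spectral parameter, so any regular value of it
    may be inserted into \<open>log_id\<close>.\<close>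
  have "infinite (reg)" unfolding reg_def by (simp add: infinite_UNIV_char_0)
  then obtain x where "x \<in> reg" by (metis infinite_imp_nonempty ex_in_conv)
  then show ?thesis by (rule log_id(2))
qed

lemma npm': "null_pair R (Ef R m') (Ff R m')"
  by (rule null_pair_EfFf) (use R m'_nz abnz m in \<open>auto simp: m'_def form_Gam_null[OF npl]\<close>)

lemma rr_orth: assumes "x \<in> reg" shows "adj (rr x) * rr x = 1" "rr x * adj (rr x) = 1"
  "adj (ss x) * ss x = 1" "ss x * adj (ss x) = 1"
proof -
  have *: "adj (P * Q) * (P * Q) = 1" "(P * Q) * adj (P * Q) = 1"
    if "adj P * P = 1" "adj Q * Q = 1" "P * adj P = 1" "Q * adj Q = 1" for P Q :: "'n omat"
  proof -
    have "adj (P * Q) * (P * Q) = adj Q * (adj P * P) * Q" by (simp add: mult.assoc)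
    then show "adj (P * Q) * (P * Q) = 1" by (simp add: that)
    have "(P * Q) * adj (P * Q) = P * (Q * adj Q) * adj P" by (simp add: mult.assoc)
    then show "(P * Q) * adj (P * Q) = 1" by (simp add: that)
  qed
  have o: "adj (GL R u c) * GL R u c = 1" "GL R u c * adj (GL R u c) = 1"
    if "null_pair R (Ef R u) (Ff R u)" "c \<noteq> 0" for u c
    using Gam_inverse[OF that] by (simp_all add: Gam_adj[OF that(1)])
  show "adj (rr x) * rr x = 1" "rr x * adj (rr x) = 1" "adj (ss x) * ss x = 1" "ss x * adj (ss x) = 1"
    unfolding rr_def ss_def using cc_nz[OF assms] by (intro *; intro o npl npm npl' npm'; simp)+
qed

lemma cc_deriv: assumes "x \<in> reg"
  shows "(cc has_field_derivative (kk x * cc x)) (at x)" "(tc has_field_derivative (sk x * tc x)) (at x)"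
proof -
  note d = regD[OF assms]
  have "((\<lambda>x. (a - x) / (a + x)) has_field_derivative (kk x * cc x)) (at x)"
    using d by (auto intro!: derivative_eq_intros) (simp add: kk_def cc_def divide_simps, (simp add: algebra_simps)?)
  then show "(cc has_field_derivative (kk x * cc x)) (at x)" by (simp add: cc_def[abs_def])
  have "((\<lambda>x. (x - b) / (x + b)) has_field_derivative (sk x * tc x)) (at x)"
    using d by (auto intro!: derivative_eq_intros) (simp add: sk_def tc_def divide_simps, (simp add: algebra_simps)?)
  then show "(tc has_field_derivative (sk x * tc x)) (at x)" by (simp add: tc_def[abs_def])
qed

text \<open>By \<open>log_id\<close> both products solve the same equation \<open>X' = X Q\<close>
  with skew \<open>Q\<close>, so the quotient of the two, formed with the adjoint as inverse, has
  derivative zero.\<close>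

lemma ss_rr_deriv:
  assumes x: "x \<in> reg"
  shows "((\<lambda>y. ss y * adj (rr y)) has_derivative (\<lambda>X. 0)) (at x)"
proof -
  have D: "((\<lambda>y. GL R u (cc y)) has_derivative (\<lambda>X. (X * kk x) *\<^sub>C (ZL R u * GL R u (cc x)))) (at x)"
    "((\<lambda>y. GL R u (tc y)) has_derivative (\<lambda>X. (X * sk x) *\<^sub>C (ZL R u * GL R u (tc x)))) (at x)"
    if "null_pair R (Ef R u) (Ff R u)" for u
    using has_derivative_Gam[OF that cc_deriv(1)[OF x]] has_derivative_Gam[OF that cc_deriv(2)[OF x]] cc_nz[OF x]
    by auto
  define k s where "k = kk x" and "s = sk x"
  have r: "(rr has_derivative (\<lambda>X. GL R l' (cc x) * ((X * s) *\<^sub>C (ZL R m * GL R m (tc x)))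
      + (X * k) *\<^sub>C (ZL R l' * GL R l' (cc x)) * GL R m (tc x))) (at x)"
    unfolding rr_def[abs_def] k_def s_def by (intro has_derivative_mult D npl' npm)
  have s: "(ss has_derivative (\<lambda>X. GL R m' (tc x) * ((X * k) *\<^sub>C (ZL R l * GL R l (cc x)))
      + (X * s) *\<^sub>C (ZL R m' * GL R m' (tc x)) * GL R l (cc x))) (at x)"
    unfolding ss_def[abs_def] k_def s_def by (intro has_derivative_mult D npl npm')
  have r': "GL R l' (cc x) * ((X * s) *\<^sub>C (ZL R m * GL R m (tc x))) + (X * k) *\<^sub>C (ZL R l' * GL R l' (cc x)) * GL R m (tc x)
      = X *\<^sub>C (rr x * (s *\<^sub>C ZL R m + k *\<^sub>C (GL R m (inverse (tc x)) * ZL R l' * GL R m (tc x))))" for X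
  proof -
    have 1: "GL R l' (cc x) * (ZL R m * GL R m (tc x)) = rr x * ZL R m"
      by (simp only: rr_def ZL_Gam_commute[OF npm] mult.assoc)
    have "rr x * (GL R m (inverse (tc x)) * ZL R l' * GL R m (tc x))
      = GL R l' (cc x) * (GL R m (tc x) * GL R m (inverse (tc x))) * (ZL R l' * GL R m (tc x))"
      by (simp only: rr_def mult.assoc)
    also have "\<dots> = (ZL R l' * GL R l' (cc x)) * GL R m (tc x)"
      by (simp only: Gam_inverse[OF npm cc_nz(2)[OF x]] mult_1_right ZL_Gam_commute[OF npl'] mult.assoc)
    finally show ?thesis
      by (simp only: distrib_left scC_mult_left scC_mult_right scC_add_right scC_scC 1)
  qed
  have s': "GL R m' (tc x) * ((X * k) *\<^sub>C (ZL R l * GL R l (cc x))) + (X * s) *\<^sub>C (ZL R m' * GL R m' (tc x)) * GL R l (cc x)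
      = X *\<^sub>C (ss x * (k *\<^sub>C ZL R l + s *\<^sub>C (GL R l (inverse (cc x)) * ZL R m' * GL R l (cc x))))" for X
  proof -
    have 1: "GL R m' (tc x) * (ZL R l * GL R l (cc x)) = ss x * ZL R l"
      by (simp only: ss_def ZL_Gam_commute[OF npl] mult.assoc)
    have "ss x * (GL R l (inverse (cc x)) * ZL R m' * GL R l (cc x))
      = GL R m' (tc x) * (GL R l (cc x) * GL R l (inverse (cc x))) * (ZL R m' * GL R l (cc x))"
      by (simp only: ss_def mult.assoc)
    also have "\<dots> = (ZL R m' * GL R m' (tc x)) * GL R l (cc x)"
      by (simp only: Gam_inverse[OF npl cc_nz(1)[OF x]] mult_1_right ZL_Gam_commute[OF npm'] mult.assoc)
    finally show ?thesis
      by (simp only: distrib_left scC_mult_left scC_mult_right scC_add_right scC_scC 1)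
  qed
  define Q where "Q = s *\<^sub>C ZL R m + k *\<^sub>C (GL R m (inverse (tc x)) * ZL R l' * GL R m (tc x))"
  have Q: "k *\<^sub>C ZL R l + s *\<^sub>C (GL R l (inverse (cc x)) * ZL R m' * GL R l (cc x)) = Q"
  proof -
    have "w + x = y + z" if "x - y = z - w" for w x y z :: "'n omat"
      using that by (simp add: algebra_simps)
    then show ?thesis
      using log_id(1)[OF x] unfolding Q_def k_def[symmetric] s_def[symmetric] scC_diff_right by blast
  qed
  have ZS: "adj (ZL R u) = - ZL R u" if "null_pair R (Ef R u) (Ff R u)" for u
    using null_pairD(5,6)[OF that] by simp
  have "adj Q = - Q"
    by (simp only: Q_def adj_simps(1,4,5) ZS[OF npm] ZS[OF npl'] Gam_adj[OF npm] inverse_inverse_eq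
        mult_minus_left mult_minus_right mult.assoc scC_minus_right minus_add_distrib)
  have 1: "((\<lambda>y. adj (rr y)) has_derivative (\<lambda>X. adj (X *\<^sub>C (rr x * Q)))) (at x)"
    using bounded_linear.has_derivative[OF bounded_linear_adj r] unfolding r' Q_def .
  have "((\<lambda>y. ss y * adj (rr y)) has_derivative
     (\<lambda>X. ss x * adj (X *\<^sub>C (rr x * Q)) + X *\<^sub>C (ss x * Q) * adj (rr x))) (at x)"
    by (rule has_derivative_mult[OF s[unfolded s' Q] 1])
  moreover have "ss x * adj (X *\<^sub>C (rr x * Q)) + X *\<^sub>C (ss x * Q) * adj (rr x) = 0" for X
    by (simp add: \<open>adj Q = - Q\<close> mult.assoc)
  ultimately show ?thesis by simp
qed

text \<open>The plane without finitely many points is connected, so a vanishing derivative makes the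
  quotient of the two orders constant.\<close>

lemma permutability:
  assumes "x \<in> reg" "y \<in> reg"
  shows "ss x * adj (rr x) = ss y * adj (rr y)"
proof (rule cmat_eqI)
  fix v
  have od: "open reg" unfolding reg_def by (intro open_Diff open_UNIV finite_imp_closed) auto
  have cd: "connected reg" unfolding reg_def by (rule connected_open_delete_finite) auto
  have d: "((\<lambda>y. (ss y * adj (rr y)) \<cdot> v) has_derivative (\<lambda>X. 0)) (at z)" if "z \<in> reg" for z
  proof -
    have bl: "bounded_linear (\<lambda>A. A \<cdot> v)"
      by (rule bounded_linear_intro[where K="norm v"]) (auto simp: norm_app_le)
    show ?thesis using bounded_linear.has_derivative[OF bl ss_rr_deriv[OF that]] by simp
  qed
  have "continuous_on reg (\<lambda>y. (ss y * adj (rr y)) \<cdot> v)"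
    using d has_derivative_continuous by (intro continuous_at_imp_continuous_on ballI) blast
  moreover have "\<forall>z\<in>reg - {}. ((\<lambda>y. (ss y * adj (rr y)) \<cdot> v) has_derivative (\<lambda>X. 0)) (at z within reg)"
    using d has_derivative_at_withinI by blast
  ultimately have "(\<lambda>y. (ss y * adj (rr y)) \<cdot> v) constant_on reg"
    by (rule has_derivative_zero_connected_constant_on[OF cd od finite.emptyI])
  then show "(ss x * adj (rr x)) \<cdot> v = (ss y * adj (rr y)) \<cdot> v"
    using assms by (auto simp: constant_on_def)
qed

lemma permutability': assumes "x \<in> reg" "y \<in> reg"
  shows "adj (ss y) * ss x = adj (rr y) * rr x"
proof -
  have "adj (ss y) * (ss x * adj (rr x)) * rr x = adj (ss y) * (ss y * adj (rr y)) * rr x"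
    using permutability[OF assms] by simp
  also have "\<dots> = (adj (ss y) * ss y) * adj (rr y) * rr x" by (simp only: mult.assoc)
  finally show ?thesis using rr_orth[OF assms(1)] rr_orth[OF assms(2)] by (simp add: mult.assoc)
qed

end

section \<open>Reality of the dressing by a line and its conjugate\<close>

lemma mconj_Gam: "mconj (Gam E F c) = Gam (mconj E) (mconj F) (cnj c)"
  by (simp add: Gam_def)

lemma mconj_Ef: "mconj (Ef R l) = Ef (mconj R) (vconj l)" "mconj (Ff R l) = Ff (mconj R) (vconj l)"
  by (simp_all add: Ef_def Ff_def vconj_app[symmetric] form_vconj)

locale real_lines = two_lines R l "vconj l" l' m' a "inverse (cnj a)" t0
  for R :: "'n::finite omat" and l l' m' a t0 +
  assumes Rreal: "mconj R = R" and na: "norm a \<noteq> 1"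
begin

lemma one_reg: "1 \<in> reg"
proof (rule ccontr)
  assume "1 \<notin> reg"
  then have "1 = a \<or> 1 = - a \<or> 1 = inverse (cnj a) \<or> 1 = - inverse (cnj a)" by (auto simp: reg_def)
  then have "norm (1 :: complex) = norm a \<or> norm (1 :: complex) = norm (inverse (cnj a))"
    by (metis norm_minus_cancel)
  then show False using na by (auto simp: norm_inverse)
qed

text \<open>Here \<open>t0\<close> equals (|a|^2 - 1)/(|a|^2 + 1). Its reality is what makes the two
  dressed lines conjugate to each other.\<close>

lemma t0_real: "cnj t0 = t0"
proof -
  have "cnj a + inverse a \<noteq> 0" "a + inverse (cnj a) \<noteq> 0" 
    using abnz(2) by (metis complex_cnj_add complex_cnj_cnj complex_cnj_inverse complex_cnj_zero_iff)+
  then show ?thesis using ab by (simp add: t0_def divide_simps) (simp add: algebra_simps)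
qed

lemma conj_lines: "vconj l' = m'" "vconj m' = l'"
proof -
  show "vconj l' = m'"
    by (simp add: l'_def m'_def vconj_app mconj_Gam mconj_Ef Rreal t0_real)
  then show "vconj m' = l'" by (metis vconj_simps(5))
qed

lemma mconj_GL: "mconj (GL R u c) = GL R (vconj u) (cnj c)"
  by (simp add: mconj_Gam mconj_Ef Rreal)

lemma cc_tc: assumes "x \<noteq> 0" shows "cnj (cc (inverse (cnj x))) = tc x" "cnj (tc (inverse (cnj x))) = cc x"
proof -
  have 1: "cnj a - inverse x = (cnj a * inverse x) * (x - inverse (cnj a))" "cnj a + inverse x = (cnj a * inverse x) * (x + inverse (cnj a))"
    "inverse x - inverse a = (inverse a * inverse x) * (a - x)" "inverse x + inverse a = (inverse a * inverse x) * (a + x)"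
    using assms ab by (simp_all add: field_simps)
  show "cnj (cc (inverse (cnj x))) = tc x" "cnj (tc (inverse (cnj x))) = cc x"
    using assms ab by (simp_all add: cc_def tc_def 1)
qed

lemma mconj_rr: "x \<noteq> 0 \<Longrightarrow> mconj (rr (inverse (cnj x))) = ss x"
  by (simp add: rr_def ss_def mconj_GL conj_lines cc_tc)

text \<open>Conjugation combined with x -> 1/cnj x exchanges the two orders of dressing and fixes x
  = 1. Permutability says that the two orders agree once they are normalised at 1.\<close>

lemma reality:
  assumes "x \<in> reg" "x \<noteq> 0"
  shows "mconj (adj (rr 1) * rr (inverse (cnj x))) = adj (rr 1) * rr x"
proof -
  have "mconj (adj (rr 1) * rr (inverse (cnj x))) = adj (ss 1) * ss x"
    using mconj_rr[of 1] mconj_rr[OF assms(2)] by (simp add: mconj_adj)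
  then show ?thesis using permutability'[OF assms(1) one_reg] by simp
qed

text \<open>The value of \<open>rr\<close> at infinity is \<open>GL R l' (- 1)\<close>.\<close>

lemma reality_inf: "mconj (adj (rr 1) * GL R l' (- 1)) = adj (rr 1) * rr 0"
proof -
  have 0: "0 \<in> reg" using ab by (auto simp: reg_def)
  have "ss 0 = GL R m' (- 1)" using ab by (simp add: ss_def cc_def tc_def)
  then have "mconj (adj (rr 1) * GL R l' (- 1)) = adj (ss 1) * ss 0"
    using mconj_rr[of 1] by (simp add: mconj_adj mconj_GL conj_lines)
  then show ?thesis using permutability'[OF 0 one_reg] by simp
qed

end

section \<open>Projections of the Baecklund construction\<close>

lemma proj_along_eqI:
  assumes "a \<in> A" "v - a \<in> B" "\<And>a'. a' \<in> A \<Longrightarrow> v - a' \<in> B \<Longrightarrow> a' = a"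
  shows "proj_along A B v = a"
  unfolding proj_along_def using assms by (intro the_equality conjI) blast+

lemma span_singleton: "vec.span {l} = {k *\<^sub>C l | k. True}" for l :: "complex ^ 'm::finite"
  by (auto simp: vec.span_singleton smult_eq_scC)

lemma perp_span: "perp (vec.span A) = perp A"
proof
  show "perp (vec.span A) \<subseteq> perp A" using vec.span_base by (auto simp: perp_def)
  show "perp A \<subseteq> perp (vec.span A)"
  proof
    fix v assume v: "v \<in> perp A"
    have "form v w = 0" if "w \<in> vec.span A" for w
      using that by (induction rule: vec.span_induct_alt) (use v in \<open>auto simp: perp_def smult_eq_scC\<close>)
    then show "v \<in> perp (vec.span A)" by (auto simp: perp_def)
  qed
qed

lemma subspace_perp: "vec.subspace (perp A)"
  unfolding vec.subspace_def by (auto simp: perp_def smult_eq_scC)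

lemma app_span: "(\<cdot>) A ` vec.span B = vec.span ((\<cdot>) A ` B)"
proof -
  interpret L: Vector_Spaces.linear "(*s)" "(*s)" "(\<cdot>) A"
    by standard (auto simp: smult_eq_scC scC_simps)
  show ?thesis by (simp add: L.span_image)
qed

context
  fixes R :: "'n::finite omat" and S :: "'n cvec set" and l :: "'n cvec"
  assumes refl: "\<And>v. refl_S S v = R \<cdot> v" and R: "R * R = 1" "adj R = R"
    and l: "form l l = 0" "form l (R \<cdot> l) \<noteq> 0"
begin

lemma line_facts: "R \<cdot> R \<cdot> v = v" "form (R \<cdot> v) w = form v (R \<cdot> w)" "form (R \<cdot> l) (R \<cdot> l) = 0" "form (R \<cdot> l) l = form l (R \<cdot> l)"
proof -
  show RR: "R \<cdot> R \<cdot> v = v" for v using R(1) by (metis app_ring(2,6))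
  show Rf: "form (R \<cdot> v) w = form v (R \<cdot> w)" for v w using adj_app[of R v w] R(2) by simp
  show "form (R \<cdot> l) (R \<cdot> l) = 0" "form (R \<cdot> l) l = form l (R \<cdot> l)" by (simp_all add: Rf RR l)
qed

lemma image_refl: "refl_S S ` vec.span {l} = vec.span {R \<cdot> l}"
  by (simp add: refl app_span)

lemma perp_pair: "perp (vec.span (vec.span {l} \<union> vec.span {R \<cdot> l})) = {v. form v l = 0 \<and> form v (R \<cdot> l) = 0}"
proof -
  have "vec.span (vec.span {l} \<union> vec.span {R \<cdot> l}) = vec.span {l, R \<cdot> l}"
    unfolding vec.span_Un[of "vec.span {l}"] vec.span_span vec.span_Un[symmetric] by (simp add: insert_commute)
  then show ?thesis by (simp add: perp_span) (auto simp: perp_def)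
qed

lemma Ef_app: "Ef R l \<cdot> v = (form v (R \<cdot> l) / form l (R \<cdot> l)) *\<^sub>C l" "Ff R l \<cdot> v = (form v l / form l (R \<cdot> l)) *\<^sub>C (R \<cdot> l)"
  by (simp_all add: Ef_def Ff_def scC_scC divide_inverse mult.commute)

lemma rest_perp: "form (v - Ef R l \<cdot> v - Ff R l \<cdot> v) l = 0" "form (v - Ef R l \<cdot> v - Ff R l \<cdot> v) (R \<cdot> l) = 0"
  using l by (simp_all add: Ef_app line_facts)

lemma span_sum_eq: "vec.span (vec.span {u} \<union> perp B) = {k *\<^sub>C u + w | k w. w \<in> perp B}"
proof -
  have 1: "vec.span (perp B) = perp B" using subspace_perp vec.span_eq_iff by blast
  show ?thesis unfolding vec.span_Un unfolding vec.span_span 1 unfolding span_singleton by blast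
qed

lemma proj_L_eq: "proj_L S (vec.span {l}) v = Ef R l \<cdot> v"
  unfolding proj_L_def image_refl
proof (rule proj_along_eqI)
  show "Ef R l \<cdot> v \<in> vec.span {l}" by (auto simp: Ef_app span_singleton)
  have "v - Ef R l \<cdot> v = (form v l / form l (R \<cdot> l)) *\<^sub>C (R \<cdot> l) + (v - Ef R l \<cdot> v - Ff R l \<cdot> v)"
    by (simp add: Ef_app)
  then show "v - Ef R l \<cdot> v \<in> vec.span (vec.span {R \<cdot> l} \<union> perp (vec.span (vec.span {l} \<union> vec.span {R \<cdot> l})))"
    unfolding span_sum_eq unfolding perp_pair using rest_perp[of v] by blast
  fix a' assume a: "a' \<in> vec.span {l}" and b: "v - a' \<in> vec.span (vec.span {R \<cdot> l} \<union> perp (vec.span (vec.span {l} \<union> vec.span {R \<cdot> l})))"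
  obtain k where k: "a' = k *\<^sub>C l" using a by (auto simp: span_singleton)
  obtain j w where j: "v - a' = j *\<^sub>C (R \<cdot> l) + w" "form w l = 0" "form w (R \<cdot> l) = 0"
    using b unfolding span_sum_eq unfolding perp_pair by auto
  have "form (v - a') (R \<cdot> l) = 0" by (simp add: j line_facts l)
  then have "form v (R \<cdot> l) = k * form l (R \<cdot> l)" by (simp add: k)
  then show "a' = Ef R l \<cdot> v" using l by (simp add: k Ef_app)
qed

lemma proj_rhoL_eq: "proj_rhoL S (vec.span {l}) v = Ff R l \<cdot> v"
  unfolding proj_rhoL_def image_refl
proof (rule proj_along_eqI)
  show "Ff R l \<cdot> v \<in> vec.span {R \<cdot> l}" by (auto simp: Ef_app span_singleton)
  have "v - Ff R l \<cdot> v = (form v (R \<cdot> l) / form l (R \<cdot> l)) *\<^sub>C l + (v - Ef R l \<cdot> v - Ff R l \<cdot> v)"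
    by (simp add: Ef_app)
  then show "v - Ff R l \<cdot> v \<in> vec.span (vec.span {l} \<union> perp (vec.span (vec.span {l} \<union> vec.span {R \<cdot> l})))"
    unfolding span_sum_eq unfolding perp_pair using rest_perp[of v] by blast
  fix a' assume a: "a' \<in> vec.span {R \<cdot> l}" and b: "v - a' \<in> vec.span (vec.span {l} \<union> perp (vec.span (vec.span {l} \<union> vec.span {R \<cdot> l})))"
  obtain k where k: "a' = k *\<^sub>C (R \<cdot> l)" using a by (auto simp: span_singleton)
  obtain j w where j: "v - a' = j *\<^sub>C l + w" "form w l = 0" "form w (R \<cdot> l) = 0"
    using b unfolding span_sum_eq unfolding perp_pair by auto
  have "form (v - a') l = 0" by (simp add: j l)
  then have "form v l = k * form l (R \<cdot> l)" by (simp add: k line_facts)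
  then show "a' = Ff R l \<cdot> v" using l by (simp add: k Ef_app)
qed

lemma proj_perp_eq: "proj_perp S (vec.span {l}) v = v - Ef R l \<cdot> v - Ff R l \<cdot> v"
  unfolding proj_perp_def image_refl perp_pair
proof (rule proj_along_eqI)
  have sp: "vec.span (vec.span {l} \<union> vec.span {R \<cdot> l}) = {i *\<^sub>C l + j *\<^sub>C (R \<cdot> l) | i j. True}"
    unfolding vec.span_Un unfolding vec.span_span unfolding span_singleton by blast
  show "v - Ef R l \<cdot> v - Ff R l \<cdot> v \<in> {v. form v l = 0 \<and> form v (R \<cdot> l) = 0}"
    using rest_perp[of v] by simp
  show "v - (v - Ef R l \<cdot> v - Ff R l \<cdot> v) \<in> vec.span (vec.span {l} \<union> vec.span {R \<cdot> l})"
    unfolding sp by (auto simp: Ef_app)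
  fix a' assume a: "a' \<in> {v. form v l = 0 \<and> form v (R \<cdot> l) = 0}" and b: "v - a' \<in> vec.span (vec.span {l} \<union> vec.span {R \<cdot> l})"
  obtain i j where j: "v - a' = i *\<^sub>C l + j *\<^sub>C (R \<cdot> l)" using b unfolding sp by auto
  then have "form (v - a') (R \<cdot> l) = form (i *\<^sub>C l + j *\<^sub>C (R \<cdot> l)) (R \<cdot> l)" "form (v - a') l = form (i *\<^sub>C l + j *\<^sub>C (R \<cdot> l)) l"
    by simp_all
  then have "i = form v (R \<cdot> l) / form l (R \<cdot> l)" "j = form v l / form l (R \<cdot> l)"
    using a l by (simp_all add: line_facts)
  then show "a' = v - Ef R l \<cdot> v - Ff R l \<cdot> v" using j by (simp add: Ef_app algebra_simps)
qed

lemma p_map_eq: "p_map S a (vec.span {l}) x v = GL R l ((a - x) / (a + x)) \<cdot> v"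
  by (simp add: p_map_def proj_L_eq proj_rhoL_eq proj_perp_eq Gam_def smult_eq_scC scC_diff_left)

lemma q_map_eq: "q_map S a (vec.span {l}) x v = GL R l ((x - a) / (x + a)) \<cdot> v"
  by (simp add: q_map_def proj_L_eq proj_rhoL_eq proj_perp_eq Gam_def smult_eq_scC scC_diff_left)

lemma p_map_inf_eq: "p_map_inf S (vec.span {l}) v = GL R l (- 1) \<cdot> v"
  by (simp add: p_map_inf_def proj_L_eq proj_rhoL_eq proj_perp_eq Gam_def smult_eq_scC scC_diff_left scC_double)

end

text \<open>Translates the condition that \<open>\<rho>L\<close> meets the complement of
  \<open>L\<close> only in 0 into the nonvanishing of the denominator of \<open>Ef\<close> and
  \<open>Ff\<close>.\<close>

lemma nondegenerate_line:
  assumes refl: "\<And>v. refl_S S v = R \<cdot> v" and R: "R * R = 1"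
    and l: "form l l = 0" "l \<noteq> 0" and i: "refl_S S ` vec.span {l} \<inter> perp (vec.span {l}) = {0}"
  shows "form l (R \<cdot> l) \<noteq> 0"
proof
  assume "form l (R \<cdot> l) = 0"
  then have "R \<cdot> l \<in> perp (vec.span {l})" by (simp add: perp_span) (simp add: perp_def form_sym[of "R \<cdot> l"])
  moreover have "R \<cdot> l \<in> refl_S S ` vec.span {l}" using vec.span_base[of l "{l}"] by (auto simp: refl)
  ultimately have "R \<cdot> l = 0" using i by auto
  then have "R \<cdot> R \<cdot> l = 0" by simp
  then show False using l R by (metis app_ring(2,6))
qed

section \<open>Frames of surfaces\<close>

text \<open>Two nowhere zero sections of a line bundle differ by a factor, which is smooth as the
  quotient of a coordinate in which the first section does not vanish near \<open>x\<close>.\<close>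

lemma section_change:
  fixes \<sigma> \<tau> :: "'n::finite sect"
  assumes V: "open V" "x \<in> V" "sm V \<sigma>" "\<And>y. y \<in> V \<Longrightarrow> \<Lambda> y = vec.span {\<sigma> y}" "\<And>y. y \<in> V \<Longrightarrow> \<sigma> y \<noteq> 0"
    and \<tau>: "local_section \<Lambda> x V' \<tau>"
  obtains V'' f where "open V''" "x \<in> V''" "V'' \<subseteq> V" "V'' \<subseteq> V'" "sm V'' f"
    "\<And>y. y \<in> V'' \<Longrightarrow> f y \<noteq> 0" "\<And>y. y \<in> V'' \<Longrightarrow> \<tau> y = f y *\<^sub>C \<sigma> y"
proof -
  have V': "open V'" "x \<in> V'" "sm V' \<tau>" "\<And>y. y \<in> V' \<Longrightarrow> \<tau> y \<in> \<Lambda> y" "\<And>y. y \<in> V' \<Longrightarrow> \<tau> y \<noteq> 0"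
    using \<tau> by (auto simp: local_section_def smooth_on_eq_sm)
  obtain i where i: "\<sigma> x $ i \<noteq> 0" using V(5)[OF V(2)] by (metis vec_eq_iff zero_index)
  have dc: "continuous_on V (\<lambda>y. \<sigma> y $ i)"
    by (intro continuous_at_imp_continuous_on ballI differentiable_imp_continuous_within)
      (rule sm_diff_at[OF sm_nth[OF V(1,3)]])
  define V'' where "V'' = V' \<inter> (V \<inter> (\<lambda>y. \<sigma> y $ i) -` (- {0}))"
  have o: "open V''"
    unfolding V''_def by (intro open_Int V'(1) continuous_open_preimage dc V(1)) auto
  have sub: "V'' \<subseteq> V" "V'' \<subseteq> V'" "x \<in> V''" using i V V' by (auto simp: V''_def)
  define f where "f = (\<lambda>y. \<tau> y $ i * inverse (\<sigma> y $ i))"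
  have f: "sm V'' f"
    unfolding f_def
    by (intro sm_mult_complex sm_inverse sm_nth o sm_subset[OF V(3) sub(1)] sm_subset[OF V'(3) sub(2)])
      (simp add: V''_def)
  have eq: "\<tau> y = f y *\<^sub>C \<sigma> y" if y: "y \<in> V''" for y
  proof -
    obtain k where "\<tau> y = k *\<^sub>C \<sigma> y"
      using V'(4)[of y] V(4)[of y] y sub unfolding span_singleton by blast
    then show ?thesis using y by (auto simp: f_def V''_def mult.assoc)
  qed
  moreover have "f y \<noteq> 0" if "y \<in> V''" for y using eq[OF that] V'(5)[of y] sub that by auto
  ultimately show ?thesis using that[OF o sub(3,1,2) f] by blast
qed

text \<open>The bundles \<open>Lam10\<close>, \<open>Lam01\<close> and \<open>csc\<close> are
  spanned over all sections; this reduces them to one section once the others stay in its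
  span.\<close>

lemma span_Union_eqI:
  assumes "B \<in> \<B>" and "\<And>B'. B' \<in> \<B> \<Longrightarrow> B' \<subseteq> vec.span B"
  shows "vec.span (\<Union>\<B>) = vec.span B"
proof (rule subset_antisym)
  show "vec.span (\<Union>\<B>) \<subseteq> vec.span B"
    by (rule vec.span_minimal) (use assms in auto)
  show "vec.span B \<subseteq> vec.span (\<Union>\<B>)"
    by (rule vec.span_mono) (use assms in auto)
qed

lemma span_scC: "u \<in> vec.span B \<Longrightarrow> c *\<^sub>C u \<in> vec.span B" for u :: "complex ^ 'm::finite"
  by (simp add: smult_eq_scC[symmetric] vec.span_scale)

locale line_frame =
  fixes \<Lambda> :: "'n::finite subbundle" and V :: "complex set" and \<sigma> :: "'n sect"
  assumes V: "open V" and sm\<sigma>: "sm V \<sigma>" and \<Lambda>_eq: "y \<in> V \<Longrightarrow> \<Lambda> y = vec.span {\<sigma> y}"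
    and \<sigma>_nz: "y \<in> V \<Longrightarrow> \<sigma> y \<noteq> 0"
begin

abbreviation "sz \<equiv> wd (- \<i>) \<sigma>"
abbreviation "sb \<equiv> wd \<i> \<sigma>"
abbreviation "szb \<equiv> wd (- \<i>) (wd \<i> \<sigma>)"

lemma loc: "y \<in> V \<Longrightarrow> local_section \<Lambda> y V \<sigma>"
  by (auto simp: local_section_def smooth_on_eq_sm V sm\<sigma> \<Lambda>_eq \<sigma>_nz intro: vec.span_base)

lemma sms: "sm V sz" "sm V sb" "sm V szb"
  by (intro sm_wd V sm\<sigma>)+

lemma sdiff: assumes "y \<in> V"
  shows "\<sigma> differentiable (at y)" "sz differentiable (at y)" "sb differentiable (at y)" "szb differentiable (at y)"
  using sm_diff_at sm\<sigma> sms assms by blast+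

lemma szb_commute: "y \<in> V \<Longrightarrow> wd \<i> sz y = szb y"
  by (rule wd_commute[OF V _ sm\<sigma>])

lemma change:
  assumes x: "x \<in> V" and t: "local_section \<Lambda> x V' \<tau>"
  obtains f0 fz fb fzb where "f0 \<noteq> 0" "\<tau> x = f0 *\<^sub>C \<sigma> x" "wd (- \<i>) \<tau> x = f0 *\<^sub>C sz x + fz *\<^sub>C \<sigma> x"
    "wd \<i> \<tau> x = f0 *\<^sub>C sb x + fb *\<^sub>C \<sigma> x"
    "wd (- \<i>) (wd \<i> \<tau>) x = f0 *\<^sub>C szb x + fz *\<^sub>C sb x + fb *\<^sub>C sz x + fzb *\<^sub>C \<sigma> x"
proof -
  obtain V'' f where f: "open V''" "x \<in> V''" "V'' \<subseteq> V" "V'' \<subseteq> V'" "sm V'' f"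
    "\<And>y. y \<in> V'' \<Longrightarrow> f y \<noteq> 0" "\<And>y. y \<in> V'' \<Longrightarrow> \<tau> y = f y *\<^sub>C \<sigma> y"
    using section_change[OF V x sm\<sigma> \<Lambda>_eq \<sigma>_nz t] by blast
  have d: "wd d \<tau> y = f y *\<^sub>C wd d \<sigma> y + wd d f y *\<^sub>C \<sigma> y" if "y \<in> V''" for d y
  proof -
    have "wd d \<tau> y = wd d (\<lambda>y. f y *\<^sub>C \<sigma> y) y" by (rule wd_cong_open[OF f(1) that f(7)])
    also have "\<dots> = wd d f y *\<^sub>C \<sigma> y + f y *\<^sub>C wd d \<sigma> y"
      using that f(3) sdiff(1)[of y] sm_diff_at[OF f(5) that] by (intro wd_scC) auto
    finally show ?thesis by (simp add: add.commute)
  qed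
  have fd: "f differentiable (at x)" "wd \<i> f differentiable (at x)"
    using sm_diff_at[OF f(5,2)] sm_diff_at[OF sm_wd[OF f(1,5)] f(2)] by auto
  have "wd (- \<i>) (wd \<i> \<tau>) x = wd (- \<i>) (\<lambda>y. f y *\<^sub>C sb y + wd \<i> f y *\<^sub>C \<sigma> y) x"
    by (rule wd_cong_open[OF f(1,2) d])
  also have "\<dots> = f x *\<^sub>C szb x + wd (- \<i>) f x *\<^sub>C sb x + wd \<i> f x *\<^sub>C sz x + wd (- \<i>) (wd \<i> f) x *\<^sub>C \<sigma> x"
    using fd sdiff[OF x] by (simp add: wd_add wd_scC differentiable_cbil[OF cbil_scC])
  finally show ?thesis
    using that[of "f x" "wd (- \<i>) f x" "wd \<i> f x"] f(6,7)[OF f(2)] d[OF f(2)] by blast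
qed

lemma Lam10_eq: assumes "x \<in> V" shows "Lam10 \<Lambda> x = vec.span {\<sigma> x, sz x}"
  unfolding Lam10_def dz_eq_wd
proof (rule span_Union_eqI)
  show "{\<sigma> x, sz x} \<in> {{s x, wd (- \<i>) s x} |s V. local_section \<Lambda> x V s}" using loc[OF assms] by blast
  fix B' assume "B' \<in> {{s x, wd (- \<i>) s x} |s V. local_section \<Lambda> x V s}"
  then obtain \<tau> V' where t: "local_section \<Lambda> x V' \<tau>" "B' = {\<tau> x, wd (- \<i>) \<tau> x}" by auto
  show "B' \<subseteq> vec.span {\<sigma> x, sz x}"
    by (rule change[OF assms t(1)])
      (simp add: t(2) vec.span_add span_scC vec.span_base)
qed

lemma Lam01_eq: assumes "x \<in> V" shows "Lam01 \<Lambda> x = vec.span {\<sigma> x, sb x}"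
  unfolding Lam01_def dzbar_eq_wd
proof (rule span_Union_eqI)
  show "{\<sigma> x, sb x} \<in> {{s x, wd \<i> s x} |s V. local_section \<Lambda> x V s}" using loc[OF assms] by blast
  fix B' assume "B' \<in> {{s x, wd \<i> s x} |s V. local_section \<Lambda> x V s}"
  then obtain \<tau> V' where t: "local_section \<Lambda> x V' \<tau>" "B' = {\<tau> x, wd \<i> \<tau> x}" by auto
  show "B' \<subseteq> vec.span {\<sigma> x, sb x}"
    by (rule change[OF assms t(1)])
      (simp add: t(2) vec.span_add span_scC vec.span_base)
qed

lemma Lam1_eq: assumes "x \<in> V" shows "Lam1 \<Lambda> x = vec.span {\<sigma> x, sz x, sb x}"
proof -
  have "vec.span (vec.span A \<union> vec.span B) = vec.span (A \<union> B)" for A B :: "'n cvec set"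
    unfolding vec.span_Un vec.span_span ..
  then show ?thesis unfolding Lam1_def Lam10_eq[OF assms] Lam01_eq[OF assms] by (simp add: insert_commute)
qed

lemma csc_eq: assumes "x \<in> V" shows "csc \<Lambda> x = vec.span {\<sigma> x, sz x, sb x, szb x}"
  unfolding csc_def dz_eq_wd dzbar_eq_wd
proof (rule span_Union_eqI)
  show "{\<sigma> x, sz x, sb x, szb x} \<in> {{s x, wd (- \<i>) s x, wd \<i> s x, wd (- \<i>) (wd \<i> s) x} |s V. local_section \<Lambda> x V s}"
    using loc[OF assms] by blast
  fix B' assume "B' \<in> {{s x, wd (- \<i>) s x, wd \<i> s x, wd (- \<i>) (wd \<i> s) x} |s V. local_section \<Lambda> x V s}"
  then obtain \<tau> V' where t: "local_section \<Lambda> x V' \<tau>" "B' = {\<tau> x, wd (- \<i>) \<tau> x, wd \<i> \<tau> x, wd (- \<i>) (wd \<i> \<tau>) x}" by auto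
  show "B' \<subseteq> vec.span {\<sigma> x, sz x, sb x, szb x}"
    by (rule change[OF assms t(1)])
      (simp add: t(2) vec.span_add span_scC vec.span_base)
qed

end

definition Rm :: "'n::finite subbundle \<Rightarrow> complex \<Rightarrow> 'n omat" where
  "Rm \<Lambda> x = of_lin (refl_S (csc \<Lambda> x))"

text \<open>\<open>conf\<close> and \<open>hnz\<close> are the complex form of a conformal chart and
  an immersion: the induced metric has no dz^2-part and a nonzero mixed part.\<close>

locale frame = line_frame +
  assumes real\<sigma>: "y \<in> V \<Longrightarrow> vconj (\<sigma> y) = \<sigma> y" and null: "y \<in> V \<Longrightarrow> form (\<sigma> y) (\<sigma> y) = 0"
    and conf: "y \<in> V \<Longrightarrow> form (sz y) (sz y) = 0" and hnz: "y \<in> V \<Longrightarrow> form (sz y) (sb y) \<noteq> 0"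
begin

definition "h y = form (sz y) (sb y)"

lemma h_nz [simp]: "y \<in> V \<Longrightarrow> h y \<noteq> 0" using hnz by (simp add: h_def)

lemma vconj_s: assumes "y \<in> V"
  shows "vconj (sz y) = sb y" "vconj (sb y) = sz y" "vconj (szb y) = szb y"
proof -
  have 1: "sz z = vconj (sb z)" if "z \<in> V" for z
  proof -
    have "sz z = wd (- \<i>) (\<lambda>y. vconj (\<sigma> y)) z"
      by (rule wd_cong_open[OF V that]) (simp add: real\<sigma>)
    then show ?thesis by (simp only: wd_vconj[OF sdiff(1)[OF that]] complex_cnj_minus complex_cnj_i minus_minus)
  qed
  show "vconj (sz y) = sb y" "vconj (sb y) = sz y" by (simp_all add: 1[OF assms])
  have "wd \<i> sz y = wd \<i> (\<lambda>y. vconj (sb y)) y"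
    by (rule wd_cong_open[OF V assms]) (rule 1)
  then have "szb y = vconj (szb y)" using wd_vconj[OF sdiff(3)[OF assms], of \<i>] szb_commute[OF assms] by simp
  then show "vconj (szb y) = szb y" by simp
qed

lemma wd_form_zero:
  assumes "y \<in> V" "\<And>z. z \<in> V \<Longrightarrow> form (u z) (v z) = 0" "u differentiable (at y)" "v differentiable (at y)"
  shows "form (wd d u y) (v y) + form (u y) (wd d v y) = 0"
proof -
  have "wd d (\<lambda>z. form (u z) (v z)) y = wd d (\<lambda>_. 0) y"
    by (rule wd_cong_open[OF V assms(1,2)])
  then show ?thesis by (simp add: wd_form[OF assms(3,4)])
qed

text \<open>Everything follows by differentiating that the section is null and that its z-derivative
  is null, together with conjugation.\<close>

lemma gram: assumes "y \<in> V"
  shows "form (\<sigma> y) (sz y) = 0" "form (\<sigma> y) (sb y) = 0" "form (sb y) (sb y) = 0" "form (\<sigma> y) (szb y) = - h y"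
    "form (sz y) (szb y) = 0" "form (sb y) (szb y) = 0"
    "form (sz y) (\<sigma> y) = 0" "form (sb y) (\<sigma> y) = 0" "form (sb y) (sz y) = h y" "form (szb y) (\<sigma> y) = - h y"
    "form (szb y) (sz y) = 0" "form (szb y) (sb y) = 0" "cnj (h y) = h y" "form (sz y) (sb y) = h y"
    "form (szb y) (szb y) = cnj (form (szb y) (szb y))"
proof -
  have g1: "form (\<sigma> z) (sz z) = 0" "form (\<sigma> z) (sb z) = 0" if "z \<in> V" for z
    using wd_form_zero[OF that null sdiff(1)[OF that] sdiff(1)[OF that], of "- \<i>"]
      wd_form_zero[OF that null sdiff(1)[OF that] sdiff(1)[OF that], of "\<i>"]
    by (simp_all add: form_sym[of "wd _ \<sigma> z"])
  have g2: "form (sb z) (sb z) = 0" if "z \<in> V" for z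
    using form_vconj[of "sz z" "sz z"] conf[OF that] vconj_s[OF that] by simp
  show 1: "form (\<sigma> y) (sz y) = 0" "form (\<sigma> y) (sb y) = 0" "form (sb y) (sb y) = 0"
    using g1 g2 assms by auto
  show 2: "form (\<sigma> y) (szb y) = - h y"
    using wd_form_zero[OF assms g1(2) sdiff(1)[OF assms] sdiff(3)[OF assms], of "- \<i>"] by (simp add: h_def eq_neg_iff_add_eq_0 add.commute)
  show 3: "form (sz y) (szb y) = 0" "form (sb y) (szb y) = 0"
    using wd_form_zero[OF assms conf sdiff(2)[OF assms] sdiff(2)[OF assms], of \<i>]
      wd_form_zero[OF assms g2 sdiff(3)[OF assms] sdiff(3)[OF assms], of "- \<i>"]
    by (simp_all add: szb_commute[OF assms] form_sym[of "szb y"])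
  show "form (sz y) (\<sigma> y) = 0" "form (sb y) (\<sigma> y) = 0" "form (sb y) (sz y) = h y" "form (szb y) (\<sigma> y) = - h y"
    "form (szb y) (sz y) = 0" "form (szb y) (sb y) = 0" "form (sz y) (sb y) = h y"
    using 1 2 3 by (simp_all add: form_sym[of "szb y"] form_sym[of _ "\<sigma> y"] form_sym[of "sb y" "sz y"] h_def)
  show "cnj (h y) = h y"
    unfolding h_def form_vconj[symmetric] vconj_s[OF assms] by (rule form_sym)
  show "form (szb y) (szb y) = cnj (form (szb y) (szb y))"
    unfolding form_vconj[symmetric] vconj_s[OF assms] ..
qed

text \<open>The orthogonal projection onto the central sphere congruence, written with the inverse
  Gram matrix of the frame. The last term corrects for \<open>szb\<close> not being null.\<close>

definition "P y = inverse (h y) *\<^sub>C (tens (sz y) (sb y) + tens (sb y) (sz y) - tens (szb y) (\<sigma> y) - tens (\<sigma> y) (szb y))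
   - (inverse (h y) * inverse (h y) * form (szb y) (szb y)) *\<^sub>C tens (\<sigma> y) (\<sigma> y)"

lemma smP: "sm V P"
  unfolding P_def[abs_def] h_def
  by (intro sm_scC sm_diff sm_add sm_inverse sm_mult_complex sm_form sm_tens V sms sm\<sigma> hnz)

lemma P_basis: assumes "y \<in> V"
  shows "P y \<cdot> \<sigma> y = \<sigma> y" "P y \<cdot> sz y = sz y" "P y \<cdot> sb y = sb y" "P y \<cdot> szb y = szb y"
proof -
  have [simp]: "inverse (h y) * inverse (h y) * t * h y = inverse (h y) * t" for t
    using h_nz[OF assms] by simp
  show "P y \<cdot> \<sigma> y = \<sigma> y" "P y \<cdot> sz y = sz y" "P y \<cdot> sb y = sb y" "P y \<cdot> szb y = szb y"
    using h_nz[OF assms] by (simp_all add: P_def gram(1-12,14)[OF assms] null[OF assms] conf[OF assms] scC_simps)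
qed

lemma P_span: assumes "y \<in> V" "v \<in> csc \<Lambda> y" shows "P y \<cdot> v = v"
  using assms(2) unfolding csc_eq[OF assms(1)]
  by (induction rule: vec.span_induct_alt) (auto simp: smult_eq_scC P_basis[OF assms(1)])

lemma P_in: assumes "y \<in> V" shows "P y \<cdot> v \<in> csc \<Lambda> y"
proof -
  have "P y \<cdot> v = inverse (h y) *s (form v (sb y) *s sz y + form v (sz y) *s sb y - form v (\<sigma> y) *s szb y - form v (szb y) *s \<sigma> y)
    - (inverse (h y) * inverse (h y) * form (szb y) (szb y) * form v (\<sigma> y)) *s \<sigma> y"
    by (simp add: P_def smult_eq_scC scC_scC)
  then show ?thesis unfolding csc_eq[OF assms]
    by (simp only:) (intro vec.span_diff vec.span_add vec.span_scale vec.span_base; simp)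
qed

lemma P_adj: "adj (P y) = P y"
  by (simp add: P_def algebra_simps)

lemma P_perp: assumes "y \<in> V" "v \<in> perp (csc \<Lambda> y)" shows "P y \<cdot> v = 0"
proof -
  have "form v w = 0" if "w \<in> {\<sigma> y, sz y, sb y, szb y}" for w
    using assms that unfolding csc_eq[OF assms(1)] perp_span by (auto simp: perp_def)
  then show ?thesis by (simp add: P_def)
qed

lemma P_rest: assumes "y \<in> V" shows "v - P y \<cdot> v \<in> perp (csc \<Lambda> y)"
proof -
  have "form (P y \<cdot> v) w = form v w" if "w \<in> csc \<Lambda> y" for w
    using adj_app[of "P y" v w] P_adj[of y] P_span[OF assms that] by simp
  then show ?thesis by (simp add: perp_def)
qed

lemma proj_S_eq: assumes "y \<in> V" shows "proj_S (csc \<Lambda> y) v = P y \<cdot> v"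
  unfolding proj_S_def
proof (rule proj_along_eqI[OF P_in[OF assms] P_rest[OF assms]])
  fix a' assume a: "a' \<in> csc \<Lambda> y" "v - a' \<in> perp (csc \<Lambda> y)"
  have "P y \<cdot> (v - a') = 0" by (rule P_perp[OF assms a(2)])
  then show "a' = P y \<cdot> v" using P_span[OF assms a(1)] by simp
qed

lemma proj_Sperp_eq: assumes "y \<in> V" shows "proj_Sperp (csc \<Lambda> y) v = v - P y \<cdot> v"
  unfolding proj_Sperp_def
proof (rule proj_along_eqI[OF P_rest[OF assms]])
  show "v - (v - P y \<cdot> v) \<in> csc \<Lambda> y" using P_in[OF assms] by simp
  fix a' assume a: "a' \<in> perp (csc \<Lambda> y)" "v - a' \<in> csc \<Lambda> y"
  have "P y \<cdot> (v - a') = v - a'" by (rule P_span[OF assms a(2)])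
  then show "a' = v - P y \<cdot> v" using P_perp[OF assms a(1)] by simp
qed

lemma Rm_eq: assumes "y \<in> V" shows "Rm \<Lambda> y = 2 *\<^sub>C P y - 1"
proof (rule cmat_eqI)
  fix v
  have 1: "refl_S (csc \<Lambda> y) v = (2 *\<^sub>C P y - 1) \<cdot> v" for v
    by (simp add: refl_S_def proj_S_eq[OF assms] proj_Sperp_eq[OF assms] scC_double)
  then have "refl_S (csc \<Lambda> y) = (\<cdot>) (2 *\<^sub>C P y - 1)" by auto
  then show "Rm \<Lambda> y \<cdot> v = (2 *\<^sub>C P y - 1) \<cdot> v"
    unfolding Rm_def by (simp only:) (subst app_of_lin; simp)
qed

lemma refl_eq: assumes "y \<in> V" shows "refl_S (csc \<Lambda> y) v = Rm \<Lambda> y \<cdot> v"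
  by (simp add: Rm_eq[OF assms] refl_S_def proj_S_eq[OF assms] proj_Sperp_eq[OF assms] scC_double)

lemma smRm: "sm V (Rm \<Lambda>)"
  by (rule iffD2[OF sm_cong[OF V Rm_eq]], assumption) (intro sm_diff sm_scC sm_const smP V)

lemma PP: assumes "y \<in> V" shows "P y * P y = P y"
  by (rule cmat_eqI) (simp add: P_span[OF assms P_in[OF assms]])

lemma Rm_props: assumes "y \<in> V"
  shows "Rm \<Lambda> y * Rm \<Lambda> y = 1" "adj (Rm \<Lambda> y) = Rm \<Lambda> y" "mconj (Rm \<Lambda> y) = Rm \<Lambda> y"
proof -
  show "Rm \<Lambda> y * Rm \<Lambda> y = 1"
    by (simp add: Rm_eq[OF assms] algebra_simps PP[OF assms] scC_double)
  show "adj (Rm \<Lambda> y) = Rm \<Lambda> y" by (simp add: Rm_eq[OF assms] P_adj)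
  have "mconj (P y) = P y"
    using gram(13,15)[OF assms] by (simp add: P_def vconj_s[OF assms] real\<sigma>[OF assms] add_ac)
  then show "mconj (Rm \<Lambda> y) = Rm \<Lambda> y" by (simp add: Rm_eq[OF assms])
qed

lemma in_csc_iff: assumes "y \<in> V" shows "v \<in> csc \<Lambda> y \<longleftrightarrow> Rm \<Lambda> y \<cdot> v = v"
proof
  assume "v \<in> csc \<Lambda> y"
  then show "Rm \<Lambda> y \<cdot> v = v" by (simp add: Rm_eq[OF assms] P_span[OF assms] scC_double)
next
  assume "Rm \<Lambda> y \<cdot> v = v"
  then have "2 *\<^sub>C (P y \<cdot> v) = 2 *\<^sub>C v" by (simp add: Rm_eq[OF assms] scC_double algebra_simps)
  then have "2 *\<^sub>C (P y \<cdot> v - v) = 0" by (simp add: scC_diff_right)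
  then have "P y \<cdot> v = v" by simp
  then show "v \<in> csc \<Lambda> y" using P_in[OF assms, of v] by simp
qed

lemma in_perp_iff: assumes "y \<in> V" shows "v \<in> perp (csc \<Lambda> y) \<longleftrightarrow> Rm \<Lambda> y \<cdot> v = - v"
proof
  assume "v \<in> perp (csc \<Lambda> y)"
  then show "Rm \<Lambda> y \<cdot> v = - v" by (simp add: Rm_eq[OF assms] P_perp[OF assms])
next
  assume "Rm \<Lambda> y \<cdot> v = - v"
  then have "P y \<cdot> v = 0" by (simp add: Rm_eq[OF assms])
  then show "v \<in> perp (csc \<Lambda> y)" using P_rest[OF assms, of v] by simp
qed

lemma Rm_basis: assumes "y \<in> V"
  shows "Rm \<Lambda> y \<cdot> \<sigma> y = \<sigma> y" "Rm \<Lambda> y \<cdot> sz y = sz y" "Rm \<Lambda> y \<cdot> sb y = sb y" "Rm \<Lambda> y \<cdot> szb y = szb y"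
  by (simp_all add: Rm_eq[OF assms] P_basis[OF assms] scC_double)

lemma Rm_diff: "y \<in> V \<Longrightarrow> Rm \<Lambda> differentiable (at y)"
  by (rule sm_diff_at[OF smRm])

text \<open>With \<open>R = 2P - 1\<close> the two projected derivatives combine to
  \<open>D = d + (1/2) R dR\<close>. From here on the splitting connection is expressed by the
  reflection alone.\<close>

lemma Dconn_eq: assumes y: "y \<in> V" and f: "f differentiable (at y)"
  shows "Dconn \<Lambda> f y X = dv f y X + (1/2) *\<^sub>C ((Rm \<Lambda> y * dv (Rm \<Lambda>) y X) \<cdot> f y)"
proof -
  have Pd: "P differentiable (at y)" by (rule sm_diff_at[OF smP y])
  have 1: "dv (\<lambda>z. proj_S (csc \<Lambda> z) (f z)) y X = dv P y X \<cdot> f y + P y \<cdot> dv f y X"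
  proof -
    have "dv (\<lambda>z. proj_S (csc \<Lambda> z) (f z)) y X = dv (\<lambda>z. P z \<cdot> f z) y X"
      by (rule dv_cong_open[OF V y]) (rule proj_S_eq)
    then show ?thesis by (simp add: dv_cbil[OF cbil_app Pd f])
  qed
  have 2: "dv (\<lambda>z. proj_Sperp (csc \<Lambda> z) (f z)) y X = dv f y X - (dv P y X \<cdot> f y + P y \<cdot> dv f y X)"
  proof -
    have "dv (\<lambda>z. proj_Sperp (csc \<Lambda> z) (f z)) y X = dv (\<lambda>z. f z - P z \<cdot> f z) y X"
      by (rule dv_cong_open[OF V y]) (rule proj_Sperp_eq)
    then show ?thesis by (simp add: dv_diff[OF f differentiable_app[OF Pd f]] dv_cbil[OF cbil_app Pd f])
  qed
  have 3: "dv (Rm \<Lambda>) y X = 2 *\<^sub>C dv P y X"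
  proof -
    have "dv (Rm \<Lambda>) y X = dv (\<lambda>z. 2 *\<^sub>C P z - 1) y X" by (rule dv_cong_open[OF V y]) (rule Rm_eq)
    then show ?thesis by (simp add: dv_diff differentiable_scC_const[OF Pd] dv_scC_const[OF Pd])
  qed
  have 4: "P y \<cdot> P y \<cdot> v = P y \<cdot> v" for v by (rule P_span[OF y P_in[OF y]])
  have "(1/2) *\<^sub>C ((Rm \<Lambda> y * (2 *\<^sub>C dv P y X)) \<cdot> f y) = Rm \<Lambda> y \<cdot> dv P y X \<cdot> f y"
    by (simp add: scC_scC)
  also have "\<dots> = P y \<cdot> dv P y X \<cdot> f y + P y \<cdot> dv P y X \<cdot> f y - dv P y X \<cdot> f y"
    by (simp only: Rm_eq[OF y] app_ring app_scC_left scC_double)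
  finally have 5: "(1/2) *\<^sub>C ((Rm \<Lambda> y * (2 *\<^sub>C dv P y X)) \<cdot> f y)
      = P y \<cdot> dv P y X \<cdot> f y + P y \<cdot> dv P y X \<cdot> f y - dv P y X \<cdot> f y" .
  show ?thesis
    unfolding Dconn_def dd_eq_dv 1 2 proj_S_eq[OF y] proj_Sperp_eq[OF y] unfolding 3 5
    by (simp add: 4)
qed

end

text \<open>The coefficient of \<open>N = d - D = -(1/2) R dR\<close> in the direction
  \<open>d\<close>.\<close>

definition Nw :: "complex \<Rightarrow> 'n::finite subbundle \<Rightarrow> complex \<Rightarrow> 'n omat" where
  "Nw d \<Lambda> x = - ((1/2) *\<^sub>C (Rm \<Lambda> x * wd d (Rm \<Lambda>) x))"

definition Dw :: "complex \<Rightarrow> 'n::finite subbundle \<Rightarrow> (complex \<Rightarrow> 'n omat) \<Rightarrow> complex \<Rightarrow> 'n omat" where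
  "Dw d \<Lambda> T x = wd d T x - (Nw d \<Lambda> x * T x - T x * Nw d \<Lambda> x)"

context frame
begin

lemma Nform_eq: assumes "y \<in> V"
  shows "Nform \<Lambda> y X v = (X *\<^sub>C Nw (- \<i>) \<Lambda> y + cnj X *\<^sub>C Nw \<i> \<Lambda> y) \<cdot> v"
  unfolding Nform_def dd_eq_dv
  by (simp add: Dconn_eq[OF assms] dv_wd[OF Rm_diff[OF assms], of X] Nw_def scC_simps mult.commute)

lemma Dconn_eq': assumes "y \<in> V" "f differentiable (at y)"
  shows "Dconn \<Lambda> f y X = dv f y X - (X *\<^sub>C Nw (- \<i>) \<Lambda> y + cnj X *\<^sub>C Nw \<i> \<Lambda> y) \<cdot> f y"
  by (simp add: Dconn_eq[OF assms] dv_wd[OF Rm_diff[OF assms(1)], of X] Nw_def scC_simps mult.commute)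

text \<open>A 2-form on a surface has a single coefficient, that of dz wedge dzbar; its value on
  \<open>X\<close>, \<open>Y\<close> is the antisymmetric scalar in front.\<close>

lemma extD_eq:
  assumes y: "y \<in> V" and P: "P' differentiable (at y)" and Q: "Q' differentiable (at y)"
    and w: "\<And>z X v. z \<in> V \<Longrightarrow> \<omega> z X v = (X *\<^sub>C P' z + cnj X *\<^sub>C Q' z) \<cdot> v"
  shows "extD \<Lambda> \<omega> y X Y v = (X * cnj Y - cnj X * Y) *\<^sub>C ((Dw (- \<i>) \<Lambda> Q' y - Dw \<i> \<Lambda> P' y) \<cdot> v)"
proof -
  define N where "N X = X *\<^sub>C Nw (- \<i>) \<Lambda> y + cnj X *\<^sub>C Nw \<i> \<Lambda> y" for X
  have M: "(\<lambda>z. X *\<^sub>C P' z + cnj X *\<^sub>C Q' z) differentiable (at y)" for X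
    by (intro differentiable_add differentiable_scC_const P Q)
  have 1: "D_End \<Lambda> (\<lambda>z. \<omega> z Y) y X v = (dv (\<lambda>z. Y *\<^sub>C P' z + cnj Y *\<^sub>C Q' z) y X
     - (N X * (Y *\<^sub>C P' y + cnj Y *\<^sub>C Q' y) - (Y *\<^sub>C P' y + cnj Y *\<^sub>C Q' y) * N X)) \<cdot> v" for X Y
  proof -
    have "Dconn \<Lambda> (\<lambda>z. \<omega> z Y v) y X = Dconn \<Lambda> (\<lambda>z. (Y *\<^sub>C P' z + cnj Y *\<^sub>C Q' z) \<cdot> v) y X"
    proof -
      have "dv (\<lambda>z. proj_S (csc \<Lambda> z) (\<omega> z Y v)) y X = dv (\<lambda>z. proj_S (csc \<Lambda> z) ((Y *\<^sub>C P' z + cnj Y *\<^sub>C Q' z) \<cdot> v)) y X"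
        "dv (\<lambda>z. proj_Sperp (csc \<Lambda> z) (\<omega> z Y v)) y X = dv (\<lambda>z. proj_Sperp (csc \<Lambda> z) ((Y *\<^sub>C P' z + cnj Y *\<^sub>C Q' z) \<cdot> v)) y X"
        by (rule dv_cong_open[OF V y]; simp only: w)+
      then show ?thesis by (simp only: Dconn_def dd_eq_dv)
    qed
    also have "\<dots> = dv (\<lambda>z. Y *\<^sub>C P' z + cnj Y *\<^sub>C Q' z) y X \<cdot> v - N X \<cdot> (Y *\<^sub>C P' y + cnj Y *\<^sub>C Q' y) \<cdot> v"
      by (subst Dconn_eq'[OF y]) (auto simp only: N_def dv_app_const[OF M] intro!: differentiable_app M differentiable_const)
    finally show ?thesis
      unfolding D_End_def w[OF y] Dconn_eq'[OF y differentiable_const] N_def[symmetric] by simp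
  qed
  have 2: "dv (\<lambda>z. Y *\<^sub>C P' z + cnj Y *\<^sub>C Q' z) y X = Y *\<^sub>C (X *\<^sub>C wd (- \<i>) P' y + cnj X *\<^sub>C wd \<i> P' y)
     + cnj Y *\<^sub>C (X *\<^sub>C wd (- \<i>) Q' y + cnj X *\<^sub>C wd \<i> Q' y)" for X Y
    using P Q by (simp add: dv_add differentiable_scC_const dv_scC_const dv_wd[of P' y X] dv_wd[of Q' y X])
  have main: "dv (\<lambda>z. Y *\<^sub>C P' z + cnj Y *\<^sub>C Q' z) y X - (N X * (Y *\<^sub>C P' y + cnj Y *\<^sub>C Q' y) - (Y *\<^sub>C P' y + cnj Y *\<^sub>C Q' y) * N X)
     - (dv (\<lambda>z. X *\<^sub>C P' z + cnj X *\<^sub>C Q' z) y Y - (N Y * (X *\<^sub>C P' y + cnj X *\<^sub>C Q' y) - (X *\<^sub>C P' y + cnj X *\<^sub>C Q' y) * N Y))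
     = (X * cnj Y - cnj X * Y) *\<^sub>C (Dw (- \<i>) \<Lambda> Q' y - Dw \<i> \<Lambda> P' y)"
    unfolding 2 N_def Dw_def
    by (simp add: distrib_left distrib_right scC_simps mult.commute)
  show ?thesis unfolding extD_def 1 app_ring(4)[symmetric] main by (simp only: app_scC_left)
qed

end

lemma bracket_wedge_eq:
  assumes "\<And>X v. q x X v = (X *\<^sub>C P + cnj X *\<^sub>C Q) \<cdot> v" "\<And>X v. \<eta> x X v = (X *\<^sub>C P' + cnj X *\<^sub>C Q') \<cdot> v"
  shows "bracket_wedge q \<eta> x X Y v = (X * cnj Y - cnj X * Y) *\<^sub>C (((P * Q' - Q' * P) - (Q * P' - P' * Q)) \<cdot> v)"
  unfolding bracket_wedge_def assms by (simp add: scC_simps mult.commute)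

section \<open>Constrained Willmore surfaces and flatness\<close>

text \<open>Indexed by the direction so that \<open>Lm d\<close> contains the section and its
  \<open>d\<close>-derivative. Any \<open>d\<close> other than \<open>- \<i>\<close> gives
  \<open>Lam01\<close>; the statements are made for \<open>d \<in> II\<close>.\<close>

definition Lm :: "complex \<Rightarrow> 'n::finite subbundle \<Rightarrow> 'n subbundle" where
  "Lm d \<Lambda> = (if d = - \<i> then Lam10 \<Lambda> else Lam01 \<Lambda>)"

definition Qw :: "complex \<Rightarrow> 'n::finite endo_form \<Rightarrow> complex \<Rightarrow> 'n omat" where
  "Qw d q x = of_lin (\<lambda>v. (1/2) *\<^sub>C (q x 1 v + d *\<^sub>C q x \<i> v))"

lemma wdg_app: "wdg u v \<cdot> w = form w u *\<^sub>C v - form w v *\<^sub>C u"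
  by (simp add: wdg_def)

lemma wdg_skew: "adj (wdg u v) = - wdg u v"
  by (simp add: wdg_def)

lemma wdg_simps:
  "wdg u (v + w) = wdg u v + wdg u w" "wdg u (c *\<^sub>C v) = c *\<^sub>C wdg u v" "wdg (c *\<^sub>C u) v = c *\<^sub>C wdg u v"
  "wdg (u + u') v = wdg u v + wdg u' v" "wdg u 0 = 0" "wdg u u = 0"
  by (simp_all add: wdg_def scC_diff_right)

text \<open>Either product equals \<open>- form v w *\<^sub>C tens u u\<close>, which is symmetric
  in \<open>v\<close> and \<open>w\<close>.\<close>

lemma wdg_commute:
  assumes "form u u = 0" "form v u = 0" "form w u = 0"
  shows "wdg u v * wdg u w = wdg u w * wdg u v"
  by (rule cmat_eqI) (simp add: wdg_app assms form_sym[of w v] form_sym[of u v] form_sym[of u w] scC_simps)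

lemma wedge_space_line:
  assumes "f \<in> wedge_space (vec.span {u}) B" "vec.subspace B"
  obtains w where "w \<in> B" "f = (\<cdot>) (wdg u w)"
proof -
  obtain k :: nat and a b where f: "f = (\<lambda>w. \<Sum>i<k. wedge (a i) (b i) w)" and ab: "\<forall>i<k. a i \<in> vec.span {u} \<and> b i \<in> B"
    using assms(1) unfolding wedge_space_def by blast
  have "\<exists>w\<in>B. \<forall>v. (\<Sum>i<k. wedge (a i) (b i) v) = wdg u w \<cdot> v"
    using ab
  proof (induction k)
    case 0
    then show ?case using vec.subspace_0[OF assms(2)] by (intro bexI[of _ 0]) (simp_all add: wdg_simps)
  next
    case (Suc k)
    then obtain w where w: "w \<in> B" "\<forall>v. (\<Sum>i<k. wedge (a i) (b i) v) = wdg u w \<cdot> v" by auto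
    have "a k \<in> vec.span {u}" "b k \<in> B" using Suc by auto
    then obtain c where c: "a k = c *\<^sub>C u" unfolding span_singleton by blast
    have "w + c *\<^sub>C b k \<in> B"
      unfolding smult_eq_scC[symmetric] using w \<open>b k \<in> B\<close> assms(2) by (simp add: vec.subspace_add vec.subspace_scale)
    then show ?case using w c by (intro bexI[of _ "w + c *\<^sub>C b k"]) (simp_all add: wedge_eq_wdg wdg_simps)
  qed
  then obtain w where w: "w \<in> B" "\<forall>v. (\<Sum>i<k. wedge (a i) (b i) v) = wdg u w \<cdot> v" by blast
  have "f = (\<cdot>) (wdg u w)" unfolding f by (rule ext) (rule w(2)[rule_format])
  with w(1) show ?thesis by (rule that)
qed

lemma wdg_in_wedge_space: assumes "u \<in> A" "v \<in> B" shows "(\<cdot>) (wdg u v) \<in> wedge_space A B"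
proof -
  have "(\<cdot>) (wdg u v) = (\<lambda>w. \<Sum>i<Suc 0. wedge ((\<lambda>_. u) i) ((\<lambda>_. v) i) w)"
    by (rule ext) (simp add: wedge_eq_wdg)
  then show ?thesis
    unfolding wedge_space_def
    by (intro CollectI exI[of _ "Suc 0"] exI[of _ "\<lambda>_. u"] exI[of _ "\<lambda>_. v"] conjI) (use assms in simp_all)
qed

lemma Nw_props:
  assumes "open V" "x \<in> V" "sm V (Rm \<Lambda>)" "\<And>y. y \<in> V \<Longrightarrow> Rm \<Lambda> y * Rm \<Lambda> y = 1" "\<And>y. y \<in> V \<Longrightarrow> adj (Rm \<Lambda> y) = Rm \<Lambda> y"
  shows "wd d (Rm \<Lambda>) x * Rm \<Lambda> x = - (Rm \<Lambda> x * wd d (Rm \<Lambda>) x)"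
    and "Rm \<Lambda> x * Nw d \<Lambda> x = - (Nw d \<Lambda> x * Rm \<Lambda> x)" and "adj (Nw d \<Lambda> x) = - Nw d \<Lambda> x"
    and "wd d (Rm \<Lambda>) x = 2 *\<^sub>C (Nw d \<Lambda> x * Rm \<Lambda> x)"
proof -
  have dif: "Rm \<Lambda> differentiable (at x)" using assms sm_diff_at by blast
  let ?R = "Rm \<Lambda> x" and ?D = "wd d (Rm \<Lambda>) x"
  have "wd d (\<lambda>y. Rm \<Lambda> y * Rm \<Lambda> y) x = wd d (\<lambda>_. 1) x"
    by (rule wd_cong_open[OF assms(1,2,4)])
  then have "?D * ?R + ?R * ?D = 0" by (simp add: wd_mult dif)
  then show 1: "?D * ?R = - (?R * ?D)" by (simp add: eq_neg_iff_add_eq_0)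
  have "wd d (\<lambda>y. adj (Rm \<Lambda> y)) x = ?D" by (rule wd_cong_open[OF assms(1,2,5)])
  then have aD: "adj ?D = ?D" by (simp add: wd_adj dif)
  have 2: "?R * (?R * ?D) = ?D" using assms(4)[OF assms(2)] by (simp add: mult.assoc[symmetric])
  show "?R * Nw d \<Lambda> x = - (Nw d \<Lambda> x * ?R)"
    by (simp add: Nw_def 1 mult.assoc)
  show "adj (Nw d \<Lambda> x) = - Nw d \<Lambda> x"
    by (simp add: Nw_def aD assms(5)[OF assms(2)] 1)
  show "?D = 2 *\<^sub>C (Nw d \<Lambda> x * ?R)"
    by (simp add: Nw_def mult.assoc 1 2 scC_scC)
qed

text \<open>The Codazzi equation: the part of the flatness of d that maps between \<open>S\<close>
  and its complement says that N is closed for the splitting connection.\<close>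

lemma Nw_closed:
  assumes "open V" "x \<in> V" "sm V (Rm \<Lambda>)" "\<And>y. y \<in> V \<Longrightarrow> Rm \<Lambda> y * Rm \<Lambda> y = 1" "\<And>y. y \<in> V \<Longrightarrow> adj (Rm \<Lambda> y) = Rm \<Lambda> y"
  shows "Dw (- \<i>) \<Lambda> (Nw \<i> \<Lambda>) x = Dw \<i> \<Lambda> (Nw (- \<i>) \<Lambda>) x"
proof -
  let ?R = "Rm \<Lambda> x" and ?Z = "wd (- \<i>) (Rm \<Lambda>) x" and ?B = "wd \<i> (Rm \<Lambda>) x"
  have dif: "Rm \<Lambda> differentiable (at x)" "wd d (Rm \<Lambda>) differentiable (at x)" for d
    using sm_diff_at[OF assms(3,2)] sm_diff_at[OF sm_wd[OF assms(1,3)] assms(2)] by auto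
  have N: "Nw d \<Lambda> = (\<lambda>y. (- (1/2)) *\<^sub>C (Rm \<Lambda> y * wd d (Rm \<Lambda>) y))" for d
    by (simp add: Nw_def fun_eq_iff)
  have dN: "wd d (Nw d' \<Lambda>) x = (- (1/2)) *\<^sub>C (wd d (Rm \<Lambda>) x * wd d' (Rm \<Lambda>) x + ?R * wd d (wd d' (Rm \<Lambda>)) x)" for d d'
    unfolding N using dif by (simp add: wd_minus differentiable_scC_const wd_scC_const wd_mult differentiable_cbil[OF cbil_mult_cmat] scC_simps)
  have c: "wd (- \<i>) (wd \<i> (Rm \<Lambda>)) x = wd \<i> (wd (- \<i>) (Rm \<Lambda>)) x"
    by (rule wd_commute[OF assms(1-3)])
  have "?R * (wd d (Rm \<Lambda>) x * (?R * T)) = - (wd d (Rm \<Lambda>) x * T)" for d T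
  proof -
    have DR: "wd d (Rm \<Lambda>) x * ?R = - (?R * wd d (Rm \<Lambda>) x)" by (rule Nw_props(1)[OF assms])
    have "?R * (wd d (Rm \<Lambda>) x * (?R * T)) = ?R * (wd d (Rm \<Lambda>) x * ?R) * T" by (simp only: mult.assoc)
    also have "\<dots> = - ((?R * ?R) * wd d (Rm \<Lambda>) x * T)"
      by (simp only: DR mult.assoc mult_minus_left mult_minus_right)
    finally show ?thesis using assms(4)[OF assms(2)] by simp
  qed
  then have NN: "Nw d \<Lambda> x * Nw d' \<Lambda> x = (- (1/4)) *\<^sub>C (wd d (Rm \<Lambda>) x * wd d' (Rm \<Lambda>) x)" for d d'
    by (simp add: Nw_def scC_scC mult.assoc)
  have "Dw (- \<i>) \<Lambda> (Nw \<i> \<Lambda>) x - Dw \<i> \<Lambda> (Nw (- \<i>) \<Lambda>) x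
     = ((- (1/2)) + 1/4 + 1/4) *\<^sub>C (?Z * ?B) - ((- (1/2)) + 1/4 + 1/4) *\<^sub>C (?B * ?Z)"
    unfolding Dw_def dN NN c scC_add_left by (simp add: scC_simps)
  then show ?thesis by simp
qed

lemma commutator_expand:
  fixes A A' B B' :: "'n::finite omat"
  shows "(p *\<^sub>C A + r *\<^sub>C B) * (s *\<^sub>C A' + t *\<^sub>C B') - (s *\<^sub>C A' + t *\<^sub>C B') * (p *\<^sub>C A + r *\<^sub>C B)
    = (p * s) *\<^sub>C (A * A' - A' * A) - (p * t) *\<^sub>C (B' * A - A * B') + (r * s) *\<^sub>C (B * A' - A' * B) + (r * t) *\<^sub>C (B * B' - B' * B)"
  by (simp add: distrib_left distrib_right scC_simps mult.commute)

text \<open>With \<open>k * l = 1\<close> all products of the coefficients are again linear in the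
  powers of \<open>l\<close>. The commutators of \<open>B\<close> and \<open>B'\<close> cancel, and
  no mixed products remain besides those in the Willmore equation.\<close>

lemma curvature_expand:
  fixes A A' B B' DA DA' DB DB' :: "'n::finite omat"
  assumes kl: "k * l = 1"
  shows "(l * l - 1) *\<^sub>C (DA' + (B * A' - A' * B)) + (l - 1) *\<^sub>C (DB' + (B * B' - B' * B))
     - ((k * k - 1) *\<^sub>C (DA + (B' * A - A * B')) + (k - 1) *\<^sub>C (DB - (B * B' - B' * B)))
     + (((k * k - 1) *\<^sub>C A + (k - 1) *\<^sub>C B) * ((l * l - 1) *\<^sub>C A' + (l - 1) *\<^sub>C B')
       - ((l * l - 1) *\<^sub>C A' + (l - 1) *\<^sub>C B') * ((k * k - 1) *\<^sub>C A + (k - 1) *\<^sub>C B))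
    = (l - 1) *\<^sub>C DB' - (k - 1) *\<^sub>C DB + (l * l - 1) *\<^sub>C DA' - (k * k - 1) *\<^sub>C DA
      + (l - k) *\<^sub>C ((B * A' - A' * B) + (B' * A - A * B')) + (2 - l * l - k * k) *\<^sub>C (A * A' - A' * A)"
proof -
  have s: "(k * k - 1) * (l * l - 1) = 2 - l * l - k * k" "(k * k - 1) * (l - 1) = (k - l) - (k * k - 1)"
    "(k - 1) * (l * l - 1) = (l - k) - (l * l - 1)" "(k - 1) * (l - 1) = - (l - 1) - (k - 1)"
  proof -
    have "k * (k * (l * l)) = 1" using kl by (metis mult.assoc mult.left_commute mult_1)
    then show "(k * k - 1) * (l * l - 1) = 2 - l * l - k * k" by (simp add: algebra_simps)
    have "k * (k * l) = k" "k * (l * l) = l" using kl by (simp_all add: mult.assoc[symmetric])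
    then show "(k * k - 1) * (l - 1) = (k - l) - (k * k - 1)" "(k - 1) * (l * l - 1) = (l - k) - (l * l - 1)"
      using kl by (simp_all add: algebra_simps)
    show "(k - 1) * (l - 1) = - (l - 1) - (k - 1)" using kl by (simp add: algebra_simps)
  qed
  have lin: "(l * l - 1) *\<^sub>C (DA' + BA) + (l - 1) *\<^sub>C (DB' + BB) - ((k * k - 1) *\<^sub>C (DA + AB) + (k - 1) *\<^sub>C (DB - BB))
     + ((2 - l * l - k * k) *\<^sub>C AA - ((k - l) - (k * k - 1)) *\<^sub>C AB + ((l - k) - (l * l - 1)) *\<^sub>C BA + (- (l - 1) - (k - 1)) *\<^sub>C BB)
    = (l - 1) *\<^sub>C DB' - (k - 1) *\<^sub>C DB + (l * l - 1) *\<^sub>C DA' - (k * k - 1) *\<^sub>C DA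
      + (l - k) *\<^sub>C (BA + AB) + (2 - l * l - k * k) *\<^sub>C AA" for AA AB BA BB :: "'n omat"
    by (simp only: scC_add_right scC_diff_right scC_add_left scC_diff_left scC_minus_left) (simp add: algebra_simps)
  show ?thesis
    unfolding commutator_expand s by (rule lin)
qed

lemma span2: "v \<in> vec.span {a, b} \<Longrightarrow> \<exists>k j. v = k *\<^sub>C a + j *\<^sub>C b" for v a b :: "complex ^ 'm::finite"
proof (induction rule: vec.span_induct_alt)
  case base
  then show ?case by (metis scC_zero_left add_0)
next
  case (step c x y)
  then obtain k j where y: "y = k *\<^sub>C a + j *\<^sub>C b" by blast
  have "c *s x + y = (c + k) *\<^sub>C a + j *\<^sub>C b \<or> c *s x + y = k *\<^sub>C a + (c + j) *\<^sub>C b"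
    using step(1) by (auto simp: y smult_eq_scC scC_add_left algebra_simps)
  then show ?case by blast
qed

section \<open>The isotropic planes in the central sphere congruence\<close>

definition II :: "complex set" where "II = {\<i>, - \<i>}"

lemma II_cases: assumes "d \<in> II" obtains "d = \<i>" | "d = - \<i>" using assms by (auto simp: II_def)

lemma II_neg: "d \<in> II \<Longrightarrow> - d \<in> II" by (auto simp: II_def)

lemma i_neq: "\<i> \<noteq> - \<i>" by (simp add: complex_eq_iff)

context frame
begin

abbreviation "sd d \<equiv> wd d \<sigma>"

lemma gramd: assumes "y \<in> V" "d \<in> II"
  shows "form (\<sigma> y) (sd d y) = 0" "form (sd d y) (\<sigma> y) = 0" "form (sd d y) (sd d y) = 0"
    "form (sd d y) (sd (- d) y) = h y" "wd d (sd (- d)) y = szb y" "form (\<sigma> y) (szb y) = - h y" "form (szb y) (\<sigma> y) = - h y"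
    "form (sd d y) (szb y) = 0" "form (\<sigma> y) (\<sigma> y) = 0" "sd d differentiable (at y)"
  using assms(2) by (rule II_cases; simp add: gram[OF assms(1)] null[OF assms(1)] conf[OF assms(1)]
      szb_commute[OF assms(1)] sdiff[OF assms(1)])+

lemma Lm_eq: assumes "y \<in> V" "d \<in> II" shows "Lm d \<Lambda> y = vec.span {\<sigma> y, sd d y}"
  using assms(2) by (rule II_cases) (simp_all add: Lm_def i_neq Lam10_eq[OF assms(1)] Lam01_eq[OF assms(1)])

text \<open>An isotropic plane in the nondegenerate four-dimensional \<open>S\<close> is its own
  annihilator there. Membership becomes a system of equations, which can be differentiated.\<close>

lemma Lm_iff: assumes y: "y \<in> V" and d: "d \<in> II"
  shows "v \<in> Lm d \<Lambda> y \<longleftrightarrow> Rm \<Lambda> y \<cdot> v = v \<and> form v (\<sigma> y) = 0 \<and> form v (sd d y) = 0"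
proof
  assume "v \<in> Lm d \<Lambda> y"
  then obtain k j where v: "v = k *\<^sub>C \<sigma> y + j *\<^sub>C sd d y" unfolding Lm_eq[OF y d] using span2 by blast
  have "Rm \<Lambda> y \<cdot> sd d y = sd d y" using d by (rule II_cases) (simp_all add: Rm_basis[OF y])
  then show "Rm \<Lambda> y \<cdot> v = v \<and> form v (\<sigma> y) = 0 \<and> form v (sd d y) = 0"
    by (simp add: v Rm_basis[OF y] gramd[OF y d])
next
  assume a: "Rm \<Lambda> y \<cdot> v = v \<and> form v (\<sigma> y) = 0 \<and> form v (sd d y) = 0"
  then have "P y \<cdot> v = v" using in_csc_iff[OF y] P_span[OF y] by blast
  moreover have "P y \<cdot> v = (inverse (h y) * form v (sd (- d) y)) *\<^sub>C sd d y - (inverse (h y) * form v (szb y)) *\<^sub>C \<sigma> y"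
    by (rule II_cases[OF d]) (use a in \<open>simp_all add: P_def scC_simps\<close>)
  ultimately show "v \<in> Lm d \<Lambda> y"
    unfolding Lm_eq[OF y d] by (metis (no_types) insert_iff span_scC vec.span_base vec.span_diff)
qed

lemma Lm_mem: assumes "y \<in> V" "d \<in> II" shows "\<sigma> y \<in> Lm d \<Lambda> y" "sd d y \<in> Lm d \<Lambda> y"
  unfolding Lm_eq[OF assms] by (auto intro: vec.span_base)

lemma Np: assumes y: "y \<in> V"
  shows "wd d (Rm \<Lambda>) y * Rm \<Lambda> y = - (Rm \<Lambda> y * wd d (Rm \<Lambda>) y)"
    "Rm \<Lambda> y * Nw d \<Lambda> y = - (Nw d \<Lambda> y * Rm \<Lambda> y)" "adj (Nw d \<Lambda> y) = - Nw d \<Lambda> y"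
    "wd d (Rm \<Lambda>) y = 2 *\<^sub>C (Nw d \<Lambda> y * Rm \<Lambda> y)"
  using Nw_props[OF V y smRm Rm_props(1,2)] by auto

text \<open>For a section of \<open>S\<close> the derivative splits into its part in
  \<open>S\<close>, which is the covariant derivative, and its part in the complement, which is N
  applied to the section.\<close>

lemma N_section:
  assumes y: "y \<in> V" and s: "s differentiable (at y)" and V': "open V'" "y \<in> V'" and fx: "\<And>z. z \<in> V' \<Longrightarrow> Rm \<Lambda> z \<cdot> s z = s z"
  shows "Rm \<Lambda> y \<cdot> (wd d s y - Nw d \<Lambda> y \<cdot> s y) = wd d s y - Nw d \<Lambda> y \<cdot> s y"
    and "Rm \<Lambda> y \<cdot> Nw d \<Lambda> y \<cdot> s y = - (Nw d \<Lambda> y \<cdot> s y)"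
    and "2 *\<^sub>C (Nw d \<Lambda> y \<cdot> s y) = wd d s y - Rm \<Lambda> y \<cdot> wd d s y"
proof -
  have "wd d (\<lambda>z. Rm \<Lambda> z \<cdot> s z) y = wd d s y" by (rule wd_cong_open[OF V' fx])
  then have 1: "wd d (Rm \<Lambda>) y \<cdot> s y + Rm \<Lambda> y \<cdot> wd d s y = wd d s y" by (simp add: wd_app Rm_diff[OF y] s)
  then show 2: "2 *\<^sub>C (Nw d \<Lambda> y \<cdot> s y) = wd d s y - Rm \<Lambda> y \<cdot> wd d s y"
    unfolding Np(4)[OF y] using fx[OF V'(2)] by (simp add: algebra_simps)
  have "Rm \<Lambda> y \<cdot> Nw d \<Lambda> y \<cdot> s y = (Rm \<Lambda> y * Nw d \<Lambda> y) \<cdot> s y" by simp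
  then show 3: "Rm \<Lambda> y \<cdot> Nw d \<Lambda> y \<cdot> s y = - (Nw d \<Lambda> y \<cdot> s y)"
    unfolding Np(2)[OF y] using fx[OF V'(2)] by simp
  have "Rm \<Lambda> y \<cdot> wd d s y = wd d s y - 2 *\<^sub>C (Nw d \<Lambda> y \<cdot> s y)" using 2 by simp
  then show "Rm \<Lambda> y \<cdot> (wd d s y - Nw d \<Lambda> y \<cdot> s y) = wd d s y - Nw d \<Lambda> y \<cdot> s y"
    by (simp add: 3 scC_double)
qed

lemma N_zero:
  assumes y: "y \<in> V" and s: "s differentiable (at y)" and V': "open V'" "y \<in> V'" and fx: "\<And>z. z \<in> V' \<Longrightarrow> Rm \<Lambda> z \<cdot> s z = s z"
    and z: "Rm \<Lambda> y \<cdot> wd d s y = wd d s y"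
  shows "Nw d \<Lambda> y \<cdot> s y = 0"
  using N_section(3)[OF y s V' fx, of d] z by simp

text \<open>The derivatives of the section and of \<open>sd (- d)\<close> in the direction
  \<open>d\<close> are \<open>sd d\<close> and \<open>szb\<close>, which lie in \<open>S\<close> and
  have no part in the complement.\<close>

lemma N_basis: assumes y: "y \<in> V" and d: "d \<in> II" shows "Nw d \<Lambda> y \<cdot> \<sigma> y = 0" "Nw d \<Lambda> y \<cdot> sd (- d) y = 0"
proof -
  have Rsd: "Rm \<Lambda> z \<cdot> sd e z = sd e z" if "z \<in> V" "e \<in> II" for z e
    using that(2) by (rule II_cases) (simp_all add: Rm_basis[OF that(1)])
  show "Nw d \<Lambda> y \<cdot> \<sigma> y = 0"
    by (rule N_zero[OF y sdiff(1)[OF y] V y Rm_basis(1)]) (use Rsd[OF y d] in auto)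
  show "Nw d \<Lambda> y \<cdot> sd (- d) y = 0"
    by (rule N_zero[OF y gramd(10)[OF y II_neg[OF d]] V y Rsd[OF _ II_neg[OF d]]])
      (simp_all add: gramd(5)[OF y d] Rm_basis[OF y])
qed

lemma Lm_N: assumes "y \<in> V" "d \<in> II" "v \<in> Lm (- d) \<Lambda> y" shows "Nw d \<Lambda> y \<cdot> v = 0"
proof -
  obtain k j where "v = k *\<^sub>C \<sigma> y + j *\<^sub>C sd (- d) y" using assms(3) unfolding Lm_eq[OF assms(1) II_neg[OF assms(2)]] using span2 by blast
  then show ?thesis by (simp add: N_basis[OF assms(1,2)])
qed

text \<open>The equations of \<open>Lm_iff\<close> are differentiated; the new terms vanish because
  the second derivative of the section in the direction \<open>d\<close> is orthogonal to
  \<open>Lm d\<close>.\<close>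

lemma D_stable:
  assumes y: "y \<in> V" and d: "d \<in> II" and s: "s differentiable (at y)" and V': "open V'" "y \<in> V'" "V' \<subseteq> V"
    and fx: "\<And>z. z \<in> V' \<Longrightarrow> s z \<in> Lm d \<Lambda> z"
  shows "wd d s y - Nw d \<Lambda> y \<cdot> s y \<in> Lm d \<Lambda> y"
proof -
  have f: "Rm \<Lambda> z \<cdot> s z = s z" "form (s z) (\<sigma> z) = 0" "form (s z) (sd d z) = 0" if "z \<in> V'" for z
    using fx[OF that] Lm_iff[of z d] that V' d by auto
  have N: "form (Nw d \<Lambda> y \<cdot> s y) u = 0" if "Rm \<Lambda> y \<cdot> u = u" for u
  proof -
    have "form (Nw d \<Lambda> y \<cdot> s y) u = form (Nw d \<Lambda> y \<cdot> s y) (Rm \<Lambda> y \<cdot> u)" using that by simp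
    also have "\<dots> = form (Rm \<Lambda> y \<cdot> Nw d \<Lambda> y \<cdot> s y) u" using adj_app[of "Rm \<Lambda> y"] Rm_props(2)[OF y] by metis
    also have "\<dots> = - form (Nw d \<Lambda> y \<cdot> s y) u" using N_section(2)[OF y s V'(1,2) f(1)] by simp
    finally show ?thesis by simp
  qed
  have z: "form (wd d s y) (u y) = - form (s y) (wd d u y)" if "\<And>z. z \<in> V' \<Longrightarrow> form (s z) (u z) = 0" "u differentiable (at y)" for u
  proof -
    have "wd d (\<lambda>z. form (s z) (u z)) y = wd d (\<lambda>_. 0) y" by (rule wd_cong_open[OF V'(1,2) that(1)])
    then show ?thesis by (simp add: wd_form[OF s that(2)] eq_neg_iff_add_eq_0)
  qed
  have Rsd: "Rm \<Lambda> y \<cdot> sd d y = sd d y" using d by (rule II_cases) (simp_all add: Rm_basis[OF y])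
  obtain k j where v: "s y = k *\<^sub>C \<sigma> y + j *\<^sub>C sd d y" using fx[OF V'(2)] unfolding Lm_eq[OF y d] using span2 by blast
  have "form (\<sigma> y) (wd d (sd d) y) = 0" "form (sd d y) (wd d (sd d) y) = 0"
    using wd_form_zero[OF y gramd(1)[OF _ d] sdiff(1)[OF y] gramd(10)[OF y d], of d]
      wd_form_zero[OF y gramd(3)[OF _ d] gramd(10)[OF y d] gramd(10)[OF y d], of d]
    by (simp_all add: gramd[OF y d] form_sym[of "wd d (sd d) y"])
  then have "form (s y) (wd d (sd d) y) = 0" by (simp add: v)
  then have "form (wd d s y) (sd d y) = 0" using z[OF f(3) gramd(10)[OF y d]] by simp
  moreover have "form (wd d s y) (\<sigma> y) = 0" using z[OF f(2) sdiff(1)[OF y]] f(3)[OF V'(2)] by simp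
  ultimately show ?thesis
    unfolding Lm_iff[OF y d] using N[OF Rm_basis(1)[OF y]] N[OF Rsd] N_section(1)[OF y s V'(1,2) f(1)] by simp
qed

end

lemma Dw_scC: "T differentiable (at x) \<Longrightarrow> Dw d \<Lambda> (\<lambda>y. c *\<^sub>C T y) x = c *\<^sub>C Dw d \<Lambda> T x"
  by (simp add: Dw_def wd_scC_const scC_diff_right)

text \<open>
  The equation \<open>d\<^sup>\<D>q = 0\<close> only says that the \<open>(1,0)\<close>- and the \<open>(0,1)\<close>-derivatives \<open>T\<close> of the two parts of \<open>q\<close>
  coincide. Evaluating \<open>T\<close> on the frame in both ways shows that it vanishes, and that \<open>q\<^sup>1\<^sup>,\<^sup>0\<close> annihilates
  \<open>\<Lambda>\<^sup>0\<^sup>,\<^sup>1\<close> and \<open>q\<^sup>0\<^sup>,\<^sup>1\<close> annihilates \<open>\<Lambda>\<^sup>1\<^sup>,\<^sup>0\<close>.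
\<close>

locale closed_pair = frame +
  fixes A :: "complex \<Rightarrow> complex \<Rightarrow> 'a::finite omat" and w
  assumes Aw: "d \<in> II \<Longrightarrow> y \<in> V \<Longrightarrow> A d y = wdg (\<sigma> y) (w d y)"
    and w_perp: "d \<in> II \<Longrightarrow> y \<in> V \<Longrightarrow> form (w d y) (\<sigma> y) = 0"
    and w_S: "d \<in> II \<Longrightarrow> y \<in> V \<Longrightarrow> Rm \<Lambda> y \<cdot> w d y = w d y"
    and A_diff: "d \<in> II \<Longrightarrow> y \<in> V \<Longrightarrow> A d differentiable (at y)"
    and closed: "y \<in> V \<Longrightarrow> Dw (- \<i>) \<Lambda> (A \<i>) y = Dw \<i> \<Lambda> (A (- \<i>)) y"
begin

definition "T y = Dw \<i> \<Lambda> (A (- \<i>)) y"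
definition "al d y = form (sd (- d) y) (w d y)"

lemma T_eq: "y \<in> V \<Longrightarrow> d \<in> II \<Longrightarrow> T y = Dw (- d) \<Lambda> (A d) y"
  by (erule II_cases) (simp_all add: T_def closed)

lemma form_Rm: assumes "y \<in> V" shows "form (Rm \<Lambda> y \<cdot> u) v = form u (Rm \<Lambda> y \<cdot> v)"
  using adj_app[of "Rm \<Lambda> y" u v] Rm_props(2)[OF assms] by simp

lemma A_skew: "y \<in> V \<Longrightarrow> d \<in> II \<Longrightarrow> adj (A d y) = - A d y"
  by (simp add: Aw wdg_skew)

lemma A_perp: assumes "y \<in> V" "d \<in> II" "Rm \<Lambda> y \<cdot> v = - v" shows "A d y \<cdot> v = 0"
proof -
  have "form v u = 0" if "Rm \<Lambda> y \<cdot> u = u" for u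
    using form_Rm[OF assms(1), of v u] that assms(3) by simp
  then show ?thesis using Rm_basis(1)[OF assms(1)] w_S[OF assms(2,1)] by (simp add: Aw assms wdg_app)
qed

lemma A_R: assumes "y \<in> V" "d \<in> II" shows "Rm \<Lambda> y * A d y = A d y * Rm \<Lambda> y"
proof -
  have "Rm \<Lambda> y * A d y * adj (Rm \<Lambda> y) = A d y"
    using wdg_conj[of "Rm \<Lambda> y" "\<sigma> y" "w d y"] by (simp add: Aw assms Rm_basis(1) w_S)
  then have "Rm \<Lambda> y * A d y * (Rm \<Lambda> y * Rm \<Lambda> y) = A d y * Rm \<Lambda> y"
    using Rm_props(2)[OF assms(1)] by (simp add: mult.assoc[symmetric])
  then show ?thesis using Rm_props(1)[OF assms(1)] by simp
qed

lemma A_sigma: assumes "y \<in> V" "d \<in> II"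
  shows "A d y \<cdot> \<sigma> y = 0" "A d y \<cdot> sd (- d) y = - (al d y *\<^sub>C \<sigma> y)"
    "A d y \<cdot> sd d y = - (form (sd d y) (w d y) *\<^sub>C \<sigma> y)"
  using gramd[OF assms] gramd[OF assms(1) II_neg[OF assms(2)]]
  by (simp_all add: Aw assms wdg_app al_def form_sym[of "\<sigma> y" "w d y"] w_perp)

lemma A_wd: assumes y: "y \<in> V" and d: "d \<in> II" and s: "s differentiable (at y)"
  shows "wd e (A d) y \<cdot> s y = wd e (\<lambda>z. A d z \<cdot> s z) y - A d y \<cdot> wd e s y"
  by (simp add: wd_app[OF A_diff[OF d y] s])

lemma NS: assumes "y \<in> V" "Rm \<Lambda> y \<cdot> v = v" shows "Rm \<Lambda> y \<cdot> Nw e \<Lambda> y \<cdot> v = - (Nw e \<Lambda> y \<cdot> v)"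
proof -
  have "Rm \<Lambda> y \<cdot> Nw e \<Lambda> y \<cdot> v = (Rm \<Lambda> y * Nw e \<Lambda> y) \<cdot> v" by simp
  then show ?thesis unfolding Np(2)[OF assms(1)] using assms(2) by simp
qed

lemma T_section: assumes y: "y \<in> V" and d: "d \<in> II" and s: "s differentiable (at y)" and f: "Rm \<Lambda> y \<cdot> s y = s y"
  shows "T y \<cdot> s y = wd (- d) (\<lambda>z. A d z \<cdot> s z) y - A d y \<cdot> wd (- d) s y - Nw (- d) \<Lambda> y \<cdot> A d y \<cdot> s y"
  unfolding T_eq[OF y d] Dw_def using A_perp[OF y d NS[OF y f, of "- d"]] by (simp add: A_wd[OF y d s])

lemma wd_zero: assumes "y \<in> V" "\<And>z. z \<in> V \<Longrightarrow> f z = 0" shows "wd e f y = 0"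
  using wd_cong_open[OF V assms(1), of f "\<lambda>_. 0" e] assms(2) by simp

lemma Rsd: assumes "y \<in> V" "e \<in> II" shows "Rm \<Lambda> y \<cdot> sd e y = sd e y"
  using assms(2) by (rule II_cases) (simp_all add: Rm_basis[OF assms(1)])

lemma N_al: assumes "y \<in> V" "d \<in> II" "e \<in> II" shows "Nw e \<Lambda> y \<cdot> A d y \<cdot> sd (- d) y = 0" "Nw e \<Lambda> y \<cdot> A d y \<cdot> sd d y = 0"
  using A_sigma[OF assms(1,2)] N_basis(1)[OF assms(1,3)] by simp_all

lemma T_sigma: assumes y: "y \<in> V" and d: "d \<in> II" shows "T y \<cdot> \<sigma> y = al d y *\<^sub>C \<sigma> y"
proof -
  have "wd (- d) (\<lambda>z. A d z \<cdot> \<sigma> z) y = 0" by (rule wd_zero[OF y]) (rule A_sigma(1)[OF _ d])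
  then show ?thesis
    using T_section[OF y d sdiff(1)[OF y] Rm_basis(1)[OF y]] A_sigma[OF y d] by simp
qed

lemma T_form1: assumes y: "y \<in> V" and d: "d \<in> II" shows "form (T y \<cdot> sd (- d) y) (sd d y) = - (al d y * h y)"
proof -
  let ?s = "sd (- d)"
  have sdf: "?s differentiable (at y)" by (rule gramd(10)[OF y II_neg[OF d]])
  have As: "(\<lambda>z. A d z \<cdot> ?s z) differentiable (at y)" by (rule differentiable_app[OF A_diff[OF d y] sdf])
  have z: "form (A d z \<cdot> ?s z) (sd d z) = 0" if "z \<in> V" for z
    using A_sigma(2)[OF that d] gramd(1)[OF that d] by simp
  have "form (wd (- d) (\<lambda>z. A d z \<cdot> ?s z) y) (sd d y) = - form (A d y \<cdot> ?s y) (wd (- d) (sd d) y)"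
    using wd_form_zero[OF y z As gramd(10)[OF y d], of "- d"] by (simp add: eq_neg_iff_add_eq_0)
  also have "\<dots> = - (al d y * h y)"
    using A_sigma(2)[OF y d] gramd(5)[OF y II_neg[OF d]] gramd(6)[OF y d] by simp
  finally have 1: "form (wd (- d) (\<lambda>z. A d z \<cdot> ?s z) y) (sd d y) = - (al d y * h y)" .
  have "form (\<sigma> y) (wd (- d) ?s y) = 0"
    using wd_form_zero[OF y gramd(1)[OF _ II_neg[OF d]] sdiff(1)[OF y] sdf, of "- d"] gramd(3)[OF y II_neg[OF d]] by simp
  then have "form (A d y \<cdot> wd (- d) ?s y) (sd d y) = 0"
    using adj_app[of "A d y" "wd (- d) ?s y" "sd d y"] A_skew[OF y d] A_sigma(3)[OF y d]
    by (simp add: form_sym[of "wd (- d) ?s y"])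
  then show ?thesis
    using T_section[OF y d sdf Rsd[OF y II_neg[OF d]]] N_al(1)[OF y d II_neg[OF d]] 1 by simp
qed

lemma T_form2: assumes y: "y \<in> V" and d: "d \<in> II" shows "form (T y \<cdot> sd d y) (sd (- d) y) = al d y * h y"
proof -
  have sdf: "sd d differentiable (at y)" by (rule gramd(10)[OF y d])
  have As: "(\<lambda>z. A d z \<cdot> sd d z) differentiable (at y)" by (rule differentiable_app[OF A_diff[OF d y] sdf])
  have z: "form (A d z \<cdot> sd d z) (sd (- d) z) = 0" if "z \<in> V" for z
    using A_sigma(3)[OF that d] gramd(1)[OF that II_neg[OF d]] by simp
  have "form (wd (- d) (\<lambda>z. A d z \<cdot> sd d z) y) (sd (- d) y) = - form (A d y \<cdot> sd d y) (wd (- d) (sd (- d)) y)"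
    using wd_form_zero[OF y z As gramd(10)[OF y II_neg[OF d]], of "- d"] by (simp add: eq_neg_iff_add_eq_0)
  moreover have "form (\<sigma> y) (wd (- d) (sd (- d)) y) = 0"
    using wd_form_zero[OF y gramd(1)[OF _ II_neg[OF d]] sdiff(1)[OF y] gramd(10)[OF y II_neg[OF d]], of "- d"] gramd(3)[OF y II_neg[OF d]] by simp
  ultimately have 1: "form (wd (- d) (\<lambda>z. A d z \<cdot> sd d z) y) (sd (- d) y) = 0"
    using A_sigma(3)[OF y d] by simp
  have "wd (- d) (sd d) y = szb y" using gramd(5)[OF y II_neg[OF d]] by simp
  then have "form (A d y \<cdot> wd (- d) (sd d) y) (sd (- d) y) = - (al d y * h y)"
    using adj_app[of "A d y" "szb y" "sd (- d) y"] A_skew[OF y d] A_sigma(2)[OF y d] gramd(7)[OF y d] by simp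
  then show ?thesis
    using T_section[OF y d sdf Rsd[OF y d]] N_al(2)[OF y d II_neg[OF d]] 1 by simp
qed

text \<open>\<open>T\<close> applied to the section gives the same scalar for both directions, while
  the pairing in \<open>T_form1\<close> and \<open>T_form2\<close> gives opposite ones.\<close>

lemma al_zero: assumes y: "y \<in> V" and d: "d \<in> II" shows "al d y = 0"
proof -
  have "al d y *\<^sub>C \<sigma> y = al (- d) y *\<^sub>C \<sigma> y" using T_sigma[OF y d] T_sigma[OF y II_neg[OF d]] by simp
  then have "(al d y - al (- d) y) *\<^sub>C \<sigma> y = 0" by (simp add: scC_diff_left)
  then have 1: "al (- d) y = al d y" using \<sigma>_nz[OF y] by simp
  have "- (al d y * h y) = al (- d) y * h y"
    using T_form1[OF y d] T_form2[OF y II_neg[OF d]] by simp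
  then have "al d y * h y + al d y * h y = 0" unfolding 1 by (metis add.right_inverse)
  then have "2 * (al d y * h y) = 0" unfolding mult_2 .
  then show ?thesis using h_nz[OF y] by simp
qed

lemma A_kill: assumes "y \<in> V" "d \<in> II" "v \<in> Lm (- d) \<Lambda> y" shows "A d y \<cdot> v = 0"
proof -
  obtain k j where "v = k *\<^sub>C \<sigma> y + j *\<^sub>C sd (- d) y" using assms(3) unfolding Lm_eq[OF assms(1) II_neg[OF assms(2)]] using span2 by blast
  then show ?thesis using A_sigma[OF assms(1,2)] al_zero[OF assms(1,2)] by simp
qed

lemma w_Lm: assumes "y \<in> V" "d \<in> II" shows "w d y \<in> Lm (- d) \<Lambda> y"
  using al_zero[OF assms] w_perp[OF assms(2,1)] w_S[OF assms(2,1)]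
  by (simp add: Lm_iff[OF assms(1) II_neg[OF assms(2)]] al_def form_sym[of "w d y"])

lemma A_Lm: assumes "y \<in> V" "d \<in> II" "v \<in> Lm d \<Lambda> y" shows "A d y \<cdot> v \<in> Lm d \<Lambda> y"
proof -
  have "form v (\<sigma> y) = 0" using assms(3) by (simp add: Lm_iff[OF assms(1,2)])
  then have "A d y \<cdot> v = (- form v (w d y)) *\<^sub>C \<sigma> y" by (simp add: Aw assms wdg_app)
  then show ?thesis using Lm_mem(1)[OF assms(1,2)] unfolding Lm_eq[OF assms(1,2)] by (metis span_scC)
qed

lemma T_kill: assumes y: "y \<in> V" and d: "d \<in> II" shows "T y \<cdot> sd (- d) y = 0"
proof -
  let ?s = "sd (- d)"
  have sdf: "?s differentiable (at y)" by (rule gramd(10)[OF y II_neg[OF d]])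
  have "wd (- d) (\<lambda>z. A d z \<cdot> ?s z) y = 0"
    by (rule wd_zero[OF y]) (use A_sigma(2)[OF _ d] al_zero[OF _ d] in simp)
  moreover have "A d y \<cdot> wd (- d) ?s y = 0"
  proof -
    have "wd (- d) ?s y - Nw (- d) \<Lambda> y \<cdot> ?s y \<in> Lm (- d) \<Lambda> y"
      by (rule D_stable[OF y II_neg[OF d] sdf V y]) (use Lm_mem(2) II_neg[OF d] in auto)
    then have "A d y \<cdot> (wd (- d) ?s y - Nw (- d) \<Lambda> y \<cdot> ?s y) = 0" by (rule A_kill[OF y d])
    moreover have "A d y \<cdot> Nw (- d) \<Lambda> y \<cdot> ?s y = 0"
      by (rule A_perp[OF y d NS[OF y Rsd[OF y II_neg[OF d]]]])
    ultimately show ?thesis by simp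
  qed
  ultimately show ?thesis
    using T_section[OF y d sdf Rsd[OF y II_neg[OF d]]] N_al(1)[OF y d II_neg[OF d]] by simp
qed

text \<open>\<open>A\<close> vanishes on the complement of \<open>S\<close>, and the connection
  preserves the splitting; so the covariant derivative \<open>T\<close> vanishes there too.\<close>

lemma T_R: assumes y: "y \<in> V" shows "T y * (1 - Rm \<Lambda> y) = 0"
proof -
  let ?A = "A (- \<i>)" and ?R = "Rm \<Lambda> y" and ?N = "Nw \<i> \<Lambda> y"
  have d: "- \<i> \<in> II" by (simp add: II_def)
  have AR: "?A z * Rm \<Lambda> z = ?A z" if "z \<in> V" for z
  proof (rule cmat_eqI)
    fix v
    have "Rm \<Lambda> z \<cdot> Rm \<Lambda> z \<cdot> v = v" using Rm_props(1)[OF that] by (metis app_ring(2,6))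
    then have "Rm \<Lambda> z \<cdot> (Rm \<Lambda> z \<cdot> v - v) = - (Rm \<Lambda> z \<cdot> v - v)" by simp
    from A_perp[OF that d this] show "(?A z * Rm \<Lambda> z) \<cdot> v = ?A z \<cdot> v" by simp
  qed
  have dA: "?A differentiable (at y)" by (rule A_diff[OF d y])
  have "wd \<i> (\<lambda>z. ?A z * Rm \<Lambda> z) y = wd \<i> ?A y" by (rule wd_cong_open[OF V y AR])
  then have 1: "wd \<i> ?A y * ?R + ?A y * wd \<i> (Rm \<Lambda>) y = wd \<i> ?A y" by (simp add: wd_mult dA Rm_diff[OF y])
  have 2: "?A y * ?R = ?A y" by (rule AR[OF y])
  have 3: "wd \<i> (Rm \<Lambda>) y = ?N * ?R + ?N * ?R" using Np(4)[OF y, of \<i>] by (simp add: scC_double)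
  have 4: "?N * ?R = - (?R * ?N)" using Np(2)[OF y, of \<i>] by simp
  have "?A y * wd \<i> (Rm \<Lambda>) y = - (?A y * ?R * ?N) - ?A y * ?R * ?N"
    unfolding 3 4 by (simp add: distrib_left right_diff_distrib mult.assoc)
  then have 5: "?A y * wd \<i> (Rm \<Lambda>) y = - (?A y * ?N) - ?A y * ?N" unfolding 2 .
  have 6: "?A y * ?N * ?R = - (?A y * ?N)" using 2 4 by (simp add: mult.assoc) (simp add: mult.assoc[symmetric])
  have "T y * ?R = wd \<i> ?A y * ?R - ?N * (?A y * ?R) + ?A y * ?N * ?R"
    by (simp add: T_def Dw_def left_diff_distrib distrib_right mult.assoc)
  also have "wd \<i> ?A y * ?R = wd \<i> ?A y + (?A y * ?N + ?A y * ?N)" using 1 5 by (simp add: algebra_simps)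
  also have "wd \<i> ?A y + (?A y * ?N + ?A y * ?N) - ?N * (?A y * ?R) + ?A y * ?N * ?R = T y"
    unfolding 2 6 by (simp add: T_def Dw_def)
  finally show ?thesis by (simp add: right_diff_distrib)
qed

text \<open>\<open>T\<close> factors through \<open>S\<close> and kills three of the four frame
  vectors, so its rank is at most one, and a skew map of rank at most one is zero.\<close>

lemma T_zero: assumes y: "y \<in> V" shows "T y = 0"
proof -
  have d: "- \<i> \<in> II" "\<i> \<in> II" by (simp_all add: II_def)
  have Tb: "T y \<cdot> \<sigma> y = 0" "T y \<cdot> sz y = 0" "T y \<cdot> sb y = 0"
    using T_sigma[OF y d(1)] al_zero[OF y d(1)] T_kill[OF y d(1)] T_kill[OF y d(2)] by simp_all
  have sk: "adj (T y) = - T y"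
  proof -
    have "wd \<i> (\<lambda>z. adj (A (- \<i>) z)) y = wd \<i> (\<lambda>z. - A (- \<i>) z) y"
      by (rule wd_cong_open[OF V y]) (rule A_skew[OF _ d(1)])
    then have "adj (wd \<i> (A (- \<i>)) y) = - wd \<i> (A (- \<i>)) y" by (simp add: wd_adj wd_minus A_diff[OF d(1) y])
    then show ?thesis by (simp add: T_def Dw_def A_skew[OF y d(1)] Np(3)[OF y])
  qed
  have TP: "T y * P y = T y"
  proof -
    have "T y * (1 - Rm \<Lambda> y) = 2 *\<^sub>C T y - 2 *\<^sub>C (T y * P y)"
      by (simp add: Rm_eq[OF y] right_diff_distrib distrib_left scC_double)
    then have "2 *\<^sub>C (T y * P y) = 2 *\<^sub>C T y" using T_R[OF y] by (metis right_minus_eq)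
    then have "2 *\<^sub>C (T y * P y - T y) = 0" by (simp add: scC_diff_right)
    then show ?thesis by simp
  qed
  have Tv: "T y \<cdot> v = - (inverse (h y) * form v (\<sigma> y)) *\<^sub>C (T y \<cdot> szb y)" for v
  proof -
    have "T y \<cdot> v = T y \<cdot> P y \<cdot> v" using TP by (metis app_ring(6))
    also have "\<dots> = - (inverse (h y) * form v (\<sigma> y)) *\<^sub>C (T y \<cdot> szb y)"
      by (simp add: P_def Tb scC_simps)
    finally show ?thesis .
  qed
  have "T y \<cdot> szb y = 0"
  proof (rule form_nondegenerate)
    fix u
    have "form (T y \<cdot> szb y) u = - form (szb y) (T y \<cdot> u)" using adj_app[of "T y" "szb y" u] sk by simp
    also have "\<dots> = inverse (h y) * form u (\<sigma> y) * form (szb y) (T y \<cdot> szb y)" by (subst Tv) simp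
    also have "form (szb y) (T y \<cdot> szb y) = 0"
      using adj_app[of "T y" "szb y" "szb y"] sk form_sym[of "T y \<cdot> szb y" "szb y"] by simp
    finally show "form (T y \<cdot> szb y) u = 0" by simp
  qed
  then show ?thesis by (intro cmat_eqI) (subst Tv, simp)
qed

end

text \<open>The pencil relative to d: the coefficient of order zero is chosen so that it vanishes at
  \<open>l = 1\<close>, where the connection is d itself. In the direction \<open>\<i>\<close> the
  parameter is 1/\<lambda>.\<close>

definition Pf :: "'n::finite subbundle \<Rightarrow> (complex \<Rightarrow> complex \<Rightarrow> 'n omat) \<Rightarrow> complex \<Rightarrow> complex \<Rightarrow> complex \<Rightarrow> 'n omat" where
  "Pf \<Lambda> A d l y = Pl (A d y) (Nw d \<Lambda> y) (- A d y - Nw d \<Lambda> y) l"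

definition Curv :: "'n::finite subbundle \<Rightarrow> (complex \<Rightarrow> complex \<Rightarrow> 'n omat) \<Rightarrow> complex \<Rightarrow> complex \<Rightarrow> 'n omat" where
  "Curv \<Lambda> A l y = wd (- \<i>) (Pf \<Lambda> A \<i> (inverse l)) y - wd \<i> (Pf \<Lambda> A (- \<i>) l) y
     + (Pf \<Lambda> A (- \<i>) l y * Pf \<Lambda> A \<i> (inverse l) y - Pf \<Lambda> A \<i> (inverse l) y * Pf \<Lambda> A (- \<i>) l y)"

text \<open>The even powers of \<open>l\<close> carry the derivatives of the multiplier and the odd
  factor \<open>l - inverse l\<close> carries the Willmore equation. This separation allows the
  equations to be recovered from flatness.\<close>

lemma Curv_eq:
  assumes l: "l \<noteq> 0" and A: "\<And>d. d \<in> II \<Longrightarrow> A d differentiable (at y)" and N: "\<And>d. Nw d \<Lambda> differentiable (at y)"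
    and closedN: "Dw (- \<i>) \<Lambda> (Nw \<i> \<Lambda>) y = Dw \<i> \<Lambda> (Nw (- \<i>) \<Lambda>) y"
    and AA: "A (- \<i>) y * A \<i> y = A \<i> y * A (- \<i>) y"
  shows "Curv \<Lambda> A l y = (l * l - 1) *\<^sub>C Dw (- \<i>) \<Lambda> (A \<i>) y - (inverse l * inverse l - 1) *\<^sub>C Dw \<i> \<Lambda> (A (- \<i>)) y
    + (l - inverse l) *\<^sub>C (Dw (- \<i>) \<Lambda> (Nw \<i> \<Lambda>) y + ((Nw (- \<i>) \<Lambda> y * A \<i> y - A \<i> y * Nw (- \<i>) \<Lambda> y)
      + (Nw \<i> \<Lambda> y * A (- \<i>) y - A (- \<i>) y * Nw \<i> \<Lambda> y)))"
proof -
  have II: "\<i> \<in> II" "- \<i> \<in> II" by (simp_all add: II_def)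
  have Pf: "Pf \<Lambda> A d k = (\<lambda>y. (inverse k * inverse k - 1) *\<^sub>C A d y + (inverse k - 1) *\<^sub>C Nw d \<Lambda> y)" for d k
    by (simp add: Pf_def Pl_def fun_eq_iff scC_diff_left)
  have wP: "wd e (Pf \<Lambda> A d k) y = (inverse k * inverse k - 1) *\<^sub>C wd e (A d) y + (inverse k - 1) *\<^sub>C wd e (Nw d \<Lambda>) y" if "d \<in> II" for e d k
    unfolding Pf using A[OF that] N by (simp add: wd_add wd_scC_const differentiable_scC_const)
  have D: "wd e T y = Dw e \<Lambda> T y + (Nw e \<Lambda> y * T y - T y * Nw e \<Lambda> y)" for e T by (simp add: Dw_def)
  have "Dw \<i> \<Lambda> (Nw (- \<i>) \<Lambda>) y - (Nw (- \<i>) \<Lambda> y * Nw \<i> \<Lambda> y - Nw \<i> \<Lambda> y * Nw (- \<i>) \<Lambda> y)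
      = Dw \<i> \<Lambda> (Nw (- \<i>) \<Lambda>) y + (Nw \<i> \<Lambda> y * Nw (- \<i>) \<Lambda> y - Nw (- \<i>) \<Lambda> y * Nw \<i> \<Lambda> y)" by simp
  note c = curvature_expand[of "inverse l" l "Dw (- \<i>) \<Lambda> (A \<i>) y" "Nw (- \<i>) \<Lambda> y" "A \<i> y" "Dw (- \<i>) \<Lambda> (Nw \<i> \<Lambda>) y" "Nw \<i> \<Lambda> y"
      "Dw \<i> \<Lambda> (A (- \<i>)) y" "A (- \<i>) y" "Dw \<i> \<Lambda> (Nw (- \<i>) \<Lambda>) y", unfolded this]
  have "Curv \<Lambda> A l y = (l - 1) *\<^sub>C Dw (- \<i>) \<Lambda> (Nw \<i> \<Lambda>) y - (inverse l - 1) *\<^sub>C Dw \<i> \<Lambda> (Nw (- \<i>) \<Lambda>) y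
    + (l * l - 1) *\<^sub>C Dw (- \<i>) \<Lambda> (A \<i>) y - (inverse l * inverse l - 1) *\<^sub>C Dw \<i> \<Lambda> (A (- \<i>)) y
      + (l - inverse l) *\<^sub>C ((Nw (- \<i>) \<Lambda> y * A \<i> y - A \<i> y * Nw (- \<i>) \<Lambda> y) + (Nw \<i> \<Lambda> y * A (- \<i>) y - A (- \<i>) y * Nw \<i> \<Lambda> y))
      + (2 - l * l - inverse l * inverse l) *\<^sub>C (A (- \<i>) y * A \<i> y - A \<i> y * A (- \<i>) y)"
    unfolding Curv_def wP[OF II(1)] wP[OF II(2)] inverse_inverse_eq
    unfolding D[of _ "A _"] D[of _ "Nw _ _"] Pf inverse_inverse_eq
    by (rule c) (use l in simp)
  then show ?thesis unfolding AA closedN[symmetric]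
    by (simp add: scC_diff_left scC_add_right scC_diff_right algebra_simps)
qed

section \<open>The defining equations in terms of coefficients\<close>

lemma real_surface_frame:
  assumes "real_surface U \<Lambda>" "x \<in> U"
  obtains V \<sigma> where "x \<in> V" "V \<subseteq> U" "frame \<Lambda> V \<sigma>"
proof -
  have im: "immerses U \<Lambda>" and cc: "conformal_coordinate U \<Lambda>"
    using assms by (simp_all add: real_surface_def)
  obtain V \<sigma> where V: "V \<subseteq> U" "local_section \<Lambda> x V \<sigma>"
    "\<forall>y\<in>V. \<Lambda> y = vec.span {\<sigma> y} \<and> \<sigma> y \<in> real_vecs \<and> form (\<sigma> y) (\<sigma> y) = 0 \<and>
      (\<forall>X. X \<noteq> 0 \<longrightarrow> dd \<sigma> y X \<notin> vec.span {\<sigma> y})"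
    using im[unfolded immerses_def] assms(2) by blast
  have ls: "open V" "x \<in> V" "sm V \<sigma>" "\<And>y. y \<in> V \<Longrightarrow> \<sigma> y \<noteq> 0"
    using V(2) by (auto simp: local_section_def smooth_on_eq_sm)
  have lf: "line_frame \<Lambda> V \<sigma>" by standard (use ls V(3) in auto)
  have cf: "form (wd (- \<i>) \<sigma> y) (wd (- \<i>) \<sigma> y) = 0 \<and> form (wd (- \<i>) \<sigma> y) (wd \<i> \<sigma> y) \<noteq> 0" if y: "y \<in> V" for y
  proof -
    have "\<exists>c>0. \<forall>X Y. form (dd \<sigma> y X) (dd \<sigma> y Y) = complex_of_real (c * (X \<bullet> Y))"
      using cc[unfolded conformal_coordinate_def, rule_format, of y V \<sigma>] V y line_frame.loc[OF lf y] by blast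
    then obtain c where c: "c > 0" "\<And>X Y. form (dv \<sigma> y X) (dv \<sigma> y Y) = complex_of_real (c * (X \<bullet> Y))"
      unfolding dd_eq_dv by blast
    have "form (wd (- \<i>) \<sigma> y) (wd (- \<i>) \<sigma> y) = 0" "form (wd (- \<i>) \<sigma> y) (wd \<i> \<sigma> y) = c / 2"
      by (simp_all add: wd_def c(2) inner_complex_def)
    then show ?thesis using c(1) by (metis divide_eq_0_iff less_irrefl of_real_eq_0_iff zero_neq_numeral)
  qed
  have "frame \<Lambda> V \<sigma>"
    by (intro frame.intro lf frame_axioms.intro) (use V(3) cf in \<open>auto simp: real_vecs_def\<close>)
  then show ?thesis using that ls(2) V(1) by blast
qed

lemma wedge_form_linear:
  assumes "real_wedge_form U \<Lambda> q" "x \<in> U" "line_frame \<Lambda> V \<sigma>" "x \<in> V"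
  obtains w where "\<And>X. w X \<in> Lam1 \<Lambda> x" "\<And>X. q x X = (\<cdot>) (wdg (\<sigma> x) (w X))"
proof -
  interpret line_frame \<Lambda> V \<sigma> by fact
  have "\<exists>w\<in>Lam1 \<Lambda> x. q x X = (\<cdot>) (wdg (\<sigma> x) w)" for X
  proof -
    have "q x X \<in> wedge_space (\<Lambda> x) (Lam1 \<Lambda> x)"
      using assms(1,2) by (simp add: real_wedge_form_def)
    then have "q x X \<in> wedge_space (vec.span {\<sigma> x}) (Lam1 \<Lambda> x)"
      by (simp only: \<Lambda>_eq[OF assms(4)])
    moreover have "vec.subspace (Lam1 \<Lambda> x)" by (simp add: Lam1_def)
    ultimately show ?thesis by (rule wedge_space_line) blast
  qed
  then show ?thesis using that by metis
qed

lemma wedge_form_Qw: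
  assumes q: "real_wedge_form U \<Lambda> q" "x \<in> U" and lf: "line_frame \<Lambda> V \<sigma>" "x \<in> V"
  shows "q x X v = (X *\<^sub>C Qw (- \<i>) q x + cnj X *\<^sub>C Qw \<i> q x) \<cdot> v"
    and "Qw d q x \<cdot> v = (1/2) *\<^sub>C (q x 1 v + d *\<^sub>C q x \<i> v)"
    and "\<exists>w. w \<in> Lam1 \<Lambda> x \<and> Qw d q x = wdg (\<sigma> x) w"
    and "cnj d = - d \<Longrightarrow> mconj (Qw d q x) = Qw (- d) q x"
proof -
  obtain w where w: "\<And>X. w X \<in> Lam1 \<Lambda> x" "\<And>X. q x X = (\<cdot>) (wdg (\<sigma> x) (w X))"
    using wedge_form_linear[OF assms] by blast
  show 1: "Qw d q x \<cdot> v = (1/2) *\<^sub>C (q x 1 v + d *\<^sub>C q x \<i> v)" for d v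
    unfolding Qw_def by (rule app_of_lin) (simp_all add: w(2) scC_simps mult.commute)
  have lin: "linear (\<lambda>X. q x X v)" for v using q by (simp add: real_wedge_form_def)
  have "q x X v = q x (Re X *\<^sub>R 1 + Im X *\<^sub>R \<i>) v"
    by (rule arg_cong[where f="\<lambda>X. q x X v"]) (simp add: complex_eq_iff)
  also have "\<dots> = Re X *\<^sub>R q x 1 v + Im X *\<^sub>R q x \<i> v"
    using linear_add[OF lin[of v]] linear_scale[OF lin[of v]] by simp
  also have "\<dots> = (X / 2 + cnj X / 2) *\<^sub>C q x 1 v + (cnj X * \<i> / 2 - X * \<i> / 2) *\<^sub>C q x \<i> v"
  proof -
    have "X / 2 + cnj X / 2 = of_real (Re X)" "cnj X * \<i> / 2 - X * \<i> / 2 = of_real (Im X)"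
      by (simp_all add: complex_eq_iff)
    then show ?thesis by (simp only: scC_of_real)
  qed
  finally show "q x X v = (X *\<^sub>C Qw (- \<i>) q x + cnj X *\<^sub>C Qw \<i> q x) \<cdot> v"
    by (simp add: 1 scC_simps)
  have sub: "vec.subspace (Lam1 \<Lambda> x)" by (simp add: Lam1_def)
  have "Qw d q x = wdg (\<sigma> x) ((1/2) *\<^sub>C (w 1 + d *\<^sub>C w \<i>))"
    by (rule cmat_eqI) (simp add: 1 w(2) wdg_simps)
  moreover have "(1/2) *\<^sub>C (w 1 + d *\<^sub>C w \<i>) \<in> Lam1 \<Lambda> x"
    unfolding smult_eq_scC[symmetric] by (intro vec.subspace_scale vec.subspace_add sub w(1))
  ultimately show "\<exists>w. w \<in> Lam1 \<Lambda> x \<and> Qw d q x = wdg (\<sigma> x) w" by blast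
  have r: "q x X (vconj v) = vconj (q x X v)" for X v using q by (simp add: real_wedge_form_def)
  show "mconj (Qw d q x) = Qw (- d) q x" if "cnj d = - d"
    by (rule cmat_eqI) (simp add: mconj_app 1 r that)
qed

text \<open>Only the existence of adapted frames is required, so the same results serve the given
  surface and, later, its transform.\<close>

locale surface =
  fixes U :: "complex set" and \<Lambda> :: "'n::finite subbundle"
  assumes openU: "open U" and frames: "x \<in> U \<Longrightarrow> \<exists>V \<sigma>. x \<in> V \<and> V \<subseteq> U \<and> frame \<Lambda> V \<sigma>"
begin

lemma smRm: "sm U (Rm \<Lambda>)"
  by (rule sm_local) (use frames frame.smRm in blast)

lemma Rm_props: assumes "x \<in> U"
  shows "Rm \<Lambda> x * Rm \<Lambda> x = 1" "adj (Rm \<Lambda> x) = Rm \<Lambda> x" "mconj (Rm \<Lambda> x) = Rm \<Lambda> x"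
  using frames[OF assms] frame.Rm_props by blast+

lemma refl_eq: "x \<in> U \<Longrightarrow> refl_S (csc \<Lambda> x) v = Rm \<Lambda> x \<cdot> v"
  using frames frame.refl_eq by blast

lemma in_csc_iff: "x \<in> U \<Longrightarrow> v \<in> csc \<Lambda> x \<longleftrightarrow> Rm \<Lambda> x \<cdot> v = v"
  using frames[of x] frame.in_csc_iff by blast

lemma in_perp_iff: "x \<in> U \<Longrightarrow> v \<in> perp (csc \<Lambda> x) \<longleftrightarrow> Rm \<Lambda> x \<cdot> v = - v"
  using frames[of x] frame.in_perp_iff by blast

lemma smN: "sm U (Nw d \<Lambda>)"
proof -
  have "sm U (\<lambda>x. (- (1/2)) *\<^sub>C (Rm \<Lambda> x * wd d (Rm \<Lambda>) x))"
    by (intro sm_scC sm_mult_cmat sm_const sm_wd openU smRm)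
  then show ?thesis by (simp add: Nw_def[abs_def])
qed

lemma N_diff: "x \<in> U \<Longrightarrow> Nw d \<Lambda> differentiable (at x)"
  using sm_diff_at[OF smN] .

lemma N_closed: "x \<in> U \<Longrightarrow> Dw (- \<i>) \<Lambda> (Nw \<i> \<Lambda>) x = Dw \<i> \<Lambda> (Nw (- \<i>) \<Lambda>) x"
  using Nw_closed[OF openU _ smRm Rm_props(1,2)] .

lemma N_conj: assumes "x \<in> U" shows "mconj (Nw d \<Lambda> x) = Nw (cnj d) \<Lambda> x"
proof -
  have "wd (cnj d) (\<lambda>y. mconj (Rm \<Lambda> y)) x = wd (cnj d) (Rm \<Lambda>) x"
    by (rule wd_cong_open[OF openU assms]) (rule Rm_props(3))
  then have "mconj (wd d (Rm \<Lambda>) x) = wd (cnj d) (Rm \<Lambda>) x"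
    by (simp add: wd_mconj[OF sm_diff_at[OF smRm assms]])
  then show ?thesis by (simp add: Nw_def Rm_props(3)[OF assms])
qed

lemma smQ: assumes "real_wedge_form U \<Lambda> q" shows "sm U (Qw d q)"
proof (rule sm_cmatI[OF openU])
  fix v
  have "sm U (\<lambda>x. q x X v)" for X using assms by (simp add: real_wedge_form_def smooth_on_eq_sm)
  then have "sm U (\<lambda>x. (1/2) *\<^sub>C (q x 1 v + d *\<^sub>C q x \<i> v))"
    by (intro sm_scC sm_add sm_const openU)
  moreover have "Qw d q x \<cdot> v = (1/2) *\<^sub>C (q x 1 v + d *\<^sub>C q x \<i> v)" if "x \<in> U" for x
    using frames[OF that] wedge_form_Qw(2)[OF assms that] frame_def by blast
  ultimately show "sm U (\<lambda>x. Qw d q x \<cdot> v)" using sm_cong[OF openU] by (metis (no_types, lifting))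
qed

lemma Q_eq: assumes "real_wedge_form U \<Lambda> q" "x \<in> U" shows "q x X v = (X *\<^sub>C Qw (- \<i>) q x + cnj X *\<^sub>C Qw \<i> q x) \<cdot> v"
  using frames[OF assms(2)] wedge_form_Qw(1)[OF assms] frame_def by blast

lemma Q_conj: assumes "real_wedge_form U \<Lambda> q" "x \<in> U" "d \<in> II" shows "mconj (Qw d q x) = Qw (- d) q x"
proof -
  have "cnj d = - d" using assms(3) by (auto simp: II_def)
  then show ?thesis using frames[OF assms(2)] wedge_form_Qw(4)[OF assms(1,2)] frame_def by blast
qed

lemma extD_at: assumes x: "x \<in> U" and "P' differentiable (at x)" "Q' differentiable (at x)"
    and w: "\<And>z X v. z \<in> U \<Longrightarrow> \<omega> z X v = (X *\<^sub>C P' z + cnj X *\<^sub>C Q' z) \<cdot> v"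
  shows "extD \<Lambda> \<omega> x X Y v = (X * cnj Y - cnj X * Y) *\<^sub>C ((Dw (- \<i>) \<Lambda> Q' x - Dw \<i> \<Lambda> P' x) \<cdot> v)"
proof -
  obtain V \<sigma> where V: "x \<in> V" "V \<subseteq> U" "frame \<Lambda> V \<sigma>" using frames[OF x] by blast
  show ?thesis by (rule frame.extD_eq[OF V(3,1) assms(2,3)]) (use V(2) w in auto)
qed

lemma extD_q: assumes q: "real_wedge_form U \<Lambda> q" and x: "x \<in> U"
  shows "extD \<Lambda> q x X Y v = (X * cnj Y - cnj X * Y) *\<^sub>C ((Dw (- \<i>) \<Lambda> (Qw \<i> q) x - Dw \<i> \<Lambda> (Qw (- \<i>) q) x) \<cdot> v)"
  by (rule extD_at[OF x sm_diff_at[OF smQ[OF q] x] sm_diff_at[OF smQ[OF q] x] Q_eq[OF q]])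

lemma star_N: "x \<in> U \<Longrightarrow> star_form (Nform \<Lambda>) x X v = (X *\<^sub>C ((- \<i>) *\<^sub>C Nw (- \<i>) \<Lambda> x) + cnj X *\<^sub>C (\<i> *\<^sub>C Nw \<i> \<Lambda> x)) \<cdot> v"
proof -
  assume x: "x \<in> U"
  have "Nform \<Lambda> x X v = (X *\<^sub>C Nw (- \<i>) \<Lambda> x + cnj X *\<^sub>C Nw \<i> \<Lambda> x) \<cdot> v" for X v
    using frames[OF x] frame.Nform_eq by blast
  then show ?thesis by (simp add: star_form_def scC_scC mult.commute)
qed

lemma extD_N: assumes x: "x \<in> U"
  shows "extD \<Lambda> (star_form (Nform \<Lambda>)) x X Y v = (X * cnj Y - cnj X * Y) *\<^sub>C (\<i> *\<^sub>C
     ((Dw (- \<i>) \<Lambda> (Nw \<i> \<Lambda>) x + Dw \<i> \<Lambda> (Nw (- \<i>) \<Lambda>) x) \<cdot> v))"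
proof -
  have d: "(\<lambda>z. c *\<^sub>C Nw e \<Lambda> z) differentiable (at x)" for c e by (rule differentiable_scC_const[OF N_diff[OF x]])
  show ?thesis
    using extD_at[OF x, of "\<lambda>z. (- \<i>) *\<^sub>C Nw (- \<i>) \<Lambda> z" "\<lambda>z. \<i> *\<^sub>C Nw \<i> \<Lambda> z", OF d d star_N]
    unfolding Dw_scC[OF N_diff[OF x]] by (simp add: scC_simps)
qed

lemma bracket_N: assumes q: "real_wedge_form U \<Lambda> q" and x: "x \<in> U"
  shows "bracket_wedge q (star_form (Nform \<Lambda>)) x X Y v = (X * cnj Y - cnj X * Y) *\<^sub>C (\<i> *\<^sub>C
     (((Qw (- \<i>) q x * Nw \<i> \<Lambda> x - Nw \<i> \<Lambda> x * Qw (- \<i>) q x) + (Qw \<i> q x * Nw (- \<i>) \<Lambda> x - Nw (- \<i>) \<Lambda> x * Qw \<i> q x)) \<cdot> v))"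
  using bracket_wedge_eq[of q x "Qw (- \<i>) q x" "Qw \<i> q x" "star_form (Nform \<Lambda>)" "(- \<i>) *\<^sub>C Nw (- \<i>) \<Lambda> x" "\<i> *\<^sub>C Nw \<i> \<Lambda> x" X Y v,
      OF Q_eq[OF q x] star_N[OF x]]
  by (simp add: scC_simps algebra_simps)

text \<open>2-forms are tested on \<open>X = 1\<close>, \<open>Y = \<i>\<close>. The star multiplies
  the two coefficients of N by -i and i; by the Codazzi equation the two summands of the left side
  agree, which absorbs the factor 2 on the right.\<close>

lemma cw_iff:
  assumes rs: "real_surface U \<Lambda>" and q: "real_wedge_form U \<Lambda> q"
  shows "constrained_willmore U \<Lambda> q \<longleftrightarrow> (\<forall>x\<in>U. Dw (- \<i>) \<Lambda> (Qw \<i> q) x = Dw \<i> \<Lambda> (Qw (- \<i>) q) x \<and>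
     Dw (- \<i>) \<Lambda> (Nw \<i> \<Lambda>) x = (Qw (- \<i>) q x * Nw \<i> \<Lambda> x - Nw \<i> \<Lambda> x * Qw (- \<i>) q x)
       + (Qw \<i> q x * Nw (- \<i>) \<Lambda> x - Nw (- \<i>) \<Lambda> x * Qw \<i> q x))"
proof -
  have e1: "(\<forall>X Y v. extD \<Lambda> q x X Y v = 0) \<longleftrightarrow> Dw (- \<i>) \<Lambda> (Qw \<i> q) x = Dw \<i> \<Lambda> (Qw (- \<i>) q) x" if x: "x \<in> U" for x
  proof
    assume "\<forall>X Y v. extD \<Lambda> q x X Y v = 0"
    then have "extD \<Lambda> q x 1 \<i> v = 0" for v by blast
    then have "(- \<i> - \<i>) *\<^sub>C ((Dw (- \<i>) \<Lambda> (Qw \<i> q) x - Dw \<i> \<Lambda> (Qw (- \<i>) q) x) \<cdot> v) = 0" for v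
      unfolding extD_q[OF q x] by simp
    moreover have "- \<i> - \<i> \<noteq> 0" by (simp add: complex_eq_iff)
    ultimately have "(Dw (- \<i>) \<Lambda> (Qw \<i> q) x - Dw \<i> \<Lambda> (Qw (- \<i>) q) x) \<cdot> v = 0" for v
      using scC_eq_0_iff by blast
    then show "Dw (- \<i>) \<Lambda> (Qw \<i> q) x = Dw \<i> \<Lambda> (Qw (- \<i>) q) x" by (intro cmat_eqI) simp
  qed (simp add: extD_q[OF q x])
  let ?H = "\<lambda>x. Dw (- \<i>) \<Lambda> (Nw \<i> \<Lambda>) x"
  let ?K = "\<lambda>x. (Qw (- \<i>) q x * Nw \<i> \<Lambda> x - Nw \<i> \<Lambda> x * Qw (- \<i>) q x) + (Qw \<i> q x * Nw (- \<i>) \<Lambda> x - Nw (- \<i>) \<Lambda> x * Qw \<i> q x)"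
  have e2: "(\<forall>X Y v. extD \<Lambda> (star_form (Nform \<Lambda>)) x X Y v = 2 *s bracket_wedge q (star_form (Nform \<Lambda>)) x X Y v)
     \<longleftrightarrow> ?H x = ?K x" if x: "x \<in> U" for x
  proof -
    have l: "extD \<Lambda> (star_form (Nform \<Lambda>)) x X Y v = (X * cnj Y - cnj X * Y) *\<^sub>C (\<i> *\<^sub>C ((2 *\<^sub>C ?H x) \<cdot> v))" for X Y v
      unfolding extD_N[OF x] N_closed[OF x, symmetric] by (simp only: scC_double)
    have r: "2 *s bracket_wedge q (star_form (Nform \<Lambda>)) x X Y v = (X * cnj Y - cnj X * Y) *\<^sub>C (\<i> *\<^sub>C ((2 *\<^sub>C ?K x) \<cdot> v))" for X Y v
      unfolding bracket_N[OF q x] smult_eq_scC by (simp only: scC_scC app_scC_left mult_ac)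
    show ?thesis
    proof
      assume "\<forall>X Y v. extD \<Lambda> (star_form (Nform \<Lambda>)) x X Y v = 2 *s bracket_wedge q (star_form (Nform \<Lambda>)) x X Y v"
      then have "extD \<Lambda> (star_form (Nform \<Lambda>)) x 1 \<i> v - 2 *s bracket_wedge q (star_form (Nform \<Lambda>)) x 1 \<i> v = 0" for v by simp
      then have "(- \<i> - \<i>) *\<^sub>C \<i> *\<^sub>C 2 *\<^sub>C ((?H x - ?K x) \<cdot> v) = 0" for v
        unfolding l r by (simp add: scC_diff_right)
      moreover have "- \<i> - \<i> \<noteq> 0" by (simp add: complex_eq_iff)
      ultimately have "(?H x - ?K x) \<cdot> v = 0" for v
        using scC_eq_0_iff by (metis complex_i_not_zero zero_neq_numeral)
      then have "?H x - ?K x = 0" by (intro cmat_eqI) simp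
      then show "?H x = ?K x" by simp
    next
      assume "?H x = ?K x"
      then show "\<forall>X Y v. extD \<Lambda> (star_form (Nform \<Lambda>)) x X Y v = 2 *s bracket_wedge q (star_form (Nform \<Lambda>)) x X Y v"
        unfolding l r by simp
    qed
  qed
  have a: "(\<forall>x\<in>U. \<forall>X Y v. extD \<Lambda> q x X Y v = 0) \<longleftrightarrow> (\<forall>x\<in>U. Dw (- \<i>) \<Lambda> (Qw \<i> q) x = Dw \<i> \<Lambda> (Qw (- \<i>) q) x)"
    by (rule ball_cong[OF refl e1])
  have b: "(\<forall>x\<in>U. \<forall>X Y v. extD \<Lambda> (star_form (Nform \<Lambda>)) x X Y v = 2 *s bracket_wedge q (star_form (Nform \<Lambda>)) x X Y v)
      \<longleftrightarrow> (\<forall>x\<in>U. ?H x = ?K x)"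
    by (rule ball_cong[OF refl e2])
  show ?thesis
    unfolding constrained_willmore_def a b using rs q by blast
qed

end

locale cw_surface = surface +
  fixes q :: "'a::finite endo_form"
  assumes cw: "constrained_willmore U \<Lambda> q"
begin

lemma rs: "real_surface U \<Lambda>" and rw: "real_wedge_form U \<Lambda> q"
  using cw by (auto simp: constrained_willmore_def)

lemma Q_diff: "x \<in> U \<Longrightarrow> Qw d q differentiable (at x)"
  by (rule sm_diff_at[OF smQ[OF rw]])

lemma pair: assumes "x \<in> U"
  obtains V \<sigma> w where "x \<in> V" "V \<subseteq> U" "closed_pair \<Lambda> V \<sigma> (\<lambda>d. Qw d q) w"
proof -
  obtain V \<sigma> where VV: "x \<in> V" "V \<subseteq> U" "frame \<Lambda> V \<sigma>" using frames[OF assms] by blast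
  interpret frame \<Lambda> V \<sigma> by fact
  define w where "w d y = (SOME w. w \<in> Lam1 \<Lambda> y \<and> Qw d q y = wdg (\<sigma> y) w)" for d y
  have w: "w d y \<in> Lam1 \<Lambda> y \<and> Qw d q y = wdg (\<sigma> y) (w d y)" if "y \<in> V" for d y
    unfolding w_def by (rule someI_ex, rule wedge_form_Qw(3)[OF rw _ line_frame_axioms that]) (use that VV(2) in auto)
  have sp: "form v (\<sigma> y) = 0 \<and> Rm \<Lambda> y \<cdot> v = v" if "v \<in> Lam1 \<Lambda> y" "y \<in> V" for v y
    using that(1) unfolding Lam1_eq[OF that(2)]
    by (induction rule: vec.span_induct_alt)
      (auto simp: smult_eq_scC gram[OF that(2)] null[OF that(2)] Rm_basis[OF that(2)])
  have "closed_pair \<Lambda> V \<sigma> (\<lambda>d. Qw d q) w"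
  proof
    fix d y assume dy: "d \<in> II" "y \<in> V"
    show "Qw d q y = wdg (\<sigma> y) (w d y)" "form (w d y) (\<sigma> y) = 0" "Rm \<Lambda> y \<cdot> w d y = w d y"
      using w[OF dy(2)] sp[OF _ dy(2)] by blast+
    show "Qw d q differentiable (at y)" using Q_diff[of y] dy VV by blast
  next
    fix y assume "y \<in> V"
    then show "Dw (- \<i>) \<Lambda> (Qw \<i> q) y = Dw \<i> \<Lambda> (Qw (- \<i>) q) y"
      using cw cw_iff[OF rs rw] VV(2) by blast
  qed
  then show ?thesis using that VV by blast
qed

text \<open>The vanishing results of \<open>closed_pair\<close> enter here: they are what makes the
  quadratic coefficient annihilate the plane \<open>Lm (- d)\<close>.\<close>

lemma half_cw: assumes d: "d \<in> II"
  shows "half d U (Rm \<Lambda>) (Qw d q) (Nw d \<Lambda>) (\<lambda>x. - Qw d q x - Nw d \<Lambda> x) (Lm (- d) \<Lambda>) (Lm d \<Lambda>)"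
proof
  show "open U" "sm U (Rm \<Lambda>)" "sm U (Qw d q)" "sm U (Nw d \<Lambda>)" by (rule openU smRm smQ[OF rw] smN)+
  then show "sm U (\<lambda>x. - Qw d q x - Nw d \<Lambda> x)" by (intro sm_diff sm_minus)
next
  fix x assume x: "x \<in> U"
  obtain V \<sigma> w where VV: "x \<in> V" "V \<subseteq> U" "closed_pair \<Lambda> V \<sigma> (\<lambda>d. Qw d q) w" using pair[OF x] .
  interpret closed_pair \<Lambda> V \<sigma> "\<lambda>d. Qw d q" w by (rule VV(3))
  show "Rm \<Lambda> x * Rm \<Lambda> x = 1" "adj (Rm \<Lambda> x) = Rm \<Lambda> x" by (rule Rm_props[OF VV(1)])+
  show 1: "adj (Qw d q x) = - Qw d q x" by (rule A_skew[OF VV(1) d])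
  show 2: "adj (Nw d \<Lambda> x) = - Nw d \<Lambda> x" by (rule Np(3)[OF VV(1)])
  show "adj (- Qw d q x - Nw d \<Lambda> x) = - (- Qw d q x - Nw d \<Lambda> x)" by (simp add: 1 2)
  show 3: "Rm \<Lambda> x * Qw d q x = Qw d q x * Rm \<Lambda> x" by (rule A_R[OF VV(1) d])
  show 4: "Rm \<Lambda> x * Nw d \<Lambda> x = - (Nw d \<Lambda> x * Rm \<Lambda> x)" by (rule Np(2)[OF VV(1)])
  show "wd d (Rm \<Lambda>) x = Rm \<Lambda> x * (- Qw d q x - Nw d \<Lambda> x) - (- Qw d q x - Nw d \<Lambda> x) * Rm \<Lambda> x"
    unfolding Np(4)[OF VV(1)] by (simp add: right_diff_distrib left_diff_distrib 3 4 scC_double)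
  show "Rm \<Lambda> x \<cdot> v = v" "Qw d q x \<cdot> v = 0" "Nw d \<Lambda> x \<cdot> v = 0" if "v \<in> Lm (- d) \<Lambda> x" for v
    using that Lm_iff[OF VV(1) II_neg[OF d]] A_kill[OF VV(1) d] Lm_N[OF VV(1) d] by blast+
  show "Qw d q x \<cdot> v = 0" if "Rm \<Lambda> x \<cdot> v = - v" for v by (rule A_perp[OF VV(1) d that])
next
  fix V' x and s :: "'a sect"
  assume V': "open V'" "x \<in> V'" "V' \<subseteq> U" and s: "s differentiable (at x)" and sW: "\<And>y. y \<in> V' \<Longrightarrow> s y \<in> Lm d \<Lambda> y"
  have x: "x \<in> U" using V' by auto
  obtain V \<sigma> w where VV: "x \<in> V" "V \<subseteq> U" "closed_pair \<Lambda> V \<sigma> (\<lambda>d. Qw d q) w" using pair[OF x] .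
  interpret closed_pair \<Lambda> V \<sigma> "\<lambda>d. Qw d q" w by (rule VV(3))
  have "wd d s x - Nw d \<Lambda> x \<cdot> s x \<in> Lm d \<Lambda> x"
    by (rule D_stable[OF VV(1) d s, of "V \<inter> V'"]) (use V VV V' sW in auto)
  moreover have "Qw d q x \<cdot> s x \<in> Lm d \<Lambda> x" by (rule A_Lm[OF VV(1) d sW[OF V'(2)]])
  ultimately have "(wd d s x - Nw d \<Lambda> x \<cdot> s x) - Qw d q x \<cdot> s x \<in> Lm d \<Lambda> x"
    unfolding Lm_eq[OF VV(1) d] by (rule vec.span_diff)
  then show "wd d s x + (- Qw d q x - Nw d \<Lambda> x) \<cdot> s x \<in> Lm d \<Lambda> x" by (simp add: algebra_simps)
qed

lemma Q_wdg: assumes "x \<in> U" "d \<in> II"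
  obtains u w where "u \<in> Lm (- d) \<Lambda> x" "w \<in> Lm (- d) \<Lambda> x" "Qw d q x = wdg u w"
proof -
  obtain V \<sigma> w where VV: "x \<in> V" "V \<subseteq> U" "closed_pair \<Lambda> V \<sigma> (\<lambda>d. Qw d q) w" using pair[OF assms(1)] .
  interpret closed_pair \<Lambda> V \<sigma> "\<lambda>d. Qw d q" w by (rule VV(3))
  show ?thesis using that Lm_mem(1)[OF VV(1) II_neg[OF assms(2)]] w_Lm[OF VV(1) assms(2)] Aw[OF assms(2) VV(1)] by blast
qed

text \<open>The derivatives of both parts of the multiplier vanish by \<open>T_zero\<close>, the two
  parts commute, and the odd part is the Willmore equation.\<close>

lemma flat: assumes x: "x \<in> U" and l: "l \<noteq> 0" shows "Curv \<Lambda> (\<lambda>d. Qw d q) l x = 0"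
proof -
  obtain V \<sigma> w where VV: "x \<in> V" "V \<subseteq> U" "closed_pair \<Lambda> V \<sigma> (\<lambda>d. Qw d q) w" using pair[OF x] .
  interpret closed_pair \<Lambda> V \<sigma> "\<lambda>d. Qw d q" w by (rule VV(3))
  have II: "\<i> \<in> II" "- \<i> \<in> II" by (simp_all add: II_def)
  have T: "Dw \<i> \<Lambda> (Qw (- \<i>) q) x = 0" "Dw (- \<i>) \<Lambda> (Qw \<i> q) x = 0"
    using T_zero[OF VV(1)] closed[OF VV(1)] by (simp_all add: T_def)
  have c: "Qw (- \<i>) q x * Qw \<i> q x = Qw \<i> q x * Qw (- \<i>) q x"
    unfolding Aw[OF II(1) VV(1)] Aw[OF II(2) VV(1)]
    by (rule wdg_commute) (use w_perp[OF _ VV(1)] II null[OF VV(1)] in auto)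
  have H: "Dw (- \<i>) \<Lambda> (Nw \<i> \<Lambda>) x = (Qw (- \<i>) q x * Nw \<i> \<Lambda> x - Nw \<i> \<Lambda> x * Qw (- \<i>) q x)
       + (Qw \<i> q x * Nw (- \<i>) \<Lambda> x - Nw (- \<i>) \<Lambda> x * Qw \<i> q x)"
    using cw cw_iff[OF rs rw] x by blast
  show ?thesis
    unfolding Curv_eq[OF l Q_diff[OF x] N_diff[OF x] N_closed[OF x] c] T H by simp
qed

end

section \<open>A dressing step for either sign of the scalar\<close>

lemma half_cong:
  assumes "half d U R A B C W W'"
    and "\<And>x. x \<in> U \<Longrightarrow> R1 x = R x" "\<And>x. x \<in> U \<Longrightarrow> A1 x = A x" "\<And>x. x \<in> U \<Longrightarrow> B1 x = B x" "\<And>x. x \<in> U \<Longrightarrow> C1 x = C x"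
    and "\<And>x. x \<in> U \<Longrightarrow> W1 x = W x" "\<And>x. x \<in> U \<Longrightarrow> W1' x = W' x"
  shows "half d U R1 A1 B1 C1 W1 W1'"
proof -
  interpret half d U R A B C W W' by fact
  have wR: "wd d R1 x = wd d R x" if "x \<in> U" for x
    by (rule wd_cong_open[OF openU that assms(2)])
  show ?thesis
  proof
    show "open U" by (rule openU)
    show "sm U R1" "sm U A1" "sm U B1" "sm U C1"
      using smR smA smB smC sm_cong[OF openU assms(2)] sm_cong[OF openU assms(3)] sm_cong[OF openU assms(4)] sm_cong[OF openU assms(5)]
      by auto
  next
    fix V x and s :: "'a sect"
    assume V: "open V" "x \<in> V" "V \<subseteq> U" and s: "s differentiable (at x)" and sW: "\<And>y. y \<in> V \<Longrightarrow> s y \<in> W1' y"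
    have "wd d s x + C x \<cdot> s x \<in> W' x"
    proof (rule stab[OF V s])
      fix y assume "y \<in> V"
      then show "s y \<in> W' y" using sW[of y] assms(7)[of y] V(3) by auto
    qed
    then show "wd d s x + C1 x \<cdot> s x \<in> W1' x" using V assms(5)[of x] assms(7)[of x] by auto
  qed (simp_all add: assms wR RR adjR skA skB skC A_R B_R dR W_R A_W B_W A_perp)
qed

lemma Pl_conj: "Pl (G * A * H) (G * B * H) (G * C * H - T) l = G * Pl A B C l * H - T"
  by (simp add: Pl_def distrib_left distrib_right)

text \<open>For \<open>s = - 1\<close> the gauge is \<open>J\<close> times the gauge for
  \<open>s = 1\<close>, and \<open>J\<close> does not involve the spectral parameter. The extra
  constant gauge moves \<open>W\<close> by \<open>J\<close> and brings \<open>W'\<close> back, since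
  \<open>J\<close> is an involution.\<close>

lemma signed_step:
  assumes dr: "dressing d U R A B C W W' E F a" and s: "s = 1 \<or> s = - 1"
  shows "\<exists>A1 B1 C1. half d U R A1 B1 C1 (\<lambda>x. (\<cdot>) (Gam (E x) (F x) s) ` W x) (\<lambda>x. (\<cdot>) (Gam (E x) (F x) (- s)) ` W' x)
    \<and> (\<forall>x\<in>U. A1 x = Gam (E x) (F x) s * A x * adj (Gam (E x) (F x) s))
    \<and> (\<forall>x\<in>U. \<forall>l. l \<noteq> 0 \<longrightarrow> l \<noteq> a \<longrightarrow> l \<noteq> - a \<longrightarrow>
        wd d (\<lambda>y. Gam (E y) (F y) (s * ((a - l) / (a + l)))) x
          + Pl (A1 x) (B1 x) (C1 x) l * Gam (E x) (F x) (s * ((a - l) / (a + l)))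
        = Gam (E x) (F x) (s * ((a - l) / (a + l))) * Pl (A x) (B x) (C x) l)"
proof -
  interpret dressing d U R A B C W W' E F a by fact
  show ?thesis
  proof (cases "s = 1")
    case True
    have "half d U R A Bh Ch (\<lambda>x. (\<cdot>) (Gam (E x) (F x) 1) ` W x) (\<lambda>x. (\<cdot>) (Gam (E x) (F x) (- 1)) ` W' x)"
      using half_step by (simp add: J_def)
    then show ?thesis
      using gauge True by (intro exI[of _ A] exI[of _ Bh] exI[of _ Ch]) auto
  next
    case False
    then have s1: "s = - 1" using s by simp
    have JJ: "adj (J x) * J x = 1" "J x * adj (J x) = 1" if "x \<in> U" for x using J_props[OF that] by auto
    have JR: "R x = J x * R x * adj (J x)" if "x \<in> U" for x
    proof -
      have "J x * R x * J x = J x * (R x * J x)" by (simp add: mult.assoc)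
      also have "\<dots> = J x * J x * R x" by (simp only: J_props(3)[OF that] mult.assoc)
      finally show ?thesis using J_props[OF that] by simp
    qed
    let ?A = "\<lambda>x. J x * A x * adj (J x)" and ?B = "\<lambda>x. J x * Bh x * adj (J x)" and ?C = "\<lambda>x. J x * Ch x * adj (J x) - wd d J x * adj (J x)"
    have "half d U R ?A ?B ?C (\<lambda>x. (\<cdot>) (J x) ` W x) (\<lambda>x. (\<cdot>) (J x) ` ((\<cdot>) (J x) ` W' x))"
      by (rule half_const_gauge[OF half_step smJ JJ JR])
    then have h: "half d U R ?A ?B ?C (\<lambda>x. (\<cdot>) (Gam (E x) (F x) (- 1)) ` W x) (\<lambda>x. (\<cdot>) (Gam (E x) (F x) 1) ` W' x)"
    proof (rule half_cong)
      fix x assume x: "x \<in> U"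
      show "(\<cdot>) (Gam (E x) (F x) 1) ` W' x = (\<cdot>) (J x) ` ((\<cdot>) (J x) ` W' x)"
        by (simp add: image_image J_props(4)[OF x])
    qed (simp_all add: J_def)
    have rel: "wd d (\<lambda>y. Gam (E y) (F y) (- 1 * c)) x + Pl (?A x) (?B x) (?C x) l * Gam (E x) (F x) (- 1 * c)
        = Gam (E x) (F x) (- 1 * c) * Pl (A x) (B x) (C x) l"
      if x: "x \<in> U" and l: "l \<noteq> 0" "l \<noteq> a" "l \<noteq> - a" and c: "c = (a - l) / (a + l)" for x l c
    proof -
      have "a + l \<noteq> 0" "a - l \<noteq> 0" using l by (auto simp: eq_neg_iff_add_eq_0 add.commute)
      then have c0: "c \<noteq> 0" using c by simp
      let ?G = "\<lambda>y. Gam (E y) (F y) c"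
      have JG: "Gam (E y) (F y) (- 1 * c) = J y * ?G y" if "y \<in> U" for y
        using Gam_mult[OF np[OF that], of "- 1" c] c0 by (simp add: J_def)
      have Gd: "?G differentiable (at x)" by (rule sm_diff_at[OF sm_Gam[OF openU smE smF] x])
      have "wd d (\<lambda>y. Gam (E y) (F y) (- 1 * c)) x = wd d (\<lambda>y. J y * ?G y) x"
        by (rule wd_cong_open[OF openU x JG])
      also have "\<dots> = wd d J x * ?G x + J x * wd d ?G x"
        by (rule wd_mult(2)[OF sm_diff_at[OF smJ x] Gd])
      finally have w: "wd d (\<lambda>y. Gam (E y) (F y) (- 1 * c)) x = wd d J x * ?G x + J x * wd d ?G x" .
      have aJ: "adj (J x) * (J x * T) = T" for T using JJ(1)[OF x] by (simp add: mult.assoc[symmetric])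
      have "wd d (\<lambda>y. Gam (E y) (F y) (- 1 * c)) x + Pl (?A x) (?B x) (?C x) l * Gam (E x) (F x) (- 1 * c)
         = J x * (wd d ?G x + Pl (A x) (Bh x) (Ch x) l * ?G x)"
        unfolding w JG[OF x] Pl_conj by (simp add: left_diff_distrib distrib_left mult.assoc aJ)
      also have "\<dots> = J x * (?G x * Pl (A x) (B x) (C x) l)"
        unfolding gauge[OF x l c] ..
      finally show ?thesis unfolding JG[OF x] by (simp only: mult.assoc)
    qed
    show ?thesis
      unfolding s1 minus_minus using h rel
      by (intro exI[of _ ?A] exI[of _ ?B] exI[of _ ?C]) (auto simp: J_def)
  qed
qed

lemma gauge_parallel:
  assumes G: "G differentiable (at x)" and s: "s differentiable (at x)"
    and rel: "wd d G x + P1 * G x = G x * P" and par: "wd d s x + P \<cdot> s x = k *\<^sub>C s x"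
  shows "wd d (\<lambda>y. G y \<cdot> s y) x + P1 \<cdot> G x \<cdot> s x = k *\<^sub>C (G x \<cdot> s x)"
proof -
  have "wd d (\<lambda>y. G y \<cdot> s y) x + P1 \<cdot> G x \<cdot> s x = (wd d G x + P1 * G x) \<cdot> s x + G x \<cdot> wd d s x"
    by (simp add: wd_app[OF G s])
  also have "\<dots> = G x \<cdot> (wd d s x + P \<cdot> s x)" unfolding rel by simp
  finally show ?thesis by (simp add: par)
qed

lemma two_vec: "2 * v = 2 *\<^sub>C v" for v :: "complex ^ 'm::finite"
  by (simp add: vec_eq_iff)

lemma part_matrix:
  assumes "\<And>X v. \<omega> x X v = (X *\<^sub>C P + cnj X *\<^sub>C Q) \<cdot> v"
  shows "part10 \<omega> x X v = X *\<^sub>C (P \<cdot> v)" "part01 \<omega> x X v = cnj X *\<^sub>C (Q \<cdot> v)"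
proof -
  have "part10 \<omega> x X v = (1/2 * X + 1/2 * X) *\<^sub>C (P \<cdot> v) + (1/2 * cnj X - 1/2 * cnj X) *\<^sub>C (Q \<cdot> v)"
    unfolding part10_def assms smult_eq_scC by (simp add: scC_simps two_vec)
  then show "part10 \<omega> x X v = X *\<^sub>C (P \<cdot> v)" by simp
  have "part01 \<omega> x X v = (1/2 * X - 1/2 * X) *\<^sub>C (P \<cdot> v) + (1/2 * cnj X + 1/2 * cnj X) *\<^sub>C (Q \<cdot> v)"
    unfolding part01_def assms smult_eq_scC by (simp add: scC_simps two_vec)
  then show "part01 \<omega> x X v = cnj X *\<^sub>C (Q \<cdot> v)" by simp
qed

context surface
begin

lemma Nform_at: "x \<in> U \<Longrightarrow> Nform \<Lambda> x X v = (X *\<^sub>C Nw (- \<i>) \<Lambda> x + cnj X *\<^sub>C Nw \<i> \<Lambda> x) \<cdot> v"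
  using frames[of x] frame.Nform_eq by blast

lemma conn_eq:
  assumes q: "real_wedge_form U \<Lambda> q" and x: "x \<in> U" and f: "f differentiable (at x)" and l: "l \<noteq> 0"
  shows "conn \<Lambda> q l f x X = X *\<^sub>C (wd (- \<i>) f x + Pf \<Lambda> (\<lambda>d. Qw d q) (- \<i>) l x \<cdot> f x)
     + cnj X *\<^sub>C (wd \<i> f x + Pf \<Lambda> (\<lambda>d. Qw d q) \<i> (inverse l) x \<cdot> f x)"
proof -
  have D: "Dconn \<Lambda> f x X = dv f x X - (X *\<^sub>C Nw (- \<i>) \<Lambda> x + cnj X *\<^sub>C Nw \<i> \<Lambda> x) \<cdot> f x"
    using frames[OF x] frame.Dconn_eq'[OF _ _ f] by blast
  show ?thesis
    unfolding conn_def D part_matrix[of "Nform \<Lambda>" x, OF Nform_at[OF x]] part_matrix[of q x, OF Q_eq[OF q x]] smult_eq_scC dv_wd[OF f, of X]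
    using l by (simp add: Pf_def Pl_def scC_simps power2_eq_square algebra_simps)
qed

lemma conn_zero:
  assumes q: "real_wedge_form U \<Lambda> q" and x: "x \<in> U" and f: "f differentiable (at x)" and l: "l \<noteq> 0"
  shows "(\<forall>X. conn \<Lambda> q l f x X = 0) \<longleftrightarrow> wd (- \<i>) f x + Pf \<Lambda> (\<lambda>d. Qw d q) (- \<i>) l x \<cdot> f x = 0
     \<and> wd \<i> f x + Pf \<Lambda> (\<lambda>d. Qw d q) \<i> (inverse l) x \<cdot> f x = 0" (is "?L \<longleftrightarrow> ?z = 0 \<and> ?b = 0")
proof
  assume "?L"
  then have "1 *\<^sub>C ?z + cnj 1 *\<^sub>C ?b = 0" "\<i> *\<^sub>C ?z + cnj \<i> *\<^sub>C ?b = 0"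
    unfolding conn_eq[OF assms] by blast+
  then have 1: "?z + ?b = 0" "\<i> *\<^sub>C (?z - ?b) = 0" by (simp_all add: scC_diff_right)
  then have zb: "?z = ?b" by simp
  then have "2 *\<^sub>C ?b = 0" using 1(1) by (simp add: scC_double)
  then show "?z = 0 \<and> ?b = 0" using zb by simp
qed (simp add: conn_eq[OF assms])

lemma conn_in_line:
  assumes q: "real_wedge_form U \<Lambda> q" and x: "x \<in> U" and f: "f differentiable (at x)" and l: "l \<noteq> 0"
    and c: "\<And>X. conn \<Lambda> q l f x X \<in> vec.span {u}"
  shows "\<exists>k. wd (- \<i>) f x + Pf \<Lambda> (\<lambda>d. Qw d q) (- \<i>) l x \<cdot> f x = k *\<^sub>C u"
    and "\<exists>k. wd \<i> f x + Pf \<Lambda> (\<lambda>d. Qw d q) \<i> (inverse l) x \<cdot> f x = k *\<^sub>C u"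
proof -
  define z b where "z = wd (- \<i>) f x + Pf \<Lambda> (\<lambda>d. Qw d q) (- \<i>) l x \<cdot> f x"
    and "b = wd \<i> f x + Pf \<Lambda> (\<lambda>d. Qw d q) \<i> (inverse l) x \<cdot> f x"
  have e: "conn \<Lambda> q l f x X = X *\<^sub>C z + cnj X *\<^sub>C b" for X unfolding z_def b_def by (rule conn_eq[OF q x f l])
  obtain j where "conn \<Lambda> q l f x 1 = j *\<^sub>C u" using c[of 1] unfolding span_singleton by blast
  then have j: "z + b = j *\<^sub>C u" by (simp add: e)
  obtain k where "conn \<Lambda> q l f x \<i> = k *\<^sub>C u" using c[of \<i>] unfolding span_singleton by blast
  then have "\<i> *\<^sub>C (z - b) = k *\<^sub>C u" by (simp add: e scC_diff_right)
  then have "(- \<i>) *\<^sub>C \<i> *\<^sub>C (z - b) = (- \<i> * k) *\<^sub>C u" by (simp only: scC_scC)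
  then have k: "z - b = (- \<i> * k) *\<^sub>C u" by (simp add: scC_scC)
  have "z = (1/2) *\<^sub>C ((z + b) + (z - b))" "b = (1/2) *\<^sub>C ((z + b) - (z - b))"
    by (simp_all add: two_vec scC_scC)
  then have "z = (1/2 * (j + (- \<i> * k))) *\<^sub>C u" "b = (1/2 * (j - (- \<i> * k))) *\<^sub>C u"
    unfolding j k by (simp_all only: scC_add_left[symmetric] scC_diff_left[symmetric] scC_scC)
  then show "\<exists>k. wd (- \<i>) f x + Pf \<Lambda> (\<lambda>d. Qw d q) (- \<i>) l x \<cdot> f x = k *\<^sub>C u"
    "\<exists>k. wd \<i> f x + Pf \<Lambda> (\<lambda>d. Qw d q) \<i> (inverse l) x \<cdot> f x = k *\<^sub>C u"
    unfolding z_def b_def by blast+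
qed

end

lemma vconj_span: "vconj ` vec.span {l} = vec.span {vconj l}"
  unfolding span_singleton
proof (intro set_eqI iffI)
  fix v assume "v \<in> {k *\<^sub>C vconj l |k. True}"
  then obtain k where "v = k *\<^sub>C vconj l" by blast
  then have "v = vconj (cnj k *\<^sub>C l)" by simp
  then show "v \<in> vconj ` {k *\<^sub>C l |k. True}" by blast
qed auto

section \<open>The Baecklund transformation\<close>

locale backlund = cw_surface U \<Lambda> q for U \<Lambda> and q :: "'a::finite endo_form" +
  fixes \<alpha> :: complex and L :: "'a subbundle"
  assumes params: "backlund_parameters U \<Lambda> q \<alpha> L"
begin

abbreviation "R \<equiv> Rm \<Lambda>"
abbreviation "be \<equiv> inverse (cnj \<alpha>)"
definition "t0 = (\<alpha> - be) / (\<alpha> + be)"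
text \<open>\<open>EM\<close> and \<open>FM\<close> belong to the conjugate of \<open>L\<close>,
  \<open>EL\<close> and \<open>FL\<close> to \<open>L_tilde\<close>. Taken from the bundles, they
  are defined over all of \<open>U\<close>; the rank-one formulas hold where a section has been
  chosen.\<close>

definition "EM x = of_lin (proj_L (csc \<Lambda> x) (vconj ` L x))"
definition "FM x = of_lin (proj_rhoL (csc \<Lambda> x) (vconj ` L x))"
definition "EL x = of_lin (proj_L (csc \<Lambda> x) (L_tilde \<Lambda> \<alpha> L x))"
definition "FL x = of_lin (proj_rhoL (csc \<Lambda> x) (L_tilde \<Lambda> \<alpha> L x))"
definition "regular = UNIV - {\<alpha>, - \<alpha>, be, - be}"
definition "rm l x = Gam (EL x) (FL x) ((\<alpha> - l) / (\<alpha> + l)) * Gam (EM x) (FM x) ((l - be) / (l + be))"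
definition "rinf x = Gam (EL x) (FL x) (- 1)"

lemma \<alpha>: "\<alpha> \<noteq> 0" "norm \<alpha> \<noteq> 1" "be \<noteq> 0" "\<alpha> \<noteq> be" "\<alpha> \<noteq> - be"
proof -
  show 1: "\<alpha> \<noteq> 0" "norm \<alpha> \<noteq> 1" using params by (auto simp: backlund_parameters_def)
  then show "be \<noteq> 0" by simp
  have "\<alpha> \<noteq> c * be" if "norm c = 1" for c
  proof
    assume "\<alpha> = c * be"
    then have "norm \<alpha> = norm (c * be)" by (rule arg_cong)
    then have e: "norm \<alpha> = inverse (norm \<alpha>)" using that by (simp add: norm_mult norm_inverse)
    have "norm \<alpha> * norm \<alpha> = 1" by (subst (2) e) (simp add: 1)
    then have "norm \<alpha> = 1" by (metis norm_ge_zero abs_of_nonneg real_sqrt_abs2 real_sqrt_one)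
    then show False using 1 by simp
  qed
  from this[of 1] this[of "- 1"] show "\<alpha> \<noteq> be" "\<alpha> \<noteq> - be" by simp_all
qed

text \<open>Collects what a local section of \<open>L\<close> provides, so that vector formulas and
  the results of \<open>real_lines\<close> can be used near each point.\<close>

definition good :: "complex set \<Rightarrow> 'a sect \<Rightarrow> bool" where
  "good V l \<longleftrightarrow> open V \<and> V \<subseteq> U \<and> sm V l \<and> (\<forall>y\<in>V. L y = vec.span {l y} \<and> local_section L y V l \<and>
     EM y = Ef (R y) (vconj (l y)) \<and> FM y = Ff (R y) (vconj (l y)) \<and>
     EL y = Ef (R y) (GL (R y) (vconj (l y)) t0 \<cdot> l y) \<and> FL y = Ff (R y) (GL (R y) (vconj (l y)) t0 \<cdot> l y) \<and>
     real_lines (R y) (l y) (GL (R y) (vconj (l y)) t0 \<cdot> l y) (GL (R y) (l y) t0 \<cdot> vconj (l y)) \<alpha> t0 \<and>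
     (\<forall>k v. p_map (csc \<Lambda> y) \<alpha> (L_tilde \<Lambda> \<alpha> L y) k v = Gam (EL y) (FL y) ((\<alpha> - k) / (\<alpha> + k)) \<cdot> v) \<and>
     (\<forall>k v. q_map (csc \<Lambda> y) be (vconj ` L y) k v = Gam (EM y) (FM y) ((k - be) / (k + be)) \<cdot> v) \<and>
     (\<forall>v. p_map_inf (csc \<Lambda> y) (L_tilde \<Lambda> \<alpha> L y) v = Gam (EL y) (FL y) (- 1) \<cdot> v))"

lemma of_lin_app: "of_lin ((\<cdot>) A) = A"
  by (rule cmat_eqI) (simp add: app_of_lin)

lemma good_exists: assumes x: "x \<in> U" shows "\<exists>V l. x \<in> V \<and> good V l"
proof -
  have nb: "null_line_bundle U L" using params by (simp add: backlund_parameters_def)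
  obtain V l where V': "V \<subseteq> U" "local_section L x V l" "\<forall>y\<in>V. L y = vec.span {l y} \<and> form (l y) (l y) = 0"
    using nb x unfolding null_line_bundle_def by blast
  then have V: "V \<subseteq> U" "local_section L x V l" "\<And>y. y \<in> V \<Longrightarrow> L y = vec.span {l y}" "\<And>y. y \<in> V \<Longrightarrow> form (l y) (l y) = 0"
    by auto
  have ls: "open V" "x \<in> V" "sm V l" "\<And>y. y \<in> V \<Longrightarrow> l y \<noteq> 0"
    using V(2) by (auto simp: local_section_def smooth_on_eq_sm)
  have "good V l" unfolding good_def
  proof (intro conjI ballI ls V(1))
    fix y assume y: "y \<in> V"
    have yU: "y \<in> U" using y V(1) by auto
    show Ly: "L y = vec.span {l y}" by (rule V(3)[OF y])
    show "local_section L y V l"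
      using ls y by (auto simp: local_section_def smooth_on_eq_sm V(3) intro: vec.span_base)
    have refl: "refl_S (csc \<Lambda> y) v = R y \<cdot> v" for v by (rule refl_eq[OF yU])
    note R = Rm_props[OF yU]
    have nd: "refl_S (csc \<Lambda> y) ` L y \<inter> perp (L y) = {0}"
      "refl_S (csc \<Lambda> y) ` L_tilde \<Lambda> \<alpha> L y \<inter> perp (L_tilde \<Lambda> \<alpha> L y) = {0}"
      using params yU by (auto simp: backlund_parameters_def)
    have l1: "form (l y) (R y \<cdot> l y) \<noteq> 0"
      using nondegenerate_line[OF refl R(1) V(4)[OF y] ls(4)[OF y]] nd(1) unfolding Ly by blast
    let ?m = "vconj (l y)"
    have m0: "form ?m ?m = 0" by (simp add: form_vconj V(4)[OF y])
    have m1: "form ?m (R y \<cdot> ?m) \<noteq> 0"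
    proof -
      have "R y \<cdot> ?m = vconj (R y \<cdot> l y)" by (simp add: vconj_app R(3))
      then show ?thesis using l1 by (simp add: form_vconj)
    qed
    have npm: "null_pair (R y) (Ef (R y) ?m) (Ff (R y) ?m)" by (rule null_pair_EfFf[OF m0 m1 R(1,2)])
    have Mb: "vconj ` L y = vec.span {?m}" by (simp add: Ly vconj_span)
    let ?l = "GL (R y) ?m t0 \<cdot> l y"
    have t0nz: "t0 \<noteq> 0" using \<alpha> by (auto simp: t0_def eq_neg_iff_add_eq_0)
    have "q_map (csc \<Lambda> y) be (vec.span {?m}) \<alpha> = (\<cdot>) (GL (R y) ?m t0)"
      unfolding t0_def by (rule ext) (rule q_map_eq[OF refl R(1,2) m0 m1])
    then have Lt: "L_tilde \<Lambda> \<alpha> L y = vec.span {?l}"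
      unfolding L_tilde_def Mb unfolding Ly by (simp add: app_span)
    have lt0: "form ?l ?l = 0" using form_Gam_null[OF npm t0nz] V(4)[OF y] by simp
    have "?l \<noteq> 0"
    proof
      assume "?l = 0"
      then have "GL (R y) ?m (inverse t0) \<cdot> ?l = 0" by simp
      then show False using Gam_app_inverse(2)[OF npm t0nz] ls(4)[OF y] by simp
    qed
    then have lt1: "form ?l (R y \<cdot> ?l) \<noteq> 0"
      using nondegenerate_line[OF refl R(1) lt0] nd(2) unfolding Lt by blast
    have pr: "proj_L (csc \<Lambda> y) (vec.span {u}) = (\<cdot>) (Ef (R y) u)" "proj_rhoL (csc \<Lambda> y) (vec.span {u}) = (\<cdot>) (Ff (R y) u)"
      if "form u u = 0" "form u (R y \<cdot> u) \<noteq> 0" for u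
      using proj_L_eq[OF refl R(1,2) that] proj_rhoL_eq[OF refl R(1,2) that] by auto
    show EM: "EM y = Ef (R y) ?m" and FM: "FM y = Ff (R y) ?m" unfolding EM_def FM_def Mb pr[OF m0 m1] of_lin_app by auto
    show EL: "EL y = Ef (R y) ?l" and FL: "FL y = Ff (R y) ?l" unfolding EL_def FL_def Lt pr[OF lt0 lt1] of_lin_app by auto
    show "real_lines (R y) (l y) ?l (GL (R y) (l y) t0 \<cdot> ?m) \<alpha> t0"
      by standard (use R V(4)[OF y] l1 m0 m1 lt1 \<alpha> t0_def in auto)
    show "\<forall>k v. p_map (csc \<Lambda> y) \<alpha> (L_tilde \<Lambda> \<alpha> L y) k v = Gam (EL y) (FL y) ((\<alpha> - k) / (\<alpha> + k)) \<cdot> v"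
      unfolding Lt EL FL using p_map_eq[OF refl R(1,2) lt0 lt1] by blast
    show "\<forall>k v. q_map (csc \<Lambda> y) be (vconj ` L y) k v = Gam (EM y) (FM y) ((k - be) / (k + be)) \<cdot> v"
      unfolding Mb EM FM using q_map_eq[OF refl R(1,2) m0 m1] by blast
    show "\<forall>v. p_map_inf (csc \<Lambda> y) (L_tilde \<Lambda> \<alpha> L y) v = Gam (EL y) (FL y) (- 1) \<cdot> v"
      unfolding Lt EL FL using p_map_inf_eq[OF refl R(1,2) lt0 lt1] by blast
  qed
  then show ?thesis using ls(2) by blast
qed

lemma goodD:
  assumes "good V l"
  shows "open V" "V \<subseteq> U" "sm V l"
  using assms by (auto simp: good_def)

lemma good_at:
  assumes "good V l" "y \<in> V"
  shows "L y = vec.span {l y}" "local_section L y V l"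
     "EM y = Ef (R y) (vconj (l y))" "FM y = Ff (R y) (vconj (l y))"
     "EL y = Ef (R y) (Gam (EM y) (FM y) t0 \<cdot> l y)" "FL y = Ff (R y) (Gam (EM y) (FM y) t0 \<cdot> l y)"
     "real_lines (R y) (l y) (Gam (EM y) (FM y) t0 \<cdot> l y) (GL (R y) (l y) t0 \<cdot> vconj (l y)) \<alpha> t0"
     "p_map (csc \<Lambda> y) \<alpha> (L_tilde \<Lambda> \<alpha> L y) k v = Gam (EL y) (FL y) ((\<alpha> - k) / (\<alpha> + k)) \<cdot> v"
     "q_map (csc \<Lambda> y) be (vconj ` L y) k v = Gam (EM y) (FM y) ((k - be) / (k + be)) \<cdot> v"
     "p_map_inf (csc \<Lambda> y) (L_tilde \<Lambda> \<alpha> L y) v = Gam (EL y) (FL y) (- 1) \<cdot> v"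
proof -
  show 1: "EM y = Ef (R y) (vconj (l y))" "FM y = Ff (R y) (vconj (l y))" using assms by (auto simp: good_def)
  show "L y = vec.span {l y}" "local_section L y V l"
     "EL y = Ef (R y) (Gam (EM y) (FM y) t0 \<cdot> l y)" "FL y = Ff (R y) (Gam (EM y) (FM y) t0 \<cdot> l y)"
     "real_lines (R y) (l y) (Gam (EM y) (FM y) t0 \<cdot> l y) (GL (R y) (l y) t0 \<cdot> vconj (l y)) \<alpha> t0"
     "p_map (csc \<Lambda> y) \<alpha> (L_tilde \<Lambda> \<alpha> L y) k v = Gam (EL y) (FL y) ((\<alpha> - k) / (\<alpha> + k)) \<cdot> v"
     "q_map (csc \<Lambda> y) be (vconj ` L y) k v = Gam (EM y) (FM y) ((k - be) / (k + be)) \<cdot> v"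
     "p_map_inf (csc \<Lambda> y) (L_tilde \<Lambda> \<alpha> L y) v = Gam (EL y) (FL y) (- 1) \<cdot> v"
    unfolding 1 using assms by (auto simp: good_def)
qed

lemma np: assumes "x \<in> U" shows "null_pair (R x) (EM x) (FM x)" "null_pair (R x) (EL x) (FL x)"
proof -
  obtain V l where V: "x \<in> V" "good V l" using good_exists[OF assms] by blast
  interpret real_lines "R x" "l x" "Gam (EM x) (FM x) t0 \<cdot> l x" "GL (R x) (l x) t0 \<cdot> vconj (l x)" \<alpha> t0
    by (rule good_at(7)[OF V(2,1)])
  show "null_pair (R x) (EM x) (FM x)" "null_pair (R x) (EL x) (FL x)"
    using npm npl' good_at(3-6)[OF V(2,1)] by auto
qed

lemma sm_EfFf:
  assumes "open V" "V \<subseteq> U" "sm V u" "\<And>y. y \<in> V \<Longrightarrow> form (u y) (R y \<cdot> u y) \<noteq> 0"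
  shows "sm V (\<lambda>y. Ef (R y) (u y))" "sm V (\<lambda>y. Ff (R y) (u y))"
proof -
  have 1: "sm V (\<lambda>y. R y \<cdot> u y)" by (intro sm_app assms sm_subset[OF smRm])
  show "sm V (\<lambda>y. Ef (R y) (u y))" "sm V (\<lambda>y. Ff (R y) (u y))"
    unfolding Ef_def Ff_def by (intro sm_scC sm_inverse sm_form sm_tens 1 assms; assumption)+
qed

lemma smM: "sm U EM" "sm U FM"
proof -
  have "sm V EM \<and> sm V FM" if g: "good V l" for V l
  proof -
    note V = goodD[OF g]
    have nz: "form (vconj (l y)) (R y \<cdot> vconj (l y)) \<noteq> 0" if "y \<in> V" for y
      using good_at(7)[OF g that] unfolding real_lines_def two_lines_def by blast
    note s = sm_EfFf[OF V(1,2) sm_vconj[OF V(1,3)] nz]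
    have "sm V EM \<longleftrightarrow> sm V (\<lambda>y. Ef (R y) (vconj (l y)))" "sm V FM \<longleftrightarrow> sm V (\<lambda>y. Ff (R y) (vconj (l y)))"
      by (rule sm_cong[OF V(1)], rule good_at[OF g], assumption)+
    then show ?thesis using s by simp
  qed
  then show "sm U EM" "sm U FM" by (intro sm_local; metis good_exists)+
qed

lemma smL: "sm U EL" "sm U FL"
proof -
  have "sm V EL \<and> sm V FL" if g: "good V l" for V l
  proof -
    note V = goodD[OF g]
    have nz: "form (Gam (EM y) (FM y) t0 \<cdot> l y) (R y \<cdot> Gam (EM y) (FM y) t0 \<cdot> l y) \<noteq> 0" if "y \<in> V" for y
      using good_at(7)[OF g that] unfolding real_lines_def two_lines_def by blast
    have "sm V (\<lambda>y. Gam (EM y) (FM y) t0 \<cdot> l y)"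
      by (intro sm_app sm_Gam V sm_subset[OF smM(1)] sm_subset[OF smM(2)])
    note s = sm_EfFf[OF V(1,2) this nz]
    have "sm V EL \<longleftrightarrow> sm V (\<lambda>y. Ef (R y) (Gam (EM y) (FM y) t0 \<cdot> l y))"
      "sm V FL \<longleftrightarrow> sm V (\<lambda>y. Ff (R y) (Gam (EM y) (FM y) t0 \<cdot> l y))"
      by (rule sm_cong[OF V(1)], rule good_at[OF g], assumption)+
    then show ?thesis using s by simp
  qed
  then show "sm U EL" "sm U FL" by (intro sm_local; metis good_exists)+
qed

lemma sm_rm: "sm U (rm l)" "sm U rinf"
  unfolding rm_def[abs_def] rinf_def[abs_def] by (intro sm_mult_cmat sm_Gam openU smL smM)+

lemma rstar_eq: assumes "x \<in> U" shows "rstar \<Lambda> \<alpha> L l x = (\<cdot>) (rm l x)" "rstar_inf \<Lambda> \<alpha> L x = (\<cdot>) (rinf x)"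
proof -
  obtain V s where V: "x \<in> V" "good V s" using good_exists[OF assms] by blast
  show "rstar \<Lambda> \<alpha> L l x = (\<cdot>) (rm l x)" "rstar_inf \<Lambda> \<alpha> L x = (\<cdot>) (rinf x)"
    by (simp_all add: fun_eq_iff rstar_def rstar_inf_def good_at(8-10)[OF V(2,1)] rm_def rinf_def q_map_inf_def)
qed

lemma one_regular: "1 \<in> regular" "0 \<in> regular"
proof -
  show "0 \<in> regular" using \<alpha> by (auto simp: regular_def)
  have "(1::complex) \<noteq> z" "(1::complex) \<noteq> - z" if "norm z \<noteq> 1" for z :: complex
    using that by (metis norm_one, metis norm_minus_cancel norm_one)
  moreover have "norm be \<noteq> 1" using \<alpha> by (simp add: norm_inverse)
  ultimately show "1 \<in> regular" using \<alpha>(2) by (auto simp: regular_def)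
qed

lemma rm_facts: assumes "x \<in> U"
  shows "l \<in> regular \<Longrightarrow> adj (rm l x) * rm l x = 1" "l \<in> regular \<Longrightarrow> rm l x * adj (rm l x) = 1"
    "l \<in> regular \<Longrightarrow> l \<noteq> 0 \<Longrightarrow> mconj (adj (rm 1 x) * rm (inverse (cnj l)) x) = adj (rm 1 x) * rm l x"
    "mconj (adj (rm 1 x) * rinf x) = adj (rm 1 x) * rm 0 x"
proof -
  obtain V s where V: "x \<in> V" "good V s" using good_exists[OF assms] by blast
  interpret real_lines "R x" "s x" "Gam (EM x) (FM x) t0 \<cdot> s x" "GL (R x) (s x) t0 \<cdot> vconj (s x)" \<alpha> t0
    by (rule good_at(7)[OF V(2,1)])
  have rr: "rr k = rm k x" for k
    unfolding rr_def rm_def cc_def tc_def by (simp only: good_at(3-6)[OF V(2,1)])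
  have reg: "reg = regular" by (simp add: reg_def regular_def)
  have ri: "GL (R x) (Gam (EM x) (FM x) t0 \<cdot> s x) (- 1) = rinf x"
    by (simp add: rinf_def good_at(5,6)[OF V(2,1)])
  show "l \<in> regular \<Longrightarrow> adj (rm l x) * rm l x = 1" "l \<in> regular \<Longrightarrow> rm l x * adj (rm l x) = 1"
    "l \<in> regular \<Longrightarrow> l \<noteq> 0 \<Longrightarrow> mconj (adj (rm 1 x) * rm (inverse (cnj l)) x) = adj (rm 1 x) * rm l x"
    "mconj (adj (rm 1 x) * rinf x) = adj (rm 1 x) * rm 0 x"
    using rr_orth(1,2)[of l] reality[of l] reality_inf unfolding reg rr ri by auto
qed

text \<open>In the direction \<open>\<i>\<close> the pencil is polynomial in 1/\<lambda>, whence
  \<open>kd\<close>. Inverting both arguments of the Cayley factor changes its sign, whence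
  \<open>eps\<close>.\<close>

definition "eps d = (if d = - \<i> then 1 else - 1 :: complex)"
definition "kd d l = (if d = - \<i> then l else inverse l :: complex)"

lemma kd_simps: "d \<in> II \<Longrightarrow> eps (- d) = - eps d" "kd d 1 = 1" "l \<noteq> 0 \<Longrightarrow> kd d l \<noteq> 0"
  by (auto simp: eps_def kd_def II_def i_neq)

lemma kd_eq: "kd d l = kd d m \<longleftrightarrow> l = m" "kd d l = - kd d m \<longleftrightarrow> l = - m"
  by (auto simp: kd_def) (metis inverse_inverse_eq inverse_minus_eq)+

lemma kd_cayley: assumes "l \<noteq> 0" "u \<noteq> 0" shows "(u - l) / (u + l) = eps d * ((kd d u - kd d l) / (kd d u + kd d l))"
proof (cases "d = - \<i>")
  case False
  have "inverse u - inverse l = (inverse u * inverse l) * (l - u)" "inverse u + inverse l = (inverse u * inverse l) * (u + l)"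
    using assms by (simp_all add: field_simps)
  then have "(inverse u - inverse l) / (inverse u + inverse l) = (l - u) / (u + l)" using assms by simp
  then show ?thesis using False by (simp add: eps_def kd_def minus_divide_left)
qed (simp add: eps_def kd_def)

abbreviation "Pq d l x \<equiv> Pf \<Lambda> (\<lambda>d. Qw d q) d l x"

lemma Pq_conj: assumes "x \<in> U" "d \<in> II" shows "mconj (Pq d l x) = Pq (- d) (cnj l) x"
proof -
  have "cnj d = - d" using assms(2) by (auto simp: II_def)
  then show ?thesis using Q_conj[OF rw assms] N_conj[OF assms(1)] by (simp add: Pf_def Pl_def)
qed

lemma l_parallel: assumes g: "good V l" and y: "y \<in> V" and d: "d \<in> II"
  shows "\<exists>k. wd d l y + Pq d (kd d \<alpha>) y \<cdot> l y = k *\<^sub>C l y"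
proof -
  have yU: "y \<in> U" using goodD(2)[OF g] y by auto
  have ld: "l differentiable (at y)" by (rule sm_diff_at[OF goodD(3)[OF g] y])
  have "parallel_bundle U \<Lambda> q \<alpha> L" using params by (simp add: backlund_parameters_def)
  then have "conn \<Lambda> q \<alpha> l y X \<in> vec.span {l y}" for X
    using good_at(1,2)[OF g y] yU unfolding parallel_bundle_def by blast
  note c = conn_in_line[OF rw yU ld \<alpha>(1) this]
  show ?thesis by (rule II_cases[OF d]) (use c in \<open>simp_all add: kd_def i_neq\<close>)
qed

text \<open>Conjugation exchanges the two directions and sends \<lambda> to 1/cnj \<lambda>; so the
  conjugate line is parallel at \<open>be\<close>.\<close>

lemma m_parallel: assumes g: "good V l" and y: "y \<in> V" and d: "d \<in> II"
  shows "\<exists>k. wd d (\<lambda>z. vconj (l z)) y + Pq d (kd d be) y \<cdot> vconj (l y) = k *\<^sub>C vconj (l y)"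
proof -
  have yU: "y \<in> U" using goodD(2)[OF g] y by auto
  have ld: "l differentiable (at y)" by (rule sm_diff_at[OF goodD(3)[OF g] y])
  obtain k where k: "wd (- d) l y + Pq (- d) (kd (- d) \<alpha>) y \<cdot> l y = k *\<^sub>C l y" using l_parallel[OF g y II_neg[OF d]] by blast
  have cd: "cnj d = - d" and kk: "cnj (kd (- d) \<alpha>) = kd d be" using d by (auto simp: II_def kd_def i_neq)
  have "vconj (wd (- d) l y + Pq (- d) (kd (- d) \<alpha>) y \<cdot> l y) = vconj (k *\<^sub>C l y)" using k by (rule arg_cong)
  then have "wd d (\<lambda>z. vconj (l z)) y + Pq d (kd d be) y \<cdot> vconj (l y) = cnj k *\<^sub>C vconj (l y)"
    by (simp add: wd_vconj[OF ld] cd vconj_app Pq_conj[OF yU II_neg[OF d]] kk)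
  then show ?thesis by blast
qed

lemma par_from_line:
  assumes V: "open V" "x \<in> V" "V \<subseteq> U" and u: "sm V u" and E: "sm U E"
    and Eu: "\<And>y. y \<in> V \<Longrightarrow> E y = Ef (R y) (u y)" and u0: "\<And>y. y \<in> V \<Longrightarrow> form (u y) (R y \<cdot> u y) \<noteq> 0"
    and np: "\<And>y. y \<in> V \<Longrightarrow> null_pair (R y) (E y) (F y)"
    and par: "\<exists>k. wd d u x + P \<cdot> u x = k *\<^sub>C u x"
  shows "(1 - E x) * (P * E x + wd d E x) = 0"
proof -
  obtain k where k: "wd d u x + P \<cdot> u x = k *\<^sub>C u x" using par by blast
  have "E differentiable (at x)" using sm_diff_at[OF E] V by blast
  moreover have "E y \<cdot> u y = u y" if "y \<in> V" for y
    using u0[OF that] by (simp add: Eu[OF that] Ef_def scC_scC)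
  moreover have "\<exists>k. E x \<cdot> v = k *\<^sub>C u x" for v
    by (rule exI[of _ "inverse (form (u x) (R x \<cdot> u x)) * form v (R x \<cdot> u x)"]) (simp add: Eu[OF V(2)] Ef_def scC_scC)
  ultimately show ?thesis
    using parallel_projection[OF V(1,2) sm_diff_at[OF u V(2)] _ _ _ _ k] null_pairD(1)[OF np] by blast
qed

definition "G x = adj (rm 1 x)"
definition "Rs x = G x * R x * adj (G x)"
text \<open>The value of the normalised gauge at the end of the spectral line where
  \<open>kd d\<close> becomes 0: \<lambda> = 0 for \<open>- \<i>\<close> and \<lambda> = infinity
  for \<open>\<i>\<close>.\<close>

definition "K d x = G x * (Gam (EL x) (FL x) (eps d) * Gam (EM x) (FM x) (- eps d))"
definition "RR l x = G x * rm l x"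

lemma G_orth: "x \<in> U \<Longrightarrow> adj (G x) * G x = 1" "x \<in> U \<Longrightarrow> G x * adj (G x) = 1"
  using rm_facts(1,2)[OF _ one_regular(1)] by (simp_all add: G_def)

lemma smG: "sm U G"
  unfolding G_def[abs_def] by (intro sm_adj openU sm_rm)

lemma sm_RR: "sm U (RR l)"
  unfolding RR_def[abs_def] by (intro sm_mult_cmat openU smG sm_rm)

lemma regular_diff: "l \<in> regular \<Longrightarrow> \<alpha> - l \<noteq> 0 \<and> \<alpha> + l \<noteq> 0 \<and> l - be \<noteq> 0 \<and> l + be \<noteq> 0 \<and> l \<noteq> \<alpha> \<and> l \<noteq> - \<alpha> \<and> l \<noteq> be \<and> l \<noteq> - be"
  by (auto simp: regular_def eq_neg_iff_add_eq_0 add.commute)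

text \<open>The two dressings and the normalisation at \<lambda> = 1 combined. At \<lambda> = 1 the
  total gauge becomes the identity, so the new pencil is again one relative to d.\<close>

lemma final_half:
  assumes d: "d \<in> II"
  shows "\<exists>A B C. half d U Rs A B C (\<lambda>x. (\<cdot>) (K d x) ` Lm (- d) \<Lambda> x) (\<lambda>x. (\<cdot>) (K (- d) x) ` Lm d \<Lambda> x)
    \<and> (\<forall>x\<in>U. A x = K d x * Qw d q x * adj (K d x))
    \<and> (\<forall>x\<in>U. \<forall>l\<in>regular. l \<noteq> 0 \<longrightarrow> wd d (RR l) x + Pl (A x) (B x) (C x) (kd d l) * RR l x = RR l x * Pq d (kd d l) x)"
proof -
  let ?C0 = "\<lambda>x. - Qw d q x - Nw d \<Lambda> x"
  have P0: "Pl (Qw d q x) (Nw d \<Lambda> x) (?C0 x) l = Pq d l x" for x l by (simp add: Pf_def)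
  have kb: "kd d be \<noteq> 0" "kd d \<alpha> \<noteq> 0" using \<alpha> kd_simps(3) by auto
  have es: "- eps d = 1 \<or> - eps d = - 1" "eps d = 1 \<or> eps d = - 1" by (auto simp: eps_def)
  have d1: "dressing d U R (Qw d q) (Nw d \<Lambda>) ?C0 (Lm (- d) \<Lambda>) (Lm d \<Lambda>) EM FM (kd d be)"
  proof (intro dressing.intro half_cw[OF d] dressing_axioms.intro smM np kb)
    fix x assume x: "x \<in> U"
    obtain V l where V: "x \<in> V" "good V l" using good_exists[OF x] by blast
    note g = goodD[OF V(2)]
    have nz: "form (vconj (l y)) (R y \<cdot> vconj (l y)) \<noteq> 0" if "y \<in> V" for y
      using good_at(7)[OF V(2) that] unfolding real_lines_def two_lines_def by blast
    show "(1 - EM x) * (Pl (Qw d q x) (Nw d \<Lambda> x) (- Qw d q x - Nw d \<Lambda> x) (kd d be) * EM x + wd d EM x) = 0"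
      unfolding P0
      by (rule par_from_line[OF g(1) V(1) g(2) sm_vconj[OF g(1,3)] smM(1) good_at(3)[OF V(2)] nz _ m_parallel[OF V(2,1) d]])
        (use np(1) g(2) in blast)+
  qed
  obtain A1 B1 C1 where h1: "half d U R A1 B1 C1 (\<lambda>x. (\<cdot>) (Gam (EM x) (FM x) (- eps d)) ` Lm (- d) \<Lambda> x)
      (\<lambda>x. (\<cdot>) (Gam (EM x) (FM x) (- (- eps d))) ` Lm d \<Lambda> x)"
    and A1: "\<forall>x\<in>U. A1 x = Gam (EM x) (FM x) (- eps d) * Qw d q x * adj (Gam (EM x) (FM x) (- eps d))"
    and r1: "\<forall>x\<in>U. \<forall>l. l \<noteq> 0 \<longrightarrow> l \<noteq> kd d be \<longrightarrow> l \<noteq> - kd d be \<longrightarrow>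
        wd d (\<lambda>y. Gam (EM y) (FM y) (- eps d * ((kd d be - l) / (kd d be + l)))) x
          + Pl (A1 x) (B1 x) (C1 x) l * Gam (EM x) (FM x) (- eps d * ((kd d be - l) / (kd d be + l)))
        = Gam (EM x) (FM x) (- eps d * ((kd d be - l) / (kd d be + l))) * Pl (Qw d q x) (Nw d \<Lambda> x) (?C0 x) l"
    using signed_step[OF d1 es(1)] by blast
  \<comment> \<open>The first factor of \<open>rm\<close> is a q-map, whose scalar is minus the
    Cayley factor; hence the sign opposite to \<open>eps d\<close>.\<close>
  have tc: "- eps d * ((kd d be - kd d l) / (kd d be + kd d l)) = (l - be) / (l + be)" if "l \<noteq> 0" for l
  proof -
    have "- eps d * ((kd d be - kd d l) / (kd d be + kd d l)) = - ((be - l) / (be + l))"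
      using kd_cayley[OF that \<alpha>(3), of d] by simp
    then show ?thesis by (metis add.commute minus_diff_eq minus_divide_left)
  qed
  have rel1: "wd d (\<lambda>y. Gam (EM y) (FM y) ((l - be) / (l + be))) x
          + Pl (A1 x) (B1 x) (C1 x) (kd d l) * Gam (EM x) (FM x) ((l - be) / (l + be))
        = Gam (EM x) (FM x) ((l - be) / (l + be)) * Pq d (kd d l) x"
    if "x \<in> U" "l \<noteq> 0" "l \<noteq> be" "l \<noteq> - be" for x l
    using r1[rule_format, OF that(1), of "kd d l"] that kd_eq[of d l be] kd_simps(3)[OF that(2)]
    unfolding tc[OF that(2)] P0 by blast
  have d2: "dressing d U R A1 B1 C1 (\<lambda>x. (\<cdot>) (Gam (EM x) (FM x) (- eps d)) ` Lm (- d) \<Lambda> x)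
      (\<lambda>x. (\<cdot>) (Gam (EM x) (FM x) (- (- eps d))) ` Lm d \<Lambda> x) EL FL (kd d \<alpha>)"
  proof (intro dressing.intro h1 dressing_axioms.intro smL np kb)
    fix x assume x: "x \<in> U"
    obtain V l where V: "x \<in> V" "good V l" using good_exists[OF x] by blast
    note g = goodD[OF V(2)]
    let ?u = "\<lambda>y. Gam (EM y) (FM y) t0 \<cdot> l y"
    have nz: "form (?u y) (R y \<cdot> ?u y) \<noteq> 0" if "y \<in> V" for y
      using good_at(7)[OF V(2) that] unfolding real_lines_def two_lines_def by blast
    have sG: "sm U (\<lambda>y. Gam (EM y) (FM y) t0)" by (intro sm_Gam openU smM)
    have su: "sm V ?u" by (intro sm_app g sm_subset[OF sG])
    obtain k where k: "wd d l x + Pq d (kd d \<alpha>) x \<cdot> l x = k *\<^sub>C l x" using l_parallel[OF V(2,1) d] by blast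
    \<comment> \<open>\<open>t0\<close> is the scalar of the first factor at \<alpha>. Gauging the
      parallel section of \<open>L\<close> by it gives a parallel section of \<open>L_tilde\<close>
      for the once dressed pencil.\<close>
    have par: "\<exists>k. wd d ?u x + Pl (A1 x) (B1 x) (C1 x) (kd d \<alpha>) \<cdot> ?u x = k *\<^sub>C ?u x"
      using gauge_parallel[OF sm_diff_at[OF sG x] sm_diff_at[OF g(3) V(1)] rel1[OF x \<alpha>(1,4,5), folded t0_def] k] by blast
    show "(1 - EL x) * (Pl (A1 x) (B1 x) (C1 x) (kd d \<alpha>) * EL x + wd d EL x) = 0"
      by (rule par_from_line[OF g(1) V(1) g(2) su smL(1) good_at(5)[OF V(2)] nz _ par])
        (use np(2) g(2) in blast)+
  qed
  obtain A2 B2 C2 where h2: "half d U R A2 B2 C2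
      (\<lambda>x. (\<cdot>) (Gam (EL x) (FL x) (eps d)) ` ((\<cdot>) (Gam (EM x) (FM x) (- eps d)) ` Lm (- d) \<Lambda> x))
      (\<lambda>x. (\<cdot>) (Gam (EL x) (FL x) (- eps d)) ` ((\<cdot>) (Gam (EM x) (FM x) (- (- eps d))) ` Lm d \<Lambda> x))"
    and A2: "\<forall>x\<in>U. A2 x = Gam (EL x) (FL x) (eps d) * A1 x * adj (Gam (EL x) (FL x) (eps d))"
    and r2: "\<forall>x\<in>U. \<forall>l. l \<noteq> 0 \<longrightarrow> l \<noteq> kd d \<alpha> \<longrightarrow> l \<noteq> - kd d \<alpha> \<longrightarrow>
        wd d (\<lambda>y. Gam (EL y) (FL y) (eps d * ((kd d \<alpha> - l) / (kd d \<alpha> + l)))) x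
          + Pl (A2 x) (B2 x) (C2 x) l * Gam (EL x) (FL x) (eps d * ((kd d \<alpha> - l) / (kd d \<alpha> + l)))
        = Gam (EL x) (FL x) (eps d * ((kd d \<alpha> - l) / (kd d \<alpha> + l))) * Pl (A1 x) (B1 x) (C1 x) l"
    using signed_step[OF d2 es(2)] by blast
  have rel2: "wd d (\<lambda>y. Gam (EL y) (FL y) ((\<alpha> - l) / (\<alpha> + l))) x
          + Pl (A2 x) (B2 x) (C2 x) (kd d l) * Gam (EL x) (FL x) ((\<alpha> - l) / (\<alpha> + l))
        = Gam (EL x) (FL x) ((\<alpha> - l) / (\<alpha> + l)) * Pl (A1 x) (B1 x) (C1 x) (kd d l)"
    if "x \<in> U" "l \<noteq> 0" "l \<noteq> \<alpha>" "l \<noteq> - \<alpha>" for x l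
    using r2[rule_format, OF that(1), of "kd d l"] that kd_eq[of d l \<alpha>] kd_simps(3)[OF that(2)]
    unfolding kd_cayley[OF that(2) \<alpha>(1), of d, symmetric] by blast
  let ?A = "\<lambda>x. G x * A2 x * adj (G x)" and ?B = "\<lambda>x. G x * B2 x * adj (G x)" and ?C = "\<lambda>x. G x * C2 x * adj (G x) - wd d G x * adj (G x)"
  have h3: "half d U Rs ?A ?B ?C (\<lambda>x. (\<cdot>) (K d x) ` Lm (- d) \<Lambda> x) (\<lambda>x. (\<cdot>) (K (- d) x) ` Lm d \<Lambda> x)"
    by (rule half_cong[OF half_const_gauge[OF h2 smG G_orth Rs_def]])
      (simp_all add: K_def image_image kd_simps(1)[OF d])
  have A3: "\<forall>x\<in>U. ?A x = K d x * Qw d q x * adj (K d x)"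
    using A1 A2 by (simp add: K_def mult.assoc)
  have rel: "wd d (RR l) x + Pl (?A x) (?B x) (?C x) (kd d l) * RR l x = RR l x * Pq d (kd d l) x"
    if x: "x \<in> U" and l: "l \<in> regular" "l \<noteq> 0" for x l
  proof -
    note ln = regular_diff[OF l(1)]
    let ?GL = "\<lambda>y. Gam (EL y) (FL y) ((\<alpha> - l) / (\<alpha> + l))" and ?GM = "\<lambda>y. Gam (EM y) (FM y) ((l - be) / (l + be))"
    have df: "G differentiable (at x)" "?GL differentiable (at x)" "?GM differentiable (at x)"
      using sm_diff_at[OF smG x] sm_diff_at[OF sm_Gam[OF openU smL] x] sm_diff_at[OF sm_Gam[OF openU smM] x] by auto
    have RR: "RR l = (\<lambda>y. G y * (?GL y * ?GM y))" by (simp add: RR_def rm_def fun_eq_iff)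
    have w: "wd d (RR l) x = wd d G x * (?GL x * ?GM x) + G x * (wd d ?GL x * ?GM x + ?GL x * wd d ?GM x)"
      unfolding RR using df by (simp add: wd_mult differentiable_cbil[OF cbil_mult_cmat])
    have GG: "adj (G x) * (G x * T) = T" for T using G_orth(1)[OF x] by (simp add: mult.assoc[symmetric])
    have "wd d (RR l) x + Pl (?A x) (?B x) (?C x) (kd d l) * RR l x
       = G x * ((wd d ?GL x + Pl (A2 x) (B2 x) (C2 x) (kd d l) * ?GL x) * ?GM x + ?GL x * wd d ?GM x)"
      unfolding w Pl_conj unfolding RR by (simp add: left_diff_distrib distrib_left distrib_right mult.assoc GG)
    also have "\<dots> = G x * (?GL x * (wd d ?GM x + Pl (A1 x) (B1 x) (C1 x) (kd d l) * ?GM x))"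
      unfolding rel2[OF x l(2) ln[THEN conjunct2, THEN conjunct2, THEN conjunct2, THEN conjunct2, THEN conjunct1] ln[THEN conjunct2, THEN conjunct2, THEN conjunct2, THEN conjunct2, THEN conjunct2, THEN conjunct1]]
      by (simp add: distrib_left mult.assoc add.commute)
    also have "\<dots> = RR l x * Pq d (kd d l) x"
      using rel1[OF x l(2)] ln unfolding RR by (simp add: mult.assoc)
    finally show ?thesis .
  qed
  show ?thesis using h3 A3 rel by (intro exI[of _ ?A] exI[of _ ?B] exI[of _ ?C]) blast
qed

end

lemma cnj_fixed_real: "cnj z = z \<Longrightarrow> z = of_real (Re z)"
  by (simp add: complex_eq_iff)

text \<open>A real vector orthogonal to a real null line is spacelike or lies on the line. This is
  the source of the positivity of the metric on the transform.\<close>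

lemma lorentz_orthogonal:
  fixes s v :: "'n::finite cvec"
  assumes "vconj s = s" "vconj v = v" "form s s = 0" "s \<noteq> 0" "form v s = 0"
  shows "\<exists>r\<ge>0. form v v = of_real r \<and> (r = 0 \<longrightarrow> v \<in> vec.span {s})"
proof -
  define a b where "a i = Re (s $ i)" and "b i = Re (v $ i)" for i
  have s: "s $ i = of_real (a i)" for i
    using assms(1) by (simp add: a_def vconj_def vec_eq_iff complex_eq_iff)
  have v: "v $ i = of_real (b i)" for i
    using assms(2) by (simp add: b_def vconj_def vec_eq_iff complex_eq_iff)
  have f: "form u w = of_real ((\<Sum>i\<in>UNIV. c (Some i) * e (Some i)) - c None * e None)"
    if "\<And>i. u $ i = of_real (c i)" "\<And>i. w $ i = of_real (e i)" for u w :: "'n cvec" and c e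
    by (simp add: form_def that)
  have ss: "(\<Sum>i\<in>UNIV. a (Some i) * a (Some i)) = a None * a None"
    using assms(3) unfolding f[OF s s] of_real_eq_0_iff by simp
  have vs: "(\<Sum>i\<in>UNIV. b (Some i) * a (Some i)) = b None * a None"
    using assms(5) unfolding f[OF v s] of_real_eq_0_iff by simp
  have a0: "a None \<noteq> 0"
  proof
    assume z: "a None = 0"
    have "a (Some i) * a (Some i) = 0" for i
      using ss z sum_nonneg_eq_0_iff[of UNIV "\<lambda>i. a (Some i) * a (Some i)"] by simp
    then have "a i = 0" for i using z by (cases i) auto
    then have "s = 0" by (simp add: vec_eq_iff s)
    then show False using assms(4) by simp
  qed
  \<comment> \<open>Subtracting \<open>k\<close> times the null vector removes the time coordinate
    without changing the length, which becomes a sum of squares.\<close>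
  define k where "k = b None / a None"
  define r where "r = (\<Sum>i\<in>UNIV. (b (Some i) - k * a (Some i)) * (b (Some i) - k * a (Some i)))"
  have r0: "r \<ge> 0" unfolding r_def by (intro sum_nonneg) simp
  have "r = (\<Sum>i\<in>UNIV. b (Some i) * b (Some i)) - 2 * k * (\<Sum>i\<in>UNIV. b (Some i) * a (Some i)) + k * k * (\<Sum>i\<in>UNIV. a (Some i) * a (Some i))"
    unfolding r_def sum_distrib_left sum_subtractf[symmetric] sum.distrib[symmetric]
    by (intro sum.cong refl) (simp add: algebra_simps)
  also have "\<dots> = (\<Sum>i\<in>UNIV. b (Some i) * b (Some i)) - b None * b None"
    unfolding ss vs using a0 by (simp add: k_def)
  finally have "form v v = of_real r" using f[OF v v] by simp
  moreover have "v \<in> vec.span {s}" if "r = 0"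
  proof -
    have "(b (Some i) - k * a (Some i)) * (b (Some i) - k * a (Some i)) = 0" for i
      using that sum_nonneg_eq_0_iff[of UNIV "\<lambda>i. (b (Some i) - k * a (Some i)) * (b (Some i) - k * a (Some i))"] by (simp add: r_def)
    then have "b i = k * a i" for i using a0 by (cases i) (auto simp: k_def)
    then have "v = of_real k *\<^sub>C s" by (simp add: vec_eq_iff s v)
    then show ?thesis unfolding span_singleton by blast
  qed
  ultimately show ?thesis using r0 by blast
qed

lemma span_orth: assumes "v \<in> vec.span B" "\<And>b. b \<in> B \<Longrightarrow> form b u = 0" shows "form v u = 0"
  using assms(1) by (induction rule: vec.span_induct_alt) (auto simp: smult_eq_scC assms(2))

text \<open>An invertible solution of the two intertwining equations has commuting second
  derivatives; writing them out conjugates one curvature into the other.\<close>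

lemma curvature_transfer:
  fixes X :: "complex \<Rightarrow> 'n::finite omat"
  assumes U: "open U" "x \<in> U" and X: "sm U X"
    and d: "P differentiable (at x)" "Q differentiable (at x)" "P' differentiable (at x)" "Q' differentiable (at x)"
    and z: "\<And>y. y \<in> U \<Longrightarrow> wd (- \<i>) X y + P' y * X y = X y * P y"
    and b: "\<And>y. y \<in> U \<Longrightarrow> wd \<i> X y + Q' y * X y = X y * Q y"
    and inv: "X x * H = 1"
    and flat: "wd (- \<i>) Q x - wd \<i> P x + (P x * Q x - Q x * P x) = 0"
  shows "wd (- \<i>) Q' x - wd \<i> P' x + (P' x * Q' x - Q' x * P' x) = 0"
proof -
  have Xd: "X differentiable (at x)" by (rule sm_diff_at[OF X U(2)])
  note di = Xd d differentiable_cbil[OF cbil_mult_cmat]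
  have Xz: "wd (- \<i>) X x = X x * P x - P' x * X x" and Xb: "wd \<i> X x = X x * Q x - Q' x * X x"
    using z[OF U(2)] b[OF U(2)] by (simp_all add: eq_diff_eq)
  have "wd \<i> (wd (- \<i>) X) x = wd \<i> (\<lambda>y. X y * P y - P' y * X y) x"
    by (rule wd_cong_open[OF U]) (use z in \<open>simp add: eq_diff_eq\<close>)
  then have 1: "wd \<i> (wd (- \<i>) X) x = (X x * Q x - Q' x * X x) * P x + X x * wd \<i> P x - (wd \<i> P' x * X x + P' x * (X x * Q x - Q' x * X x))"
    by (simp add: wd_diff wd_mult di Xb)
  have "wd (- \<i>) (wd \<i> X) x = wd (- \<i>) (\<lambda>y. X y * Q y - Q' y * X y) x"
    by (rule wd_cong_open[OF U]) (use b in \<open>simp add: eq_diff_eq\<close>)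
  then have 2: "wd (- \<i>) (wd \<i> X) x = (X x * P x - P' x * X x) * Q x + X x * wd (- \<i>) Q x - (wd (- \<i>) Q' x * X x + Q' x * (X x * P x - P' x * X x))"
    by (simp add: wd_diff wd_mult di Xz)
  have "wd (- \<i>) (wd \<i> X) x - wd \<i> (wd (- \<i>) X) x = X x * (wd (- \<i>) Q x - wd \<i> P x + (P x * Q x - Q x * P x))
     - (wd (- \<i>) Q' x - wd \<i> P' x + (P' x * Q' x - Q' x * P' x)) * X x"
    unfolding 1 2 by (simp add: algebra_simps)
  then have "(wd (- \<i>) Q' x - wd \<i> P' x + (P' x * Q' x - Q' x * P' x)) * X x = 0"
    unfolding flat using wd_commute[OF U X, of "- \<i>" \<i>] by simp
  then have "(wd (- \<i>) Q' x - wd \<i> P' x + (P' x * Q' x - Q' x * P' x)) * (X x * H) = 0"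
    by (simp add: mult.assoc[symmetric])
  then show ?thesis by (simp add: inv)
qed

context backlund
begin

definition "As d x = K d x * Qw d q x * adj (K d x)"
definition "Wt d x = (\<cdot>) (K (- d) x) ` Lm d \<Lambda> x"
abbreviation "Ls \<equiv> backlund_transform \<Lambda> \<alpha> L"
abbreviation "qs \<equiv> backlund_multiplier \<Lambda> q \<alpha> L"

definition hB :: "complex \<Rightarrow> (complex \<Rightarrow> 'a omat) \<Rightarrow> bool" where
  "hB d B \<longleftrightarrow> half d U Rs (As d) B (\<lambda>x. - As d x - B x) (Wt (- d)) (Wt d)
    \<and> (\<forall>x\<in>U. \<forall>l\<in>regular. l \<noteq> 0 \<longrightarrow> wd d (RR l) x + Pl (As d x) (B x) (- As d x - B x) (kd d l) * RR l x = RR l x * Pq d (kd d l) x)"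

text \<open>Since \<open>RR 1\<close> is the identity, the new pencil vanishes at parameter 1. This
  forces its coefficient of order zero to be \<open>- As d x - B x\<close>.\<close>

lemma hB_exists: assumes d: "d \<in> II" shows "\<exists>B. hB d B"
proof -
  obtain A B C where h: "half d U Rs A B C (\<lambda>x. (\<cdot>) (K d x) ` Lm (- d) \<Lambda> x) (\<lambda>x. (\<cdot>) (K (- d) x) ` Lm d \<Lambda> x)"
    and A: "\<forall>x\<in>U. A x = K d x * Qw d q x * adj (K d x)"
    and rel: "\<forall>x\<in>U. \<forall>l\<in>regular. l \<noteq> 0 \<longrightarrow> wd d (RR l) x + Pl (A x) (B x) (C x) (kd d l) * RR l x = RR l x * Pq d (kd d l) x"
    using final_half[OF d] by blast
  have RR1: "RR 1 x = 1" if "x \<in> U" for x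
    using rm_facts(1)[OF that one_regular(1)] by (simp add: RR_def G_def)
  have C: "C x = - As d x - B x" if x: "x \<in> U" for x
  proof -
    have "wd d (RR 1) x = wd d (\<lambda>_. 1) x" by (rule wd_cong_open[OF openU x RR1])
    then have "Pl (A x) (B x) (C x) 1 = Pq d 1 x"
      using rel[rule_format, OF x one_regular(1)] by (simp add: RR1[OF x] kd_simps(2))
    then have "A x + B x + C x = 0" by (simp add: Pl_def Pf_def)
    then have "C x = - (A x + B x)" by (metis eq_neg_iff_add_eq_0 add.commute)
    moreover have "A x = As d x" using A x by (simp add: As_def)
    ultimately show ?thesis by simp
  qed
  have "half d U Rs (As d) B (\<lambda>x. - As d x - B x) (Wt (- d)) (Wt d)"
    by (rule half_cong[OF h]) (use A C in \<open>auto simp: As_def Wt_def\<close>)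
  moreover have "\<forall>x\<in>U. \<forall>l\<in>regular. l \<noteq> 0 \<longrightarrow> wd d (RR l) x + Pl (As d x) (B x) (- As d x - B x) (kd d l) * RR l x = RR l x * Pq d (kd d l) x"
    using rel A C by (simp add: As_def)
  ultimately show ?thesis unfolding hB_def by blast
qed

text \<open>An arbitrary choice suffices: \<open>Nw_Ls\<close> later identifies it with the
  coefficient of N of the transform.\<close>

definition "Bs d = (SOME B. hB d B)"

lemma hBs: "d \<in> II \<Longrightarrow> hB d (Bs d)"
  unfolding Bs_def using hB_exists by (rule someI_ex)

lemma halfs: "d \<in> II \<Longrightarrow> half d U Rs (As d) (Bs d) (\<lambda>x. - As d x - Bs d x) (Wt (- d)) (Wt d)"
  using hBs by (simp add: hB_def)

lemma K_orth: assumes x: "x \<in> U" and d: "d \<in> II" shows "adj (K d x) * K d x = 1" "K d x * adj (K d x) = 1"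
proof -
  have e: "eps d \<noteq> 0" "inverse (eps d) = eps d" "inverse (- eps d) = - eps d" by (auto simp: eps_def)
  note a = Gam_adj[OF np(1)[OF x]] Gam_adj[OF np(2)[OF x]]
  have i: "Gam (EM x) (FM x) (- eps d) * Gam (EM x) (FM x) (- eps d) = 1" "Gam (EL x) (FL x) (eps d) * Gam (EL x) (FL x) (eps d) = 1"
    using Gam_inverse(1)[OF np(1)[OF x], of "- eps d"] Gam_inverse(1)[OF np(2)[OF x], of "eps d"] e by simp_all
  have i': "Gam (EM x) (FM x) (- eps d) * (Gam (EM x) (FM x) (- eps d) * T) = T" "Gam (EL x) (FL x) (eps d) * (Gam (EL x) (FL x) (eps d) * T) = T"
    "adj (G x) * (G x * T) = T" "G x * adj (G x) = 1" for T
    using i G_orth[OF x] by (simp_all add: mult.assoc[symmetric])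
  show "adj (K d x) * K d x = 1" "K d x * adj (K d x) = 1"
    by (simp_all add: K_def a e i i' mult.assoc)
qed

lemma Lm_null: assumes x: "x \<in> U" and d: "d \<in> II" and v: "v \<in> Lm d \<Lambda> x" and w: "w \<in> Lm d \<Lambda> x" shows "form v w = 0"
proof -
  obtain V \<sigma> where VV: "x \<in> V" "frame \<Lambda> V \<sigma>" using frames[OF x] by blast
  interpret frame \<Lambda> V \<sigma> by (rule VV(2))
  obtain k j where w': "w = k *\<^sub>C \<sigma> x + j *\<^sub>C sd d x" using w unfolding Lm_eq[OF VV(1) d] using span2 by blast
  show ?thesis using v unfolding Lm_iff[OF VV(1) d] by (simp add: w')
qed

lemma Wt_facts: assumes x: "x \<in> U" and d: "d \<in> II" and v: "v \<in> Wt d x"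
  shows "Rs x \<cdot> v = v" "w \<in> Wt d x \<Longrightarrow> form v w = 0" "As (- d) x \<cdot> v = 0" "Bs (- d) x \<cdot> v = 0"
proof -
  interpret half "- d" U Rs "As (- d)" "Bs (- d)" "\<lambda>x. - As (- d) x - Bs (- d) x" "Wt (- (- d))" "Wt (- d)"
    by (rule halfs[OF II_neg[OF d]])
  show "Rs x \<cdot> v = v" "As (- d) x \<cdot> v = 0" "Bs (- d) x \<cdot> v = 0"
    using W_R[OF x, of v] A_W[OF x, of v] B_W[OF x, of v] v by simp_all
  show "form v w = 0" if ww: "w \<in> Wt d x"
  proof -
    obtain v' where "v = K (- d) x \<cdot> v'" "v' \<in> Lm d \<Lambda> x" using v unfolding Wt_def by blast
    moreover obtain w' where "w = K (- d) x \<cdot> w'" "w' \<in> Lm d \<Lambda> x" using ww unfolding Wt_def by blast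
    moreover have "adj (K (- d) x) \<cdot> K (- d) x \<cdot> w' = w'" using K_orth(1)[OF x II_neg[OF d]] by (metis app_ring(2,6))
    ultimately show ?thesis using Lm_null[OF x d] by (simp add: adj_app)
  qed
qed

lemma inv_matrix: assumes "adj A * A = 1" "A * adj A = 1" shows "inv ((\<cdot>) A) = (\<cdot>) (adj A)"
proof (rule inv_equality)
  show "adj A \<cdot> A \<cdot> v = v" "A \<cdot> adj A \<cdot> v = v" for v using assms by (metis app_ring(2,6))+
qed

lemma inv_rstar: "x \<in> U \<Longrightarrow> inv (rstar \<Lambda> \<alpha> L 1 x) = (\<cdot>) (G x)"
  using inv_matrix[OF rm_facts(1,2)[OF _ one_regular(1) ]] by (simp add: rstar_eq G_def one_regular)

lemma K_eq: "K \<i> x = G x * rinf x" "K (- \<i>) x = G x * rm 0 x"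
  using \<alpha> by (simp_all add: K_def eps_def i_neq rinf_def rm_def)

lemma Ls_eq: assumes "x \<in> U" shows "Ls x = Wt (- \<i>) x \<inter> Wt \<i> x"
proof -
  have "(\<lambda>v. G x \<cdot> A \<cdot> v) = (\<cdot>) (G x * A)" for A by auto
  then show ?thesis
    unfolding backlund_transform_def backlund_10_def backlund_01_def inv_rstar[OF assms]
    unfolding rstar_eq[OF assms]
    by (simp add: o_def Wt_def K_eq Lm_def i_neq)
qed

text \<open>The section lies in both planes, so the coefficients annihilating
  \<open>Wt (- d)\<close> kill it. The stability of \<open>Wt d\<close> under \<open>d + C\<close>
  then speaks about the plain derivative.\<close>

lemma section_Wt:
  assumes V: "open V" "x \<in> V" "V \<subseteq> U" and s: "s differentiable (at x)" and sL: "\<And>y. y \<in> V \<Longrightarrow> s y \<in> Ls y" and d: "d \<in> II"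
  shows "s x \<in> Wt d x" "wd d s x \<in> Wt d x"
proof -
  have sW: "s y \<in> Wt d y" if "y \<in> V" "d \<in> II" for y d
    using sL[OF that(1)] Ls_eq[of y] that V(3) by (auto elim: II_cases)
  show "s x \<in> Wt d x" by (rule sW[OF V(2) d])
  interpret half d U Rs "As d" "Bs d" "\<lambda>x. - As d x - Bs d x" "Wt (- d)" "Wt d" by (rule halfs[OF d])
  have x: "x \<in> U" using V by auto
  have "As d x \<cdot> s x = 0" "Bs d x \<cdot> s x = 0"
    using A_W[OF x sW[OF V(2) II_neg[OF d]]] B_W[OF x sW[OF V(2) II_neg[OF d]]] by auto
  moreover have "wd d s x + (- As d x - Bs d x) \<cdot> s x \<in> Wt d x"
    by (rule stab[OF V s sW[OF _ d]])
  ultimately show "wd d s x \<in> Wt d x" by simp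
qed

lemma Rs_props: "x \<in> U \<Longrightarrow> Rs x * Rs x = 1" "x \<in> U \<Longrightarrow> adj (Rs x) = Rs x" "sm U Rs"
proof -
  interpret half "\<i>" U Rs "As \<i>" "Bs \<i>" "\<lambda>x. - As \<i> x - Bs \<i> x" "Wt (- \<i>)" "Wt \<i>" by (rule halfs) (simp add: II_def)
  show "x \<in> U \<Longrightarrow> Rs x * Rs x = 1" "x \<in> U \<Longrightarrow> adj (Rs x) = Rs x" "sm U Rs" by (rule RR adjR smR; assumption?)+
qed

end

section \<open>The transformed surface\<close>

locale transform = backlund U \<Lambda> q \<alpha> L for U \<Lambda> and q :: "'a::finite endo_form" and \<alpha> L +
  assumes imm: "immerses U (backlund_transform \<Lambda> \<alpha> L)"
begin

lemma real_wd: assumes "open V" "x \<in> V" "s differentiable (at x)" "\<And>y. y \<in> V \<Longrightarrow> vconj (s y) = s y"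
  shows "vconj (dv s x X) = dv s x X"
proof -
  have "dv (\<lambda>y. vconj (s y)) x X = dv s x X" by (rule dv_cong_open[OF assms(1,2,4)])
  then show ?thesis using dv_blinear[OF bounded_linear_vconj assms(3)] by metis
qed

text \<open>Conformality comes from isotropy: the z-derivative lies in \<open>Wt (- \<i>)\<close>
  and is null, so the coordinate derivatives are orthogonal of equal length, and the Lorentz
  signature makes that length nonnegative.\<close>

lemma section_metric:
  assumes V: "open V" "x \<in> V" "V \<subseteq> U" and s: "s differentiable (at x)" and sL: "\<And>y. y \<in> V \<Longrightarrow> s y \<in> Ls y"
    and re: "\<And>y. y \<in> V \<Longrightarrow> vconj (s y) = s y" and nz: "s x \<noteq> 0"
  shows "\<exists>r\<ge>0. form (dv s x 1) (dv s x 1) = of_real r \<and> form (dv s x \<i>) (dv s x \<i>) = of_real r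
     \<and> form (dv s x 1) (dv s x \<i>) = 0 \<and> (r = 0 \<longrightarrow> dv s x 1 \<in> vec.span {s x})"
    and "form (wd (- \<i>) s x) (wd (- \<i>) s x) = 0" "form (s x) (s x) = 0"
proof -
  have II: "\<i> \<in> II" "- \<i> \<in> II" by (simp_all add: II_def)
  have x: "x \<in> U" using V by auto
  have W: "s x \<in> Wt d x" "wd d s x \<in> Wt d x" if "d \<in> II" for d
    using section_Wt[OF V s _ that] sL by blast+
  show 0: "form (wd (- \<i>) s x) (wd (- \<i>) s x) = 0" "form (s x) (s x) = 0"
    using Wt_facts(2)[OF x II(2) W(2)[OF II(2)] W(2)[OF II(2)]] Wt_facts(2)[OF x II(2) W(1)[OF II(2)] W(1)[OF II(2)]] by auto
  let ?a = "dv s x 1" and ?b = "dv s x \<i>"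
  have rl: "vconj ?a = ?a" "vconj ?b = ?b" "vconj (s x) = s x"
    using real_wd[OF V(1,2) s re] re[OF V(2)] by auto
  have rf: "cnj (form u v) = form u v" if "vconj u = u" "vconj v = v" for u v :: "'a cvec"
    using form_vconj[of u v] that by simp
  obtain A B C where ABC: "form ?a ?a = of_real A" "form ?b ?b = of_real B" "form ?a ?b = of_real C"
    using cnj_fixed_real[OF rf[OF rl(1,1)]] cnj_fixed_real[OF rf[OF rl(2,2)]] cnj_fixed_real[OF rf[OF rl(1,2)]] by blast
  have "4 * form (wd (- \<i>) s x) (wd (- \<i>) s x) = form ?a ?a - form ?b ?b - 2 * \<i> * form ?a ?b"
    by (simp add: wd_def form_sym[of ?b ?a] algebra_simps)
  then have "of_real A - of_real B - 2 * \<i> * of_real C = (0 :: complex)" unfolding 0 ABC by simp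
  then have AB: "A = B" "C = 0" by (simp_all add: complex_eq_iff)
  have fs: "form (wd d s x) (s x) = 0" if "d \<in> II" for d
    by (rule Wt_facts(2)[OF x that W(2)[OF that] W(1)[OF that]])
  have "?a = wd (- \<i>) s x + wd \<i> s x" using dv_wd[OF s, of 1] by simp
  then have "form ?a (s x) = 0" using fs II by simp
  from lorentz_orthogonal[OF rl(3,1) 0(2) nz this]
  obtain r where "r \<ge> 0" "form ?a ?a = of_real r" "r = 0 \<longrightarrow> ?a \<in> vec.span {s x}" by blast
  then show "\<exists>r\<ge>0. form ?a ?a = of_real r \<and> form ?b ?b = of_real r \<and> form ?a ?b = 0 \<and> (r = 0 \<longrightarrow> ?a \<in> vec.span {s x})"
    using ABC AB by (intro exI[of _ r]) simp
qed

lemma Ls_frame: assumes x: "x \<in> U" shows "\<exists>V \<sigma>. x \<in> V \<and> V \<subseteq> U \<and> frame Ls V \<sigma>"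
proof -
  obtain V \<sigma> where V: "V \<subseteq> U" "local_section Ls x V \<sigma>"
    "\<forall>y\<in>V. Ls y = vec.span {\<sigma> y} \<and> \<sigma> y \<in> real_vecs \<and> form (\<sigma> y) (\<sigma> y) = 0 \<and>
      (\<forall>X. X \<noteq> 0 \<longrightarrow> dd \<sigma> y X \<notin> vec.span {\<sigma> y})"
    using imm[unfolded immerses_def] x by blast
  have ls: "open V" "x \<in> V" "sm V \<sigma>" "\<And>y. y \<in> V \<Longrightarrow> \<sigma> y \<noteq> 0" "\<And>y. y \<in> V \<Longrightarrow> \<sigma> y \<in> Ls y"
    using V(2) by (auto simp: local_section_def smooth_on_eq_sm)
  have re: "vconj (\<sigma> y) = \<sigma> y" if "y \<in> V" for y using V(3) that by (auto simp: real_vecs_def)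
  have "frame Ls V \<sigma>"
  proof (intro frame.intro line_frame.intro frame_axioms.intro)
    fix y assume y: "y \<in> V"
    show "Ls y = vec.span {\<sigma> y}" "\<sigma> y \<noteq> 0" "vconj (\<sigma> y) = \<sigma> y" "form (\<sigma> y) (\<sigma> y) = 0"
      using V(3) y ls(4) re by auto
    note m = section_metric[OF ls(1) y V(1) sm_diff_at[OF ls(3) y] ls(5) re ls(4)[OF y]]
    show "form (wd (- \<i>) \<sigma> y) (wd (- \<i>) \<sigma> y) = 0" by (rule m(2))
    obtain r where r: "r \<ge> 0" "form (dv \<sigma> y 1) (dv \<sigma> y 1) = of_real r" "form (dv \<sigma> y \<i>) (dv \<sigma> y \<i>) = of_real r"
      "form (dv \<sigma> y 1) (dv \<sigma> y \<i>) = 0" "r = 0 \<longrightarrow> dv \<sigma> y 1 \<in> vec.span {\<sigma> y}" using m(1) by blast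
    have "dv \<sigma> y 1 \<notin> vec.span {\<sigma> y}" using V(3) y unfolding dd_eq_dv by auto
    then have "r \<noteq> 0" using r(5) by blast
    moreover have "2 * form (wd (- \<i>) \<sigma> y) (wd \<i> \<sigma> y) = of_real r"
      using r(2-4) by (simp add: wd_def form_sym[of "dv \<sigma> y \<i>" "dv \<sigma> y 1"])
    ultimately show "form (wd (- \<i>) \<sigma> y) (wd \<i> \<sigma> y) \<noteq> 0" by auto
  qed (use ls in auto)
  then show ?thesis using ls(2) V(1) by blast
qed

sublocale S: surface U Ls
  by (rule surface.intro[OF openU Ls_frame])

lemma Ls_real_surface: "real_surface U Ls"
  unfolding real_surface_def conformal_coordinate_def
proof (intro conjI imm ballI allI impI)
  fix x V' \<tau> assume x: "x \<in> U" and t: "local_section Ls x V' \<tau> \<and> (\<forall>y\<in>V'. \<tau> y \<in> real_vecs)"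
  obtain V \<sigma> where V: "x \<in> V" "V \<subseteq> U" "frame Ls V \<sigma>" using Ls_frame[OF x] by blast
  interpret F: frame Ls V \<sigma> by (rule V(3))
  have ls: "open V'" "x \<in> V'" "sm V' \<tau>" "\<And>y. y \<in> V' \<Longrightarrow> \<tau> y \<noteq> 0" "\<And>y. y \<in> V' \<Longrightarrow> \<tau> y \<in> Ls y"
    using t by (auto simp: local_section_def smooth_on_eq_sm)
  have re: "vconj (\<tau> y) = \<tau> y" if "y \<in> V'" for y using t that by (auto simp: real_vecs_def)
  have td: "\<tau> differentiable (at x)" by (rule sm_diff_at[OF ls(3,2)])
  obtain r where r: "r \<ge> 0" "form (dv \<tau> x 1) (dv \<tau> x 1) = of_real r" "form (dv \<tau> x \<i>) (dv \<tau> x \<i>) = of_real r"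
      "form (dv \<tau> x 1) (dv \<tau> x \<i>) = 0"
    using section_metric(1)[of "V \<inter> V'" x \<tau>] V F.V ls re td by auto
  obtain f0 fz fb fzb where f: "f0 \<noteq> 0" "wd (- \<i>) \<tau> x = f0 *\<^sub>C wd (- \<i>) \<sigma> x + fz *\<^sub>C \<sigma> x" "wd \<i> \<tau> x = f0 *\<^sub>C wd \<i> \<sigma> x + fb *\<^sub>C \<sigma> x"
    using F.change[OF V(1)] t by metis
  have "form (wd (- \<i>) \<tau> x) (wd \<i> \<tau> x) = f0 * f0 * F.h x"
    by (simp add: f F.gram[OF V(1)] F.null[OF V(1)])
  then have nz: "form (wd (- \<i>) \<tau> x) (wd \<i> \<tau> x) \<noteq> 0" using f(1) F.h_nz[OF V(1)] by simp
  have "2 * form (wd (- \<i>) \<tau> x) (wd \<i> \<tau> x) = of_real r"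
    using r(2-4) by (simp add: wd_def form_sym[of "dv \<tau> x \<i>" "dv \<tau> x 1"])
  then have r0: "r > 0" using r(1) nz by (cases "r = 0") auto
  show "\<exists>c>0. \<forall>X Y. form (dd \<tau> x X) (dd \<tau> x Y) = complex_of_real (c * (X \<bullet> Y))"
  proof (intro exI[of _ r] conjI allI r0)
    fix X Y
    show "form (dd \<tau> x X) (dd \<tau> x Y) = complex_of_real (r * (X \<bullet> Y))"
      unfolding dd_eq_dv dv_conv[OF td, of X] dv_conv[OF td, of Y]
      using r(2-4) form_sym[of "dv \<tau> x \<i>" "dv \<tau> x 1"]
      by (simp add: inner_complex_def) (simp add: scaleR_conv_of_real algebra_simps)
  qed
qed

end

section \<open>Dimension counts for the frame\<close>

lemma image_span_eqI:
  assumes "finite B" "vec.independent B" "B \<subseteq> (\<cdot>) A ` vec.span C" "finite C" "card C \<le> card B"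
  shows "(\<cdot>) A ` vec.span C = vec.span B"
proof (rule subset_antisym)
  have "vec.dim (vec.span ((\<cdot>) A ` C)) \<le> card ((\<cdot>) A ` C)"
    by (rule vec.dim_le_card) (use assms(4) in auto)
  also have "\<dots> \<le> card B" using card_image_le[OF assms(4)] assms(5) order_trans by blast
  finally show "(\<cdot>) A ` vec.span C \<subseteq> vec.span B"
    using assms(3) unfolding app_span by (intro vec.card_ge_dim_independent[OF _ assms(2)])
  show "vec.span B \<subseteq> (\<cdot>) A ` vec.span C"
    using assms(3) unfolding app_span by (intro vec.span_minimal) auto
qed

text \<open>The functional given by \<open>u\<close> vanishes on the span of \<open>S\<close> and
  not on \<open>a\<close>. For the surface frame suitable \<open>u\<close> are found among the frame
  vectors themselves.\<close>

lemma independent_insert_form: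
  assumes "vec.independent S" "\<And>b. b \<in> S \<Longrightarrow> form b u = 0" "form a u \<noteq> 0"
  shows "vec.independent (insert a S)" "a \<notin> S"
proof -
  have "a \<notin> vec.span S" using span_orth[of a S u] assms(2,3) by blast
  then show "vec.independent (insert a S)" "a \<notin> S"
    using assms(1) vec.independent_insertI vec.span_base by blast+
qed

context frame
begin

lemma csc_independent: assumes "y \<in> V"
  shows "vec.independent {\<sigma> y, sz y, sb y, szb y}" "card {\<sigma> y, sz y, sb y, szb y} = 4"
proof -
  note [simp] = gram[OF assms] null[OF assms] conf[OF assms] h_nz[OF assms]
  have 0: "vec.independent ({} :: 'a cvec set)" by (rule vec.independent_empty)
  have 1: "vec.independent {sb y}" by (rule independent_insert_form[OF 0, of "sz y"]) auto
  have 2: "vec.independent {sz y, sb y}" "sz y \<notin> {sb y}" by (rule independent_insert_form[OF 1, of "sb y"]; auto)+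
  have 3: "vec.independent {\<sigma> y, sz y, sb y}" "\<sigma> y \<notin> {sz y, sb y}" by (rule independent_insert_form[OF 2(1), of "szb y"]; auto)+
  have 4: "vec.independent {szb y, \<sigma> y, sz y, sb y}" "szb y \<notin> {\<sigma> y, sz y, sb y}"
    by (rule independent_insert_form[OF 3(1), of "\<sigma> y"]; auto)+
  have e: "{\<sigma> y, sz y, sb y, szb y} = {szb y, \<sigma> y, sz y, sb y}" by auto
  show "vec.independent {\<sigma> y, sz y, sb y, szb y}" "card {\<sigma> y, sz y, sb y, szb y} = 4"
    unfolding e using 2 3 4 by simp_all
qed

lemma Lm_independent: assumes "y \<in> V" "d \<in> II"
  shows "vec.independent {\<sigma> y, sd d y}" "card {\<sigma> y, sd d y} = 2"
proof -
  note g = gramd[OF assms]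
  have 1: "vec.independent {sd d y}"
    by (rule independent_insert_form[OF vec.independent_empty, of "sd (- d) y"]) (auto simp: g assms)
  have 2: "vec.independent {\<sigma> y, sd d y}" "\<sigma> y \<notin> {sd d y}"
    by (rule independent_insert_form[OF 1, of "szb y"]; auto simp: g assms)+
  then show "vec.independent {\<sigma> y, sd d y}" "card {\<sigma> y, sd d y} = 2" by auto
qed

end

lemma wdg_span2:
  assumes "u \<in> vec.span {a, b}" "w \<in> vec.span {a, b}"
  shows "\<exists>c. wdg u w = wdg a (c *\<^sub>C b)"
proof -
  obtain i j k l where u: "u = i *\<^sub>C a + j *\<^sub>C b" and w: "w = k *\<^sub>C a + l *\<^sub>C b"
    using span2[OF assms(1)] span2[OF assms(2)] by blast
  have "wdg b a = - wdg a b" by (rule wdg_anti)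
  then have "wdg u w = wdg a ((i * l - j * k) *\<^sub>C b)"
    by (simp add: u w wdg_simps scC_simps(1,2,5)) (simp add: scC_simps mult.commute)
  then show ?thesis by blast
qed

section \<open>The transformed multiplier as a matrix-valued form\<close>

context backlund
begin

lemma Ad_inv: assumes "adj A * A = 1" "A * adj A = 1" "\<And>v. B v = C \<cdot> v" shows "Ad ((\<cdot>) A) B v = (A * C * adj A) \<cdot> v"
  by (simp add: Ad_def inv_matrix[OF assms(1,2)] assms(3))

lemma As_eq: "As (- \<i>) x = G x * (rm 0 x * Qw (- \<i>) q x * adj (rm 0 x)) * adj (G x)"
  "As \<i> x = G x * (rinf x * Qw \<i> q x * adj (rinf x)) * adj (G x)"
  by (simp_all add: As_def K_eq mult.assoc)

lemma qs_eq: assumes x: "x \<in> U" shows "qs x X v = (X *\<^sub>C As (- \<i>) x + cnj X *\<^sub>C As \<i> x) \<cdot> v"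
proof -
  have ri: "adj (rinf x) * rinf x = 1" "rinf x * adj (rinf x) = 1"
  proof -
    have "K \<i> x = G x * rinf x" by (rule K_eq(1))
    then have e: "rinf x = adj (G x) * K \<i> x" using G_orth(1)[OF x] by (simp add: mult.assoc[symmetric])
    have "adj (K \<i> x) * (G x * (adj (G x) * K \<i> x)) = 1" "adj (G x) * (K \<i> x * (adj (K \<i> x) * G x)) = 1"
      using G_orth[OF x] K_orth[OF x, of \<i>] by (simp_all add: II_def mult.assoc[symmetric])
    then show "adj (rinf x) * rinf x = 1" "rinf x * adj (rinf x) = 1" unfolding e by (simp_all add: mult.assoc)
  qed
  note p = part_matrix[of q x, OF Q_eq[OF rw x]]
  have 1: "Ad (rstar \<Lambda> \<alpha> L 0 x) (part10 q x X) v = (rm 0 x * (X *\<^sub>C Qw (- \<i>) q x) * adj (rm 0 x)) \<cdot> v" for v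
    unfolding rstar_eq[OF x] by (rule Ad_inv[OF rm_facts(1,2)[OF x one_regular(2)]]) (simp add: p)
  have 2: "Ad (rstar_inf \<Lambda> \<alpha> L x) (part01 q x X) v = (rinf x * (cnj X *\<^sub>C Qw \<i> q x) * adj (rinf x)) \<cdot> v" for v
    unfolding rstar_eq[OF x] by (rule Ad_inv[OF ri]) (simp add: p)
  have GG: "adj (G x) * G x = 1" "G x * adj (G x) = 1" by (rule G_orth[OF x])+
  have "qs x X v = (G x * (rm 0 x * (X *\<^sub>C Qw (- \<i>) q x) * adj (rm 0 x) + rinf x * (cnj X *\<^sub>C Qw \<i> q x) * adj (rinf x)) * adj (G x)) \<cdot> v"
    unfolding backlund_multiplier_def inv_rstar[OF x] by (rule Ad_inv[OF GG]) (simp add: 1 2)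
  then show ?thesis unfolding As_eq by (simp add: distrib_left distrib_right)
qed

lemma sm_As: assumes "d \<in> II" shows "sm U (As d)"
proof -
  interpret half d U Rs "As d" "Bs d" "\<lambda>x. - As d x - Bs d x" "Wt (- d)" "Wt d" by (rule halfs[OF assms])
  show ?thesis by (rule smA)
qed

text \<open>The values of the normalised gauge at 0 and infinity are conjugate, by the reality
  statement at infinity; so are the two parts of the new multiplier.\<close>

lemma As_conj: assumes x: "x \<in> U" and d: "d \<in> II" shows "mconj (As d x) = As (- d) x"
proof -
  have "mconj (K \<i> x) = K (- \<i>) x" using rm_facts(4)[OF x] by (simp add: K_eq G_def)
  moreover from this have "mconj (K (- \<i>) x) = K \<i> x" by (metis mconj_simps(8))
  ultimately have "mconj (K d x) = K (- d) x" using d by (auto simp: II_def)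
  then show ?thesis by (simp add: As_def mconj_adj Q_conj[OF rw x d])
qed

lemma Qw_qs: assumes "x \<in> U" "d \<in> II" shows "Qw d qs x = As d x"
proof (rule cmat_eqI)
  fix v
  have "Qw d qs x = of_lin ((\<cdot>) ((1/2) *\<^sub>C ((1 + d * \<i>) *\<^sub>C As (- \<i>) x + (1 - d * \<i>) *\<^sub>C As \<i> x)))"
    unfolding Qw_def qs_eq[OF assms(1)] by (rule arg_cong[of _ _ of_lin]) (simp add: fun_eq_iff scC_simps algebra_simps)
  also have "\<dots> = As d x" unfolding of_lin_app
    by (rule II_cases[OF assms(2)]) (simp_all add: scC_scC)
  finally show "Qw d qs x \<cdot> v = As d x \<cdot> v" by simp
qed

end

section \<open>Identification of the new pencil with that of the transform\<close>

context transform
begin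

text \<open>For the mixed derivative, \<open>wd \<i> \<sigma>\<close> lies in \<open>Wt \<i>\<close>
  and is killed by both coefficients in the direction \<open>- \<i>\<close>. So the derivative of
  \<open>Rs\<close> kills it, and being fixed by \<open>Rs\<close> passes to its derivative.\<close>

lemma section_facts:
  assumes F: "frame Ls V \<sigma>" and V: "V \<subseteq> U" and y: "y \<in> V"
  shows "d \<in> II \<Longrightarrow> \<sigma> y \<in> Wt d y" "d \<in> II \<Longrightarrow> wd d \<sigma> y \<in> Wt d y" "Rs y \<cdot> wd (- \<i>) (wd \<i> \<sigma>) y = wd (- \<i>) (wd \<i> \<sigma>) y"
proof -
  interpret F: frame Ls V \<sigma> by (rule F)
  have y': "y \<in> U" using y V by auto
  have sL: "\<sigma> z \<in> Ls z" if "z \<in> V" for z using F.\<Lambda>_eq[OF that] by (simp add: vec.span_base)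
  have W: "\<sigma> z \<in> Wt d z" "wd d \<sigma> z \<in> Wt d z" if "d \<in> II" "z \<in> V" for d z
    using section_Wt[OF F.V that(2) V F.sdiff(1)[OF that(2)] _ that(1)] sL by blast+
  show "d \<in> II \<Longrightarrow> \<sigma> y \<in> Wt d y" "d \<in> II \<Longrightarrow> wd d \<sigma> y \<in> Wt d y" using W y by auto
  interpret h: half "- \<i>" U Rs "As (- \<i>)" "Bs (- \<i>)" "\<lambda>x. - As (- \<i>) x - Bs (- \<i>) x" "Wt (- (- \<i>))" "Wt (- \<i>)"
    by (rule halfs) (simp add: II_def)
  have i: "\<i> \<in> II" by (simp add: II_def)
  have fx: "Rs z \<cdot> wd \<i> \<sigma> z = wd \<i> \<sigma> z" if "z \<in> V" for z
    using Wt_facts(1)[OF _ i W(2)[OF i that]] that V by auto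
  have z: "As (- \<i>) y \<cdot> wd \<i> \<sigma> y = 0" "Bs (- \<i>) y \<cdot> wd \<i> \<sigma> y = 0"
    using Wt_facts(3,4)[OF y' i W(2)[OF i y]] by auto
  have "wd (- \<i>) (\<lambda>z. Rs z \<cdot> wd \<i> \<sigma> z) y = wd (- \<i>) (wd \<i> \<sigma>) y" by (rule wd_cong_open[OF F.V y fx])
  then have "wd (- \<i>) Rs y \<cdot> wd \<i> \<sigma> y + Rs y \<cdot> wd (- \<i>) (wd \<i> \<sigma>) y = wd (- \<i>) (wd \<i> \<sigma>) y"
    using h.diff_at(1)[OF y'] F.sdiff(3)[OF y] by (simp add: wd_app)
  moreover have "wd (- \<i>) Rs y \<cdot> wd \<i> \<sigma> y = 0"
    unfolding h.dR[OF y'] by (simp add: fx[OF y] z)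
  ultimately show "Rs y \<cdot> wd (- \<i>) (wd \<i> \<sigma>) y = wd (- \<i>) (wd \<i> \<sigma>) y" by simp
qed

text \<open>The four frame vectors of the transform are independent and fixed by \<open>Rs\<close>,
  so they span the fixed space of \<open>Rs\<close>, which also has dimension four.\<close>

lemma csc_Ls: assumes x: "x \<in> U" shows "csc Ls x = (\<cdot>) (G x) ` csc \<Lambda> x"
proof -
  obtain V \<sigma> where VV: "x \<in> V" "V \<subseteq> U" "frame Ls V \<sigma>" using Ls_frame[OF x] by blast
  obtain V' \<sigma>' where VV': "x \<in> V'" "frame \<Lambda> V' \<sigma>'" using frames[OF x] by blast
  interpret F: frame Ls V \<sigma> by (rule VV(3))
  interpret F': frame \<Lambda> V' \<sigma>' by (rule VV'(2))
  let ?B = "{\<sigma> x, wd (- \<i>) \<sigma> x, wd \<i> \<sigma> x, wd (- \<i>) (wd \<i> \<sigma>) x}"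
  have fx: "v \<in> (\<cdot>) (G x) ` csc \<Lambda> x" if "Rs x \<cdot> v = v" for v
  proof -
    have GG: "adj (G x) \<cdot> G x \<cdot> u = u" "G x \<cdot> adj (G x) \<cdot> u = u" for u
      using G_orth[OF x] by (metis app_ring(2,6))+
    have "adj (G x) \<cdot> Rs x \<cdot> v = adj (G x) \<cdot> v" using that by simp
    then have "R x \<cdot> adj (G x) \<cdot> v = adj (G x) \<cdot> v" by (simp add: Rs_def GG)
    then have "adj (G x) \<cdot> v \<in> csc \<Lambda> x" by (simp add: in_csc_iff[OF x])
    then show ?thesis using GG(2)[of v] by force
  qed
  have II: "\<i> \<in> II" "- \<i> \<in> II" by (simp_all add: II_def)
  note s = section_facts[OF VV(3,2,1)]
  have "?B \<subseteq> (\<cdot>) (G x) ` csc \<Lambda> x"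
    using fx[OF Wt_facts(1)[OF x II(1) s(1)[OF II(1)]]] fx[OF Wt_facts(1)[OF x II(1) s(2)[OF II(1)]]]
      fx[OF Wt_facts(1)[OF x II(2) s(2)[OF II(2)]]] fx[OF s(3)] by blast
  then show ?thesis
    unfolding F.csc_eq[OF VV(1)] F'.csc_eq[OF VV'(1)]
    by (intro image_span_eqI[symmetric])
      (use F.csc_independent[OF VV(1)] F'.csc_independent[OF VV'(1)] in auto)
qed

lemma Rm_Ls: assumes x: "x \<in> U" shows "Rm Ls x = Rs x"
proof (rule cmat_eqI)
  fix v
  have GG: "adj (G x) \<cdot> G x \<cdot> u = u" "G x \<cdot> adj (G x) \<cdot> u = u" for u
    using G_orth[OF x] by (metis app_ring(2,6))+
  have csc: "u \<in> csc Ls x" if "Rs x \<cdot> u = u" for u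
  proof -
    have "adj (G x) \<cdot> Rs x \<cdot> u = adj (G x) \<cdot> u" using that by simp
    then have "adj (G x) \<cdot> u \<in> csc \<Lambda> x" by (simp add: Rs_def GG in_csc_iff[OF x])
    then show ?thesis unfolding csc_Ls[OF x] using GG(2)[of u] by force
  qed
  have csc': "Rs x \<cdot> u = u" if "u \<in> csc Ls x" for u
    using that unfolding csc_Ls[OF x] by (auto simp: Rs_def GG in_csc_iff[OF x])
  have RR: "Rs x \<cdot> Rs x \<cdot> v = v" using Rs_props(1)[OF x] by (metis app_ring(2,6))
  have 1: "Rm Ls x \<cdot> (v + Rs x \<cdot> v) = v + Rs x \<cdot> v"
    using csc[of "v + Rs x \<cdot> v"] by (simp add: S.in_csc_iff[OF x] RR add.commute)
  have "form (v - Rs x \<cdot> v) u = 0" if "u \<in> csc Ls x" for u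
    using adj_app[of "Rs x" v u] Rs_props(2)[OF x] csc'[OF that] by simp
  then have "v - Rs x \<cdot> v \<in> perp (csc Ls x)" by (simp add: perp_def)
  then have 2: "Rm Ls x \<cdot> (v - Rs x \<cdot> v) = - (v - Rs x \<cdot> v)" by (simp add: S.in_perp_iff[OF x])
  have "2 *\<^sub>C (Rm Ls x \<cdot> v) = Rm Ls x \<cdot> (v + Rs x \<cdot> v) + Rm Ls x \<cdot> (v - Rs x \<cdot> v)" by (simp add: scC_double)
  also have "\<dots> = 2 *\<^sub>C (Rs x \<cdot> v)" unfolding 1 2 by (simp add: scC_double)
  finally have "2 *\<^sub>C (Rm Ls x \<cdot> v - Rs x \<cdot> v) = 0" by (simp add: scC_diff_right)
  then show "Rm Ls x \<cdot> v = Rs x \<cdot> v" by simp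
qed

text \<open>\<open>Rs\<close> is parallel for \<open>d - As - Bs\<close>, where \<open>As\<close>
  commutes and \<open>Bs\<close> anticommutes with it; so its derivative is
  \<open>- 2 Rs Bs\<close>, and the formula for N returns \<open>Bs\<close>.\<close>

lemma Nw_Ls: assumes x: "x \<in> U" and d: "d \<in> II" shows "Nw d Ls x = Bs d x"
proof -
  interpret h: half d U Rs "As d" "Bs d" "\<lambda>x. - As d x - Bs d x" "Wt (- d)" "Wt d" by (rule halfs[OF d])
  have RR: "Rs x * (Rs x * T) = T" for T using h.RR[OF x] by (simp add: mult.assoc[symmetric])
  have "wd d (Rm Ls) x = wd d Rs x" by (rule wd_cong_open[OF openU x Rm_Ls])
  also have "\<dots> = - (Rs x * Bs d x) - Rs x * Bs d x"
    unfolding h.dR[OF x] using h.B_R[OF x] h.A_R[OF x] by (simp add: algebra_simps)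
  finally have w: "wd d (Rm Ls) x = - (Rs x * Bs d x) - Rs x * Bs d x" .
  have "Rm Ls x * wd d (Rm Ls) x = (- 2) *\<^sub>C Bs d x"
    unfolding w Rm_Ls[OF x] by (simp add: right_diff_distrib RR scC_double)
  then show ?thesis by (simp add: Nw_def scC_scC)
qed

lemma Lm_Ls: assumes x: "x \<in> U" and d: "d \<in> II" shows "Wt d x = Lm d Ls x"
proof -
  obtain V \<sigma> where VV: "x \<in> V" "V \<subseteq> U" "frame Ls V \<sigma>" using Ls_frame[OF x] by blast
  obtain V' \<sigma>' where VV': "x \<in> V'" "frame \<Lambda> V' \<sigma>'" using frames[OF x] by blast
  interpret F: frame Ls V \<sigma> by (rule VV(3))
  interpret F': frame \<Lambda> V' \<sigma>' by (rule VV'(2))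
  note s = section_facts(1,2)[OF VV(3,2,1) d]
  show ?thesis
    using s unfolding Wt_def F.Lm_eq[OF VV(1) d] F'.Lm_eq[OF VV'(1) d]
    by (intro image_span_eqI) (use F.Lm_independent[OF VV(1) d] F'.Lm_independent[OF VV'(1) d] in auto)
qed

text \<open>The bivectors of a plane form a line, and the plane is spanned by the section and one
  derivative. This puts the new multiplier into the required wedge space.\<close>

lemma As_wdg: assumes "x \<in> U" "d \<in> II" "x \<in> V" "frame Ls V \<sigma>"
  shows "\<exists>c. As d x = wdg (\<sigma> x) (c *\<^sub>C wd (- d) \<sigma> x)"
proof -
  interpret F: frame Ls V \<sigma> by fact
  obtain u w where u: "u \<in> Lm (- d) \<Lambda> x" "w \<in> Lm (- d) \<Lambda> x" "Qw d q x = wdg u w" using Q_wdg[OF assms(1,2)] .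
  have "K d x \<cdot> u \<in> Wt (- d) x" "K d x \<cdot> w \<in> Wt (- d) x" using u by (auto simp: Wt_def)
  then have "K d x \<cdot> u \<in> vec.span {\<sigma> x, wd (- d) \<sigma> x}" "K d x \<cdot> w \<in> vec.span {\<sigma> x, wd (- d) \<sigma> x}"
    unfolding Lm_Ls[OF assms(1) II_neg[OF assms(2)]] F.Lm_eq[OF assms(3) II_neg[OF assms(2)]] by auto
  then show ?thesis unfolding As_def u(3) wdg_conj by (rule wdg_span2)
qed

lemma qs_real_wedge: "real_wedge_form U Ls qs"
  unfolding real_wedge_form_def
proof (intro conjI ballI allI)
  have II: "\<i> \<in> II" "- \<i> \<in> II" by (simp_all add: II_def)
  show "smooth_on U (\<lambda>x. qs x X v)" for X v
    unfolding smooth_on_eq_sm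
    by (rule iffD2[OF sm_cong[OF openU qs_eq]], assumption) (intro sm_app sm_add sm_scC sm_const sm_As II openU)
  fix x assume x: "x \<in> U"
  show "linear (\<lambda>X. qs x X v)" for v
    unfolding qs_eq[OF x] by (rule linearI) (simp_all add: scC_simps scC_of_real[symmetric] scaleR_conv_of_real)
  obtain V \<sigma> where VV: "x \<in> V" "V \<subseteq> U" "frame Ls V \<sigma>" using Ls_frame[OF x] by blast
  interpret F: frame Ls V \<sigma> by (rule VV(3))
  obtain a where a: "As (- \<i>) x = wdg (\<sigma> x) (a *\<^sub>C wd \<i> \<sigma> x)" using As_wdg[OF x II(2) VV(1,3)] by auto
  obtain b where b: "As \<i> x = wdg (\<sigma> x) (b *\<^sub>C wd (- \<i>) \<sigma> x)" using As_wdg[OF x II(1) VV(1,3)] by auto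
  show "qs x X \<in> wedge_space (Ls x) (Lam1 Ls x)" for X
  proof -
    let ?w = "(X * a) *\<^sub>C wd \<i> \<sigma> x + (cnj X * b) *\<^sub>C wd (- \<i>) \<sigma> x"
    have "qs x X = (\<cdot>) (wdg (\<sigma> x) ?w)" by (rule ext) (simp add: qs_eq[OF x] a b wdg_simps scC_simps)
    moreover have "\<sigma> x \<in> Ls x" by (simp add: F.\<Lambda>_eq[OF VV(1)] vec.span_base)
    moreover have "?w \<in> Lam1 Ls x"
      unfolding F.Lam1_eq[OF VV(1)] by (intro vec.span_add span_scC vec.span_base) auto
    ultimately show ?thesis by (simp only: wdg_in_wedge_space)
  qed
  show "qs x X (vconj v) = vconj (qs x X v)" for X v
    using As_conj[OF x] II by (simp add: qs_eq[OF x] vconj_app add.commute)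
qed

end

lemma two_generic_parameters:
  assumes "finite (S :: complex set)"
  obtains l m where "l \<notin> S" "m \<notin> S" "l * l \<noteq> 1" "m * m \<noteq> 1" "l * l \<noteq> m * m"
proof -
  have inf: "infinite (UNIV :: complex set)" by (simp add: infinite_UNIV_char_0)
  obtain l where l: "l \<notin> S \<union> {1, - 1}" using ex_new_if_finite[OF inf, of "S \<union> {1, - 1}"] assms by auto
  obtain m where m: "m \<notin> S \<union> {1, - 1, l, - l}" using ex_new_if_finite[OF inf, of "S \<union> {1, - 1, l, - l}"] assms by auto
  show ?thesis
    by (rule that[of l m]) (use l m in \<open>auto simp: square_eq_iff square_eq_1_iff\<close>)
qed

text \<open>Passing from \<open>l\<close> to \<open>- l\<close> isolates the odd term. The even part
  then reads \<open>(l * l) *\<^sub>C A1 = - A2\<close>, which for two different squares leaves only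
  zero.\<close>

lemma curvature_coefficients:
  fixes A1 A2 H :: "'a::cvs"
  assumes S: "finite S" "0 \<in> S" "\<And>l. l \<in> S \<Longrightarrow> - l \<in> S"
    and c: "\<And>l. l \<notin> S \<Longrightarrow> (l * l - 1) *\<^sub>C A1 - (inverse l * inverse l - 1) *\<^sub>C A2 + (l - inverse l) *\<^sub>C H = 0"
  shows "A1 = 0" "A2 = 0" "H = 0"
proof -
  have neg: "- l \<notin> S" if "l \<notin> S" for l using S(3)[of "- l"] that by auto
  have H: "(l - inverse l) *\<^sub>C H = 0" and A: "(l * l - 1) *\<^sub>C A1 = (inverse l * inverse l - 1) *\<^sub>C A2" if l: "l \<notin> S" for l
  proof -
    have "(l * l - 1) *\<^sub>C A1 - (inverse l * inverse l - 1) *\<^sub>C A2 - (l - inverse l) *\<^sub>C H = 0"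
    proof -
      have e: "- l - inverse (- l) = - (l - inverse l)" by simp
      show ?thesis using c[OF neg[OF l]] unfolding e scC_minus_left by simp
    qed
    then have "2 *\<^sub>C ((l - inverse l) *\<^sub>C H) = 0" using c[OF l] by (metis add_diff_cancel_left' add.inverse_inverse diff_0 diff_0_right diff_add_cancel eq_iff_diff_eq_0 scC_double)
    then show 1: "(l - inverse l) *\<^sub>C H = 0" by simp
    show "(l * l - 1) *\<^sub>C A1 = (inverse l * inverse l - 1) *\<^sub>C A2" using c[OF l] unfolding 1 by simp
  qed
  obtain l m where lm: "l \<notin> S" "m \<notin> S" "l * l \<noteq> 1" "m * m \<noteq> 1" "l * l \<noteq> m * m"
    using two_generic_parameters[OF S(1)] .
  have l0: "l \<noteq> 0" "m \<noteq> 0" using lm S(2) by auto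
  have "l - inverse l \<noteq> 0" using lm(3) l0 by (metis eq_iff_diff_eq_0 right_inverse)
  then show "H = 0" using H[OF lm(1)] by simp
  have e: "(k * k) *\<^sub>C A1 = - A2" if k: "k \<notin> S" "k * k \<noteq> 1" "k \<noteq> 0" for k
  proof -
    have 1: "k * k * (inverse k * inverse k - 1) = - (k * k - 1)" using k(3) by (simp add: algebra_simps)
    have "(k * k - 1) *\<^sub>C ((k * k) *\<^sub>C A1) = (k * k) *\<^sub>C ((k * k - 1) *\<^sub>C A1)" by (simp only: scC_scC mult.commute)
    also have "\<dots> = (k * k - 1) *\<^sub>C (- A2)"
      unfolding A[OF k(1)] by (simp only: scC_scC 1 scC_minus_left scC_minus_right)
    finally have "(k * k - 1) *\<^sub>C ((k * k) *\<^sub>C A1) = (k * k - 1) *\<^sub>C (- A2)" .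
    then have "(k * k - 1) *\<^sub>C ((k * k) *\<^sub>C A1 - (- A2)) = 0" unfolding scC_diff_right by simp
    then show ?thesis using k(2) by (simp add: add_eq_0_iff2)
  qed
  have "(l * l - m * m) *\<^sub>C A1 = 0" using e[OF lm(1,3) l0(1)] e[OF lm(2,4) l0(2)] by (simp add: scC_diff_left)
  then show "A1 = 0" using lm(5) by simp
  then show "A2 = 0" using e[OF lm(1,3) l0(1)] by simp
qed

lemma (in surface) sm_Pf: assumes "real_wedge_form U \<Lambda> q" shows "sm U (Pf \<Lambda> (\<lambda>d. Qw d q) d l)"
  unfolding Pf_def[abs_def] Pl_def by (intro sm_add sm_diff sm_minus sm_scC sm_const smN smQ[OF assms] openU)

context transform
begin

abbreviation "Ps \<equiv> Pf Ls (\<lambda>d. Qw d qs)"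

lemma RR_rel: assumes "x \<in> U" "d \<in> II" "l \<in> regular" "l \<noteq> 0"
  shows "wd d (RR l) x + Ps d (kd d l) x * RR l x = RR l x * Pq d (kd d l) x"
proof -
  have 1: "Pl (As d x) (Bs d x) (- As d x - Bs d x) (kd d l) = Ps d (kd d l) x"
    unfolding Pf_def Qw_qs[OF assms(1,2)] Nw_Ls[OF assms(1,2)] ..
  show ?thesis
    using hBs[OF assms(2), unfolded hB_def, THEN conjunct2, rule_format, OF assms(1,3,4)] unfolding 1 .
qed

lemma RR_inverse: assumes "x \<in> U" "l \<in> regular" shows "RR l x * adj (RR l x) = 1"
proof -
  have "RR l x * adj (RR l x) = G x * (rm l x * adj (rm l x)) * adj (G x)" by (simp add: RR_def mult.assoc)
  then show ?thesis using rm_facts(2)[OF assms] G_orth(2)[OF assms(1)] by simp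
qed

text \<open>The normalised gauge intertwines the old and the new pencil, so the flatness of the
  given surface is transported.\<close>

lemma Curv_Ls: assumes x: "x \<in> U" and l: "l \<in> regular" "l \<noteq> 0" shows "Curv Ls (\<lambda>d. Qw d qs) l x = 0"
  unfolding Curv_def
proof (rule curvature_transfer[OF openU x sm_RR[of l]])
  have II: "\<i> \<in> II" "- \<i> \<in> II" by (simp_all add: II_def)
  show "Pf \<Lambda> (\<lambda>d. Qw d q) (- \<i>) l differentiable (at x)" "Pf \<Lambda> (\<lambda>d. Qw d q) \<i> (inverse l) differentiable (at x)"
    "Ps (- \<i>) l differentiable (at x)" "Ps \<i> (inverse l) differentiable (at x)"
    by (rule sm_diff_at[OF _ x], rule sm_Pf[OF rw] S.sm_Pf[OF qs_real_wedge])+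
  show "RR l x * adj (RR l x) = 1" by (rule RR_inverse[OF x l(1)])
  fix y assume y: "y \<in> U"
  show "wd (- \<i>) (RR l) y + Ps (- \<i>) l y * RR l y = RR l y * Pf \<Lambda> (\<lambda>d. Qw d q) (- \<i>) l y"
    using RR_rel[OF y II(2) l] by (simp add: kd_def)
  show "wd \<i> (RR l) y + Ps \<i> (inverse l) y * RR l y = RR l y * Pf \<Lambda> (\<lambda>d. Qw d q) \<i> (inverse l) y"
    using RR_rel[OF y II(1) l] by (simp add: kd_def i_neq)
next
  show "wd (- \<i>) (Pf \<Lambda> (\<lambda>d. Qw d q) \<i> (inverse l)) x - wd \<i> (Pf \<Lambda> (\<lambda>d. Qw d q) (- \<i>) l) x
    + (Pf \<Lambda> (\<lambda>d. Qw d q) (- \<i>) l x * Pf \<Lambda> (\<lambda>d. Qw d q) \<i> (inverse l) x - Pf \<Lambda> (\<lambda>d. Qw d q) \<i> (inverse l) x * Pf \<Lambda> (\<lambda>d. Qw d q) (- \<i>) l x) = 0"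
    using flat[OF x l(2)] by (simp add: Curv_def)
qed

lemma Ls_constrained_willmore: "constrained_willmore U Ls qs"
  unfolding S.cw_iff[OF Ls_real_surface qs_real_wedge]
proof
  fix x assume x: "x \<in> U"
  have II: "\<i> \<in> II" "- \<i> \<in> II" by (simp_all add: II_def)
  let ?Q = "\<lambda>d. Qw d qs x" and ?N = "\<lambda>d. Nw d Ls x"
  let ?H = "Dw (- \<i>) Ls (Nw \<i> Ls) x + ((?N (- \<i>) * ?Q \<i> - ?Q \<i> * ?N (- \<i>)) + (?N \<i> * ?Q (- \<i>) - ?Q (- \<i>) * ?N \<i>))"
  obtain V \<sigma> where VV: "x \<in> V" "V \<subseteq> U" "frame Ls V \<sigma>" using Ls_frame[OF x] by blast
  interpret F: frame Ls V \<sigma> by (rule VV(3))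
  have c: "?Q (- \<i>) * ?Q \<i> = ?Q \<i> * ?Q (- \<i>)"
  proof -
    obtain a where a: "As (- \<i>) x = wdg (\<sigma> x) (a *\<^sub>C wd \<i> \<sigma> x)" using As_wdg[OF x II(2) VV(1,3)] by auto
    obtain b where b: "As \<i> x = wdg (\<sigma> x) (b *\<^sub>C wd (- \<i>) \<sigma> x)" using As_wdg[OF x II(1) VV(1,3)] by auto
    show ?thesis unfolding Qw_qs[OF x II(1)] Qw_qs[OF x II(2)] a b
      by (rule wdg_commute) (simp_all add: F.null[OF VV(1)] F.gram[OF VV(1)])
  qed
  have "(l * l - 1) *\<^sub>C Dw (- \<i>) Ls (Qw \<i> qs) x - (inverse l * inverse l - 1) *\<^sub>C Dw \<i> Ls (Qw (- \<i>) qs) x + (l - inverse l) *\<^sub>C ?H = 0"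
    if "l \<notin> {0, \<alpha>, - \<alpha>, be, - be}" for l
  proof -
    have l: "l \<noteq> 0" "l \<in> regular" using that by (auto simp: regular_def)
    have dQ: "Qw d qs differentiable (at x)" for d by (rule sm_diff_at[OF S.smQ[OF qs_real_wedge] x])
    show ?thesis using Curv_eq[OF l(1) dQ S.N_diff[OF x] S.N_closed[OF x] c] Curv_Ls[OF x l(2,1)] by simp
  qed
  note co = curvature_coefficients[of "{0, \<alpha>, - \<alpha>, be, - be}", OF _ _ _ this]
  have z: "Dw (- \<i>) Ls (Qw \<i> qs) x = 0" "Dw \<i> Ls (Qw (- \<i>) qs) x = 0" "?H = 0"
    by (rule co; auto)+
  have "Dw (- \<i>) Ls (Nw \<i> Ls) x = - ((?N (- \<i>) * ?Q \<i> - ?Q \<i> * ?N (- \<i>)) + (?N \<i> * ?Q (- \<i>) - ?Q (- \<i>) * ?N \<i>))"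
    using z(3) by (simp only: eq_neg_iff_add_eq_0)
  then show "Dw (- \<i>) Ls (Qw \<i> qs) x = Dw \<i> Ls (Qw (- \<i>) qs) x \<and>
     Dw (- \<i>) Ls (Nw \<i> Ls) x = (?Q (- \<i>) * ?N \<i> - ?N \<i> * ?Q (- \<i>)) + (?Q \<i> * ?N (- \<i>) - ?N (- \<i>) * ?Q \<i>)"
    using z(1,2) by (simp add: algebra_simps)
qed

end

section \<open>The transformed conserved quantity\<close>

lemma tendsto_scC: "(f \<longlongrightarrow> a) F \<Longrightarrow> (g \<longlongrightarrow> b) F \<Longrightarrow> ((\<lambda>x. f x *\<^sub>C g x) \<longlongrightarrow> a *\<^sub>C b) F" for b :: "'a::cvs"
  using cbil_scC unfolding cbil_def by (blast intro: bounded_bilinear.tendsto)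

text \<open>Away from a finite set the function vanishes, so its limit at \<open>k\<close> is zero,
  and continuity at \<open>k\<close> identifies this limit with the value.\<close>

lemma generic_limit_zero:
  fixes f :: "complex \<Rightarrow> 'a::real_normed_vector"
  assumes "finite S" "\<And>l. l \<notin> S \<Longrightarrow> f l = 0" "(f \<longlongrightarrow> f k) (at k)"
  shows "f k = 0"
proof -
  have "open (- (S - {k}))" by (intro open_Compl finite_imp_closed) (use assms(1) in simp)
  then have "\<forall>\<^sub>F l in at k. f l = 0"
    unfolding eventually_at_topological by (intro exI[of _ "- (S - {k})"]) (auto intro: assms(2))
  then have "(f \<longlongrightarrow> 0) (at k)" by (rule tendsto_eventually)
  then show ?thesis using tendsto_unique[OF _ assms(3)] by auto
qed

text \<open>The projection onto \<open>\<rho>L\<close> measures the pairing with \<open>L\<close>,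
  and the projection onto \<open>L\<close> the pairing with \<open>\<rho>L\<close>. One
  orthogonality relation thus yields both vanishing conditions of
  \<open>Gam_conserved\<close>.\<close>

lemma EfFf_kill:
  assumes "form w u = 0" "R * R = 1" "adj R = R"
  shows "Ff R u \<cdot> w = 0" "R \<cdot> w' = w \<Longrightarrow> Ef R u \<cdot> w' = 0"
proof -
  show "Ff R u \<cdot> w = 0" by (simp add: Ff_def assms(1))
  show "Ef R u \<cdot> w' = 0" if "R \<cdot> w' = w"
    using adj_app[of R w' u] assms that by (simp add: Ef_def)
qed

locale conserved = transform U \<Lambda> q \<alpha> L for U \<Lambda> and q :: "'a::finite endo_form" and \<alpha> L +
  fixes v v0 :: "'a sect"
  assumes smv: "sm U v" "sm U v0" and v_perp: "x \<in> U \<Longrightarrow> R x \<cdot> v x = - v x" and v0_csc: "x \<in> U \<Longrightarrow> R x \<cdot> v0 x = v0 x"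
    and v0_real: "x \<in> U \<Longrightarrow> vconj (v0 x) = v0 x"
    and nz: "x \<in> U \<Longrightarrow> v x + v0 x + vconj (v x) \<noteq> 0"
    and par: "x \<in> U \<Longrightarrow> d \<in> II \<Longrightarrow> l \<noteq> 0 \<Longrightarrow>
      wd d (\<lambda>y. inverse l *\<^sub>C v y + v0 y + l *\<^sub>C vconj (v y)) x + Pq d (kd d l) x \<cdot> (inverse l *\<^sub>C v x + v0 x + l *\<^sub>C vconj (v x)) = 0"
    and L_perp: "x \<in> U \<Longrightarrow> w \<in> L x \<Longrightarrow> form (inverse \<alpha> *\<^sub>C v x + v0 x + \<alpha> *\<^sub>C vconj (v x)) w = 0"
begin

definition "pp l x = inverse l *\<^sub>C v x + v0 x + l *\<^sub>C vconj (v x)"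
definition "vs x = K (- \<i>) x \<cdot> v x"
text \<open>The middle coefficient is fixed by the value at parameter 1, where the normalised gauge
  is the identity. Its reality and \<open>ps 1 = pp 1\<close> are then immediate.\<close>

definition "v0s x = pp 1 x - vs x - vconj (vs x)"
definition "ps l x = inverse l *\<^sub>C vs x + v0s x + l *\<^sub>C vconj (vs x)"

lemma vconj_vs: assumes "x \<in> U" shows "vconj (vs x) = K \<i> x \<cdot> vconj (v x)"
proof -
  have "mconj (K \<i> x) = K (- \<i>) x" unfolding K_eq G_def by (rule rm_facts(4)[OF assms])
  then have "mconj (K (- \<i>) x) = K \<i> x" by (metis mconj_simps(8))
  then show ?thesis by (simp only: vs_def vconj_app)
qed

text \<open>
  The condition \<open>p(\<alpha>) \<bottom> L\<close> removes the pole of \<open>r\<^sup>*p\<close> at \<open>\<alpha>\<close>; the symmetries of \<open>p\<close> under \<open>\<rho>\<close> and conjugation remove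
  those at \<open>-\<alpha>\<close> and \<open>\<plusminus>1 / cnj \<alpha>\<close>.
\<close>

lemma dressed_pencil: assumes x: "x \<in> U"
  shows "\<exists>u. R x \<cdot> u = u \<and> (\<forall>l\<in>regular. l \<noteq> 0 \<longrightarrow> RR l x \<cdot> pp l x = inverse l *\<^sub>C vs x + G x \<cdot> u + l *\<^sub>C vconj (vs x))"
    and "R x \<cdot> rm 0 x \<cdot> v x = - (rm 0 x \<cdot> v x)"
proof -
  obtain V s where V: "x \<in> V" "good V s" using good_exists[OF x] by blast
  note g = good_at[OF V(2,1)]
  note R = Rm_props[OF x]
  note np1 = np(1)[OF x] and np2 = np(2)[OF x]
  note n1 = null_pairD[OF np1] and n2 = null_pairD[OF np2]
  have Rv: "R x \<cdot> vconj (v x) = - vconj (v x)"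
    using arg_cong[OF v_perp[OF x], of vconj] R(3) by (simp add: vconj_app)
  \<comment> \<open>The vector on the left is p at \<open>- l\<close>: the reflection changes the
    sign of the odd coefficients.\<close>
  have Rpp: "R x \<cdot> (- (inverse l *\<^sub>C v x) + v0 x - l *\<^sub>C vconj (v x)) = pp l x" for l
    by (simp add: pp_def v_perp[OF x] v0_csc[OF x] Rv)
  let ?J = "Gam (EM x) (FM x) (- 1)" and ?GM = "\<lambda>c. Gam (EM x) (FM x) c" and ?GL = "\<lambda>c. Gam (EL x) (FL x) c"
  have JR: "R x \<cdot> ?J \<cdot> w = ?J \<cdot> R x \<cdot> w" for w
    using Gam_refl[OF np1, of "- 1"] by (metis app_ring(6) inverse_minus_eq inverse_1)
  have JJ: "?J \<cdot> ?J \<cdot> w = w" for w using Gam_app_inverse(1)[OF np1, of "- 1"] by simp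
  have ZR1: "R x \<cdot> (EM x - FM x) \<cdot> w = - ((EM x - FM x) \<cdot> R x \<cdot> w)" for w
  proof -
    have "R x * (EM x - FM x) = - ((EM x - FM x) * R x)" using n1(7,8) by (simp add: left_diff_distrib right_diff_distrib)
    then show ?thesis by (metis app_ring(5,6))
  qed
  have ZR2: "R x \<cdot> (EL x - FL x) \<cdot> w = - ((EL x - FL x) \<cdot> R x \<cdot> w)" for w
  proof -
    have "R x * (EL x - FL x) = - ((EL x - FL x) * R x)" using n2(7,8) by (simp add: left_diff_distrib right_diff_distrib)
    then show ?thesis by (metis app_ring(5,6))
  qed
  have sL: "s x \<in> L x" unfolding g(1) by (simp add: vec.span_base)
  have al: "form (pp \<alpha> x) (s x) = 0" using L_perp[OF x sL] by (simp add: pp_def)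
  \<comment> \<open>Reality of p carries the orthogonality from \<alpha> and \<open>L\<close> to
    \<open>be\<close> and the conjugate line.\<close>
  have "vconj (pp \<alpha> x) = pp be x" by (simp add: pp_def v0_real[OF x] add_ac)
  then have bl: "form (pp be x) (vconj (s x)) = 0" using al form_vconj[of "pp \<alpha> x" "s x"] by simp
  define v0' where "v0' = v0 x - (2 * inverse be) *\<^sub>C ((EM x - FM x) \<cdot> v x)"
  have Rv0': "R x \<cdot> v0' = v0'" using ZR1[of "v x"] by (simp add: v0'_def v0_csc[OF x] v_perp[OF x])
  have FE1: "FM x \<cdot> pp be x = 0" "EM x \<cdot> (- (inverse be *\<^sub>C v x) + v0 x - be *\<^sub>C vconj (v x)) = 0"
    unfolding g(3,4) using EfFf_kill[OF bl R(1,2)] Rpp[of be] by blast+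
  have step1: "?GM ((l - be) / (l + be)) \<cdot> pp l x = inverse l *\<^sub>C (?J \<cdot> v x) + ?J \<cdot> v0' + l *\<^sub>C vconj (v x)"
    if l: "l \<noteq> 0" "l \<noteq> be" "l \<noteq> - be" for l
  proof -
    have nz: "be - l \<noteq> 0" "be + l \<noteq> 0" using l by (auto simp: eq_neg_iff_add_eq_0 add.commute)
    have e: "(l - be) / (l + be) = - 1 * ((be - l) / (be + l))" by (simp add: add.commute minus_divide_left)
    \<comment> \<open>Splitting off \<open>?J\<close> turns the q-map into a p-map, for which the
      cancellation of poles is available.\<close>
    have "?GM ((l - be) / (l + be)) = ?J * ?GM ((be - l) / (be + l))"
      unfolding e by (rule Gam_mult[OF np1, symmetric]) (use nz in auto)
    moreover have "?GM ((be - l) / (be + l)) \<cdot> pp l x = inverse l *\<^sub>C v x + v0' + l *\<^sub>C (?J \<cdot> vconj (v x))"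
      unfolding pp_def v0'_def
      by (rule Gam_conserved[OF np1 \<alpha>(3) l refl FE1[unfolded pp_def]])
    ultimately show ?thesis by (simp add: JJ)
  qed
  let ?p1 = "\<lambda>l. inverse l *\<^sub>C (?J \<cdot> v x) + ?J \<cdot> v0' + l *\<^sub>C vconj (v x)"
  have t0: "t0 \<noteq> 0" using \<alpha> by (auto simp: t0_def eq_neg_iff_add_eq_0)
  have p1: "?GM t0 \<cdot> pp \<alpha> x = ?p1 \<alpha>" unfolding t0_def by (rule step1[OF \<alpha>(1,4,5)])
  \<comment> \<open>The first gauge at \<alpha> is orthogonal and moves both p(\<alpha>) and
    \<open>L\<close>, so the dressed quantity is still orthogonal to \<open>L_tilde\<close>.\<close>
  have bl2: "form (?p1 \<alpha>) (?GM t0 \<cdot> s x) = 0"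
    unfolding p1[symmetric] form_Gam_null[OF np1 t0] by (rule al)
  have Rp1: "R x \<cdot> (- (inverse \<alpha> *\<^sub>C (?J \<cdot> v x)) + ?J \<cdot> v0' - \<alpha> *\<^sub>C vconj (v x)) = ?p1 \<alpha>"
    by (simp add: JR v_perp[OF x] Rv Rv0')
  have FE2: "FL x \<cdot> ?p1 \<alpha> = 0" "EL x \<cdot> (- (inverse \<alpha> *\<^sub>C (?J \<cdot> v x)) + ?J \<cdot> v0' - \<alpha> *\<^sub>C vconj (v x)) = 0"
    unfolding g(5,6) using EfFf_kill[OF bl2 R(1,2)] Rp1 by blast+
  define u where "u = ?J \<cdot> v0' - (2 * inverse \<alpha>) *\<^sub>C ((EL x - FL x) \<cdot> ?J \<cdot> v x)"
  have rm0: "rm 0 x = ?J" using \<alpha> by (simp add: rm_def)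
  show "R x \<cdot> rm 0 x \<cdot> v x = - (rm 0 x \<cdot> v x)" unfolding rm0 by (simp add: JR v_perp[OF x])
  have "R x \<cdot> u = u" using ZR2[of "?J \<cdot> v x"] by (simp add: u_def JR Rv0' v_perp[OF x])
  moreover have "RR l x \<cdot> pp l x = inverse l *\<^sub>C vs x + G x \<cdot> u + l *\<^sub>C vconj (vs x)" if l: "l \<in> regular" "l \<noteq> 0" for l
  proof -
    note ln = regular_diff[OF l(1)]
    have "rm l x \<cdot> pp l x = ?GL ((\<alpha> - l) / (\<alpha> + l)) \<cdot> ?p1 l"
      using step1[OF l(2)] ln by (simp add: rm_def)
    also have "\<dots> = inverse l *\<^sub>C (?J \<cdot> v x) + u + l *\<^sub>C (?GL (- 1) \<cdot> vconj (v x))"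
      unfolding u_def by (rule Gam_conserved[OF np2 \<alpha>(1) l(2) _ _ refl FE2]) (use ln in auto)
    finally show ?thesis
      unfolding vconj_vs[OF x] by (simp add: RR_def vs_def K_eq rm0 rinf_def)
  qed
  ultimately show "\<exists>u. R x \<cdot> u = u \<and> (\<forall>l\<in>regular. l \<noteq> 0 \<longrightarrow> RR l x \<cdot> pp l x = inverse l *\<^sub>C vs x + G x \<cdot> u + l *\<^sub>C vconj (vs x))"
    by blast
qed

lemma RR_one: "x \<in> U \<Longrightarrow> RR 1 x = 1"
  using rm_facts(1)[OF _ one_regular(1)] by (simp add: RR_def G_def)

lemma ps_eq: assumes x: "x \<in> U"
  shows "l \<in> regular \<Longrightarrow> l \<noteq> 0 \<Longrightarrow> RR l x \<cdot> pp l x = ps l x" and "Rs x \<cdot> v0s x = v0s x" "Rs x \<cdot> vs x = - vs x"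
proof -
  obtain u where u: "R x \<cdot> u = u" "\<And>l. l \<in> regular \<Longrightarrow> l \<noteq> 0 \<Longrightarrow> RR l x \<cdot> pp l x = inverse l *\<^sub>C vs x + G x \<cdot> u + l *\<^sub>C vconj (vs x)"
    using dressed_pencil(1)[OF x] by blast
  have GG: "adj (G x) \<cdot> G x \<cdot> w = w" for w using G_orth(1)[OF x] by (metis app_ring(2,6))
  have 0: "v0s x = G x \<cdot> u" using u(2)[OF one_regular(1)] by (simp add: v0s_def RR_one[OF x])
  show "l \<in> regular \<Longrightarrow> l \<noteq> 0 \<Longrightarrow> RR l x \<cdot> pp l x = ps l x" using u(2) by (simp add: ps_def 0)
  show "Rs x \<cdot> v0s x = v0s x" by (simp add: 0 Rs_def GG u(1))
  show "Rs x \<cdot> vs x = - vs x" using dressed_pencil(2)[OF x] by (simp add: vs_def K_eq Rs_def GG)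
qed

lemma sm_pp: "sm U (pp l)"
  unfolding pp_def[abs_def] by (intro sm_add sm_scC sm_const sm_vconj smv openU)

lemma sm_vs: "sm U vs" "sm U v0s"
proof -
  have "K (- \<i>) = (\<lambda>x. G x * rm 0 x)" by (simp add: K_eq fun_eq_iff)
  then have "sm U (K (- \<i>))" using sm_mult_cmat[OF openU smG sm_rm(1)] by simp
  then show 1: "sm U vs" unfolding vs_def[abs_def] by (intro sm_app smv openU)
  then show "sm U v0s" unfolding v0s_def[abs_def] by (intro sm_diff sm_pp sm_vconj openU)
qed

lemma sm_ps: "sm U (ps l)"
  unfolding ps_def[abs_def] by (intro sm_add sm_scC sm_const sm_vconj sm_vs openU)

lemma ps_parallel_regular:
  assumes x: "x \<in> U" and d: "d \<in> II" and l: "l \<in> regular" "l \<noteq> 0"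
  shows "wd d (ps l) x + Ps d (kd d l) x \<cdot> ps l x = 0"
proof -
  have p: "wd d (pp l) x + Pq d (kd d l) x \<cdot> pp l x = 0 *\<^sub>C pp l x"
    using par[OF x d l(2)] by (simp add: pp_def[abs_def])
  have "wd d (\<lambda>y. RR l y \<cdot> pp l y) x = wd d (ps l) x"
    by (rule wd_cong_open[OF openU x ps_eq(1)[OF _ l]])
  then show ?thesis
    using gauge_parallel[OF sm_diff_at[OF sm_RR x] sm_diff_at[OF sm_pp x] RR_rel[OF x d l] p] ps_eq(1)[OF x l] by simp
qed

text \<open>For fixed \<open>x\<close> the left side is a Laurent polynomial in the spectral
  parameter, so it vanishes also at the finitely many nonzero values where the gauge is
  singular.\<close>

lemma ps_parallel:
  assumes x: "x \<in> U" and d: "d \<in> II" and k: "k \<noteq> 0"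
  shows "wd d (ps k) x + Ps d (kd d k) x \<cdot> ps k x = 0"
proof (rule generic_limit_zero[where S = "{0, \<alpha>, - \<alpha>, be, - be}" and f = "\<lambda>l. wd d (ps l) x + Ps d (kd d l) x \<cdot> ps l x"])
  show "wd d (ps l) x + Ps d (kd d l) x \<cdot> ps l x = 0" if "l \<notin> {0, \<alpha>, - \<alpha>, be, - be}" for l
    by (rule ps_parallel_regular[OF x d]) (use that in \<open>auto simp: regular_def\<close>)
  have w: "wd d (ps l) x = inverse l *\<^sub>C wd d vs x + wd d v0s x + l *\<^sub>C wd d (\<lambda>y. vconj (vs y)) x" for l
    unfolding ps_def[abs_def]
    using sm_diff_at[OF sm_vs(1) x] sm_diff_at[OF sm_vs(2) x] sm_diff_at[OF sm_vconj[OF openU sm_vs(1)] x]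
    by (simp add: wd_add wd_scC_const differentiable_scC_const)
  have P: "Ps d m x \<cdot> w = (inverse m * inverse m) *\<^sub>C (Qw d qs x \<cdot> w) + inverse m *\<^sub>C (Nw d Ls x \<cdot> w) + (- (Qw d qs x \<cdot> w) - Nw d Ls x \<cdot> w)" for m w
    by (simp add: Pf_def Pl_def)
  have kd: "(kd d \<longlongrightarrow> kd d k) (at k)" unfolding kd_def[abs_def] using k by (auto intro: tendsto_intros)
  have ps_lim: "((\<lambda>l. ps l x) \<longlongrightarrow> ps k x) (at k)"
    unfolding ps_def by (intro tendsto_intros tendsto_scC k)
  show "((\<lambda>l. wd d (ps l) x + Ps d (kd d l) x \<cdot> ps l x) \<longlongrightarrow> wd d (ps k) x + Ps d (kd d k) x \<cdot> ps k x) (at k)"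
    unfolding w P
    by (intro tendsto_intros tendsto_scC kd ps_lim bounded_linear.tendsto[OF bounded_linear_app] k kd_simps(3)[OF k])
qed simp

lemma transformed_conserved: "conserved_quantity U Ls qs ps"
  unfolding conserved_quantity_def
proof (intro conjI ballI allI impI Ls_constrained_willmore)
  show "\<exists>v v0. smooth_on U v \<and> smooth_on U v0 \<and>
        (\<forall>x\<in>U. v0 x \<in> csc Ls x \<and> v0 x \<in> real_vecs \<and> v x \<in> perp (csc Ls x)) \<and>
        (\<forall>l. l \<noteq> 0 \<longrightarrow> (\<forall>x\<in>U. ps l x = inverse l *s v x + v0 x + l *s vconj (v x)))"
  proof (rule exI[of _ vs], rule exI[of _ v0s], intro conjI ballI allI impI)
    show "smooth_on U vs" "smooth_on U v0s" using sm_vs by (simp_all add: smooth_on_eq_sm)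
    show "ps l x = inverse l *s vs x + v0s x + l *s vconj (vs x)" for l x by (simp add: ps_def smult_eq_scC)
    fix x assume x: "x \<in> U"
    show "v0s x \<in> csc Ls x" "vs x \<in> perp (csc Ls x)"
      using ps_eq(2,3)[OF x] by (simp_all add: S.in_csc_iff[OF x] S.in_perp_iff[OF x] Rm_Ls[OF x])
    show "v0s x \<in> real_vecs" by (simp add: real_vecs_def v0s_def pp_def v0_real[OF x] algebra_simps)
  qed
  fix x assume x: "x \<in> U"
  show "ps 1 x \<noteq> 0" using nz[OF x] by (simp add: ps_def v0s_def pp_def add.assoc)
  fix l :: complex and X assume l: "l \<noteq> 0"
  have II: "\<i> \<in> II" "- \<i> \<in> II" by (simp_all add: II_def)
  show "conn Ls qs l (ps l) x X = 0"
    using S.conn_zero[OF qs_real_wedge x sm_diff_at[OF sm_ps[of l] x] l]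
      ps_parallel[OF x II(1) l] ps_parallel[OF x II(2) l] by (simp add: kd_def i_neq)
qed

end

theorem theorem7p7:
  fixes U :: "complex set"
    and \<Lambda> L :: "'n::finite subbundle"
    and q :: "'n endo_form"
    and p :: "complex \<Rightarrow> 'n sect"
    and \<alpha> :: complex
  assumes "CARD('n) \<ge> 3"
    and "open U" and "U \<noteq> {}"
    and "\<not> in_proper_subsphere U \<Lambda>"
    and "constrained_willmore U \<Lambda> q"
    and "conserved_quantity U \<Lambda> q p"
    and "backlund_parameters U \<Lambda> q \<alpha> L"
    and "\<forall>x\<in>U. \<forall>w\<in>L x. form (p \<alpha> x) w = 0"
    and "immerses U (backlund_transform \<Lambda> \<alpha> L)"
  shows "\<exists>p'. conserved_quantity U (backlund_transform \<Lambda> \<alpha> L) (backlund_multiplier \<Lambda> q \<alpha> L) p' \<and>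
           (\<forall>l. l \<notin> {0, \<alpha>, - \<alpha>, inverse (cnj \<alpha>), - inverse (cnj \<alpha>)} \<longrightarrow>
              (\<forall>x\<in>U. p' l x = conserved_transform \<Lambda> \<alpha> L p l x))"
proof -
  have rs: "real_surface U \<Lambda>" using assms(5) by (simp add: constrained_willmore_def)
  interpret surface U \<Lambda>
    by (rule surface.intro[OF assms(2)]) (metis real_surface_frame[OF rs])
  interpret transform U \<Lambda> q \<alpha> L
    by (intro transform.intro backlund.intro cw_surface.intro surface_axioms cw_surface_axioms.intro
        backlund_axioms.intro transform_axioms.intro assms)
  obtain v v0 where sm: "smooth_on U v" "smooth_on U v0"
    and vv: "\<forall>x\<in>U. v0 x \<in> csc \<Lambda> x \<and> v0 x \<in> real_vecs \<and> v x \<in> perp (csc \<Lambda> x)"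
    and p': "\<forall>l. l \<noteq> 0 \<longrightarrow> (\<forall>x\<in>U. p l x = inverse l *s v x + v0 x + l *s vconj (v x))"
    using assms(6) unfolding conserved_quantity_def by blast
  have p: "p l x = inverse l *\<^sub>C v x + v0 x + l *\<^sub>C vconj (v x)" if "l \<noteq> 0" "x \<in> U" for l x
    using p' that by (simp add: smult_eq_scC)
  have c: "\<forall>x\<in>U. p 1 x \<noteq> 0" "\<And>l x X. l \<noteq> 0 \<Longrightarrow> x \<in> U \<Longrightarrow> conn \<Lambda> q l (p l) x X = 0"
    using assms(6) unfolding conserved_quantity_def by blast+
  note sm' = sm[unfolded smooth_on_eq_sm]
  interpret conserved U \<Lambda> q \<alpha> L v v0
  proof (intro conserved.intro transform_axioms conserved_axioms.intro sm')
    fix x assume x: "x \<in> U"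
    show "R x \<cdot> v x = - v x" "R x \<cdot> v0 x = v0 x" "vconj (v0 x) = v0 x"
      using vv x in_csc_iff[OF x] in_perp_iff[OF x] by (auto simp: real_vecs_def)
    have "p 1 x = v x + v0 x + vconj (v x)" using p[OF _ x, of 1] by simp
    then show "v x + v0 x + vconj (v x) \<noteq> 0" using c(1) x by metis
    show "form (inverse \<alpha> *\<^sub>C v x + v0 x + \<alpha> *\<^sub>C vconj (v x)) w = 0" if "w \<in> L x" for w
      using assms(8) x that p[OF \<alpha>(1) x] by metis
    show "wd d (\<lambda>y. inverse l *\<^sub>C v y + v0 y + l *\<^sub>C vconj (v y)) x + Pq d (kd d l) x \<cdot> (inverse l *\<^sub>C v x + v0 x + l *\<^sub>C vconj (v x)) = 0"
      if d: "d \<in> II" and l: "l \<noteq> 0" for d l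
    proof -
      have "sm U (\<lambda>y. inverse l *\<^sub>C v y + v0 y + l *\<^sub>C vconj (v y))"
        by (intro sm_add sm_scC sm_const sm_vconj sm' openU)
      then have "sm U (p l)" by (rule iffD2[OF sm_cong[OF openU p[OF l]], rotated])
      then have "wd (- \<i>) (p l) x + Pq (- \<i>) l x \<cdot> p l x = 0" "wd \<i> (p l) x + Pq \<i> (inverse l) x \<cdot> p l x = 0"
        using conn_zero[OF rw x sm_diff_at[OF _ x] l] c(2)[OF l x] by blast+
      then have "wd d (p l) x + Pq d (kd d l) x \<cdot> p l x = 0"
        using d by (auto simp: II_def kd_def i_neq)
      then show ?thesis using wd_cong_open[OF openU x, of "p l", OF p[OF l], of d] p[OF l x] by metis
    qed
  qed
  show ?thesis
  \<comment> \<open>The witness is the Laurent polynomial \<open>ps\<close>. It agrees with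
    \<open>conserved_transform\<close> off the poles and has the correct values at them.\<close>
  proof (intro exI[of _ ps] conjI transformed_conserved allI impI ballI)
    fix l x assume l: "l \<notin> {0, \<alpha>, - \<alpha>, be, - be}" and x: "x \<in> U"
    have l': "l \<in> regular" "l \<noteq> 0" using l by (auto simp: regular_def)
    have "conserved_transform \<Lambda> \<alpha> L p l x = G x \<cdot> rm l x \<cdot> p l x"
      unfolding conserved_transform_def inv_rstar[OF x] unfolding rstar_eq[OF x] ..
    also have "\<dots> = ps l x" using ps_eq(1)[OF x l'] p[OF l'(2) x] by (simp add: RR_def pp_def)
    finally show "ps l x = conserved_transform \<Lambda> \<alpha> L p l x" ..
  qed
qed

end
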